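(* For every ``$F$-crystal'' $(M,\phi)$ over $k$ one has $n_M \ge \ell_M$, where $n_M$ is its isomorphism number and $\ell_M$ its level torsion.
   Context: Let $k$ be an algebraically closed field of characteristic $p>0$, let $q$ be a power of $p$, and let $\sigma$ be the automorphism of $k((\epsilon))$ given by $\sigma(\sum a_n\epsilon^n)=\sum a_n^q\epsilon^n$ ($a_n\in k$). An ``$F$-crystal'' over $k$ is a pair $(M,\phi)$ where $M$ is a free $k[[\epsilon]]$-module of finite rank, $V=M\otimes_{k[[\epsilon]]}k((\epsilon))$, and $\phi$ is a $\sigma$-linear bijection of $V$ with $\phi(M)\subset M$. Its isomorphism number $n_M$ is the smallest integer $n\ge 0$ such that for every $h\in GL(M)$ with $h\equiv 1 \bmod \epsilon^n$ there exists $g\in GL(M)$ with $h\phi=g^{-1}\phi g$. Let $\tilde\phi$ be the $\sigma$-linear bijection of $\mathrm{End}(V)$ given by $f\mapsto \phi f\phi^{-1}$. By the Dieudonné–Manin classification, $V=\bigoplus_{\lambda\in\mathbb Q}V^{\lambda}$ with each $V^\lambda$ a $\phi$-stable $k((\epsilon))$-subspace on which $\phi$ is isoclinic of slope $\lambda$. Put $V_+=\bigoplus_{\lambda_1<\lambda_2}\mathrm{Hom}(V^{\lambda_1},V^{\lambda_2})$, $V_0=\bigoplus_\lambda\mathrm{Hom}(V^\lambda,V^\lambda)$, $V_-=\bigoplus_{\lambda_1<\lambda_2}\mathrm{Hom}(V^{\lambda_2},V^{\lambda_1})$, so $\mathrm{End}(V)=V_+\oplus V_0\oplus V_-$. For a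 lattice $H$ of $\mathrm{End}(V)$ let $O_{H,+}\subset V_+\cap H$, $O_{H,0}\subset V_0\cap H$, $O_{H,-}\subset V_-\cap H$ be the maximal $k[[\epsilon]]$-submodules with $\tilde\phi(O_{H,+})\subset O_{H,+}$, $\tilde\phi(O_{H,0})=O_{H,0}$, $\tilde\phi^{-1}(O_{H,-})\subset O_{H,-}$, and set $O_H=O_{H,+}\oplus O_{H,0}\oplus O_{H,-}$. With $H=\mathrm{End}(M)$, the level torsion $\ell_M$ is defined by: (a) $\ell_M=1$ if $H=O_H$ and $O_{H,+}\oplus O_{H,-}$ is not topologically nilpotent; (b) otherwise $\ell_M=\min\{n\in\mathbb Z_{\ge0};\ \epsilon^nH\subset O_H\}$. *)

theory Defs
  imports
    "HOL-Computational_Algebra.Formal_Laurent_Series"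
    "HOL-Library.Function_Algebras"
    "HOL-Library.Extended_Nat"
begin

definition fls_frob :: "nat \<Rightarrow> 'k::field fls \<Rightarrow> 'k fls" where
  "fls_frob q f = Abs_fls (\<lambda>n. fls_nth f n ^ q)"

lemma fls_nth_fls_frob:
  assumes "q > 0"
  shows "fls_nth (fls_frob q f) n = fls_nth f n ^ q"
proof -
  obtain N where "\<forall>n<N. fls_nth f n = 0"
    by (elim fls_nth_vanishes_belowE)
  thus ?thesis
    unfolding fls_frob_def using assms by (intro nth_Abs_fls_lower_bound[of N]) simp
qed

text \<open>
  The tensor product of \<open>M\<close> with \<open>k((\<epsilon>))\<close> is represented by a \<open>k((\<epsilon>))\<close>-vector space (the type
  \<open>'v\<close> with scalar multiplication \<open>scale\<close>) containing \<open>M\<close> as a lattice.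
  Modules over \<open>k[[\<epsilon>]]\<close> inside it use the restricted scalar multiplication \<open>int_scale scale\<close>.
\<close>

definition int_scale :: "('k::field fls \<Rightarrow> 'v \<Rightarrow> 'v) \<Rightarrow> 'k fps \<Rightarrow> 'v \<Rightarrow> 'v" where
  "int_scale scale c v = scale (fps_to_fls c) v"

definition lattice_of ::
  "('k::field fls \<Rightarrow> 'v::ab_group_add \<Rightarrow> 'v) \<Rightarrow> 'v set \<Rightarrow> 'v set \<Rightarrow> bool" where
  "lattice_of scale W L \<longleftrightarrow>
     (\<exists>B. finite B \<and> \<not> module.dependent scale B \<and>
          module.span scale B = W \<and> module.span (int_scale scale) B = L)"

locale f_crystal = vector_space scale
  for scale :: "'k::alg_closed_field fls \<Rightarrow> 'v::ab_group_add \<Rightarrow> 'v" +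
  fixes q :: nat and M :: "'v set" and \<phi> :: "'v \<Rightarrow> 'v"
  assumes char_pos: "CHAR('k) > 0"
    and q_power: "\<exists>r>0. q = CHAR('k) ^ r"
    and lattice_M: "lattice_of scale UNIV M"
    and \<phi>_add: "\<And>v w. \<phi> (v + w) = \<phi> v + \<phi> w"
    and \<phi>_scale: "\<And>c v. \<phi> (scale c v) = scale (fls_frob q c) (\<phi> v)"
    and \<phi>_bij: "bij \<phi>"
    and \<phi>_M: "\<phi> ` M \<subseteq> M"
begin

definition end_scale :: "'k fls \<Rightarrow> ('v \<Rightarrow> 'v) \<Rightarrow> 'v \<Rightarrow> 'v" where
  "end_scale c f = (\<lambda>v. scale c (f v))"

definition EndV :: "('v \<Rightarrow> 'v) set" where
  "EndV = {f. Vector_Spaces.linear scale scale f}"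

text \<open>
  Endomorphisms and automorphisms of \<open>M\<close> are identified with their unique \<open>k((\<epsilon>))\<close>-linear extensions.
\<close>

definition EndM :: "('v \<Rightarrow> 'v) set" where
  "EndM = {f \<in> EndV. f ` M \<subseteq> M}"

definition GLM :: "('v \<Rightarrow> 'v) set" where
  "GLM = {g \<in> EndV. bij g \<and> g ` M = M}"

definition cong_one :: "nat \<Rightarrow> ('v \<Rightarrow> 'v) \<Rightarrow> bool" where
  "cong_one n h \<longleftrightarrow> h - id \<in> end_scale (fls_X ^ n) ` EndM"

text \<open>
  Minima are taken in \<^typ>\<open>enat\<close>, so that an empty set of candidates would have minimum \<open>\<infinity>\<close>
  instead of an unspecified value.
\<close>

definition isomorphism_number :: enat where
  "isomorphism_number =
     (INF n \<in> {n. \<forall>h\<in>GLM. cong_one n h \<longrightarrow> (\<exists>g\<in>GLM. h \<circ> \<phi> = inv g \<circ> \<phi> \<circ> g)}. enat n)"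

definition phi_end :: "('v \<Rightarrow> 'v) \<Rightarrow> 'v \<Rightarrow> 'v" where
  "phi_end f = \<phi> \<circ> f \<circ> inv \<phi>"

definition isoclinic :: "rat \<Rightarrow> 'v set \<Rightarrow> bool" where
  "isoclinic \<alpha> W \<longleftrightarrow>
     (\<exists>(r::int) (s::nat) L. s > 0 \<and> \<alpha> = of_int r / of_nat s \<and>
        lattice_of scale W L \<and> (\<phi> ^^ s) ` L = scale (fls_X powi r) ` L)"

text \<open>
  The summand \<open>V\<^sup>\<alpha>\<close> of the Dieudonne-Manin decomposition is the largest \<open>\<phi>\<close>-stable subspace that
  is isoclinic of slope \<open>\<alpha>\<close>, which is the sum of all of them.
\<close>

definition slope_part :: "rat \<Rightarrow> 'v set" where
  "slope_part \<alpha> = span (\<Union>{W. subspace W \<and> \<phi> ` W = W \<and> isoclinic \<alpha> W})"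

text \<open>\<open>Hom(V\<^sup>\<alpha>, V\<^sup>\<beta>)\<close> sits inside \<open>End(V)\<close> by extending with zero on the other summands.\<close>

definition slope_hom :: "rat \<Rightarrow> rat \<Rightarrow> ('v \<Rightarrow> 'v) set" where
  "slope_hom \<alpha> \<beta> = {f \<in> EndV. f ` slope_part \<alpha> \<subseteq> slope_part \<beta> \<and>
                             (\<forall>\<gamma>. \<gamma> \<noteq> \<alpha> \<longrightarrow> (\<forall>v\<in>slope_part \<gamma>. f v = 0))}"

definition V_pos :: "('v \<Rightarrow> 'v) set" where
  "V_pos = module.span end_scale (\<Union>{slope_hom \<alpha> \<beta> | \<alpha> \<beta>. \<alpha> < \<beta>})"

definition V_zero :: "('v \<Rightarrow> 'v) set" where
  "V_zero = module.span end_scale (\<Union>{slope_hom \<alpha> \<alpha> | \<alpha>. True})"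

definition V_neg :: "('v \<Rightarrow> 'v) set" where
  "V_neg = module.span end_scale (\<Union>{slope_hom \<beta> \<alpha> | \<alpha> \<beta>. \<alpha> < \<beta>})"

definition end_submodule :: "('v \<Rightarrow> 'v) set \<Rightarrow> bool" where
  "end_submodule A \<longleftrightarrow> module.subspace (int_scale end_scale) A"

definition O_pos :: "('v \<Rightarrow> 'v) set \<Rightarrow> ('v \<Rightarrow> 'v) set" where
  "O_pos H = (GREATEST A. end_submodule A \<and> A \<subseteq> V_pos \<inter> H \<and> phi_end ` A \<subseteq> A)"

definition O_zero :: "('v \<Rightarrow> 'v) set \<Rightarrow> ('v \<Rightarrow> 'v) set" where
  "O_zero H = (GREATEST A. end_submodule A \<and> A \<subseteq> V_zero \<inter> H \<and> phi_end ` A = A)"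

definition O_neg :: "('v \<Rightarrow> 'v) set \<Rightarrow> ('v \<Rightarrow> 'v) set" where
  "O_neg H = (GREATEST A. end_submodule A \<and> A \<subseteq> V_neg \<inter> H \<and> inv phi_end ` A \<subseteq> A)"

definition O_all :: "('v \<Rightarrow> 'v) set \<Rightarrow> ('v \<Rightarrow> 'v) set" where
  "O_all H = {a + b + c | a b c. a \<in> O_pos H \<and> b \<in> O_zero H \<and> c \<in> O_neg H}"

text \<open>
  Topological nilpotence refers to the \<open>\<epsilon>\<close>-adic topology: the lattices \<open>\<epsilon>\<^sup>m End(M)\<close> form a
  neighbourhood basis of zero in \<open>End(V)\<close>.
\<close>

definition top_nilpotent :: "('v \<Rightarrow> 'v) set \<Rightarrow> bool" where
  "top_nilpotent S \<longleftrightarrow>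
     (\<forall>m::nat. \<exists>N. \<forall>fs. set fs \<subseteq> S \<and> length fs \<ge> N \<longrightarrow>
        foldr (\<circ>) fs id \<in> end_scale (fls_X ^ m) ` EndM)"

definition level_torsion :: enat where
  "level_torsion =
     (if EndM = O_all EndM \<and> \<not> top_nilpotent {a + c | a c. a \<in> O_pos EndM \<and> c \<in> O_neg EndM}
      then 1
      else (INF n \<in> {n. end_scale (fls_X ^ n) ` EndM \<subseteq> O_all EndM}. enat n))"

end

end

theory Submission
  imports Defs "Jordan_Normal_Form.Determinant"
begin

text \<open>
  Let \<open>H = End(M)\<close>, let \<open>\<Phi>\<close> be the map \<open>f \<mapsto> \<phi> f \<phi>\<^sup>-\<^sup>1\<close> on \<open>End(V)\<close>, and let \<open>n \<ge> 1\<close> be such that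
  all \<open>h \<equiv> 1 mod \<epsilon>\<^sup>n\<close> in \<open>GL(M)\<close> are of the form required by the isomorphism number. Taking
  \<open>h = 1 + \<epsilon>\<^sup>m f\<close> with \<open>m \<ge> n\<close> yields \<open>g \<in> GL(M)\<close> with \<open>\<Phi> g - g = \<epsilon>\<^sup>m g f\<close>. The pairs
  \<open>(g mod \<epsilon>, \<epsilon>\<^sup>-\<^sup>m (\<Phi> g - g) mod \<epsilon>)\<close> with \<open>g \<in> H\<close> are the zeros of additive polynomials, and comparing
  the growth of spaces of polynomial functions shows that every matrix over \<open>k\<close> occurs as a second
  component, although a priori only the \<open>g f\<close> do. Since \<open>\<epsilon>\<^sup>m H \<subseteq> (\<Phi> - 1) H\<close> for large \<open>m\<close> by the
  Dieudonne--Manin classification, descending induction on \<open>m\<close> gives \<open>\<epsilon>\<^sup>n H \<subseteq> (\<Phi> - 1) H\<close>.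

  Solving \<open>\<Phi> g - g = x f\<close> for all \<open>x\<close> in the field with \<open>q\<^sup>R\<close> elements and averaging, every \<open>f \<in> \<epsilon>\<^sup>n H\<close> is
  \<open>\<Phi>\<^sup>R a - a\<close> with \<open>\<Phi>\<^sup>i a \<in> H\<close> for all \<open>i \<le> R\<close>. For large \<open>R\<close> the three slope components of \<open>a\<close> can be
  separated, and those of \<open>f\<close> turn out to lie in \<open>O\<^sub>H\<^sub>,\<^sub>+\<close>, \<open>O\<^sub>H\<^sub>,\<^sub>0\<close> and \<open>O\<^sub>H\<^sub>,\<^sub>-\<close>. Hence \<open>\<epsilon>\<^sup>n H \<subseteq> O\<^sub>H\<close>.

  If \<open>n = 0\<close> is admissible, then the relative position of \<open>h \<phi> M\<close> and \<open>\<phi>\<^sup>-\<^sup>1 M\<close> modulo \<open>\<epsilon>\<close> is the same for all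
  \<open>h \<in> GL(M)\<close>, which forces \<open>\<phi> M = \<epsilon>\<^sup>a M\<close>; then the level torsion is \<open>0\<close>.
\<close>

section \<open>Semilinear equations over Laurent series\<close>

text \<open>The \<open>g\<close> supplied by the isomorphism condition depends on \<open>f\<close>,
  so a priori the products \<open>g f\<close> could all lie in a small set. Dimension excludes this.
  Let G be the group of pairs (g, w) and C its fibre over w = 0. Invertible elements of C act on G
  by left multiplication and preserve \<open>g\<^sup>-\<^sup>1 w\<close>. If every f has the form
  \<open>g\<^sup>-\<^sup>1 w\<close>, then G has dimension at least \<open>N\<^sup>2\<close> + dim
  C, whereas a projection to w that is not onto allows at most \<open>N\<^sup>2\<close> - 1 + dim C.
  Dimensions are measured by the number of independent functions of bounded degree.

  One equation controls only g and \<Phi> g. A long run of integral iterates is needed to tell the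
  slopes apart: positive parts contract forwards, negative parts backwards. The slope zero part does
  neither; its integrality spreads from a finite window to all iterates by a descending chain of
  spaces over k.

  The case n = 0 needs its own argument: 1 + f need not be invertible, and case (a) of the
  definition puts the level torsion at 1 even though H = \<open>O\<^sub>H\<close>.\<close>

definition ordge :: "int \<Rightarrow> 'k::field fls \<Rightarrow> bool" where
  "ordge c x \<longleftrightarrow> (\<forall>n<c. fls_nth x n = 0)"

lemma ordgeD: "ordge c x \<Longrightarrow> n < c \<Longrightarrow> fls_nth x n = 0"
  by (simp add: ordge_def)

lemma ordge_0 [simp]: "ordge c 0"
  by (simp add: ordge_def)

lemma ordge_mono: "ordge c x \<Longrightarrow> d \<le> c \<Longrightarrow> ordge d x"
  by (auto simp: ordge_def)

lemma ordge_add: "ordge c x \<Longrightarrow> ordge c y \<Longrightarrow> ordge c (x + y)"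
  by (simp add: ordge_def)

lemma ordge_diff: "ordge c x \<Longrightarrow> ordge c y \<Longrightarrow> ordge c (x - y)"
  by (simp add: ordge_def)

lemma ordge_sum: "(\<And>i. i \<in> A \<Longrightarrow> ordge c (f i)) \<Longrightarrow> ordge c (sum f A)"
  by (induction A rule: infinite_finite_induct) (auto intro: ordge_add)

text \<open>Since \<open>fls_subdegree 0 = 0\<close>, bounds on \<open>fls_subdegree\<close> would
  force a case distinction for zero in every sum; \<open>ordge\<close> gives the zero series every
  order.\<close>

lemma ordge_iff: "ordge c x \<longleftrightarrow> x = 0 \<or> c \<le> fls_subdegree x"
proof
  assume "ordge c x"
  then show "x = 0 \<or> c \<le> fls_subdegree x"
    using fls_subdegree_geI[of x c] by (auto simp: ordge_def)
qed (auto simp: ordge_def)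

lemma ordge_mult: "ordge a x \<Longrightarrow> ordge b y \<Longrightarrow> ordge (a + b) (x * y)"
  by (cases "x = 0 \<or> y = 0") (auto simp: ordge_iff)

lemma ordge_ex: "\<exists>c. ordge c x"
  unfolding ordge_iff by auto

lemma ordge_all_imp_0: "(\<And>c. ordge c x) \<Longrightarrow> x = 0"
  by (rule fls_zero_eqI) (metis ordgeD less_add_one)

lemma ordge_1 [simp]: "ordge 0 1"
  by (simp add: ordge_def)

lemma ordge_fps [simp]: "ordge 0 (fps_to_fls f)"
  by (simp add: ordge_def)

lemma ordge_0_fps: "ordge 0 x \<Longrightarrow> \<exists>f. x = fps_to_fls f"
  by (metis fls_regpart_to_fls_trivial ordge_iff fps_zero_to_fls)

lemma ordge_const [simp]: "ordge 0 (fls_const c)"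
  by (simp add: ordge_def)

declare fls_X_power_int [simp del]

lemma fls_X_powi_mult_nth: "fls_nth (fls_X powi r * f) n = fls_nth (f::'k::field fls) (n - r)"
  by (simp add: fls_X_power_int fls_X_intpow_times_conv_shift)

lemma fls_X_power_mult_nth: "fls_nth (fls_X ^ r * f) n = fls_nth (f::'k::field fls) (n - int r)"
  using fls_X_powi_mult_nth[of "int r" f n] by simp

lemma fls_X_powi_nonzero [simp]: "fls_X powi r \<noteq> (0 :: 'k::field fls)"
  by (simp add: fls_X_power_int)

lemma ordge_X_powi_mult: "ordge c (fls_X powi r * x) \<longleftrightarrow> ordge (c - r) x"
proof
  assume a: "ordge c (fls_X powi r * x)"
  show "ordge (c - r) x"
    unfolding ordge_def
  proof (intro allI impI)
    fix n assume "n < c - r"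
    then show "fls_nth x n = 0"
      using ordgeD[OF a, of "n + r"] unfolding fls_X_powi_mult_nth by simp
  qed
qed (unfold ordge_def fls_X_powi_mult_nth, simp)

text \<open>Any lower bounds for the orders may fix the summation range. A product and its image
  under the Frobenius, which preserves such bounds, can therefore be written over the same
  range.\<close>

lemma fls_mult_nth_ordge:
  fixes x y :: "'k::field fls"
  assumes "ordge a x" "ordge b y"
  shows "fls_nth (x * y) n = (\<Sum>i=a..n-b. fls_nth x i * fls_nth y (n - i))"
proof (cases "x = 0 \<or> y = 0")
  case True
  then show ?thesis by auto
next
  case False
  then have "a \<le> fls_subdegree x" "b \<le> fls_subdegree y"
    using assms by (auto simp: ordge_iff)
  then show ?thesis
    unfolding fls_times_nth(2)
    by (intro sum.mono_neutral_left) auto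
qed

text \<open>An additive polynomial, stored by its coefficients as an ordinary one:
  \<open>degree\<close> is the q-degree, and for instance \<open>[:-1, 1:]\<close> stands for x^q -
  x.\<close>

definition qev :: "nat \<Rightarrow> 'k::field poly \<Rightarrow> 'k \<Rightarrow> 'k" where
  "qev q p x = (\<Sum>l\<le>degree p. coeff p l * x ^ (q ^ l))"

lemma qev_sum_upto: "degree p \<le> d \<Longrightarrow> qev q p x = (\<Sum>l\<le>d. coeff p l * x ^ (q ^ l))"
  unfolding qev_def by (rule sum.mono_neutral_left) (auto simp: coeff_eq_0)

lemma qev_0 [simp]: "qev q 0 x = 0"
  by (simp add: qev_def)

lemma qev_diff: "qev q (p - r) x = qev q p x - qev q r x"
proof -
  define d where "d = max (degree p) (degree r)"
  have "degree (p - r) \<le> d" by (simp add: d_def degree_diff_le)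
  then show ?thesis
    by (simp add: qev_sum_upto[of _ d] d_def sum_subtractf left_diff_distrib)
qed

lemma qev_smult: "qev q (Polynomial.smult a p) x = a * qev q p x"
  by (simp add: qev_sum_upto[of "Polynomial.smult a p" "degree p"] qev_def degree_smult_le sum_distrib_left mult.assoc)

text \<open>The prime power is a parameter separate from the crystal because
  \<open>\<phi> ^^ t\<close> is semilinear for \<open>q ^ t\<close>; everything here is instantiated
  again at such powers.\<close>

locale frobenius_field =
  fixes q :: nat and ty :: "'k::alg_closed_field itself"
  assumes char_pos': "CHAR('k) > 0" and q_power': "\<exists>r>0. q = CHAR('k) ^ r"
begin

lemma prime_char: "prime (CHAR('k))"
  using char_pos' by (rule prime_CHAR_semidom)

lemma q_gt1: "q > 1"
  using q_power' prime_char by (metis one_less_power prime_gt_1_nat)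

lemma q_pos [simp]: "q > 0" "q \<noteq> 0"
  using q_gt1 by auto

lemma q_pow_char: "\<exists>r. q ^ l = CHAR('k) ^ r"
  using q_power' by (metis power_mult)

lemma pow_add: "(x + y :: 'k) ^ (q ^ l) = x ^ (q ^ l) + y ^ (q ^ l)"
  using q_pow_char[of l] freshmans_dream'[OF prime_char] by metis

lemma pow_sum: "(sum f A :: 'k) ^ (q ^ l) = (\<Sum>i\<in>A. f i ^ (q ^ l))"
  by (induction A rule: infinite_finite_induct) (auto simp: pow_add)

lemma pow_uminus: "(- x :: 'k) ^ (q ^ l) = - (x ^ (q ^ l))"
  using pow_add[of "-x" x l] q_pos by (simp add: eq_neg_iff_add_eq_0 power_0_left)

lemma pow_diff: "(x - y :: 'k) ^ (q ^ l) = x ^ (q ^ l) - y ^ (q ^ l)"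
  using pow_add[of x "-y" l] by (simp add: pow_uminus)

lemma pow_inj: "(x :: 'k) ^ (q ^ l) = y ^ (q ^ l) \<longleftrightarrow> x = y"
  using pow_diff[of x y l] by auto

lemma frobenius_field_power: "s > 0 \<Longrightarrow> frobenius_field TYPE('k) (q ^ s)"
  using q_power' char_pos'
  by unfold_locales (auto simp flip: power_mult intro: exI[of _ "_ * s"])

lemma qev_add: "qev q p (x + y :: 'k) = qev q p x + qev q p y"
  by (simp add: qev_def pow_add ring_distribs sum.distrib)

lemma qpow_inj: "q ^ l = q ^ m \<longleftrightarrow> l = m"
  using q_gt1 by (simp add: power_inject_exp)

text \<open>The top exponent \<open>q ^ degree p\<close> is positive even for q-degree 0, so
  subtracting \<open>b\<close> leaves a nonconstant polynomial, which has a root.\<close>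

lemma qev_surj:
  assumes "p \<noteq> (0 :: 'k poly)"
  shows "\<exists>x. qev q p x = b"
proof -
  define P where "P = (\<Sum>l\<le>degree p. monom (coeff p l) (q ^ l)) - [:b:]"
  have ev: "poly P x = qev q p x - b" for x
    by (simp add: P_def poly_sum poly_monom qev_def)
  have "coeff P (q ^ degree p) = (\<Sum>l\<le>degree p. if q ^ l = q ^ degree p then coeff p l else 0)"
    by (simp add: P_def coeff_sum coeff_pCons split: nat.splits)
  also have "\<dots> = coeff p (degree p)"
    by (simp add: qpow_inj)
  finally have "coeff P (q ^ degree p) \<noteq> 0" using assms by simp
  then have "degree P \<ge> q ^ degree p" by (rule le_degree)
  then have "degree P > 0" by (metis gr0I le_zero_eq power_eq_0_iff q_pos(2))
  then obtain x where "poly P x = 0" using alg_closed_imp_poly_has_root by blast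
  then show ?thesis using ev by auto
qed

text \<open>Dividing by x turns the exponents into \<open>q ^ l - 1\<close>. The quotient is
  nonconstant, hence has a root, and its constant term \<open>coeff p 0\<close> keeps that root away
  from 0.\<close>

lemma qev_nonzero_root:
  assumes "coeff p 0 \<noteq> (0::'k)" "degree p > 0"
  shows "\<exists>x. x \<noteq> 0 \<and> qev q p x = 0"
proof -
  define P where "P = (\<Sum>l\<le>degree p. monom (coeff p l) (q ^ l - 1))"
  have pw: "x * x ^ (q ^ l - 1) = x ^ (q ^ l)" for x :: 'k and l
    by (metis Suc_diff_1 power_Suc q_pos(1) zero_less_power)
  have ev: "x * poly P x = qev q p x" for x
    by (simp add: P_def poly_sum poly_monom qev_def sum_distrib_left mult.left_commute[of x] pw[unfolded One_nat_def])
  have inj: "q ^ l - 1 = q ^ m - 1 \<longleftrightarrow> l = m" for l m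
    by (metis Suc_diff_1 q_pos(1) qpow_inj zero_less_power)
  have co: "coeff P (q ^ m - 1) = coeff p m" if "m \<le> degree p" for m
  proof -
    have "coeff P (q ^ m - 1) = (\<Sum>l\<le>degree p. if l = m then coeff p l else 0)"
      by (simp add: P_def coeff_sum inj[unfolded One_nat_def])
    then show ?thesis using that by simp
  qed
  have "coeff P (q ^ degree p - 1) \<noteq> 0" using co[of "degree p"] assms by auto
  then have "degree P \<ge> q ^ degree p - 1" by (rule le_degree)
  moreover have "q ^ degree p > 1" using assms(2) by (intro one_less_power q_gt1)
  ultimately have "degree P > 0" by linarith
  then obtain x where x: "poly P x = 0" using alg_closed_imp_poly_has_root by blast
  have "poly P 0 = coeff p 0" using co[of 0] by (simp add: poly_0_coeff_0)
  then have "x \<noteq> 0" using x assms by auto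
  then show ?thesis using ev[of x] x by auto
qed

section \<open>The coefficientwise Frobenius of k((\<epsilon>))\<close>

abbreviation frob :: "'k fls \<Rightarrow> 'k fls" where "frob \<equiv> fls_frob q"

lemma frob_nth [simp]: "fls_nth (frob x) n = fls_nth x n ^ q"
  by (simp add: fls_nth_fls_frob)

lemma pow_add1: "(x + y :: 'k) ^ q = x ^ q + y ^ q"
  using pow_add[of x y 1] by simp

lemma pow_sum1: "(sum f A :: 'k) ^ q = (\<Sum>i\<in>A. f i ^ q)"
  using pow_sum[of f A 1] by simp

lemma pow_inj1: "(x :: 'k) ^ q = y ^ q \<longleftrightarrow> x = y"
  using pow_inj[of x 1 y] by simp

lemma frob_0 [simp]: "frob 0 = 0"
  by (rule fls_eqI) simp

lemma frob_const: "frob (fls_const c) = fls_const (c ^ q)"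
  by (rule fls_eqI) simp

lemma frob_add: "frob (x + y) = frob x + frob y"
  by (rule fls_eqI) (simp add: pow_add1)

lemma frob_sum: "frob (sum f A) = (\<Sum>i\<in>A. frob (f i))"
  by (induction A rule: infinite_finite_induct) (auto simp: frob_add)

lemma ordge_frob [simp]: "ordge c (frob x) \<longleftrightarrow> ordge c x"
  by (simp add: ordge_def)

lemma frob_mult: "frob (x * y) = frob x * frob y"
proof -
  obtain a b where ab: "ordge a x" "ordge b y" using ordge_ex by metis
  then have ab': "ordge a (frob x)" "ordge b (frob y)" by auto
  show ?thesis
    by (rule fls_eqI)
      (simp add: fls_mult_nth_ordge[OF ab] fls_mult_nth_ordge[OF ab'] pow_sum1 power_mult_distrib)
qed

lemma frob_inj: "frob x = frob y \<longleftrightarrow> x = y"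
  by (auto simp: fls_eq_iff pow_inj1)

lemma frob_eq_0 [simp]: "frob x = 0 \<longleftrightarrow> x = 0"
  using frob_inj[of x 0] by simp

lemma frob_X_powi [simp]: "frob (fls_X powi r) = fls_X powi r"
  by (rule fls_eqI) (simp add: fls_X_power_int power_0_left)

lemma frob_surj: "\<exists>y. frob y = x"
proof -
  obtain c where c: "ordge c x" using ordge_ex by blast
  obtain g where g: "\<And>a. g a ^ q = (a::'k)" using nth_root_exists[OF q_pos(1)] by metis
  \<comment> \<open>The series of roots thus vanishes wherever \<open>x\<close> does and is a
    Laurent series.\<close>
  have g0: "g 0 = 0" using g[of 0] by simp
  have "fls_nth (Abs_fls (\<lambda>n. g (fls_nth x n))) n = g (fls_nth x n)" for n
    by (rule nth_Abs_fls_lower_bound[of c]) (simp add: ordgeD[OF c] g0)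
  then have "frob (Abs_fls (\<lambda>n. g (fls_nth x n))) = x"
    by (intro fls_eqI) (simp add: g)
  then show ?thesis by blast
qed

lemma frob_funpow: "(frob ^^ s) x = fls_frob (q ^ s) x"
proof (rule fls_eqI)
  fix n show "fls_nth ((frob ^^ s) x) n = fls_nth (fls_frob (q ^ s) x) n"
    by (induction s) (simp_all add: fls_nth_fls_frob power_mult[symmetric] mult.commute)
qed

text \<open>Unknown coefficients are found one after the other by dependent choice: the hypothesis
  on \<open>G\<close> says that the right-hand side at \<open>n\<close> sees only coefficients of
  smaller index.\<close>

lemma recursive_solution:
  assumes "p \<noteq> (0 :: 'k poly)"
    and "\<And>n f g. (\<And>i. i < n \<Longrightarrow> f i = g i) \<Longrightarrow> G n f = G n g"
  shows "\<exists>t :: nat \<Rightarrow> 'k. \<forall>n. qev q p (t n) = G n t"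
proof (rule dependent_wf_choice[of "{(m, n). m < n}" "\<lambda>t n x. qev q p x = G n t"])
  show "wf {(m::nat, n). m < n}" by (rule wf_less)
  show "(qev q p r = G x f) = (qev q p r = G x g)"
    if "\<And>z. (z, x) \<in> {(m, n). m < n} \<Longrightarrow> f z = g z" for f g x r
    using assms(2)[of x f g] that by simp
  show "\<exists>r. qev q p r = G x f" for x f
    by (rule qev_surj[OF assms(1)])
qed

lemma nat_fls_ex: "\<exists>x :: 'k fls. ordge c x \<and> (\<forall>n. fls_nth x (c + int n) = t n)"
proof -
  let ?x = "Abs_fls (\<lambda>n. if n < c then 0 else t (nat (n - c)))"
  have "fls_nth ?x n = (if n < c then 0 else t (nat (n - c)))" for n
    by (rule nth_Abs_fls_lower_bound[of c]) simp
  then show ?thesis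
    by (intro exI[of _ ?x]) (simp add: ordge_def)
qed

lemma fls_eq_ordgeI:
  assumes "ordge c x" "ordge c y" "\<And>n. fls_nth x (c + int n) = fls_nth y (c + int n)"
  shows "x = y"
proof (rule fls_eqI)
  fix m show "fls_nth x m = fls_nth y m"
  proof (cases "m < c")
    case False
    then show ?thesis using assms(3)[of "nat (m - c)"] by simp
  qed (use assms in \<open>simp add: ordge_def\<close>)
qed

text \<open>The twisted Artin--Schreier equation is solved coefficient by coefficient; which coefficient
  is determined at each stage depends on the sign of \<open>r\<close>.\<close>

lemma artin_schreier_fls:
  assumes f: "ordge c f"
  shows "\<exists>a. ordge c a \<and> fls_X powi r * frob a - a = f"
proof -
  consider (zero) "r = 0" | (pos) "r > 0" | (neg) "r < 0" by linarith
  then show ?thesis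
  proof cases
    case zero
    have "[:-1, 1:] \<noteq> (0::'k poly)" by simp
    from recursive_solution[OF this, of "\<lambda>n t. fls_nth f (c + int n)"] obtain t
      where t: "\<And>n. qev q [:-1, 1:] (t n) = fls_nth f (c + int n)" by auto
    obtain a where a: "ordge c a" "\<And>n. fls_nth a (c + int n) = t n" using nat_fls_ex by blast
    have "frob a - a = f"
      by (rule fls_eq_ordgeI[of c])
        (use a f t in \<open>auto simp: qev_def intro: ordge_diff\<close>)
    then show ?thesis using a zero by auto
  next
    case pos
    define s where "s = nat r"
    have s: "r = int s" "s > 0" using pos by (auto simp: s_def)
    \<comment> \<open>For r > 0 the twisted term involves earlier coefficients only, so
      \<open>t n\<close> is given explicitly; the polynomial to invert is \<open>[:1:]\<close>, the
      identity.\<close>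
    define G :: "nat \<Rightarrow> (nat \<Rightarrow> 'k) \<Rightarrow> 'k"
      where "G = (\<lambda>n t. (if n < s then 0 else t (n - s) ^ q) - fls_nth f (c + int n))"
    have "\<exists>t. \<forall>n. qev q [:1:] (t n) = G n t"
    proof (rule recursive_solution)
      show "G n f = G n g" if "\<And>i. i < n \<Longrightarrow> f i = g i" for n f g
        using that[of "n - s"] s by (auto simp: G_def)
    qed simp
    then obtain t where t: "\<And>n. t n = G n t" by (auto simp: qev_def)
    obtain a where a: "ordge c a" "\<And>n. fls_nth a (c + int n) = t n" using nat_fls_ex by blast
    have "fls_X powi r * frob a - a = f"
    proof (rule fls_eq_ordgeI[of c])
      show "ordge c (fls_X powi r * frob a - a)"
        using a(1) pos ordge_mono[OF a(1), of "c - r"]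
        by (auto intro!: ordge_diff simp: ordge_X_powi_mult)
      fix n
      have "fls_nth (fls_X powi r * frob a) (c + int n) = (if n < s then 0 else t (n - s) ^ q)"
        using a(2)[of "n - s"] ordgeD[OF a(1), of "c + int n - r"]
        unfolding fls_X_powi_mult_nth by (auto simp: s of_nat_diff algebra_simps)
      then show "fls_nth (fls_X powi r * frob a - a) (c + int n) = fls_nth f (c + int n)"
        using a(2)[of n] t[of n] by (simp add: G_def)
    qed (rule f)
    then show ?thesis using a by blast
  next
    case neg
    define s where "s = nat (- r)"
    have s: "r = - int s" "s > 0" using neg by (auto simp: s_def)
    \<comment> \<open>For r < 0 the twisted term leads, and \<open>t n ^ q\<close> is determined.
      Setting the first \<open>s\<close> coefficients to 0 keeps this term, which is shifted down by
      \<open>s\<close>, from reaching below \<open>c\<close>; so the solution has the same order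
      bound as \<open>f\<close>.\<close>
    define G :: "nat \<Rightarrow> (nat \<Rightarrow> 'k) \<Rightarrow> 'k"
      where "G = (\<lambda>n t. if n < s then 0 else t (n - s) + fls_nth f (c + int (n - s)))"
    have "\<exists>t. \<forall>n. qev q (monom 1 1) (t n) = G n t"
    proof (rule recursive_solution)
      show "G n f = G n g" if "\<And>i. i < n \<Longrightarrow> f i = g i" for n f g
        using that[of "n - s"] s by (auto simp: G_def)
    qed simp
    then obtain t where t: "\<And>n. t n ^ q = G n t"
      by (auto simp: qev_def degree_monom_eq)
    obtain a where a: "ordge c a" "\<And>n. fls_nth a (c + int n) = t n" using nat_fls_ex by blast
    have nth: "fls_nth (fls_X powi r * frob a) (c + int m - int s) = G m t" for m
      using t[of m] a(2)[of m] unfolding fls_X_powi_mult_nth by (auto simp: s algebra_simps)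
    have "fls_X powi r * frob a - a = f"
    proof (rule fls_eq_ordgeI[of c])
      have "ordge c (fls_X powi r * frob a)"
        unfolding ordge_def
      proof (intro allI impI)
        fix m assume m: "m < c"
        show "fls_nth (fls_X powi r * frob a) m = 0"
        proof (cases "m + int s < c")
          case True
          then show ?thesis using ordgeD[OF a(1), of "m - r"] by (simp add: fls_X_powi_mult_nth s)
        next
          case False
          define l where "l = nat (m + int s - c)"
          have "m = c + int l - int s" "l < s" using False m by (auto simp: l_def)
          then show ?thesis using nth[of l] by (simp add: G_def)
        qed
      qed
      then show "ordge c (fls_X powi r * frob a - a)" using a by (auto intro: ordge_diff)
      fix n
      have "fls_nth (fls_X powi r * frob a) (c + int n) = t n + fls_nth f (c + int n)"
        using nth[of "n + s"] by (simp add: G_def)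
      then show "fls_nth (fls_X powi r * frob a - a) (c + int n) = fls_nth f (c + int n)"
        using a(2)[of n] by simp
    qed (rule f)
    then show ?thesis using a by blast
  qed
qed

text \<open>Every coefficient satisfies the same additive polynomial \<open>p\<close> with a
  right-hand side made of earlier coefficients. Its linear coefficient is 1, and \<open>c u\<close>
  gives it positive q-degree, so the homogeneous equation at index 0 has a nonzero solution to start
  from.\<close>

lemma semilinear_fixed_point_fls:
  assumes c: "\<And>j. j \<in> {1..d} \<Longrightarrow> ordge 0 (c j)" and u: "u \<in> {1..d}" "fls_nth (c u) 0 \<noteq> 0"
  shows "\<exists>t. fls_nth t 0 \<noteq> 0 \<and> t = (\<Sum>j=1..d. c j * (frob ^^ j) t)"
proof -
  define p where "p = (\<Sum>j\<le>d. monom (if j = 0 then 1 else - fls_nth (c j) 0) j)"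
  have co: "coeff p j = (if j = 0 then 1 else if j \<le> d then - fls_nth (c j) 0 else 0)" for j
    by (auto simp: p_def coeff_sum)
  have deg: "degree p \<le> d" by (rule degree_le) (auto simp: co)
  have ev: "qev q p x = x - (\<Sum>j=1..d. fls_nth (c j) 0 * x ^ (q ^ j))" for x
  proof -
    have "qev q p x = (\<Sum>j\<in>insert 0 {1..d}. coeff p j * x ^ (q ^ j))"
      unfolding qev_sum_upto[OF deg] by (rule sum.cong) auto
    also have "\<dots> = x + (\<Sum>j=1..d. coeff p j * x ^ (q ^ j))"
      by (subst sum.insert) (auto simp: co)
    also have "(\<Sum>j=1..d. coeff p j * x ^ (q ^ j)) = (\<Sum>j=1..d. - (fls_nth (c j) 0 * x ^ (q ^ j)))"
      by (rule sum.cong) (auto simp: co)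
    finally show ?thesis by (simp add: sum_negf)
  qed
  have "coeff p u \<noteq> 0" using u by (auto simp: co)
  then have "degree p > 0" using u le_degree[of p u] by auto
  then obtain t0 where t0: "t0 \<noteq> 0" "qev q p t0 = 0"
    using qev_nonzero_root[of p] co[of 0] by auto
  define G :: "nat \<Rightarrow> (nat \<Rightarrow> 'k) \<Rightarrow> 'k"
    where "G = (\<lambda>n t. \<Sum>j=1..d. \<Sum>i=1..n. fls_nth (c j) (int i) * t (n - i) ^ (q ^ j))"
  have "\<exists>t. \<forall>n. qev q p (t n) = G n t \<and> (n = 0 \<longrightarrow> t n = t0)"
  proof (rule dependent_wf_choice[of "{(m, n). m < n}"
        "\<lambda>t n x. qev q p x = G n t \<and> (n = 0 \<longrightarrow> x = t0)"])
    show "(qev q p r = G x f \<and> (x = 0 \<longrightarrow> r = t0)) = (qev q p r = G x g \<and> (x = 0 \<longrightarrow> r = t0))"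
      if "\<And>z. (z, x) \<in> {(m, n). m < n} \<Longrightarrow> f z = g z" for f g x r
    proof -
      have "G x f = G x g" unfolding G_def by (intro sum.cong refl) (use that in auto)
      then show ?thesis by simp
    qed
    show "\<exists>r. qev q p r = G x f \<and> (x = 0 \<longrightarrow> r = t0)" for x f
    proof (cases "x = 0")
      case True
      then show ?thesis using t0 by (auto simp: G_def)
    next
      case False
      have "p \<noteq> 0" using \<open>coeff p u \<noteq> 0\<close> by auto
      then show ?thesis using qev_surj False by auto
    qed
  qed (simp add: wf_less)
  then obtain t where t: "\<And>n. qev q p (t n) = G n t" "t 0 = t0" by auto
  obtain a where a: "ordge 0 a" "\<And>n. fls_nth a (0 + int n) = t n" using nat_fls_ex by blast
  have fr: "ordge 0 ((frob ^^ j) a)" for j by (induction j) (auto simp: a)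
  have frn: "fls_nth ((frob ^^ j) a) n = fls_nth a n ^ (q ^ j)" for j n
    by (simp add: frob_funpow fls_nth_fls_frob)
  have "a = (\<Sum>j=1..d. c j * (frob ^^ j) a)"
  proof (rule fls_eq_ordgeI[of 0])
    show "ordge 0 (\<Sum>j=1..d. c j * (frob ^^ j) a)"
      by (rule ordge_sum) (use ordge_mult[OF c fr] in auto)
    fix n
    have "fls_nth (\<Sum>j=1..d. c j * (frob ^^ j) a) (int n)
        = (\<Sum>j=1..d. \<Sum>i=0..int n. fls_nth (c j) i * fls_nth a (int n - i) ^ (q ^ j))"
      by (simp add: fls_nth_sum frn fls_mult_nth_ordge[OF c fr])
    also have "\<dots> = (\<Sum>j=1..d. \<Sum>i=0..n. fls_nth (c j) (int i) * t (n - i) ^ (q ^ j))"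
    proof (rule sum.cong[OF refl])
      fix j
      have "{0..int n} = int ` {0..n}" by (simp add: image_int_atLeastAtMost)
      then show "(\<Sum>i=0..int n. fls_nth (c j) i * fls_nth a (int n - i) ^ (q ^ j))
        = (\<Sum>i=0..n. fls_nth (c j) (int i) * t (n - i) ^ (q ^ j))"
        using a(2) by (simp add: sum.reindex flip: of_nat_diff)
    qed
    also have "\<dots> = (\<Sum>j=1..d. fls_nth (c j) 0 * t n ^ (q ^ j)) + G n t"
      by (simp add: G_def sum.atLeast_Suc_atMost sum.distrib)
    also have "\<dots> = t n" using t(1)[of n] by (simp add: ev diff_eq_eq add.commute)
    finally show "fls_nth a (0 + int n) = fls_nth (\<Sum>j=1..d. c j * (frob ^^ j) a) (0 + int n)"
      using a(2)[of n] by simp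
  qed (rule a)
  moreover have "fls_nth a 0 \<noteq> 0" using a(2)[of 0] t(2) t0 by simp
  ultimately show ?thesis by blast
qed

end

section \<open>Systems of additive polynomial equations\<close>

context frobenius_field
begin

definition qmap :: "'i set \<Rightarrow> ('i \<Rightarrow> 'k poly) \<Rightarrow> ('i \<Rightarrow> 'k) \<Rightarrow> 'k" where
  "qmap I c z = (\<Sum>i\<in>I. qev q (c i) (z i))"

text \<open>Points are functions on the whole index type; coordinates outside \<open>I\<close> are
  unconstrained. Additivity makes the zero set a group, so nonempty fibres of its projections are
  translates of each other.\<close>

definition qzeros :: "'i set \<Rightarrow> ('i \<Rightarrow> 'k poly) list \<Rightarrow> ('i \<Rightarrow> 'k) set" where
  "qzeros I es = {z. \<forall>c\<in>set es. qmap I c z = 0}"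

lemma qmap_add: "qmap I c (\<lambda>i. z i + z' i) = qmap I c z + qmap I c z'"
  by (simp add: qmap_def qev_add sum.distrib)

lemma qmap_zero: "qmap I c (\<lambda>i. 0) = 0"
  using qmap_add[of I c "\<lambda>i. 0" "\<lambda>i. 0"] by (simp only: add_0 add_cancel_right_right)

lemma qmap_diff: "qmap I c (\<lambda>i. z i - z' i) = qmap I c z - qmap I c z'"
  using qmap_add[of I c "\<lambda>i. z i - z' i" z'] by simp

lemma qzeros_diff: "z \<in> qzeros I es \<Longrightarrow> z' \<in> qzeros I es \<Longrightarrow> (\<lambda>i. z i - z' i) \<in> qzeros I es"
  by (simp add: qzeros_def qmap_diff)

lemma qmap_cong: "(\<And>i. i \<in> I \<Longrightarrow> c i \<noteq> 0 \<Longrightarrow> z i = z' i) \<Longrightarrow> qmap I c z = qmap I c z'"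
  unfolding qmap_def by (rule sum.cong[OF refl]) (metis qev_0)

lemma qmap_mono_neutral:
  "finite I \<Longrightarrow> I' \<subseteq> I \<Longrightarrow> (\<And>i. i \<in> I - I' \<Longrightarrow> c i = 0) \<Longrightarrow> qmap I c z = qmap I' c z"
  unfolding qmap_def by (rule sum.mono_neutral_right) auto

text \<open>Left composition of an additive polynomial with a power of the Frobenius, x \<mapsto>
  p(x)^(q^l). It is used to match leading terms of different q-degree.\<close>

definition qshift :: "nat \<Rightarrow> 'k poly \<Rightarrow> 'k poly" where
  "qshift l p = monom 1 l * map_poly (\<lambda>x. x ^ (q ^ l)) p"

lemma coeff_qshift: "coeff (qshift l p) n = (if n < l then 0 else coeff p (n - l) ^ (q ^ l))"
  by (simp add: qshift_def coeff_monom_mult coeff_map_poly)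

lemma qshift_0 [simp]: "qshift l 0 = 0"
  by (simp add: qshift_def)

lemma degree_qshift_le: "degree (qshift l p) \<le> degree p + l"
  by (rule degree_le) (auto simp: coeff_qshift coeff_eq_0 power_0_left)

lemma qev_qshift: "qev q (qshift l p) x = qev q p x ^ (q ^ l)"
proof -
  have "qev q (qshift l p) x = (\<Sum>n\<le>degree p + l. coeff (qshift l p) n * x ^ (q ^ n))"
    by (rule qev_sum_upto[OF degree_qshift_le])
  also have "\<dots> = (\<Sum>n\<in>{l..degree p + l}. coeff (qshift l p) n * x ^ (q ^ n))"
    by (rule sum.mono_neutral_right) (auto simp: coeff_qshift)
  also have "\<dots> = (\<Sum>n\<in>{0..degree p}. coeff (qshift l p) (n + l) * x ^ (q ^ (n + l)))"
    using sum.shift_bounds_cl_nat_ivl[of "\<lambda>n. coeff (qshift l p) n * x ^ (q ^ n)" 0 l "degree p"]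
    by simp
  also have "\<dots> = (\<Sum>n\<le>degree p. coeff p n ^ (q ^ l) * (x ^ (q ^ n)) ^ (q ^ l))"
    by (rule sum.cong) (auto simp: coeff_qshift power_add power_mult)
  also have "\<dots> = qev q p x ^ (q ^ l)"
    by (simp add: qev_def pow_sum power_mult_distrib)
  finally show ?thesis .
qed

text \<open>Unlike \<open>degree\<close>, this separates the zero polynomial from q-degree 0, so
  that cancelling a leading coefficient always decreases the measure.\<close>

definition qsize :: "'k poly \<Rightarrow> nat" where
  "qsize p = (if p = 0 then 0 else Suc (degree p))"

text \<open>The division step for additive polynomials: a scaled Frobenius power of the second
  equation cancels the top coefficient of the first one at coordinate \<open>j\<close>. No
  coordinate appears that was absent from both equations.\<close>

lemma qmap_reduce:
  assumes "c1 j \<noteq> 0" "c2 j \<noteq> 0" "degree (c2 j) \<le> degree (c1 j)"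
  shows "\<exists>c a l. qsize (c j) < qsize (c1 j) \<and> (\<forall>i. c1 i = 0 \<longrightarrow> c2 i = 0 \<longrightarrow> c i = 0) \<and>
           (\<forall>z. qmap I c z = qmap I c1 z - a * qmap I c2 z ^ (q ^ l))"
proof -
  define l where "l = degree (c1 j) - degree (c2 j)"
  define a where "a = lead_coeff (c1 j) / lead_coeff (c2 j) ^ (q ^ l)"
  define c where "c = (\<lambda>i. c1 i - Polynomial.smult a (qshift l (c2 i)))"
  have co: "coeff (c j) n = 0" if "n \<ge> degree (c1 j)" for n
  proof (cases "n = degree (c1 j)")
    case True
    then show ?thesis using assms by (auto simp: c_def coeff_qshift l_def a_def)
  next
    case False
    then have "n > degree (c1 j)" "n > degree (qshift l (c2 j))"
      using that degree_qshift_le[of l "c2 j"] assms(3) by (auto simp: l_def)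
    then show ?thesis by (simp add: c_def coeff_eq_0)
  qed
  have "qsize (c j) < qsize (c1 j)"
    using co[of "degree (c j)"] assms(1) by (force simp: qsize_def not_le)
  moreover have "qmap I c z = qmap I c1 z - a * qmap I c2 z ^ (q ^ l)" for z
    by (simp add: qmap_def c_def qev_diff qev_smult qev_qshift pow_sum sum_subtractf sum_distrib_left)
  moreover have "c1 i = 0 \<longrightarrow> c2 i = 0 \<longrightarrow> c i = 0" for i by (simp add: c_def)
  ultimately show ?thesis by blast
qed

text \<open>Euclid's algorithm on the coefficients at \<open>j\<close>: while two equations involve
  this coordinate, one is reduced by the other. A single remaining equation can be solved for the
  coordinate, because nonzero additive polynomials are onto, and so imposes nothing on the
  others.\<close>

lemma eliminate_coordinate:
  assumes I: "finite I" "j \<in> I"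
  shows "\<exists>es'. (\<forall>c\<in>set es'. c j = 0) \<and> (\<forall>i. (\<forall>c\<in>set es. c i = 0) \<longrightarrow> (\<forall>c\<in>set es'. c i = 0)) \<and>
           (\<forall>z. (\<exists>t. z(j := t) \<in> qzeros I es) \<longleftrightarrow> z \<in> qzeros I es')"
proof (induction "sum_list (map (\<lambda>c. qsize (c j)) es)" arbitrary: es rule: less_induct)
  case less
  define F where "F = filter (\<lambda>c. c j \<noteq> 0) es"
  define E where "E = filter (\<lambda>c. c j = 0) es"
  have set: "set es = set F \<union> set E" by (auto simp: F_def E_def)
  have Ej: "\<forall>c\<in>set E. c j = 0" and Esub: "set E \<subseteq> set es" by (auto simp: E_def)
  have E0: "qmap I c (z(j := t)) = qmap I c z" if "c \<in> set E" for c z t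
    using that by (intro qmap_cong) (auto simp: E_def)
  have split: "sum_list (map (\<lambda>c. qsize (c j)) es) = sum_list (map (\<lambda>c. qsize (c j)) F)"
    unfolding F_def by (induction es) (auto simp: qsize_def)
  have szE: "sum_list (map (\<lambda>c. qsize (c j)) E) = 0"
    unfolding E_def by (induction es) (auto simp: qsize_def)
  consider "F = []" | c where "F = [c]" | c1 c2 F' where "F = c1 # c2 # F'"
    by (cases F rule: list.exhaust) (metis list.exhaust)+
  then show ?case
  proof cases
    case 1
    have "(\<forall>c\<in>set E. qmap I c (z(j := t)) = 0) = (\<forall>c\<in>set E. qmap I c z = 0)" for z t
      by (rule ball_cong[OF refl]) (simp only: E0)
    then have "z(j := t) \<in> qzeros I es \<longleftrightarrow> z \<in> qzeros I E" for z t
      unfolding qzeros_def set 1 list.set Un_empty_left mem_Collect_eq .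
    then show ?thesis using Ej Esub by (intro exI[of _ E] conjI) blast+
  next
    case (2 c)
    have "c \<in> set F" using 2 by auto
    then have cj: "c j \<noteq> 0" by (auto simp: F_def)
    have "(\<exists>t. z(j := t) \<in> qzeros I es) \<longleftrightarrow> z \<in> qzeros I E" for z
    proof
      assume "\<exists>t. z(j := t) \<in> qzeros I es"
      then obtain t where "z(j := t) \<in> qzeros I es" by blast
      then show "z \<in> qzeros I E" using E0[of _ z t] set by (auto simp: qzeros_def)
    next
      assume z: "z \<in> qzeros I E"
      obtain t where t: "qev q (c j) t = - qmap (I - {j}) c z"
        using qev_surj[OF cj] by blast
      have "qmap I c (z(j := t)) = qev q (c j) t + qmap (I - {j}) c (z(j := t))"
        using I by (simp add: qmap_def sum.remove[of I j])
      also have "qmap (I - {j}) c (z(j := t)) = qmap (I - {j}) c z"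
        by (rule qmap_cong) auto
      finally have e: "qmap I c (z(j := t)) = qev q (c j) t + qmap (I - {j}) c z" .
      have "qmap I c (z(j := t)) = 0" by (subst e) (simp add: t)
      moreover have "qmap I c' (z(j := t)) = 0" if "c' \<in> set E" for c'
        using E0[OF that, of z t] z that unfolding qzeros_def by auto
      ultimately have "z(j := t) \<in> qzeros I es"
        unfolding qzeros_def set 2 list.set mem_Collect_eq by blast
      then show "\<exists>t. z(j := t) \<in> qzeros I es" ..
    qed
    then show ?thesis using Ej Esub by (intro exI[of _ E] conjI) blast+
  next
    case (3 c1 c2 F')
    have "c1 \<in> set F" "c2 \<in> set F" using 3 by auto
    then have nz: "c1 j \<noteq> 0" "c2 j \<noteq> 0" by (auto simp: F_def)
    obtain x y where xy: "x j \<noteq> 0" "y j \<noteq> 0" "degree (y j) \<le> degree (x j)"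
      "{x, y} = {c1, c2}" "qsize (x j) + qsize (y j) = qsize (c1 j) + qsize (c2 j)"
    proof (cases "degree (c2 j) \<le> degree (c1 j)")
      case True
      then show ?thesis using that[of c1 c2] nz by simp
    next
      case False
      then show ?thesis using that[of c2 c1] nz by (simp add: insert_commute add.commute)
    qed
    obtain c a l where c: "qsize (c j) < qsize (x j)" "\<And>i. x i = 0 \<Longrightarrow> y i = 0 \<Longrightarrow> c i = 0"
      "\<And>z. qmap I c z = qmap I x z - a * qmap I y z ^ (q ^ l)"
      using qmap_reduce[of x j y I] xy(1-3) by auto
    define es2 where "es2 = c # y # F' @ E"
    have "sum_list (map (\<lambda>c. qsize (c j)) es2) < sum_list (map (\<lambda>c. qsize (c j)) es)"
      unfolding split 3 es2_def using c(1) xy(5) by (simp add: szE del: sum_list_eq_0_iff)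
    from less[OF this] obtain es' where es': "\<forall>c\<in>set es'. c j = 0"
      "\<And>i. (\<forall>c\<in>set es2. c i = 0) \<longrightarrow> (\<forall>c\<in>set es'. c i = 0)"
      "\<And>z. (\<exists>t. z(j := t) \<in> qzeros I es2) \<longleftrightarrow> z \<in> qzeros I es'" by blast
    have s: "set es = {x, y} \<union> set F' \<union> set E" using set 3 xy(4) by auto
    \<comment> \<open>\<open>c\<close> differs from \<open>x\<close> by a multiple of a Frobenius
      power of \<open>y\<close>, so in the presence of the equation \<open>y\<close> both impose the
      same condition.\<close>
    have same: "qzeros I es2 = qzeros I es"
    proof (rule Set.set_eqI)
      fix z
      have "qmap I y z = 0 \<Longrightarrow> qmap I c z = qmap I x z" by (simp add: c(3) power_0_left)
      then show "z \<in> qzeros I es2 \<longleftrightarrow> z \<in> qzeros I es"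
        unfolding qzeros_def s es2_def mem_Collect_eq list.set set_append Set.ball_simps(7)
          Set.ball_Un by (cases "qmap I y z = 0") simp_all
    qed
    have "(\<forall>c\<in>set es. c i = 0) \<longrightarrow> (\<forall>c\<in>set es'. c i = 0)" for i
      using es'(2)[of i] c(2)[of i] unfolding s es2_def list.set set_append by blast
    then show ?thesis using es'(1,3) unfolding same by blast
  qed
qed

lemma eliminate_coordinates:
  assumes I: "finite I" "J \<subseteq> I"
  shows "\<exists>es'. (\<forall>c\<in>set es'. \<forall>j\<in>J. c j = 0) \<and>
           (\<forall>i. (\<forall>c\<in>set es. c i = 0) \<longrightarrow> (\<forall>c\<in>set es'. c i = 0)) \<and>
           (\<forall>z. (\<exists>z'. (\<forall>i. i \<notin> J \<longrightarrow> z' i = z i) \<and> z' \<in> qzeros I es) \<longleftrightarrow> z \<in> qzeros I es')"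
proof -
  have "finite J" using I finite_subset by blast
  then show ?thesis using I(2)
  proof (induction J rule: finite_induct)
    case empty
    have "(\<exists>z'. (\<forall>i. z' i = z i) \<and> z' \<in> qzeros I es) \<longleftrightarrow> z \<in> qzeros I es" for z
      by (metis ext)
    then show ?case by (intro exI[of _ es]) simp
  next
    case (insert j J)
    then obtain es1 where es1: "\<forall>c\<in>set es1. \<forall>j\<in>J. c j = 0"
      "\<And>i. (\<forall>c\<in>set es. c i = 0) \<longrightarrow> (\<forall>c\<in>set es1. c i = 0)"
      "\<And>z. (\<exists>z'. (\<forall>i. i \<notin> J \<longrightarrow> z' i = z i) \<and> z' \<in> qzeros I es) \<longleftrightarrow> z \<in> qzeros I es1"
      by auto
    obtain es2 where es2: "\<forall>c\<in>set es2. c j = 0"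
      "\<And>i. (\<forall>c\<in>set es1. c i = 0) \<longrightarrow> (\<forall>c\<in>set es2. c i = 0)"
      "\<And>z. (\<exists>t. z(j := t) \<in> qzeros I es1) \<longleftrightarrow> z \<in> qzeros I es2"
      using eliminate_coordinate[OF I(1), of j es1] insert.prems by blast
    have "(\<exists>z'. (\<forall>i. i \<notin> insert j J \<longrightarrow> z' i = z i) \<and> z' \<in> qzeros I es) \<longleftrightarrow> z \<in> qzeros I es2" for z
    proof
      assume "\<exists>z'. (\<forall>i. i \<notin> insert j J \<longrightarrow> z' i = z i) \<and> z' \<in> qzeros I es"
      then obtain z' where z': "\<forall>i. i \<notin> insert j J \<longrightarrow> z' i = z i" "z' \<in> qzeros I es" by blast
      have "\<forall>i. i \<notin> J \<longrightarrow> z' i = (z(j := z' j)) i" using z' by auto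
      then have "z(j := z' j) \<in> qzeros I es1" using es1(3) z'(2) by blast
      then show "z \<in> qzeros I es2" using es2(3) by blast
    next
      assume "z \<in> qzeros I es2"
      then obtain t where "z(j := t) \<in> qzeros I es1" using es2(3) by blast
      then obtain z' where "\<forall>i. i \<notin> J \<longrightarrow> z' i = (z(j := t)) i" "z' \<in> qzeros I es"
        using es1(3) by blast
      then show "\<exists>z'. (\<forall>i. i \<notin> insert j J \<longrightarrow> z' i = z i) \<and> z' \<in> qzeros I es"
        by (intro exI[of _ z']) auto
    qed
    moreover have "\<forall>c\<in>set es2. \<forall>i\<in>insert j J. c i = 0"
      using es1(1) es2(1) es2(2) by simp
    moreover have "\<forall>i. (\<forall>c\<in>set es. c i = 0) \<longrightarrow> (\<forall>c\<in>set es2. c i = 0)"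
      using es1(2) es2(2) by blast
    ultimately show ?case by blast
  qed
qed

text \<open>Noether normalisation of the fibres of the projection of \<open>qzeros I es\<close> to the coordinates
  in \<open>B\<close>. The relations are again additive, so over every point of the image the fibre surjects
  onto the space of the free coordinates \<open>J\<close>.\<close>

lemma relative_normalization:
  assumes I: "finite I" "A \<subseteq> I" "A \<inter> B = {}" and es: "\<And>c i. c \<in> set es \<Longrightarrow> i \<notin> A \<union> B \<Longrightarrow> c i = 0"
  shows "\<exists>J rel es'. J \<subseteq> A \<and> fst ` set rel = A - J \<and>
     sorted_wrt (\<lambda>(r, c) (r', c'). c' r = 0) rel \<and>
     (\<forall>(r, c)\<in>set rel. c r \<noteq> 0 \<and> (\<forall>i. i \<notin> B \<longrightarrow> degree (c i) \<le> degree (c r)) \<and>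
        (\<forall>i. i \<notin> A \<union> B \<longrightarrow> c i = 0) \<and> (\<forall>z\<in>qzeros I es. qmap I c z = 0)) \<and>
     (\<forall>c\<in>set es'. \<forall>i. i \<notin> B \<longrightarrow> c i = 0) \<and>
     (\<forall>c\<in>set es'. \<forall>z\<in>qzeros I es. qmap I c z = 0) \<and>
     (\<forall>z\<in>qzeros I es'. \<exists>z'\<in>qzeros I es. \<forall>i\<in>J \<union> B. z' i = z i)"
  using assms(2-)
proof (induction "card A" arbitrary: A es rule: less_induct)
  case less
  have finA: "finite A" using less.prems I(1) finite_subset by blast
  show ?case
  proof (cases "\<forall>c\<in>set es. \<forall>i\<in>A. c i = 0")
    case True
    then have "\<forall>c\<in>set es. \<forall>i. i \<notin> B \<longrightarrow> c i = 0" using less.prems(3) by blast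
    then show ?thesis
      by (intro exI[of _ A] exI[of _ "[]"] exI[of _ es]) (auto simp: qzeros_def)
  next
    case False
    then obtain c i where c: "c \<in> set es" "i \<in> A" "c i \<noteq> 0" by blast
    define A' where "A' = {i\<in>A. c i \<noteq> 0}"
    have "finite A'" "A' \<noteq> {}" using finA c by (auto simp: A'_def)
    \<comment> \<open>With a pivot of maximal q-degree among the fibre coordinates, the relation
      expresses a power of the pivot by terms of no larger degree in these coordinates.\<close>
    then obtain r0 where r: "r0 \<in> A'" "\<And>i. i \<in> A' \<Longrightarrow> degree (c i) \<le> degree (c r0)"
      using obtains_MAX[of A' "\<lambda>i. degree (c i)"] by (metis Max_ge finite_imageI image_eqI)
    have r': "r0 \<in> A" "c r0 \<noteq> 0" using r by (auto simp: A'_def)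
    have deg: "degree (c i) \<le> degree (c r0)" if "i \<notin> B" for i
    proof (cases "i \<in> A'")
      case False
      then have "c i = 0" using that less.prems(3)[OF c(1), of i] by (auto simp: A'_def)
      then show ?thesis by simp
    qed (use r in auto)
    \<comment> \<open>The recursion runs on the projection that forgets the pivot, so later
      relations cannot involve it; this gives \<open>rel\<close> its triangular shape.\<close>
    obtain es1 where es1: "\<forall>c\<in>set es1. c r0 = 0"
      "\<And>i. (\<forall>c\<in>set es. c i = 0) \<longrightarrow> (\<forall>c\<in>set es1. c i = 0)"
      "\<And>z. (\<exists>t. z(r0 := t) \<in> qzeros I es) \<longleftrightarrow> z \<in> qzeros I es1"
      using eliminate_coordinate[OF I(1) subsetD[OF less.prems(1) r'(1)], of es] by blast
    have sub: "qzeros I es \<subseteq> qzeros I es1"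
      using es1(3) by (metis fun_upd_triv subsetI)
    have "card (A - {r0}) < card A" using r' finA by (intro card_Diff1_less)
    moreover have "c i = 0" if "c \<in> set es1" "i \<notin> (A - {r0}) \<union> B" for c i
      using that es1(1) es1(2)[of i] less.prems(3) by blast
    moreover have "A - {r0} \<subseteq> I" "(A - {r0}) \<inter> B = {}" using less.prems by auto
    ultimately have "\<exists>J rel es'. J \<subseteq> A - {r0} \<and> fst ` set rel = (A - {r0}) - J \<and>
       sorted_wrt (\<lambda>(r, c) (r', c'). c' r = 0) rel \<and>
       (\<forall>(r, c)\<in>set rel. c r \<noteq> 0 \<and> (\<forall>i. i \<notin> B \<longrightarrow> degree (c i) \<le> degree (c r)) \<and>
          (\<forall>i. i \<notin> (A - {r0}) \<union> B \<longrightarrow> c i = 0) \<and> (\<forall>z\<in>qzeros I es1. qmap I c z = 0)) \<and>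
       (\<forall>c\<in>set es'. \<forall>i. i \<notin> B \<longrightarrow> c i = 0) \<and>
       (\<forall>c\<in>set es'. \<forall>z\<in>qzeros I es1. qmap I c z = 0) \<and>
       (\<forall>z\<in>qzeros I es'. \<exists>z'\<in>qzeros I es1. \<forall>i\<in>J \<union> B. z' i = z i)"
      by (intro less.hyps) blast+
    then obtain J rel es' where IH: "J \<subseteq> A - {r0}" "fst ` set rel = (A - {r0}) - J"
      "sorted_wrt (\<lambda>(r, c) (r', c'). c' r = 0) rel"
      "\<forall>(r, c)\<in>set rel. c r \<noteq> 0 \<and> (\<forall>i. i \<notin> B \<longrightarrow> degree (c i) \<le> degree (c r)) \<and>
        (\<forall>i. i \<notin> (A - {r0}) \<union> B \<longrightarrow> c i = 0) \<and> (\<forall>z\<in>qzeros I es1. qmap I c z = 0)"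
      "\<forall>c\<in>set es'. \<forall>i. i \<notin> B \<longrightarrow> c i = 0"
      "\<forall>c\<in>set es'. \<forall>z\<in>qzeros I es1. qmap I c z = 0"
      "\<forall>z\<in>qzeros I es'. \<exists>z'\<in>qzeros I es1. \<forall>i\<in>J \<union> B. z' i = z i"
      by (elim exE conjE) (rule that; assumption)
    have relr: "\<forall>(r', c')\<in>set rel. c' r0 = 0"
    proof safe
      fix r' c' assume "(r', c') \<in> set rel"
      then have "r0 \<notin> (A - {r0}) \<union> B \<Longrightarrow> c' r0 = 0" using IH(4) by blast
      then show "c' r0 = 0" using r'(1) less.prems(2) by blast
    qed
    have vanish: "qmap I c' z = 0" if "z \<in> qzeros I es" "c' \<in> set es' \<or> (\<exists>r'. (r', c') \<in> set rel)" for c' z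
    proof -
      have z: "z \<in> qzeros I es1" using that(1) sub by blast
      from that(2) show ?thesis
      proof
        assume "c' \<in> set es'"
        then show ?thesis using IH(6) z by blast
      next
        assume "\<exists>r'. (r', c') \<in> set rel"
        then show ?thesis using IH(4) z by blast
      qed
    qed
    show ?thesis
    proof (intro exI[of _ J] exI[of _ "(r0, c) # rel"] exI[of _ es'] conjI)
      show "\<forall>z\<in>qzeros I es'. \<exists>z'\<in>qzeros I es. \<forall>i\<in>J \<union> B. z' i = z i"
      proof
        fix z assume "z \<in> qzeros I es'"
        then obtain z1 where z1: "z1 \<in> qzeros I es1" "\<forall>i\<in>J \<union> B. z1 i = z i" using IH(7) by blast
        then obtain t where t: "z1(r0 := t) \<in> qzeros I es" using es1(3) by blast
        have "r0 \<notin> J \<union> B" using IH(1) r'(1) less.prems(2) by auto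
        then show "\<exists>z'\<in>qzeros I es. \<forall>i\<in>J \<union> B. z' i = z i"
          using t z1 by (intro bexI[of _ "z1(r0 := t)"]) auto
      qed
      show "fst ` set ((r0, c) # rel) = A - J" using IH(1,2) r'(1) by auto
      show "sorted_wrt (\<lambda>(r, c) (r', c'). c' r = 0) ((r0, c) # rel)" using IH(3) relr by auto
      show "\<forall>(r, c)\<in>set ((r0, c) # rel). c r \<noteq> 0 \<and> (\<forall>i. i \<notin> B \<longrightarrow> degree (c i) \<le> degree (c r)) \<and>
          (\<forall>i. i \<notin> A \<union> B \<longrightarrow> c i = 0) \<and> (\<forall>z\<in>qzeros I es. qmap I c z = 0)"
      proof (intro ballI, clarify)
        fix r' c' assume mem: "(r', c') \<in> set ((r0, c) # rel)"
        show "c' r' \<noteq> 0 \<and> (\<forall>i. i \<notin> B \<longrightarrow> degree (c' i) \<le> degree (c' r')) \<and>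
          (\<forall>i. i \<notin> A \<union> B \<longrightarrow> c' i = 0) \<and> (\<forall>z\<in>qzeros I es. qmap I c' z = 0)"
        proof (cases "(r', c') = (r0, c)")
          case True
          then show ?thesis using r'(2) deg less.prems(3)[OF c(1)] c(1) by (auto simp: qzeros_def)
        next
          case False
          then have "(r', c') \<in> set rel" using mem by auto
          note mem' = this
          have "c' r' \<noteq> 0" "\<forall>i. i \<notin> B \<longrightarrow> degree (c' i) \<le> degree (c' r')"
            "\<forall>i. i \<notin> (A - {r0}) \<union> B \<longrightarrow> c' i = 0"
            using bspec[OF IH(4) mem'] by auto
          moreover have "\<forall>z\<in>qzeros I es. qmap I c' z = 0" using mem' vanish by metis
          ultimately show ?thesis by blast
        qed
      qed
      show "\<forall>c\<in>set es'. \<forall>i. i \<notin> B \<longrightarrow> c i = 0" by (rule IH(5))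
      show "\<forall>c\<in>set es'. \<forall>z\<in>qzeros I es. qmap I c z = 0" using vanish by blast
      show "J \<subseteq> A" using IH(1) by blast
    qed
  qed
qed

end

section \<open>Spaces of polynomial functions\<close>

definition fun_scale :: "'k::field \<Rightarrow> ('p \<Rightarrow> 'k) \<Rightarrow> 'p \<Rightarrow> 'k" where
  "fun_scale c f = (\<lambda>z. c * f z)"

lemma fun_sum_apply: "(\<Sum>i\<in>A. f i) z = (\<Sum>i\<in>A. f i z :: 'a::comm_monoid_add)"
  by (induction A rule: infinite_finite_induct) auto

interpretation fs: vector_space "fun_scale :: 'k::field \<Rightarrow> ('p \<Rightarrow> 'k) \<Rightarrow> 'p \<Rightarrow> 'k"
  by unfold_locales (auto simp: fun_scale_def fun_eq_iff algebra_simps)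

text \<open>The span after restriction to \<open>G\<close>, phrased with total functions so that a
  single vector space of functions suffices.\<close>

definition span_on :: "'p set \<Rightarrow> ('p \<Rightarrow> 'k::field) set \<Rightarrow> ('p \<Rightarrow> 'k) set" where
  "span_on G S = {f. \<exists>g\<in>fs.span S. \<forall>z\<in>G. f z = g z}"

lemma span_on_subspace: "fs.subspace (span_on G S)"
  unfolding fs.subspace_def span_on_def
proof (safe; (elim bexE)?)
  show "\<exists>g\<in>fs.span S. \<forall>z\<in>G. 0 z = g z" using fs.span_zero by blast
next
  fix x y g h assume "g \<in> fs.span S" "\<forall>z\<in>G. x z = g z" "h \<in> fs.span S" "\<forall>z\<in>G. y z = h z"
  then show "\<exists>g\<in>fs.span S. \<forall>z\<in>G. (x + y) z = g z"
    by (intro bexI[of _ "g + h"]) (auto intro: fs.span_add)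
next
  fix c x g assume "g \<in> fs.span S" "\<forall>z\<in>G. x z = g z"
  then show "\<exists>g\<in>fs.span S. \<forall>z\<in>G. fun_scale c x z = g z"
    by (intro bexI[of _ "fun_scale c g"] fs.span_scale) (auto simp: fun_scale_def)
qed

lemma span_on_superset: "f \<in> S \<Longrightarrow> f \<in> span_on G S"
  unfolding span_on_def by (auto intro: fs.span_base)

lemma span_on_cong: "f \<in> span_on G S \<Longrightarrow> (\<And>z. z \<in> G \<Longrightarrow> f' z = f z) \<Longrightarrow> f' \<in> span_on G S"
  unfolding span_on_def by auto

lemma span_on_sum:
  assumes "\<And>i. i \<in> X \<Longrightarrow> f i \<in> span_on G S"
  shows "(\<lambda>z. \<Sum>i\<in>X. a i * f i z) \<in> span_on G S"
proof -
  have "(\<lambda>z. \<Sum>i\<in>X. a i * f i z) = (\<Sum>i\<in>X. fun_scale (a i) (f i))"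
    by (auto simp: fun_eq_iff fun_scale_def fun_sum_apply)
  moreover have "(\<Sum>i\<in>X. fun_scale (a i) (f i)) \<in> span_on G S"
    by (intro fs.subspace_sum[OF span_on_subspace] fs.subspace_scale[OF span_on_subspace] assms)
  ultimately show ?thesis by (simp only:)
qed

lemma span_on_trans:
  assumes "f \<in> span_on G S" "S \<subseteq> span_on G T"
  shows "f \<in> span_on G T"
proof -
  obtain g where g: "g \<in> fs.span S" "\<forall>z\<in>G. f z = g z" using assms(1) by (auto simp: span_on_def)
  have "g \<in> span_on G T"
    using g(1) assms(2) fs.span_minimal[OF _ span_on_subspace] by blast
  then show ?thesis using g(2) by (auto intro: span_on_cong)
qed

section \<open>Polynomial functions of bounded weighted degree\<close>

definition mon :: "'i set \<Rightarrow> ('i \<Rightarrow> nat) \<Rightarrow> ('i \<Rightarrow> 'k::field) \<Rightarrow> 'k" where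
  "mon I e z = (\<Prod>i\<in>I. z i ^ e i)"

definition wt :: "'i set \<Rightarrow> ('i \<Rightarrow> nat) \<Rightarrow> ('i \<Rightarrow> nat) \<Rightarrow> nat" where
  "wt I w e = (\<Sum>i\<in>I. w i * e i)"

lemma mon_update:
  assumes "finite I" "i \<in> I"
  shows "mon I (e(i := e i + a)) z = mon I e z * z i ^ a"
proof -
  have "mon I (e(i := e i + a)) z = z i ^ (e i + a) * (\<Prod>j\<in>I-{i}. z j ^ e j)"
    unfolding mon_def using assms by (subst prod.remove[of I i]) (auto intro!: prod.cong)
  also have "\<dots> = mon I e z * z i ^ a"
    unfolding mon_def using prod.remove[OF assms, of "\<lambda>i. z i ^ e i"] by (simp add: power_add)
  finally show ?thesis .
qed

lemma wt_update:
  assumes "finite I" "i \<in> I"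
  shows "wt I w (e(i := e i + a)) = wt I w e + w i * a"
proof -
  have "wt I w (e(i := e i + a)) = w i * (e i + a) + (\<Sum>j\<in>I-{i}. w j * e j)"
    unfolding wt_def using assms by (subst sum.remove[of I i]) (auto intro!: sum.cong)
  also have "\<dots> = wt I w e + w i * a"
    unfolding wt_def using sum.remove[OF assms, of "\<lambda>i. w i * e i"] by (simp add: algebra_simps)
  finally show ?thesis .
qed

definition pol :: "'i set \<Rightarrow> ('i \<Rightarrow> nat) \<Rightarrow> nat \<Rightarrow> (('i \<Rightarrow> 'k::field) \<Rightarrow> 'k) set" where
  "pol I w d = fs.span {mon I e |e. wt I w e \<le> d}"

lemma pol_subspace: "fs.subspace (pol I w d)"
  unfolding pol_def by (rule fs.subspace_span)

lemma pol_mono: "f \<in> pol I w d \<Longrightarrow> d \<le> d' \<Longrightarrow> f \<in> pol I w d'"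
  unfolding pol_def by (rule subsetD[OF fs.span_mono]) auto

lemma pol_add: "f \<in> pol I w d \<Longrightarrow> g \<in> pol I w d \<Longrightarrow> (\<lambda>z. f z + g z) \<in> pol I w d"
  using fs.subspace_add[OF pol_subspace, of f I w d g] by (simp add: plus_fun_def)

lemma pol_scale: "f \<in> pol I w d \<Longrightarrow> (\<lambda>z. c * f z) \<in> pol I w d"
  using fs.subspace_scale[OF pol_subspace, of f I w d c] by (simp add: fun_scale_def)

lemma pol_diff: "f \<in> pol I w d \<Longrightarrow> g \<in> pol I w d \<Longrightarrow> (\<lambda>z. f z - g z) \<in> pol I w d"
  using pol_add[of f I w d "\<lambda>z. - 1 * g z"] pol_scale[of g I w d "-1"] by simp

lemma pol_sum: "(\<And>x. x \<in> X \<Longrightarrow> f x \<in> pol I w d) \<Longrightarrow> (\<lambda>z. \<Sum>x\<in>X. f x z) \<in> pol I w d"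
proof (induction X rule: infinite_finite_induct)
  case (insert x F)
  then show ?case by (simp add: pol_add)
qed (use fs.subspace_0[OF pol_subspace] in \<open>auto simp: zero_fun_def\<close>)

lemma pol_const: "(\<lambda>z. c) \<in> pol I w d"
proof -
  have "mon I (\<lambda>_. 0) \<in> pol I w d"
    unfolding pol_def by (rule fs.span_base) (auto simp: wt_def intro!: exI[of _ "\<lambda>_. 0"])
  from pol_scale[OF this, of c] show ?thesis by (simp add: mon_def)
qed

lemma pol_coord:
  assumes "finite I" "i \<in> I"
  shows "(\<lambda>z. z i) \<in> pol I w (w i)"
proof -
  define e :: "'a \<Rightarrow> nat" where "e = (\<lambda>_. 0)(i := 0 + 1)"
  have m: "mon I e = (\<lambda>z. z i)"
  proof (rule ext)
    fix z
    have "mon I e z = mon I (\<lambda>_. 0) z * z i ^ 1"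
      unfolding e_def by (rule mon_update[OF assms])
    then show "mon I e z = z i" by (simp add: mon_def[of I "\<lambda>_. 0"])
  qed
  have "wt I w e = w i"
    unfolding e_def using wt_update[OF assms, of w "\<lambda>_. 0" 1] by (simp add: wt_def[of I w "\<lambda>_. 0"])
  then have "mon I e \<in> pol I w (w i)"
    unfolding pol_def by (intro fs.span_base CollectI exI[of _ e]) simp
  then show ?thesis by (simp only: m)
qed

lemma pol_mult:
  assumes f: "f \<in> pol I w d" and g: "g \<in> pol I w d'"
  shows "(\<lambda>z. f z * g z) \<in> pol I w (d + d')"
proof -
  have mm: "(\<lambda>z. mon I e z * mon I e' z) \<in> pol I w (d + d')" if "wt I w e \<le> d" "wt I w e' \<le> d'" for e e'
  proof -
    have "(\<lambda>z. mon I e z * mon I e' z) = mon I (\<lambda>i. e i + e' i)"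
      by (auto simp: mon_def power_add prod.distrib)
    moreover have "wt I w (\<lambda>i. e i + e' i) \<le> d + d'"
      using that by (simp add: wt_def algebra_simps sum.distrib)
    ultimately show ?thesis unfolding pol_def by (auto intro: fs.span_base)
  qed
  have m: "(\<lambda>z. f z * mon I e' z) \<in> pol I w (d + d')" if e': "wt I w e' \<le> d'" for e'
    using f unfolding pol_def[of I w d]
  proof (induction rule: fs.span_induct_alt)
    case base
    then show ?case using pol_const[of 0] by simp
  next
    case (step c x y)
    then obtain e where "x = mon I e" "wt I w e \<le> d" by blast
    then show ?case using pol_add[OF pol_scale[OF mm[OF _ e'], of e c] step(2)]
      by (simp add: fun_scale_def algebra_simps)
  qed
  show ?thesis
    using g unfolding pol_def[of I w d']
  proof (induction rule: fs.span_induct_alt)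
    case base
    then show ?case using pol_const[of 0] by simp
  next
    case (step c x y)
    then obtain e' where "x = mon I e'" "wt I w e' \<le> d'" by blast
    then show ?case using pol_add[OF pol_scale[OF m, of e' c] step(2)]
      by (simp add: fun_scale_def algebra_simps)
  qed
qed

lemma pol_prod:
  assumes "finite X" "\<And>x. x \<in> X \<Longrightarrow> f x \<in> pol I w (d x)"
  shows "(\<lambda>z. \<Prod>x\<in>X. f x z) \<in> pol I w (\<Sum>x\<in>X. d x)"
  using assms
proof (induction X rule: finite_induct)
  case empty
  show ?case using pol_const[of 1] by simp
next
  case (insert x F)
  then show ?case using pol_mult[of "f x" I w "d x"] by simp
qed

lemma pol_det:
  assumes "\<And>z. M z \<in> carrier_mat n n" "\<And>i j. i < n \<Longrightarrow> j < n \<Longrightarrow> (\<lambda>z. M z $$ (i, j)) \<in> pol I w d"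
  shows "(\<lambda>z. det (M z)) \<in> pol I w (n * d)"
proof -
  have "(\<lambda>z. \<Sum>p\<in>{p. p permutes {0..<n}}. signof p * (\<Prod>i\<in>{0..<n}. M z $$ (i, p i))) \<in> pol I w (n * d)"
  proof (intro pol_sum pol_scale)
    fix p assume p: "p \<in> {p. p permutes {0..<n}}"
    have "(\<lambda>z. M z $$ (i, p i)) \<in> pol I w d" if "i \<in> {0..<n}" for i
      using p that permutes_in_image[of p "{0..<n}" i] by (intro assms) auto
    from pol_prod[OF _ this, of "{0..<n}"]
    show "(\<lambda>z. \<Prod>i\<in>{0..<n}. M z $$ (i, p i)) \<in> pol I w (n * d)" by simp
  qed
  moreover have "dim_row (M z) = n" "dim_col (M z) = n" for z using assms(1)[of z] by auto
  ultimately show ?thesis by (simp add: det_def)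
qed

text \<open>The entries are signed minors of size \<open>n - 1\<close>; the bound is relaxed to that
  of the determinant, with which they are later combined.\<close>

lemma pol_adj:
  assumes M: "\<And>z. M z \<in> carrier_mat n n" "\<And>i j. i < n \<Longrightarrow> j < n \<Longrightarrow> (\<lambda>z. M z $$ (i, j)) \<in> pol I w d"
    and ij: "i < n" "j < n"
  shows "(\<lambda>z. adj_mat (M z) $$ (i, j)) \<in> pol I w (n * d)"
proof -
  have dim: "dim_row (M z) = n" "dim_col (M z) = n" for z using M(1)[of z] by auto
  have "(\<lambda>z. det (mat_delete (M z) j i)) \<in> pol I w ((n - 1) * d)"
  proof (rule pol_det)
    show "mat_delete (M z) j i \<in> carrier_mat (n - 1) (n - 1)" for z
      by (auto simp: mat_delete_def dim)
    fix a b assume ab: "a < n - 1" "b < n - 1"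
    have "mat_delete (M z) j i $$ (a, b) = M z $$ (insert_index j a, insert_index i b)" for z
      using ab by (simp add: mat_delete_def dim insert_index_def)
    moreover have "insert_index j a < n" "insert_index i b < n" using ab by (auto simp: insert_index_def)
    ultimately show "(\<lambda>z. mat_delete (M z) j i $$ (a, b)) \<in> pol I w d" using M(2) by simp
  qed
  from pol_scale[OF this, of "(- 1) ^ (j + i)"]
  have "(\<lambda>z. adj_mat (M z) $$ (i, j)) \<in> pol I w ((n - 1) * d)"
    using ij by (simp add: adj_mat_def cofactor_def dim)
  then show ?thesis by (rule pol_mono) simp
qed

text \<open>Evaluation at the points shows that the functions \<open>F x\<close> are linearly
  independent on \<open>G\<close>, so they cannot outnumber a set spanning all functions of this
  degree there.\<close>

lemma card_separated_le:
  assumes S: "finite S" and span: "\<And>e. wt I w e \<le> d \<Longrightarrow> mon I e \<in> span_on G S"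
    and X: "finite X" "\<And>x. x \<in> X \<Longrightarrow> pt x \<in> G"
    and F: "\<And>x. x \<in> X \<Longrightarrow> F x \<in> pol I w d" "\<And>x. x \<in> X \<Longrightarrow> F x (pt x) \<noteq> 0"
      "\<And>x y. x \<in> X \<Longrightarrow> y \<in> X \<Longrightarrow> x \<noteq> y \<Longrightarrow> F x (pt y) = 0"
  shows "card X \<le> card S"
proof -
  have "F x \<in> span_on G S" if "x \<in> X" for x
    using F(1)[OF that] fs.span_minimal[OF _ span_on_subspace, of "{mon I e |e. wt I w e \<le> d}" G S] span
    unfolding pol_def by blast
  then have "\<forall>x\<in>X. \<exists>g. g \<in> fs.span S \<and> (\<forall>z\<in>G. F x z = g z)"
    by (auto simp: span_on_def)
  then obtain g where g: "\<And>x. x \<in> X \<Longrightarrow> g x \<in> fs.span S" "\<And>x z. x \<in> X \<Longrightarrow> z \<in> G \<Longrightarrow> g x z = F x z"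
    by (metis bchoice)
  have inj: "inj_on g X"
  proof (rule inj_onI, rule ccontr)
    fix x y assume xy: "x \<in> X" "y \<in> X" "g x = g y" "x \<noteq> y"
    then have "F x (pt x) = F y (pt x)" using g(2) X(2) by metis
    then show False using F xy by metis
  qed
  have "fs.independent (g ` X)"
    unfolding fs.independent_explicit_finite_subsets
  proof (intro allI impI)
    fix T u assume T: "T \<subseteq> g ` X" "finite T" and sum: "(\<Sum>v\<in>T. fun_scale (u v) v) = 0"
    show "\<forall>v\<in>T. u v = 0"
    proof
    fix v assume v: "v \<in> T"
    obtain x where x: "x \<in> X" "v = g x" using T v by auto
    have "0 = (\<Sum>v\<in>T. fun_scale (u v) v) (pt x)" by (simp add: sum)
    also have "\<dots> = (\<Sum>v\<in>T. u v * v (pt x))" by (simp add: fun_sum_apply fun_scale_def)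
    also have "\<dots> = (\<Sum>v'\<in>{v}. u v' * v' (pt x))"
    proof (rule sum.mono_neutral_right)
      show "\<forall>i\<in>T - {v}. u i * i (pt x) = 0"
      proof
        fix i assume i: "i \<in> T - {v}"
        then obtain y where y: "y \<in> X" "i = g y" using T by auto
        then show "u i * i (pt x) = 0" using i x g(2)[OF y(1) X(2)[OF x(1)]] F(3)[OF y(1) x(1)] by auto
      qed
    qed (use T v in auto)
    also have "\<dots> = u v * F x (pt x)" using x(2) g(2)[OF x(1) X(2)[OF x(1)]] by simp
    finally have "u v * F x (pt x) = 0" by (rule sym)
    then show "u v = 0" using F(2)[OF x(1)] by simp
    qed
  qed
  moreover have "g ` X \<subseteq> fs.span S" using g by auto
  ultimately have "card (g ` X) \<le> card S" using fs.independent_span_bound[OF S] by blast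
  then show ?thesis using inj by (simp add: card_image)
qed

section \<open>Normal forms of monomials modulo additive relations\<close>

context frobenius_field
begin

text \<open>On \<open>G\<close> the relation can be solved for the top power of \<open>z r\<close>.
  Substitution lowers the exponent at \<open>r\<close>; by the hypothesis on \<open>w\<close> no
  replacing term is heavier, and coordinates absent from the relation keep their exponents.\<close>

lemma mon_reduce:
  assumes I: "finite I" "r \<in> I" and c: "c r \<noteq> 0" and G: "\<And>z. z \<in> G \<Longrightarrow> qmap I c z = 0"
    and w: "\<And>i l. i \<in> I \<Longrightarrow> c i \<noteq> 0 \<Longrightarrow> l \<le> degree (c i) \<Longrightarrow> w i * q ^ l \<le> w r * q ^ degree (c r)"
  shows "mon I e \<in> span_on G {mon I e' |e'. e' r < q ^ degree (c r) \<and> wt I w e' \<le> wt I w e \<and>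
            (\<forall>i. c i = 0 \<longrightarrow> e' i = e i)}"
proof (induction "e r" arbitrary: e rule: less_induct)
  case less
  define D where "D = degree (c r)"
  show ?case
  proof (cases "e r < q ^ D")
    case True
    then show ?thesis by (intro span_on_superset) (auto simp: D_def)
  next
    case False
    define e0 where "e0 = e(r := e r - q ^ D)"
    have e: "e = e0(r := e0 r + q ^ D)" using False by (auto simp: e0_def)
    \<comment> \<open>All terms of the relation except the top term of the pivot.\<close>
    define X where "X = (SIGMA i:{i\<in>I. c i \<noteq> 0}. {..degree (c i)}) - {(r, D)}"
    define a where "a = (\<lambda>(i, l). - (coeff (c i) l / coeff (c r) D))"
    define f where "f = (\<lambda>(i, l). e0(i := e0 i + q ^ l))"
    have finX: "finite X" unfolding X_def using I by auto
    have red: "mon I e z = (\<Sum>x\<in>X. a x * mon I (f x) z)" if "z \<in> G" for z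
    proof -
      have "0 = qmap I c z" using G that by simp
      also have "\<dots> = (\<Sum>i\<in>{i\<in>I. c i \<noteq> 0}. \<Sum>l\<le>degree (c i). coeff (c i) l * z i ^ (q ^ l))"
        unfolding qmap_def qev_def using I by (intro sum.mono_neutral_right) auto
      also have "\<dots> = (\<Sum>(i, l)\<in>(SIGMA i:{i\<in>I. c i \<noteq> 0}. {..degree (c i)}). coeff (c i) l * z i ^ (q ^ l))"
        using I by (subst sum.Sigma) auto
      also have "\<dots> = coeff (c r) D * z r ^ (q ^ D) + (\<Sum>(i, l)\<in>X. coeff (c i) l * z i ^ (q ^ l))"
        unfolding X_def using I c by (subst sum.remove[of _ "(r, D)"]) (auto simp: D_def)
      finally have "coeff (c r) D * z r ^ (q ^ D) = - (\<Sum>(i, l)\<in>X. coeff (c i) l * z i ^ (q ^ l))"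
        by (simp add: eq_neg_iff_add_eq_0)
      moreover have cD: "coeff (c r) D \<noteq> 0" using c by (simp add: D_def)
      ultimately have "z r ^ (q ^ D) = - (\<Sum>(i, l)\<in>X. coeff (c i) l * z i ^ (q ^ l)) / coeff (c r) D"
        by (simp add: field_simps)
      also have "\<dots> = (\<Sum>x\<in>X. a x * z (fst x) ^ (q ^ snd x))"
        by (simp add: a_def sum_divide_distrib case_prod_beta flip: sum_negf)
      finally have zr: "z r ^ (q ^ D) = (\<Sum>x\<in>X. a x * z (fst x) ^ (q ^ snd x))" .
      have "mon I e z = mon I e0 z * z r ^ (q ^ D)"
        by (subst e) (rule mon_update[OF I])
      also have "\<dots> = (\<Sum>x\<in>X. a x * (mon I e0 z * z (fst x) ^ (q ^ snd x)))"
        unfolding zr by (simp add: sum_distrib_left mult.left_commute)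
      also have "\<dots> = (\<Sum>x\<in>X. a x * mon I (f x) z)"
        by (rule sum.cong[OF refl]) (auto simp: f_def X_def mon_update[OF I(1)])
      finally show ?thesis .
    qed
    have "mon I (f x) \<in> span_on G {mon I e' |e'. e' r < q ^ degree (c r) \<and> wt I w e' \<le> wt I w e \<and>
            (\<forall>i. c i = 0 \<longrightarrow> e' i = e i)}" if x: "x \<in> X" for x
    proof -
      obtain i l where il: "x = (i, l)" by force
      have i: "i \<in> I" "c i \<noteq> 0" "l \<le> degree (c i)" "(i, l) \<noteq> (r, D)" using x by (auto simp: X_def il)
      have "f x r < e r"
      proof (cases "i = r")
        case True
        then have "l < D" using i by (auto simp: D_def)
        then have "q ^ l < q ^ D" using q_gt1 by simp
        then show ?thesis using False True by (auto simp: f_def il e0_def)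
      next
        case False
        then have "f x r = e r - q ^ D" by (simp add: f_def il e0_def)
        moreover have "0 < q ^ D" by simp
        ultimately show ?thesis using \<open>\<not> e r < q ^ D\<close> by linarith
      qed
      note IH = less[of "f x", OF this]
      have "wt I w e = wt I w e0 + w r * q ^ D" by (subst e) (rule wt_update[OF I])
      moreover have "wt I w (f x) = wt I w e0 + w i * q ^ l"
        by (simp add: f_def il wt_update[OF I(1) i(1)])
      ultimately have "wt I w (f x) \<le> wt I w e" using w[OF i(1-3)] by (simp add: D_def)
      moreover have "f x j = e j" if "c j = 0" for j
        using that i c by (auto simp: f_def il e0_def)
      ultimately show ?thesis
        by (intro span_on_trans[OF IH] subsetI span_on_superset) (fastforce)
    qed
    from span_on_sum[OF this, of X "\<lambda>x. x" a] show ?thesis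
      by (rule span_on_cong) (use red in auto)
  qed
qed

text \<open>Triangularity allows the reductions to be made in order: a later relation does not
  involve earlier pivots, hence preserves the exponent bounds already reached.\<close>

lemma mon_reduce_chain:
  assumes I: "finite I" and rel: "sorted_wrt (\<lambda>(r, c) (r', c'). c' r = 0) rel"
    "\<And>r c. (r, c) \<in> set rel \<Longrightarrow> r \<in> I \<and> c r \<noteq> 0"
    "\<And>r c z. (r, c) \<in> set rel \<Longrightarrow> z \<in> G \<Longrightarrow> qmap I c z = 0"
    "\<And>r c i l. (r, c) \<in> set rel \<Longrightarrow> i \<in> I \<Longrightarrow> c i \<noteq> 0 \<Longrightarrow> l \<le> degree (c i) \<Longrightarrow>
        w i * q ^ l \<le> w r * q ^ degree (c r)"
  shows "mon I e \<in> span_on G {mon I e' |e'. (\<forall>(r, c)\<in>set rel. e' r < q ^ degree (c r)) \<and>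
            wt I w e' \<le> wt I w e \<and> (\<forall>i. (\<forall>(r, c)\<in>set rel. c i = 0) \<longrightarrow> e' i = e i)}"
  using rel
proof (induction rel arbitrary: e)
  case Nil
  then show ?case by (intro span_on_superset) auto
next
  case (Cons x rel)
  obtain r c where x: "x = (r, c)" by force
  have r: "r \<in> I" "c r \<noteq> 0" using Cons.prems(2)[of r c] x by auto
  have "mon I e \<in> span_on G {mon I e' |e'. e' r < q ^ degree (c r) \<and> wt I w e' \<le> wt I w e \<and>
            (\<forall>i. c i = 0 \<longrightarrow> e' i = e i)}"
    by (rule mon_reduce[of I r c G w e]) (use I r Cons.prems(3,4)[of r c] x in auto)
  then show ?case
  proof (rule span_on_trans, intro subsetI)
    fix m :: "(_ \<Rightarrow> 'k) \<Rightarrow> 'k"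
    assume "m \<in> {mon I e' |e'. e' r < q ^ degree (c r) \<and> wt I w e' \<le> wt I w e \<and>
            (\<forall>i. c i = 0 \<longrightarrow> e' i = e i)}"
    then obtain e1 where e1: "m = mon I e1" "e1 r < q ^ degree (c r)" "wt I w e1 \<le> wt I w e"
      "\<And>i. c i = 0 \<Longrightarrow> e1 i = e i" by blast
    have rel0: "\<forall>(r', c')\<in>set rel. c' r = 0" using Cons.prems(1) x by auto
    have "mon I e1 \<in> span_on G {mon I e' |e'. (\<forall>(r, c)\<in>set rel. e' r < q ^ degree (c r)) \<and>
            wt I w e' \<le> wt I w e1 \<and> (\<forall>i. (\<forall>(r, c)\<in>set rel. c i = 0) \<longrightarrow> e' i = e1 i)}"
    proof (rule Cons.IH)
      show "sorted_wrt (\<lambda>(r, c) (r', c'). c' r = 0) rel" using Cons.prems(1) by simp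
      show "r \<in> I \<and> c r \<noteq> 0" if "(r, c) \<in> set rel" for r c
        using Cons.prems(2)[of r c] that by simp
      show "qmap I c z = 0" if "(r, c) \<in> set rel" "z \<in> G" for r c z
        using Cons.prems(3)[of r c z] that by simp
      show "w i * q ^ l \<le> w r * q ^ degree (c r)"
        if "(r, c) \<in> set rel" "i \<in> I" "c i \<noteq> 0" "l \<le> degree (c i)" for r c i l
        using Cons.prems(4)[of r c i l] that by simp
    qed
    then show "m \<in> span_on G {mon I e' |e'. (\<forall>(r, c)\<in>set (x # rel). e' r < q ^ degree (c r)) \<and>
            wt I w e' \<le> wt I w e \<and> (\<forall>i. (\<forall>(r, c)\<in>set (x # rel). c i = 0) \<longrightarrow> e' i = e i)}"
      unfolding e1(1)
    proof (rule span_on_trans, intro subsetI span_on_superset)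
      fix m' :: "(_ \<Rightarrow> 'k) \<Rightarrow> 'k"
      assume "m' \<in> {mon I e' |e'. (\<forall>(r, c)\<in>set rel. e' r < q ^ degree (c r)) \<and>
            wt I w e' \<le> wt I w e1 \<and> (\<forall>i. (\<forall>(r, c)\<in>set rel. c i = 0) \<longrightarrow> e' i = e1 i)}"
      then obtain e' where e': "m' = mon I e'" "\<forall>(r, c)\<in>set rel. e' r < q ^ degree (c r)"
        "wt I w e' \<le> wt I w e1" "\<And>i. (\<forall>(r, c)\<in>set rel. c i = 0) \<Longrightarrow> e' i = e1 i" by blast
      have "e' r = e1 r" using e'(4) rel0 by blast
      then show "m' \<in> {mon I e' |e'. (\<forall>(r, c)\<in>set (x # rel). e' r < q ^ degree (c r)) \<and>
            wt I w e' \<le> wt I w e \<and> (\<forall>i. (\<forall>(r, c)\<in>set (x # rel). c i = 0) \<longrightarrow> e' i = e i)}"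
        unfolding e'(1)
      proof (intro CollectI exI[of _ e'] conjI refl)
        show "\<forall>(r, c)\<in>set (x # rel). e' r < q ^ degree (c r)"
          using e'(2) e1(2) \<open>e' r = e1 r\<close> x by simp
        show "wt I w e' \<le> wt I w e" using e'(3) e1(3) by simp
        show "\<forall>i. (\<forall>(r, c)\<in>set (x # rel). c i = 0) \<longrightarrow> e' i = e i"
          using e'(4) e1(4) x by simp
      qed
    qed
  qed
qed

end

text \<open>Since weights are at least 1, the weight bounds every exponent by \<open>s\<close>. Only
  coordinates outside \<open>R\<close> contribute growth in \<open>s\<close>, so
  \<open>card I - card R\<close> plays the role of the dimension.\<close>

lemma finite_reduced_monomials:
  fixes I :: "'i set"
  assumes "finite I" "R \<subseteq> I" "\<And>i. i \<in> I \<Longrightarrow> w i \<ge> 1"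
  shows "\<exists>S :: (('i \<Rightarrow> 'k::field) \<Rightarrow> 'k) set. finite S \<and> card S \<le> Q ^ card R * (s + 1) ^ (card I - card R) \<and>
     {mon I e |e. (\<forall>i\<in>R. e i < Q) \<and> wt I w e \<le> s} \<subseteq> S"
proof -
  define P where "P = PiE I (\<lambda>i. if i \<in> R then {..<Q} else {..s})"
  have finR: "finite R" using assms finite_subset by blast
  have fin: "finite P" unfolding P_def using assms by (intro finite_PiE) auto
  have "card P = (\<Prod>i\<in>I. if i \<in> R then Q else s + 1)"
    unfolding P_def using assms by (subst card_PiE) (auto intro!: prod.cong)
  also have "\<dots> = Q ^ card R * (s + 1) ^ card (I - R)"
    using assms by (subst prod.If_cases) (auto simp: Int_absorb1 Diff_eq)
  finally have card: "card P = Q ^ card R * (s + 1) ^ (card I - card R)"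
    using assms finR by (simp add: card_Diff_subset)
  have "{mon I e |e. (\<forall>i\<in>R. e i < Q) \<and> wt I w e \<le> s} \<subseteq> (mon I :: _ \<Rightarrow> ('i \<Rightarrow> 'k) \<Rightarrow> 'k) ` P"
  proof safe
    fix e assume e: "\<forall>i\<in>R. e i < Q" "wt I w e \<le> s"
    have "e i \<le> s" if "i \<in> I" for i
    proof -
      have "e i \<le> w i * e i" using assms(3)[OF that] by simp
      also have "\<dots> \<le> wt I w e" unfolding wt_def using assms that by (intro member_le_sum) auto
      finally show ?thesis using e by simp
    qed
    then have "restrict e I \<in> P" unfolding P_def using e by auto
    moreover have "mon I e = (mon I (restrict e I) :: ('i \<Rightarrow> 'k) \<Rightarrow> 'k)"
      by (auto simp: mon_def fun_eq_iff)
    ultimately show "mon I e \<in> (mon I :: _ \<Rightarrow> ('i \<Rightarrow> 'k) \<Rightarrow> 'k) ` P" by blast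
  qed
  moreover have "card ((mon I :: _ \<Rightarrow> ('i \<Rightarrow> 'k) \<Rightarrow> 'k) ` P) \<le> card P" by (rule card_image_le[OF fin])
  ultimately show ?thesis
    unfolding card using fin by (intro exI[of _ "mon I ` P"] conjI finite_imageI)
qed

section \<open>A counting argument for additive correspondences of matrices\<close>

lemma infinite_alg_closed_field: "infinite (UNIV :: 'k::alg_closed_field set)"
proof
  assume fin: "finite (UNIV :: 'k set)"
  define P :: "'k poly" where "P = (\<Prod>a\<in>UNIV. [:-a, 1:])"
  have degP: "degree P = card (UNIV :: 'k set)"
    unfolding P_def by (subst degree_prod_eq_sum_degree) auto
  then have "degree P > 0" using fin by (simp add: finite_UNIV_card_ge_0)
  then have "degree (P + 1) > 0" by (simp add: degree_add_eq_left)
  then obtain x where "poly (P + 1) x = 0" using alg_closed_imp_poly_has_root by blast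
  moreover have "poly P x = 0" unfolding P_def poly_prod using fin by (intro prod_zero) auto
  ultimately show False by simp
qed

text \<open>A point encodes a pair of matrices, with leading index 1 for \<open>g\<close> and 0 for
  the right-hand side. This numbering leaves \<open>Suc t\<close> free to index the coefficient of
  \<epsilon>^t of \<open>g\<close> later on.\<close>

definition gmat :: "nat \<Rightarrow> (nat \<times> nat \<times> nat \<Rightarrow> 'k) \<Rightarrow> 'k mat" where
  "gmat n z = mat n n (\<lambda>(i, j). z (1, i, j))"

definition wmat :: "nat \<Rightarrow> (nat \<times> nat \<times> nat \<Rightarrow> 'k) \<Rightarrow> 'k mat" where
  "wmat n z = mat n n (\<lambda>(i, j). z (0, i, j))"

lemma gmat_carrier [simp]: "gmat n z \<in> carrier_mat n n" and wmat_carrier [simp]: "wmat n z \<in> carrier_mat n n"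
  by (auto simp: gmat_def wmat_def)

lemma gmat_index [simp]: "i < n \<Longrightarrow> j < n \<Longrightarrow> gmat n z $$ (i, j) = z (1, i, j)"
  and wmat_index [simp]: "i < n \<Longrightarrow> j < n \<Longrightarrow> wmat n z $$ (i, j) = z (0, i, j)"
  by (auto simp: gmat_def wmat_def)

lemma gmat_dim [simp]: "dim_row (gmat n z) = n" "dim_col (gmat n z) = n"
  and wmat_dim [simp]: "dim_row (wmat n z) = n" "dim_col (wmat n z) = n"
  by (auto simp: gmat_def wmat_def)

lemma gmat_diff: "gmat n (\<lambda>i. z i - z' i) = gmat n z - gmat n (z' :: _ \<Rightarrow> 'k::field)"
  and wmat_diff: "wmat n (\<lambda>i. z i - z' i) = wmat n z - wmat n (z' :: _ \<Rightarrow> 'k::field)"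
  by (auto intro!: eq_matI)

context frobenius_field
begin

text \<open>Every element of the ring \<open>C\<close> is a unit up to a translation from a finite set, because the
  polynomials \<open>det (\<sqdot> - a)\<close> span a finite-dimensional space.\<close>

lemma finite_unit_cover:
  fixes I :: "(nat \<times> nat \<times> nat) set"
  assumes I: "finite I" "{1} \<times> {..<n} \<times> {..<n} \<subseteq> I"
    and C: "\<And>z z'. z \<in> C \<Longrightarrow> z' \<in> C \<Longrightarrow> (\<lambda>i. z i - z' i) \<in> C"
    and z0: "z0 \<in> C" "gmat n z0 = (1\<^sub>m n :: 'k mat)"
  shows "\<exists>F. finite F \<and> F \<subseteq> C \<and> F \<noteq> {} \<and> (\<forall>z\<in>C. \<exists>a\<in>F. det (gmat n z - gmat n a) \<noteq> 0)"
proof -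
  define D where "D = (\<lambda>a z. det (gmat n z - gmat n a :: 'k mat))"
  define w :: "nat \<times> nat \<times> nat \<Rightarrow> nat" where "w = (\<lambda>_. 1)"
  have pol: "D a \<in> pol I w (n * 1)" for a
    unfolding D_def
  proof (rule pol_det)
    show "gmat n z - gmat n a \<in> carrier_mat n n" for z by (rule minus_carrier_mat) simp
    fix i j assume ij: "i < n" "j < n"
    have "(\<lambda>z. z (1, i, j)) \<in> pol I w (w (1, i, j))"
      by (rule pol_coord[OF I(1)]) (use ij I(2) in auto)
    then have "(\<lambda>z. z (1, i, j) - a (1, i, j)) \<in> pol I w 1"
      by (intro pol_diff pol_const) (simp add: w_def)
    then show "(\<lambda>z. (gmat n z - gmat n a) $$ (i, j)) \<in> pol I w 1" using ij by simp
  qed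
  obtain B where B: "B \<subseteq> D ` C" "fs.independent B" "D ` C \<subseteq> fs.span B"
    using fs.maximal_independent_subset by blast
  obtain S :: "((nat \<times> nat \<times> nat \<Rightarrow> 'k) \<Rightarrow> 'k) set"
    where S: "finite S" "{mon I e |e. (\<forall>i\<in>{}. e i < (0::nat)) \<and> wt I w e \<le> n * 1} \<subseteq> S"
    using finite_reduced_monomials[of I "{}" w 0 "n * 1", OF I(1)] by (auto simp: w_def)
  have "D a \<in> fs.span S" for a
    using pol[of a] fs.span_mono[OF S(2)] unfolding pol_def by auto
  then have "B \<subseteq> fs.span S" using B(1) by blast
  then have finB: "finite B" using fs.independent_span_bound[OF S(1) B(2)] by blast
  obtain F0 where F0: "F0 \<subseteq> C" "finite F0" "B = D ` F0"
    using finite_subset_image[OF finB B(1)] by blast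
  \<comment> \<open>\<open>z0\<close> only ensures that the set is nonempty, as the pigeonhole
    principle will require.\<close>
  define F where "F = insert z0 F0"
  have "\<exists>a\<in>F. D a z \<noteq> 0" if z: "z \<in> C" for z
  proof (rule ccontr)
    assume "\<not> (\<exists>a\<in>F. D a z \<noteq> 0)"
    then have "B \<subseteq> {f. f z = 0}" unfolding F0(3) F_def by auto
    moreover have "fs.subspace {f. f z = 0}"
      by (auto simp: fs.subspace_def fun_scale_def)
    ultimately have "fs.span B \<subseteq> {f. f z = 0}" by (rule fs.span_minimal)
    \<comment> \<open>All of \<open>span B\<close> vanishes at \<open>z\<close>, but translation by
      z - z0 leaves the identity matrix there, whose determinant is 1.\<close>
    moreover have "D (\<lambda>i. z i - z0 i) \<in> fs.span B" using B(3) C[OF z z0(1)] by blast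
    ultimately have "D (\<lambda>i. z i - z0 i) z = 0" by blast
    moreover have "gmat n z - gmat n (\<lambda>i. z i - z0 i) = gmat n z0"
      unfolding gmat_diff by (rule eq_matI) auto
    ultimately show False using z0(2) by (simp add: D_def)
  qed
  then show ?thesis
    using F0 z0(1) unfolding F_def D_def by (intro exI[of _ "insert z0 F0"]) auto
qed

text \<open>With w = g f this recovers \<open>f\<close> up to the factor \<open>det g\<close> by a
  polynomial expression in g and w, which an inverse of g would not be.\<close>

lemma adj_mat_mult_prod:
  assumes "(g :: 'k mat) \<in> carrier_mat n n" "f \<in> carrier_mat n n"
  shows "adj_mat g * (g * f) = det g \<cdot>\<^sub>m f"
proof -
  have "adj_mat g * (g * f) = (adj_mat g * g) * f"
    using assms adj_mat(1)[OF assms(1)] by (intro assoc_mult_mat[symmetric]) auto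
  also have "\<dots> = det g \<cdot>\<^sub>m f"
    using assms by (simp add: adj_mat(3)[OF assms(1)] mult_smult_assoc_mat[of _ n n _ n])
  finally show ?thesis .
qed

lemma right_inverse_mat_ex:
  assumes "(g :: 'k mat) \<in> carrier_mat n n" "det g \<noteq> 0"
  shows "\<exists>h\<in>carrier_mat n n. g * h = 1\<^sub>m n"
proof -
  have "g * (inverse (det g) \<cdot>\<^sub>m adj_mat g) = inverse (det g) \<cdot>\<^sub>m (g * adj_mat g)"
    using assms adj_mat(1)[OF assms(1)] by (intro mult_smult_distrib) auto
  also have "\<dots> = 1\<^sub>m n" using assms adj_mat(2)[OF assms(1)] by (auto intro!: eq_matI)
  finally show ?thesis using adj_mat(1)[OF assms(1)]
    by (intro bexI[of _ "inverse (det g) \<cdot>\<^sub>m adj_mat g"]) auto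
qed

text \<open>If the second projection of \<open>G\<close> were not surjective, then the functions of bounded degree on
  \<open>G\<close> would grow too slowly to separate the points \<open>(c - a) g\<^sub>f\<close>, where \<open>f\<close> runs through a grid in
  the space of all matrices and \<open>c\<close> through a grid in the fibre over \<open>0\<close>.\<close>

theorem twisted_surj_imp_surj:
  fixes es :: "(nat \<times> nat \<times> nat \<Rightarrow> 'k poly) list" and n :: nat
  defines "A \<equiv> {1} \<times> {..<n} \<times> {..<n}" and "B \<equiv> {0} \<times> {..<n} \<times> {..<n}"
  defines "G \<equiv> qzeros (A \<union> B) es"
  assumes es: "\<And>c i. c \<in> set es \<Longrightarrow> i \<notin> A \<union> B \<Longrightarrow> c i = 0"
    and one: "\<exists>z\<in>G. gmat n z = 1\<^sub>m n \<and> wmat n z = 0\<^sub>m n n"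
    and mult: "\<And>z z'. z \<in> G \<Longrightarrow> z' \<in> G \<Longrightarrow> wmat n z = 0\<^sub>m n n \<Longrightarrow>
        \<exists>z''\<in>G. gmat n z'' = gmat n z * gmat n z' \<and> wmat n z'' = gmat n z * wmat n z'"
    and twisted: "\<And>f. f \<in> carrier_mat n n \<Longrightarrow> \<exists>z\<in>G. det (gmat n z) \<noteq> 0 \<and> wmat n z = gmat n z * f"
    and v: "v \<in> carrier_mat n n"
  shows "\<exists>z\<in>G. wmat n z = v"
proof (rule ccontr)
  assume contra: "\<not> (\<exists>z\<in>G. wmat n z = v)"
  note [simp del] = split_paired_All split_paired_Ex
  define I where "I = A \<union> B"
  have fin: "finite A" "finite B" "finite I" by (auto simp: A_def B_def I_def)
  have AB: "A \<inter> B = {}" by (auto simp: A_def B_def)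
  have cardA: "card A = n * n" and cardB: "card B = n * n" by (auto simp: A_def B_def card_cartesian_product)
  have cardI: "card I = n * n + n * n" unfolding I_def by (simp add: card_Un_disjoint fin AB cardA cardB)
  have G: "G = qzeros I es" by (simp add: G_def I_def)
  have "\<exists>J rel es'. J \<subseteq> A \<and> fst ` set rel = A - J \<and>
     sorted_wrt (\<lambda>(r, c) (r', c'). c' r = 0) rel \<and>
     (\<forall>(r, c)\<in>set rel. c r \<noteq> 0 \<and> (\<forall>i. i \<notin> B \<longrightarrow> degree (c i) \<le> degree (c r)) \<and>
        (\<forall>i. i \<notin> A \<union> B \<longrightarrow> c i = 0) \<and> (\<forall>z\<in>qzeros I es. qmap I c z = 0)) \<and>
     (\<forall>c\<in>set es'. \<forall>i. i \<notin> B \<longrightarrow> c i = 0) \<and>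
     (\<forall>c\<in>set es'. \<forall>z\<in>qzeros I es. qmap I c z = 0) \<and>
     (\<forall>z\<in>qzeros I es'. \<exists>z'\<in>qzeros I es. \<forall>i\<in>J \<union> B. z' i = z i)"
  proof (rule relative_normalization)
    show "A \<subseteq> I" by (simp add: I_def)
    show "c i = 0" if "c \<in> set es" "i \<notin> A \<union> B" for c i using es[OF that] .
  qed (rule fin AB)+
  then obtain J rel es' where J: "J \<subseteq> A" and relA: "fst ` set rel = A - J"
    and relS: "sorted_wrt (\<lambda>(r, c) (r', c'). c' r = 0) rel"
    and rel: "\<forall>(r, c)\<in>set rel. c r \<noteq> 0 \<and> (\<forall>i. i \<notin> B \<longrightarrow> degree (c i) \<le> degree (c r)) \<and>
        (\<forall>i. i \<notin> A \<union> B \<longrightarrow> c i = 0) \<and> (\<forall>z\<in>qzeros I es. qmap I c z = 0)"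
    and es'B: "\<forall>c\<in>set es'. \<forall>i. i \<notin> B \<longrightarrow> c i = 0"
    and es'G: "\<forall>c\<in>set es'. \<forall>z\<in>qzeros I es. qmap I c z = 0"
    and lift: "\<forall>z\<in>qzeros I es'. \<exists>z'\<in>qzeros I es. \<forall>i\<in>J \<union> B. z' i = z i"
    by (elim exE conjE) (rule that; assumption)
  have finJ: "finite J" using J fin finite_subset by blast
  \<comment> \<open>If no equation restricted the coordinates in \<open>B\<close>, every
    \<open>v\<close> would lift to \<open>G\<close>. The equation found here lowers the dimension of
    the image by one.\<close>
  have "\<exists>c\<in>set es'. \<exists>i\<in>B. c i \<noteq> 0"
  proof (rule ccontr)
    assume a: "\<not> (\<exists>c\<in>set es'. \<exists>i\<in>B. c i \<noteq> 0)"
    define z where "z = (\<lambda>(l::nat, i, j). v $$ (i, j))"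
    have "c i = 0" if "c \<in> set es'" for c i using a es'B that by blast
    note c_0 = this
    have "qmap I c z = 0" if "c \<in> set es'" for c
      unfolding qmap_def using c_0[OF that] by simp
    then have "z \<in> qzeros I es'" by (simp add: qzeros_def)
    then obtain z' where z': "z' \<in> G" "\<forall>i\<in>J \<union> B. z' i = z i" using lift G by blast
    have "wmat n z' = v"
      using z'(2) v by (intro eq_matI) (auto simp: B_def z_def)
    then show False using contra z'(1) by blast
  qed
  then obtain c0 i0 where c0: "c0 \<in> set es'" "i0 \<in> B" "c0 i0 \<noteq> 0" by blast
  define B' where "B' = {i\<in>B. c0 i \<noteq> 0}"
  have "finite B'" "B' \<noteq> {}" using fin c0 unfolding B'_def by auto
  then obtain r2 where r2: "r2 \<in> B'" "\<And>i. i \<in> B' \<Longrightarrow> degree (c0 i) \<le> degree (c0 r2)"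
    using obtains_MAX[of B' "\<lambda>i. degree (c0 i)"] by (metis Max_ge finite_imageI image_eqI)
  have r2B: "r2 \<in> B" "c0 r2 \<noteq> 0" using r2 by (auto simp: B'_def)
  have n_pos: "n * n \<ge> 1" using r2B(1) by (auto simp: B_def)
  define rel2 where "rel2 = rel @ [(r2, c0)]"
  \<comment> \<open>\<open>W = q ^ Dmax\<close> is at least every Frobenius power occurring at a
    \<open>B\<close>-coordinate of \<open>rel\<close>. With weight \<open>W\<close> on
    \<open>A\<close> and 1 on \<open>B\<close>, the pivot term is therefore heaviest in each
    relation.\<close>
  define Dmax where "Dmax = (\<Sum>x\<in>set rel. \<Sum>i\<in>B. degree (snd x i))"
  define W where "W = q ^ Dmax"
  define w where "w = (\<lambda>i. if i \<in> B then 1 else W)"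
  define Q where "Q = (\<Sum>x\<in>set rel2. q ^ degree (snd x (fst x)))"
  \<comment> \<open>The pivots, one of them in \<open>B\<close>: the coordinates left free are
    \<open>J\<close> and all of \<open>B\<close> except \<open>r2\<close>.\<close>
  define R where "R = insert r2 (A - J)"
  have W1: "W \<ge> 1" by (simp add: W_def Suc_le_eq)
  have w1: "w i \<ge> 1" for i using W1 by (simp add: w_def)
  have RI: "R \<subseteq> I" using r2B by (auto simp: R_def I_def)
  have Rset: "R = fst ` set rel2" by (auto simp: R_def rel2_def relA)
  have "r2 \<notin> A - J" using r2B AB by auto
  then have cardR: "card R = n * n - card J + 1"
    using fin finJ J by (simp add: R_def card_Diff_subset cardA)
  have cardJ: "card J \<le> n * n" using card_mono[OF fin(1) J] cardA by simp
  have reduce: "mon I e \<in> span_on G {mon I e' |e'. (\<forall>(r, c)\<in>set rel2. e' r < q ^ degree (c r)) \<and>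
      wt I w e' \<le> wt I w e \<and> (\<forall>i. (\<forall>(r, c)\<in>set rel2. c i = 0) \<longrightarrow> e' i = e i)}" for e
  proof (rule mon_reduce_chain)
    show "finite I" by (rule fin)
    have "c0 r = 0" if "(r, c) \<in> set rel" for r c
    proof -
      have "r \<in> A" using relA that by (metis DiffD1 fst_conv image_eqI)
      then show ?thesis using es'B c0(1) AB by blast
    qed
    then show "sorted_wrt (\<lambda>(r, c) (r', c'). c' r = 0) rel2"
      unfolding rel2_def sorted_wrt_append using relS by auto
    show "r \<in> I \<and> c r \<noteq> 0" if m: "(r, c) \<in> set rel2" for r c
    proof -
      have "r \<in> I" using RI Rset m by (metis fst_conv image_eqI subsetD)
      moreover have "c r \<noteq> 0" using m rel r2B by (auto simp: rel2_def)
      ultimately show ?thesis by blast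
    qed
    show "qmap I c z = 0" if m: "(r, c) \<in> set rel2" and z: "z \<in> G" for r c z
    proof (cases "(r, c) \<in> set rel")
      case True
      then show ?thesis using bspec[OF rel True] z G by auto
    next
      case False
      then have "c = c0" using m by (auto simp: rel2_def)
      then show ?thesis using es'G c0(1) z G by blast
    qed
    show "w i * q ^ l \<le> w r * q ^ degree (c r)"
      if m: "(r, c) \<in> set rel2" and i: "i \<in> I" "c i \<noteq> 0" and l: "l \<le> degree (c i)" for r c i l
    proof (cases "(r, c) \<in> set rel")
      case True
      have rA: "r \<in> A" using relA True by (metis DiffD1 fst_conv image_eqI)
      then have wr: "w r = W" using AB by (auto simp: w_def)
      show ?thesis
      proof (cases "i \<in> B")
        case iB: True
        have "degree (c i) \<le> (\<Sum>i\<in>B. degree (c i))"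
          using fin iB by (intro member_le_sum) auto
        also have "\<dots> \<le> Dmax" unfolding Dmax_def
          using member_le_sum[of "(r, c)" "set rel" "\<lambda>x. \<Sum>i\<in>B. degree (snd x i)"] True by auto
        finally have "q ^ l \<le> W * 1" unfolding W_def mult_1_right using l
          by (intro power_increasing) (auto simp: Suc_le_eq)
        also have "W * 1 \<le> W * q ^ degree (c r)" by (intro mult_le_mono2) (simp add: Suc_le_eq)
        finally show ?thesis using iB wr by (simp add: w_def)
      next
        case False
        then have "degree (c i) \<le> degree (c r)" using bspec[OF rel True] by auto
        then have "q ^ l \<le> q ^ degree (c r)" using l by (intro power_increasing) (auto simp: Suc_le_eq)
        then show ?thesis using False wr by (simp add: w_def)
      qed
    next
      case False
      then have rc: "r = r2" "c = c0" using m by (auto simp: rel2_def)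
      have iB: "i \<in> B" using i es'B c0(1) rc by blast
      then have "degree (c0 i) \<le> degree (c0 r2)" using r2(2)[of i] i rc by (auto simp: B'_def)
      then have "q ^ l \<le> q ^ degree (c0 r2)" using l rc by (intro power_increasing) (auto simp: Suc_le_eq)
      then show ?thesis using iB r2B rc by (simp add: w_def)
    qed
  qed
  \<comment> \<open>Functions of weight at most \<open>d\<close> on \<open>G\<close> span a space
    whose dimension is bounded by a constant times the power of \<open>d + 1\<close> with exponent
    \<open>n * n + card J - 1\<close>.\<close>
  have span: "\<exists>S :: ((nat \<times> nat \<times> nat \<Rightarrow> 'k) \<Rightarrow> 'k) set. finite S \<and>
      card S \<le> Q ^ card R * (d + 1) ^ (card I - card R) \<and> (\<forall>e. wt I w e \<le> d \<longrightarrow> mon I e \<in> span_on G S)" for d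
  proof -
    obtain S :: "((nat \<times> nat \<times> nat \<Rightarrow> 'k) \<Rightarrow> 'k) set" where S: "finite S"
      "card S \<le> Q ^ card R * (d + 1) ^ (card I - card R)"
      "{mon I e |e. (\<forall>i\<in>R. e i < Q) \<and> wt I w e \<le> d} \<subseteq> S"
      using finite_reduced_monomials[OF fin(3) RI, of w Q d] w1 by blast
    have "mon I e \<in> span_on G S" if e: "wt I w e \<le> d" for e
    proof (rule span_on_trans[OF reduce], intro subsetI span_on_superset)
      fix m :: "(_ \<Rightarrow> 'k) \<Rightarrow> 'k"
      assume "m \<in> {mon I e' |e'. (\<forall>(r, c)\<in>set rel2. e' r < q ^ degree (c r)) \<and>
        wt I w e' \<le> wt I w e \<and> (\<forall>i. (\<forall>(r, c)\<in>set rel2. c i = 0) \<longrightarrow> e' i = e i)}"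
      then obtain e' where e': "m = mon I e'" "\<forall>(r, c)\<in>set rel2. e' r < q ^ degree (c r)"
        "wt I w e' \<le> wt I w e" by blast
      have "e' r < Q" if "r \<in> R" for r
      proof -
        obtain c where m: "(r, c) \<in> set rel2" using \<open>r \<in> R\<close> unfolding Rset by force
        then have "e' r < q ^ degree (c r)" using e'(2) by blast
        also have "\<dots> \<le> Q" unfolding Q_def
          using member_le_sum[of "(r, c)" "set rel2" "\<lambda>x. q ^ degree (snd x (fst x))"] m by auto
        finally show ?thesis .
      qed
      then have "m \<in> {mon I e |e. (\<forall>i\<in>R. e i < Q) \<and> wt I w e \<le> d}"
        unfolding e'(1) using e'(3) e by (intro CollectI exI[of _ e']) auto
      then show "m \<in> S" using S(3) by blast
    qed
    then show ?thesis using S(1,2) by blast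
  qed
  \<comment> \<open>The fibre over 0; it is closed under differences and, by \<open>mult\<close>,
    multiplies \<open>G\<close> from the left.\<close>
  define C where "C = {z\<in>G. wmat n z = 0\<^sub>m n n}"
  obtain z0 where z0: "z0 \<in> G" "gmat n z0 = 1\<^sub>m n" "wmat n z0 = 0\<^sub>m n n" using one by blast
  have C_diff: "(\<lambda>i. z i - z' i) \<in> C" if "z \<in> C" "z' \<in> C" for z z'
    using that qzeros_diff[of z I es z'] G by (auto simp: C_def wmat_diff)
  obtain F where F: "finite F" "F \<subseteq> C" "F \<noteq> {}" "\<And>z. z \<in> C \<Longrightarrow> \<exists>a\<in>F. det (gmat n z - gmat n a) \<noteq> 0"
    using finite_unit_cover[of I n C z0, OF fin(3) _ C_diff] z0 by (auto simp: C_def I_def A_def)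
  obtain zf where zf: "\<And>f. f \<in> carrier_mat n n \<Longrightarrow> zf f \<in> G"
    "\<And>f. f \<in> carrier_mat n n \<Longrightarrow> det (gmat n (zf f)) \<noteq> 0"
    "\<And>f. f \<in> carrier_mat n n \<Longrightarrow> wmat n (zf f) = gmat n (zf f) * f"
    using twisted by metis
  have "\<exists>h\<in>carrier_mat n n. gmat n (zf f) * h = 1\<^sub>m n" if "f \<in> carrier_mat n n" for f
    using right_inverse_mat_ex[OF gmat_carrier zf(2)[OF that]] .
  then obtain hf where hf: "\<And>f. f \<in> carrier_mat n n \<Longrightarrow> hf f \<in> carrier_mat n n"
    "\<And>f. f \<in> carrier_mat n n \<Longrightarrow> gmat n (zf f) * hf f = 1\<^sub>m n" by metis
  \<comment> \<open>\<open>es'\<close> only constrains \<open>B\<close>, so over the zero matrix the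
    coordinates in \<open>J\<close> can be prescribed freely.\<close>
  have cy: "\<exists>z\<in>C. \<forall>i\<in>J. z i = y i" for y
  proof -
    define z where "z = (\<lambda>i. if i \<in> J then y i else 0)"
    have "qmap I c z = 0" if "c \<in> set es'" for c
    proof -
      have "qmap I c z = qmap I c (\<lambda>_. 0)"
      proof (rule qmap_cong)
        fix i assume "c i \<noteq> 0"
        then have "i \<in> B" using es'B that by blast
        then show "z i = 0" using J AB by (auto simp: z_def)
      qed
      then show ?thesis by (simp add: qmap_zero)
    qed
    then have "z \<in> qzeros I es'" by (simp add: qzeros_def)
    then obtain z' where z': "z' \<in> G" "\<forall>i\<in>J \<union> B. z' i = z i" using lift G by blast
    have "wmat n z' = 0\<^sub>m n n"
      using z'(2) J AB by (intro eq_matI) (auto simp: B_def z_def A_def)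
    then show ?thesis using z' by (intro bexI[of _ z']) (auto simp: C_def z_def)
  qed
  then obtain cy where cy: "\<And>y. cy y \<in> C" "\<And>y i. i \<in> J \<Longrightarrow> cy y i = y i" by metis
  \<comment> \<open>The weight of the separating functions \<open>FF\<close> below, per unit of
    \<open>s\<close>: each entry of \<open>f\<close> costs \<open>n * W + 1\<close> and each
    coordinate in \<open>J\<close> costs \<open>W\<close>.\<close>
  define kap where "kap = n * n * (n * W + 1) + card J * W"
  have bound: "(s + 1) ^ (n * n) * (s + 1) ^ card J \<le>
      card F * (Q ^ card R * (kap * s + 1) ^ (card I - card R))" for s
  proof -
    obtain ts :: "'k set" where ts: "card ts = s + 1" "finite ts"
      using infinite_arbitrarily_large[OF infinite_alg_closed_field] by blast
    define Fg where "Fg = PiE ({..<n} \<times> {..<n}) (\<lambda>_. ts)"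
    define Yg where "Yg = PiE J (\<lambda>_. ts)"
    have finFg: "finite Fg" and finYg: "finite Yg"
      unfolding Fg_def Yg_def using ts finJ by (auto intro!: finite_PiE)
    have cardFg: "card Fg = (s + 1) ^ (n * n)" and cardYg: "card Yg = (s + 1) ^ card J"
      unfolding Fg_def Yg_def using ts finJ by (simp_all add: card_PiE card_cartesian_product)
    \<comment> \<open>The matrix of \<open>cy y\<close> may be singular; subtracting a suitable
      element of the finite set \<open>F\<close> makes it invertible.\<close>
    define ia where "ia = (\<lambda>y. SOME a. a \<in> F \<and> det (gmat n (cy y) - gmat n a) \<noteq> 0)"
    have ia: "ia y \<in> F" "det (gmat n (cy y) - gmat n (ia y)) \<noteq> 0" for y
    proof -
      have "\<exists>a. a \<in> F \<and> det (gmat n (cy y) - gmat n a) \<noteq> 0" using F(4)[OF cy(1)] by blast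
      from someI_ex[OF this] show "ia y \<in> F" "det (gmat n (cy y) - gmat n (ia y)) \<noteq> 0"
        unfolding ia_def by auto
    qed
    \<comment> \<open>A single translation \<open>a\<close>, which \<open>F2\<close> has to contain,
      serves at least the fraction 1 / card F of the grid.\<close>
    obtain a where a: "a \<in> F" "card (ia -` {a} \<inter> Yg) * card F \<ge> card Yg"
      using pigeonhole_card[of ia Yg F] ia(1) finYg F(1,3) by blast
    define Y where "Y = ia -` {a} \<inter> Yg"
    have finY: "finite Y" using finYg by (simp add: Y_def)
    have detY: "det (gmat n (cy y) - gmat n a) \<noteq> 0" if "y \<in> Y" for y
      using that ia(2)[of y] by (auto simp: Y_def)
    define X where "X = Fg \<times> Y"
    define fm where "fm = (\<lambda>f. mat n n f :: 'k mat)"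
    have fm [simp]: "fm f \<in> carrier_mat n n" for f by (simp add: fm_def)
    define ca where "ca = (\<lambda>y. (\<lambda>i. cy y i - a i))"
    have ca: "ca y \<in> C" for y unfolding ca_def using C_diff cy(1) F(2) a(1) by blast
    have ca_g: "gmat n (ca y) = gmat n (cy y) - gmat n a" for y by (simp add: ca_def gmat_diff)
    have "\<exists>z\<in>G. gmat n z = gmat n (ca y) * gmat n (zf (fm f)) \<and> wmat n z = gmat n (ca y) * wmat n (zf (fm f))" for f y
      using ca[of y] zf(1)[OF fm, of f] by (intro mult) (auto simp: C_def)
    note ex = this
    define pt where "pt = (\<lambda>(f, y). SOME z. z \<in> G \<and> gmat n z = gmat n (ca y) * gmat n (zf (fm f)) \<and>
        wmat n z = gmat n (ca y) * wmat n (zf (fm f)))"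
    have pt: "pt (f, y) \<in> G" "gmat n (pt (f, y)) = gmat n (ca y) * gmat n (zf (fm f))"
      "wmat n (pt (f, y)) = gmat n (ca y) * wmat n (zf (fm f))" for f y
      using someI_ex[OF ex[of y f, unfolded Bex_def]] unfolding pt_def by auto
    have ptw: "wmat n (pt (f, y)) = gmat n (pt (f, y)) * fm f" for f y
      unfolding pt zf(3)[OF fm] by (rule assoc_mult_mat[symmetric]) (auto simp: fm_def)
    have pth: "gmat n (pt (f, y)) * hf (fm f) = gmat n (ca y)" for f y
    proof -
      have "gmat n (pt (f, y)) * hf (fm f) = gmat n (ca y) * (gmat n (zf (fm f)) * hf (fm f))"
        unfolding pt(2) using hf(1)[OF fm] by (intro assoc_mult_mat) auto
      then show ?thesis using hf(2)[OF fm] by (simp add: right_mult_one_mat[OF gmat_carrier])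
    qed
    have det_pt: "det (gmat n (pt (f, y))) \<noteq> 0" if "y \<in> Y" for f y
    proof -
      have "det (gmat n (pt (f, y))) = det (gmat n (ca y)) * det (gmat n (zf (fm f)))"
        unfolding pt(2) by (rule det_mult) auto
      then show ?thesis using detY[OF that] zf(2)[OF fm] ca_g by simp
    qed
    \<comment> \<open>At the point belonging to (f', y), the adjugate of g times w is
      \<open>det g\<close> times f', so the product vanishes as soon as f' differs from f on the
      grid.\<close>
    define F1 where "F1 = (\<lambda>f z. \<Prod>ij\<in>{..<n} \<times> {..<n}. \<Prod>t\<in>ts - {f ij}.
        ((adj_mat (gmat n z) * wmat n z) $$ ij - t * det (gmat n z)) :: 'k)"
    \<comment> \<open>Right multiplication by \<open>hf (fm f)\<close> leaves the matrix of
      \<open>cy y - a\<close>, whose coordinates in \<open>J\<close> are known. This holds only at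
      points with the same \<open>f\<close>; different \<open>f\<close> are already separated by
      \<open>F1\<close>.\<close>
    define F2 where "F2 = (\<lambda>f y z. \<Prod>x\<in>J. \<Prod>t\<in>ts - {y x}.
        ((gmat n z * hf (fm f)) $$ snd x + gmat n a $$ snd x - t) :: 'k)"
    define FF where "FF = (\<lambda>(f, y) z. F1 f z * F2 f y z)"
    have adjw: "(adj_mat (gmat n (pt (f, y))) * wmat n (pt (f, y))) $$ ij = det (gmat n (pt (f, y))) * f ij"
      if "ij \<in> {..<n} \<times> {..<n}" for f y ij
      unfolding ptw adj_mat_mult_prod[OF gmat_carrier fm] using that by (auto simp: fm_def)
    have F1_eval: "F1 f (pt (f', y)) = (\<Prod>ij\<in>{..<n} \<times> {..<n}. \<Prod>t\<in>ts - {f ij}.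
        det (gmat n (pt (f', y))) * (f' ij - t))" for f f' y
      unfolding F1_def by (intro prod.cong refl) (simp add: adjw algebra_simps)
    have Jx: "\<exists>i j. x = (1, i, j) \<and> i < n \<and> j < n" if "x \<in> J" for x
      using that J by (auto simp: A_def)
    have F2_eval: "F2 f y (pt (f, y')) = (\<Prod>x\<in>J. \<Prod>t\<in>ts - {y x}. (y' x - t))" for f y y'
      unfolding F2_def
    proof (intro prod.cong refl)
      fix x t assume x: "x \<in> J"
      obtain i j where ij: "x = (1, i, j)" "i < n" "j < n" using Jx[OF x] by blast
      have "gmat n (ca y') $$ (i, j) + gmat n a $$ (i, j) = y' x"
        using ij cy(2)[OF x, of y'] by (simp add: ca_def)
      then show "(gmat n (pt (f, y')) * hf (fm f)) $$ snd x + gmat n a $$ snd x - t = y' x - t"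
        unfolding pth using ij by simp
    qed
    obtain S :: "((nat \<times> nat \<times> nat \<Rightarrow> 'k) \<Rightarrow> 'k) set" where S: "finite S"
      "card S \<le> Q ^ card R * (kap * s + 1) ^ (card I - card R)"
      "\<And>e. wt I w e \<le> kap * s \<Longrightarrow> mon I e \<in> span_on G S" using span[of "kap * s"] by blast
    have "card X \<le> card S"
    proof (rule card_separated_le[where pt = pt and F = FF, OF S(1) S(3)])
      show "finite X" using finFg finY by (simp add: X_def)
      show "pt x \<in> G" for x using pt(1) by (cases x) auto
      show "FF x \<in> pol I w (kap * s)" if "x \<in> X" for x
      proof -
        obtain f y where x: "x = (f, y)" by force
        have f: "f ij \<in> ts" if "ij \<in> {..<n} \<times> {..<n}" for ij
          using that \<open>x \<in> X\<close> unfolding x X_def Fg_def by auto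
        have y: "y i \<in> ts" if "i \<in> J" for i
          using that \<open>x \<in> X\<close> unfolding x X_def Y_def Yg_def by auto
        have cg: "(\<lambda>z. gmat n z $$ (i, j)) \<in> pol I w W" if "i < n" "j < n" for i j
        proof -
          have "(\<lambda>z. z (1, i, j)) \<in> pol I w (w (1, i, j))"
            by (rule pol_coord[OF fin(3)]) (use that in \<open>auto simp: I_def A_def\<close>)
          then show ?thesis using that by (simp add: w_def B_def)
        qed
        have cw: "(\<lambda>z. wmat n z $$ (i, j)) \<in> pol I w 1" if "i < n" "j < n" for i j
        proof -
          have "(\<lambda>z. z (0, i, j)) \<in> pol I w (w (0, i, j))"
            by (rule pol_coord[OF fin(3)]) (use that in \<open>auto simp: I_def B_def\<close>)
          then show ?thesis using that by (simp add: w_def B_def)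
        qed
        have p_det: "(\<lambda>z. det (gmat n z)) \<in> pol I w (n * W)"
          by (rule pol_det[OF gmat_carrier cg])
        have p_aw: "(\<lambda>z :: nat \<times> nat \<times> nat \<Rightarrow> 'k. (adj_mat (gmat n z) * wmat n z) $$ (i, j)) \<in> pol I w (n * W + 1)"
          if ij: "i < n" "j < n" for i j
        proof -
          have "(adj_mat (gmat n z) * wmat n z) $$ (i, j) =
              (\<Sum>k\<in>{0..<n}. adj_mat (gmat n z) $$ (i, k) * wmat n z $$ (k, j))" for z :: "nat \<times> nat \<times> nat \<Rightarrow> 'k"
            using ij adj_mat(1)[OF gmat_carrier[of n z]] by (simp add: scalar_prod_def)
          moreover have "(\<lambda>z. \<Sum>k\<in>{0..<n}. adj_mat (gmat n z) $$ (i, k) * wmat n z $$ (k, j)) \<in> pol I w (n * W + 1)"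
            using ij by (intro pol_sum pol_mult pol_adj[OF gmat_carrier cg] cw) auto
          ultimately show ?thesis by (simp only:)
        qed
        have p1: "F1 f \<in> pol I w (n * n * (s * (n * W + 1)))"
        proof -
          have "(\<lambda>z. \<Prod>t\<in>ts - {f ij}. ((adj_mat (gmat n z) * wmat n z) $$ ij - t * det (gmat n z)))
            \<in> pol I w (s * (n * W + 1))" if ij: "ij \<in> {..<n} \<times> {..<n}" for ij
          proof -
            have "(\<lambda>z. \<Prod>t\<in>ts - {f ij}. ((adj_mat (gmat n z) * wmat n z) $$ ij - t * det (gmat n z)))
              \<in> pol I w (\<Sum>t\<in>ts - {f ij}. n * W + 1)"
            proof (rule pol_prod)
              fix t :: 'k
              show "(\<lambda>z. (adj_mat (gmat n z) * wmat n z) $$ ij - t * det (gmat n z)) \<in> pol I w (n * W + 1)"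
              proof -
                obtain i j where i: "ij = (i, j)" "i < n" "j < n" using ij by auto
                have "(\<lambda>z. t * det (gmat n z)) \<in> pol I w (n * W + 1)"
                  using pol_scale[OF p_det, of t] by (rule pol_mono) simp
                from pol_diff[OF p_aw[OF i(2,3)] this] show ?thesis unfolding i(1) .
              qed
            qed (use ts in simp)
            then show ?thesis using ts f[OF ij] by simp
          qed
          from pol_prod[OF _ this, of "{..<n} \<times> {..<n}"]
          show ?thesis unfolding F1_def by (simp add: card_cartesian_product)
        qed
        have p2: "F2 f y \<in> pol I w (card J * (s * W))"
        proof -
          have "(\<lambda>z. \<Prod>t\<in>ts - {y x}. ((gmat n z * hf (fm f)) $$ snd x + gmat n a $$ snd x - t))
            \<in> pol I w (s * W)" if x: "x \<in> J" for x
          proof -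
            obtain i j where ij: "x = (1, i, j)" "i < n" "j < n" using Jx[OF x] by blast
            have "(gmat n z * hf (fm f)) $$ (i, j) = (\<Sum>k\<in>{0..<n}. hf (fm f) $$ (k, j) * gmat n z $$ (i, k))"
              for z :: "nat \<times> nat \<times> nat \<Rightarrow> 'k"
              using ij hf(1)[OF fm, of f] by (auto simp: scalar_prod_def mult.commute intro!: sum.cong)
            moreover have "(\<lambda>z. \<Sum>k\<in>{0..<n}. hf (fm f) $$ (k, j) * gmat n z $$ (i, k)) \<in> pol I w W"
              using ij by (intro pol_sum pol_scale cg) auto
            ultimately have gh: "(\<lambda>z. (gmat n z * hf (fm f)) $$ (i, j)) \<in> pol I w W" by simp
            have "(\<lambda>z. \<Prod>t\<in>ts - {y x}. ((gmat n z * hf (fm f)) $$ snd x + gmat n a $$ snd x - t))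
              \<in> pol I w (\<Sum>t\<in>ts - {y x}. W)"
              using ts gh ij by (intro pol_prod pol_diff pol_add pol_const) auto
            then show ?thesis using ts y[OF x] by simp
          qed
          from pol_prod[OF finJ this] show ?thesis unfolding F2_def by simp
        qed
        have "n * n * (s * (n * W + 1)) + card J * (s * W) = kap * s"
          by (simp add: kap_def algebra_simps)
        then show ?thesis using pol_mult[OF p1 p2] by (simp add: FF_def x)
      qed
      show "FF x (pt x) \<noteq> 0" if "x \<in> X" for x
      proof -
        obtain f y where xfy: "x = (f, y)" by force
        then have x: "x = (f, y)" "y \<in> Y" using that by (auto simp: X_def)
        have "F1 f (pt (f, y)) \<noteq> 0" unfolding F1_eval using ts det_pt[OF x(2)] by simp
        moreover have "F2 f y (pt (f, y)) \<noteq> 0" unfolding F2_eval using ts finJ by simp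
        ultimately show ?thesis by (simp add: FF_def x)
      qed
      show "FF x (pt x') = 0" if xx: "x \<in> X" "x' \<in> X" "x \<noteq> x'" for x x'
      proof -
        obtain f y f' y' where x: "x = (f, y)" "x' = (f', y')" by force
        have mem: "f \<in> Fg" "f' \<in> Fg" "y \<in> Yg" "y' \<in> Yg" using xx by (auto simp: X_def x Y_def)
        show ?thesis
        proof (cases "f = f'")
          case False
          then obtain ij where ij: "ij \<in> {..<n} \<times> {..<n}" "f ij \<noteq> f' ij"
            using PiE_ext[of f "{..<n} \<times> {..<n}" "\<lambda>_. ts" f'] mem unfolding Fg_def by blast
          have "f' ij \<in> ts" using ij mem unfolding Fg_def by auto
          then have "(\<Prod>t\<in>ts - {f ij}. det (gmat n (pt (f', y'))) * (f' ij - t)) = 0"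
            using ts ij by (intro prod_zero bexI[of _ "f' ij"]) auto
          then have "F1 f (pt (f', y')) = 0" unfolding F1_eval using ij by (intro prod_zero) auto
          then show ?thesis by (simp add: FF_def x)
        next
          case True
          then have "y \<noteq> y'" using xx x by auto
          then obtain i where i: "i \<in> J" "y i \<noteq> y' i"
            using PiE_ext[of y "J" "\<lambda>_. ts" y'] mem unfolding Yg_def by blast
          have "y' i \<in> ts" using i mem unfolding Yg_def by auto
          then have "(\<Prod>t\<in>ts - {y i}. (y' i - t)) = 0"
            using ts i by (intro prod_zero bexI[of _ "y' i"]) auto
          then have "F2 f y (pt (f, y')) = 0" unfolding F2_eval using i finJ by (intro prod_zero) auto
          then show ?thesis using True by (simp add: FF_def x)
        qed
      qed
    qed
    have "(s + 1) ^ (n * n) * (s + 1) ^ card J \<le> card Fg * (card Y * card F)"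
      using a(2) cardFg cardYg by (simp add: Y_def)
    also have "\<dots> = card F * card X" by (simp add: X_def card_cartesian_product)
    also have "\<dots> \<le> card F * card S" using \<open>card X \<le> card S\<close> by simp
    also have "\<dots> \<le> card F * (Q ^ card R * (kap * s + 1) ^ (card I - card R))" using S(2) by simp
    finally show ?thesis .
  qed
  define E where "E = card I - card R"
  have E: "n * n + card J = E + 1" using n_pos cardJ by (simp add: E_def cardI cardR)
  \<comment> \<open>The left side of \<open>bound\<close> has degree \<open>E + 1\<close> in
    \<open>s\<close>, the right side degree \<open>E\<close>; this value of \<open>s\<close> makes
    the contradiction explicit.\<close>
  define K where "K = card F * Q ^ card R * (kap + 1) ^ E"
  have "(K + 1) ^ (E + 1) \<le> card F * (Q ^ card R * (kap * K + 1) ^ E)"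
    using bound[of K] by (simp only: E_def[symmetric] E power_add[symmetric])
  also have "\<dots> \<le> card F * (Q ^ card R * ((kap + 1) * (K + 1)) ^ E)"
    by (intro mult_le_mono power_mono) auto
  also have "\<dots> = (card F * Q ^ card R * (kap + 1) ^ E) * (K + 1) ^ E"
    by (simp only: power_mult_distrib mult.assoc)
  also have "card F * Q ^ card R * (kap + 1) ^ E = K" by (simp add: K_def)
  finally have "K + 1 \<le> K" by simp
  then show False by simp
qed

end

section \<open>Eigenbases of powers of \<open>\<phi>\<close>\<close>

text \<open>An arbitrary indexed basis, because two are used side by side: one adapted to the
  lattice and one to the slopes.\<close>

locale fin_basis = vector_space scale
  for scale :: "'k::field fls \<Rightarrow> 'v::ab_group_add \<Rightarrow> 'v" +
  fixes N :: nat and b :: "nat \<Rightarrow> 'v"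
  assumes b_inj: "inj_on b {..<N}" and b_indep: "independent (b ` {..<N})"
    and b_span: "span (b ` {..<N}) = UNIV"
begin

definition coord :: "'v \<Rightarrow> nat \<Rightarrow> 'k fls" where
  "coord v i = representation (b ` {..<N}) v (b i)"

lemma coord_expand: "v = (\<Sum>i<N. scale (coord v i) (b i))"
proof -
  have "v = (\<Sum>x\<in>b ` {..<N}. scale (representation (b ` {..<N}) v x) x)"
    by (rule sum_representation_eq[symmetric]) (auto simp: b_indep b_span)
  then show ?thesis by (simp add: sum.reindex[OF b_inj] coord_def)
qed

lemma coord_add: "coord (v + w) i = coord v i + coord w i"
  unfolding coord_def by (subst representation_add) (auto simp: b_indep b_span)

lemma coord_scale: "coord (scale c v) i = c * coord v i"
  unfolding coord_def by (subst representation_scale) (auto simp: b_indep b_span)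

lemma coord_0 [simp]: "coord 0 i = 0"
  using coord_scale[of 0 0 i] by simp

lemma coord_diff: "coord (v - w) i = coord v i - coord w i"
  using coord_add[of "v - w" w i] by simp

lemma coord_sum: "coord (sum f A) i = (\<Sum>a\<in>A. coord (f a) i)"
  by (induction A rule: infinite_finite_induct) (auto simp: coord_add)

lemma coord_basis: "i < N \<Longrightarrow> j < N \<Longrightarrow> coord (b j) i = (if i = j then 1 else 0)"
  unfolding coord_def using b_inj
  by (subst representation_basis) (auto simp: b_indep inj_on_def)

lemma coord_eqI: "(\<And>i. i < N \<Longrightarrow> coord v i = coord w i) \<Longrightarrow> v = w"
  using coord_expand[of v] coord_expand[of w] by simp

lemma coord_comb: "i < N \<Longrightarrow> coord (\<Sum>j<N. scale (c j) (b j)) i = c i"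
  by (simp add: coord_sum coord_scale coord_basis if_distrib[of "(*) _"] cong: if_cong)

definition ent :: "('v \<Rightarrow> 'v) \<Rightarrow> nat \<Rightarrow> nat \<Rightarrow> 'k fls" where
  "ent f i j = coord (f (b j)) i"

lemma linear_coord:
  assumes "Vector_Spaces.linear scale scale f"
  shows "coord (f v) i = (\<Sum>j<N. ent f i j * coord v j)"
proof -
  interpret f: Vector_Spaces.linear scale scale f by (rule assms)
  have "coord (f v) i = coord (f (\<Sum>j<N. scale (coord v j) (b j))) i"
    by (subst coord_expand[of v]) (rule refl)
  also have "\<dots> = (\<Sum>j<N. ent f i j * coord v j)"
    by (simp add: f.sum f.scale coord_sum coord_scale ent_def mult.commute)
  finally show ?thesis .
qed

lemma linear_eqI:
  assumes "Vector_Spaces.linear scale scale f" "Vector_Spaces.linear scale scale g"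
    "\<And>i j. i < N \<Longrightarrow> j < N \<Longrightarrow> ent f i j = ent g i j"
  shows "f = g"
  by (rule ext, rule coord_eqI) (simp add: linear_coord[OF assms(1)] linear_coord[OF assms(2)] assms(3))

definition matmap :: "(nat \<Rightarrow> nat \<Rightarrow> 'k fls) \<Rightarrow> 'v \<Rightarrow> 'v" where
  "matmap A v = (\<Sum>i<N. scale (\<Sum>j<N. A i j * coord v j) (b i))"

lemma coord_matmap: "i < N \<Longrightarrow> coord (matmap A v) i = (\<Sum>j<N. A i j * coord v j)"
  unfolding matmap_def by (rule coord_comb)

lemma linear_matmap: "Vector_Spaces.linear scale scale (matmap A)"
proof -
  have "matmap A (v + w) = matmap A v + matmap A w" for v w
    by (rule coord_eqI) (simp add: coord_matmap coord_add ring_distribs sum.distrib)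
  moreover have "matmap A (scale c v) = scale c (matmap A v)" for c v
    by (rule coord_eqI) (simp add: coord_matmap coord_scale sum_distrib_left mult.left_commute)
  ultimately show ?thesis
    unfolding Vector_Spaces.linear_iff using vector_space_axioms by blast
qed

lemma ent_matmap: "i < N \<Longrightarrow> j < N \<Longrightarrow> ent (matmap A) i j = A i j"
  by (simp add: ent_def coord_matmap coord_basis if_distrib[of "(*) _"] cong: if_cong)

lemma ent_comp:
  assumes "Vector_Spaces.linear scale scale f"
  shows "ent (f \<circ> g) i j = (\<Sum>l<N. ent f i l * ent g l j)"
  by (simp add: ent_def[of "f \<circ> g"] linear_coord[OF assms]) (simp add: ent_def)

lemma ent_id: "i < N \<Longrightarrow> j < N \<Longrightarrow> ent id i j = (if i = j then 1 else 0)"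
  by (simp add: ent_def coord_basis)

end

text \<open>Read x as a series in \<eta> with \<eta>^s = \<epsilon>. It is the sum over rho modulo s
  of \<eta>^rho times a series in \<eta>^s, and \<open>sec s rho x\<close> is that series, read in
  \<epsilon>.\<close>

definition sec :: "nat \<Rightarrow> int \<Rightarrow> 'k::field fls \<Rightarrow> 'k fls" where
  "sec s rho x = Abs_fls (\<lambda>m. fls_nth x (rho + int s * m))"

context
  fixes s :: nat assumes s: "s > 0"
begin

lemma sec_nth [simp]: "fls_nth (sec s rho x) m = fls_nth x (rho + int s * m)"
proof -
  obtain c where c: "ordge c x" using ordge_ex by blast
  have "fls_nth x (rho + int s * n) = 0" if n: "n < - \<bar>c\<bar> - \<bar>rho\<bar>" for n
  proof -
    have "int s * n \<le> 1 * n" using s n by (intro mult_right_mono_neg) auto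
    then have "rho + int s * n < c" using n by linarith
    then show ?thesis using c by (rule ordgeD[rotated])
  qed
  then show ?thesis
    unfolding sec_def by (intro nth_Abs_fls_lower_bound[of "- \<bar>c\<bar> - \<bar>rho\<bar>"]) simp
qed

lemma sec_add: "sec s rho (x + y) = sec s rho x + sec s rho y"
  by (rule fls_eqI) simp

lemma sec_X_powi: "sec s rho (fls_X powi r * x) = sec s (rho - r) x"
  by (rule fls_eqI) (simp only: sec_nth fls_X_powi_mult_nth, simp add: algebra_simps)

lemma sec_shift: "sec s (rho - int s * r) x = fls_X powi r * sec s rho x"
  by (rule fls_eqI) (simp add: fls_X_powi_mult_nth algebra_simps)

text \<open>\<open>fls_compose_power\<close> embeds k((\<epsilon>)) into the ramified extension.
  Only exponents divisible by \<open>s\<close> occur in its image, so multiplication by the image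
  respects residue classes modulo \<open>s\<close>.\<close>

lemma sec_compose_power: "sec s rho (fls_compose_power a s * x) = a * sec s rho x"
proof (rule fls_eqI)
  fix m
  obtain c d where cd: "ordge c a" "ordge d x" using ordge_ex by metis
  have a': "ordge (int s * c) (fls_compose_power a s)"
    unfolding ordge_def
  proof (intro allI impI)
    fix n assume n: "n < int s * c"
    show "fls_nth (fls_compose_power a s) n = 0"
    proof (cases "int s dvd n")
      case True
      then obtain l where l: "n = int s * l" by blast
      then have "l < c" using n s by simp
      then show ?thesis using cd(1) l s by (simp add: fls_nth_compose_power ordgeD)
    qed (use s in \<open>simp add: fls_nth_compose_power\<close>)
  qed
  define d' where "d' = - \<bar>d\<bar> - \<bar>rho\<bar>"
  have d': "ordge d' (sec s rho x)"
    unfolding ordge_def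
  proof (intro allI impI)
    fix n assume n: "n < d'"
    have "int s * n \<le> 1 * n" using s n by (intro mult_right_mono_neg) (auto simp: d'_def)
    then have "rho + int s * n < d" using n by (simp add: d'_def)
    then show "fls_nth (sec s rho x) n = 0" using cd(2) by (simp add: ordgeD)
  qed
  define n where "n = rho + int s * m"
  let ?f = "\<lambda>i. fls_nth (fls_compose_power a s) i * fls_nth x (n - i)"
  have "fls_nth (sec s rho (fls_compose_power a s * x)) m = (\<Sum>i=int s * c..n - d. ?f i)"
    by (simp add: n_def fls_mult_nth_ordge[OF a' cd(2)])
  also have "\<dots> = (\<Sum>i\<in>(\<lambda>l. int s * l) ` {c..m - d'}. ?f i)"
  proof (rule sum.mono_neutral_cong)
    show "?f i = 0" if i: "i \<in> (\<lambda>l. int s * l) ` {c..m - d'} - {int s * c..n - d}" for i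
    proof -
      have "i > n - d" using i s by auto
      then have "n - i < d" by simp
      then show ?thesis using ordgeD[OF cd(2)] by simp
    qed
    show "?f i = 0" if i: "i \<in> {int s * c..n - d} - (\<lambda>l. int s * l) ` {c..m - d'}" for i
    proof (cases "int s dvd i")
      case True
      then obtain l where l: "i = int s * l" by blast
      then have "c \<le> l" using i s by simp
      then have "l > m - d'" using i l by auto
      then have "m - l < d'" by simp
      then have "fls_nth (sec s rho x) (m - l) = 0" using d' by (rule ordgeD[rotated])
      then show ?thesis by (simp add: l n_def algebra_simps)
    qed (use s in \<open>simp add: fls_nth_compose_power\<close>)
  qed auto
  also have "\<dots> = (\<Sum>l=c..m - d'. fls_nth a l * fls_nth (sec s rho x) (m - l))"
    using s by (subst sum.reindex) (auto simp: inj_on_def fls_nth_compose_power n_def algebra_simps)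
  also have "\<dots> = fls_nth (a * sec s rho x) m"
    by (simp only: fls_mult_nth_ordge[OF cd(1) d'])
  finally show "fls_nth (sec s rho (fls_compose_power a s * x)) m = fls_nth (a * sec s rho x) m" .
qed

end

lemma (in frobenius_field) sec_frob: "s > 0 \<Longrightarrow> sec s rho (frob x) = frob (sec s rho x)"
  by (rule fls_eqI) simp

section \<open>Powers of \<phi> and their eigenvectors\<close>

sublocale f_crystal \<subseteq> frobenius_field q "TYPE('k)"
  using char_pos q_power by unfold_locales auto

context f_crystal
begin

lemma \<phi>_funpow_add: "(\<phi> ^^ t) (v + w) = (\<phi> ^^ t) v + (\<phi> ^^ t) w"
  by (induction t) (auto simp: \<phi>_add)

lemma \<phi>_funpow_scale: "(\<phi> ^^ t) (scale c v) = scale (fls_frob (q ^ t) c) ((\<phi> ^^ t) v)"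
proof -
  have "(\<phi> ^^ t) (scale c v) = scale ((frob ^^ t) c) ((\<phi> ^^ t) v)"
    by (induction t) (auto simp: \<phi>_scale)
  then show ?thesis by (simp only: frob_funpow)
qed

lemma \<phi>_funpow_0: "(\<phi> ^^ t) 0 = 0"
  using \<phi>_funpow_add[of t 0 0] by simp

lemma \<phi>_funpow_sum: "(\<phi> ^^ t) (sum f A) = (\<Sum>a\<in>A. (\<phi> ^^ t) (f a))"
  by (induction A rule: infinite_finite_induct) (auto simp: \<phi>_funpow_add \<phi>_funpow_0)

lemma \<phi>_funpow_bij: "bij (\<phi> ^^ t)"
  by (induction t) (simp_all only: funpow.simps bij_id bij_comp \<phi>_bij)

lemma \<phi>_funpow_inj: "(\<phi> ^^ t) v = (\<phi> ^^ t) w \<longleftrightarrow> v = w"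
  using \<phi>_funpow_bij[of t] by (metis bij_is_inj injD)

text \<open>One exponent \<open>t\<close> is common to all vectors, so \<open>e i\<close> has slope
  \<open>r i / t\<close>. The family need not span; it is enlarged one vector at a time.\<close>

definition eigen_family :: "nat \<Rightarrow> nat \<Rightarrow> (nat \<Rightarrow> 'v) \<Rightarrow> (nat \<Rightarrow> int) \<Rightarrow> bool" where
  "eigen_family t n e r \<longleftrightarrow> t > 0 \<and> inj_on e {..<n} \<and> independent (e ` {..<n}) \<and>
     (\<forall>i<n. (\<phi> ^^ t) (e i) = scale (fls_X powi r i) (e i))"

lemma span_image_lessThan:
  fixes n :: nat
  assumes "x \<in> span (e ` {..<n})"
  shows "\<exists>c. x = (\<Sum>i<n. scale (c i) (e i))"
  using assms
proof (induction rule: span_induct_alt)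
  case base
  then show ?case by (intro exI[of _ "\<lambda>_. 0"]) simp
next
  case (step a x y)
  then obtain c j where c: "y = (\<Sum>i<n. scale (c i) (e i))" "j < n" "x = e j" by auto
  have "scale a x = (\<Sum>i<n. scale (if i = j then a else 0) (e i))"
    using c(2) unfolding c(3) by (subst sum.remove[of _ j]) (auto intro!: sum.neutral)
  then show ?case
    by (intro exI[of _ "\<lambda>i. (if i = j then a else 0) + c i"]) (simp add: c scale_left_distrib sum.distrib)
qed

lemma sum_scale_in_span: "(\<Sum>i<n. scale (g i) (e i)) \<in> span (e ` {..<n})"
  by (intro span_sum span_scale span_base) auto

text \<open>For the converse, the coefficients are divided by the eigenvalues and pulled back along
  the Frobenius, which is onto. Thus \<open>\<phi> ^^ t\<close> stays injective modulo the
  span.\<close>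

lemma eigen_family_span:
  assumes "eigen_family t n e r"
  shows "(\<phi> ^^ t) x \<in> span (e ` {..<n}) \<longleftrightarrow> x \<in> span (e ` {..<n})"
proof
  interpret F: frobenius_field "q ^ t" "TYPE('k)"
    using assms frobenius_field_power by (auto simp: eigen_family_def)
  have eig: "(\<phi> ^^ t) (e i) = scale (fls_X powi r i) (e i)" if "i < n" for i
    using assms that by (auto simp: eigen_family_def)
  have comb: "(\<phi> ^^ t) (\<Sum>i<n. scale (c i) (e i)) = (\<Sum>i<n. scale (F.frob (c i) * fls_X powi r i) (e i))" for c
    by (simp add: \<phi>_funpow_sum \<phi>_funpow_scale eig)
  {
    assume "x \<in> span (e ` {..<n})"
    then obtain c where "x = (\<Sum>i<n. scale (c i) (e i))" using span_image_lessThan by blast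
    then have "(\<phi> ^^ t) x = (\<Sum>i<n. scale (F.frob (c i) * fls_X powi r i) (e i))" using comb by simp
    then show "(\<phi> ^^ t) x \<in> span (e ` {..<n})" using sum_scale_in_span by metis
  next
    assume "(\<phi> ^^ t) x \<in> span (e ` {..<n})"
    then obtain c where c: "(\<phi> ^^ t) x = (\<Sum>i<n. scale (c i) (e i))" using span_image_lessThan by blast
    obtain g where g: "\<And>y. F.frob (g y) = y" using F.frob_surj by metis
    have "(\<phi> ^^ t) x = (\<phi> ^^ t) (\<Sum>i<n. scale (g (c i * fls_X powi (- r i))) (e i))"
      unfolding comb c by (intro sum.cong refl) (simp add: g power_int_minus mult.assoc)
    then have "x = (\<Sum>i<n. scale (g (c i * fls_X powi (- r i))) (e i))"
      using \<phi>_funpow_inj by blast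
    then show "x \<in> span (e ` {..<n})" using sum_scale_in_span by metis
  }
qed

lemma finite_spanning: "\<exists>B. finite B \<and> independent B \<and> span B = UNIV"
  using lattice_M unfolding lattice_of_def by blast

lemma independent_card_bound: "\<exists>n. \<forall>S. independent S \<longrightarrow> finite S \<and> card S \<le> n"
proof -
  obtain B where B: "finite B" "span B = UNIV" using finite_spanning by blast
  then have "\<forall>S. independent S \<longrightarrow> finite S \<and> card S \<le> card B"
    using independent_span_bound[OF B(1)] by simp
  then show ?thesis by blast
qed

text \<open>In finite dimension the iterates of \<open>v\<close> become dependent modulo
  \<open>span E\<close>. The least such \<open>d\<close> yields the relation, its minimality the
  independence of the earlier iterates; it is positive because \<open>v\<close> is not in the
  span.\<close>

lemma iterate_relation:
  fixes psi :: "'v \<Rightarrow> 'v"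
  assumes E: "independent E" "v \<notin> span E"
  shows "\<exists>d a y. d > 0 \<and> (psi ^^ d) v = y + (\<Sum>i<d. scale (a i) ((psi ^^ i) v)) \<and> y \<in> span E \<and>
     (\<forall>i<d. (psi ^^ i) v \<notin> span (E \<union> (\<lambda>i. (psi ^^ i) v) ` {..<i}))"
proof -
  let ?U = "\<lambda>d. E \<union> (\<lambda>i. (psi ^^ i) v) ` {..<d}"
  obtain m where m: "\<And>S. independent S \<Longrightarrow> finite S \<and> card S \<le> m" using independent_card_bound by blast
  have ind: "independent (?U d) \<and> card (?U d) = card E + d" if "\<forall>i<d. (psi ^^ i) v \<notin> span (?U i)" for d
    using that
  proof (induction d)
    case 0
    then show ?case using E by simp
  next
    case (Suc d)
    have U: "?U (Suc d) = insert ((psi ^^ d) v) (?U d)" by (auto simp: lessThan_Suc)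
    have nin: "(psi ^^ d) v \<notin> span (?U d)" using Suc.prems by simp
    then have "(psi ^^ d) v \<notin> ?U d" using span_base[of "(psi ^^ d) v" "?U d"] by metis
    moreover have "independent (?U d)" "card (?U d) = card E + d" using Suc by auto
    ultimately show ?case
      unfolding U using independent_insertI[OF nin] m[of "?U d"] by auto
  qed
  have "\<exists>d. (psi ^^ d) v \<in> span (?U d)"
  proof (rule ccontr)
    assume "\<not> ?thesis"
    then have "independent (?U (Suc m)) \<and> card (?U (Suc m)) = card E + Suc m" by (intro ind) auto
    then show False using m[of "?U (Suc m)"] by linarith
  qed
  then obtain d where d: "(psi ^^ d) v \<in> span (?U d)" "\<And>i. i < d \<Longrightarrow> (psi ^^ i) v \<notin> span (?U i)"
    using exists_least_iff[of "\<lambda>d. (psi ^^ d) v \<in> span (?U d)"] by blast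
  have "d \<noteq> 0" using d(1) E(2) by (metis Un_empty_right funpow_0 image_empty lessThan_0)
  moreover obtain y x where yx: "(psi ^^ d) v = y + x" "y \<in> span E" "x \<in> span ((\<lambda>i. (psi ^^ i) v) ` {..<d})"
    using d(1) unfolding span_Un by blast
  moreover obtain a where "x = (\<Sum>i<d. scale (a i) ((psi ^^ i) v))"
    using span_image_lessThan[OF yx(3)] by blast
  ultimately show ?thesis using d(2) by blast
qed

text \<open>An eigenvector modulo \<open>span E\<close> of a power of \<open>psi\<close> is found in the cyclic subspace generated by
  \<open>v\<close>, over the ramified extension \<open>k((\<epsilon>\<^sup>1\<^sup>/\<^sup>s))\<close> where \<open>rr / s\<close> is the smallest Newton slope
  of \<open>v\<close>; the sections \<open>sec s rho\<close> bring it back to \<open>k((\<epsilon>))\<close>.\<close>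

lemma eigenvector_modulo:
  fixes psi :: "'v \<Rightarrow> 'v" and Q :: nat
  assumes Q: "frobenius_field TYPE('k) Q"
    and add: "\<And>v w. psi (v + w) = psi v + psi w" and sc: "\<And>c v. psi (scale c v) = scale (fls_frob Q c) (psi v)"
    and E: "independent E" "\<And>x. psi x \<in> span E \<longleftrightarrow> x \<in> span E" and v: "v \<notin> span E"
  shows "\<exists>w s rr. s > 0 \<and> w \<notin> span E \<and> (psi ^^ s) w - scale (fls_X powi rr) w \<in> span E"
proof -
  interpret F: frobenius_field Q "TYPE('k)" by (rule Q)
  obtain d a y where d: "d > 0" and rel: "(psi ^^ d) v = y + (\<Sum>i<d. scale (a i) ((psi ^^ i) v))"
    and y: "y \<in> span E" and free: "\<And>i. i < d \<Longrightarrow> (psi ^^ i) v \<notin> span (E \<union> (\<lambda>i. (psi ^^ i) v) ` {..<i})"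
    using iterate_relation[OF E(1) v, of psi] by blast
  have E_pow: "(psi ^^ i) x \<in> span E \<longleftrightarrow> x \<in> span E" for i x by (induction i) (auto simp: E(2))
  have psi_0: "psi 0 = 0" using add[of 0 0] by simp
  have psi_sum: "psi (sum f A) = (\<Sum>a\<in>A. psi (f a))" for f and A :: "nat set"
    by (induction A rule: infinite_finite_induct) (auto simp: add psi_0)
  define Z where "Z = {i. i < d \<and> a i \<noteq> 0}"
  have "Z \<noteq> {}"
  proof
    assume "Z = {}"
    then have "(psi ^^ d) v = y" using rel by (auto simp: Z_def intro!: sum.neutral)
    then show False using y E_pow v by blast
  qed
  \<comment> \<open>Up to sign, the slopes of the segments from the points (i, ord (a i)) to the end
    point (d, 0) of the Newton diagram of the relation.\<close>
  define h :: "nat \<Rightarrow> rat" where "h = (\<lambda>i. of_int (fls_subdegree (a i)) / of_nat (d - i))"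
  have "finite Z" by (simp add: Z_def)
  then have "Min (h ` Z) \<in> h ` Z" "\<And>i. i \<in> Z \<Longrightarrow> Min (h ` Z) \<le> h i" using \<open>Z \<noteq> {}\<close> by auto
  then obtain u where "u \<in> Z" "\<And>i. i \<in> Z \<Longrightarrow> h u \<le> h i" by force
  then have u: "u \<in> Z"
    "\<And>i. i \<in> Z \<Longrightarrow> of_int (fls_subdegree (a u)) / of_nat (d - u) \<le> (of_int (fls_subdegree (a i)) / of_nat (d - i) :: rat)"
    unfolding h_def by auto
  define s where "s = d - u"
  define rr where "rr = fls_subdegree (a u)"
  have s: "s > 0" using u(1) by (auto simp: s_def Z_def)
  have min: "rr * int (d - i) \<le> int s * fls_subdegree (a i)" if "i \<in> Z" for i
  proof -
    have "d - i > 0" using that by (auto simp: Z_def)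
    then have "(of_int rr :: rat) * of_nat (d - i) \<le> of_nat s * of_int (fls_subdegree (a i))"
      using u(2)[OF that] s by (simp add: field_simps s_def rr_def)
    then have "(of_int (rr * int (d - i)) :: rat) \<le> of_int (int s * fls_subdegree (a i))" by simp
    then show ?thesis by (simp only: of_int_le_iff)
  qed
  define io where "io = (\<lambda>x :: 'k fls. fls_compose_power x s)"
  have io_ord: "ordge (rr * int (d - i)) (io (a i))" if "i < d" for i
    unfolding ordge_def
  proof (intro allI impI)
    fix n assume n: "n < rr * int (d - i)"
    show "fls_nth (io (a i)) n = 0"
    proof (cases "int s dvd n \<and> a i \<noteq> 0")
      case True
      then obtain l where l: "n = int s * l" by blast
      have "int s * l < int s * fls_subdegree (a i)" using n l min[of i] True that by (auto simp: Z_def)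
      then have "l < fls_subdegree (a i)" using s by simp
      then show ?thesis using s l by (simp add: io_def fls_nth_compose_power)
    qed (use s in \<open>auto simp: io_def fls_nth_compose_power\<close>)
  qed
  have io_u: "fls_nth (io (a u)) (rr * int (d - u)) \<noteq> 0"
    using u(1) s by (simp add: io_def fls_nth_compose_power flip: s_def) (auto simp: rr_def Z_def)
  \<comment> \<open>The rescaled coefficients of the relation over the ramified field. The
    minimality of the slope makes them integral, and the one at \<open>d - u\<close> has a nonzero
    constant term.\<close>
  define c where "c = (\<lambda>j. fls_X powi (- rr * int j) * (F.frob ^^ (j - 1)) (io (a (d - j))))"
  have frob_pow_nth: "fls_nth ((F.frob ^^ j) x) n = fls_nth x n ^ (Q ^ j)" for j x n
    by (simp add: F.frob_funpow fls_nth_fls_frob)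
  have frob_pow_ord: "ordge m ((F.frob ^^ j) x) \<longleftrightarrow> ordge m x" for j x m
    by (induction j) auto
  have "\<exists>T. fls_nth T 0 \<noteq> 0 \<and> T = (\<Sum>j=1..d. c j * (F.frob ^^ j) T)"
  proof (rule F.semilinear_fixed_point_fls)
    show "ordge 0 (c j)" if "j \<in> {1..d}" for j
      unfolding c_def ordge_X_powi_mult frob_pow_ord using io_ord[of "d - j"] that by simp
    show "d - u \<in> {1..d}" using u(1) by (auto simp: Z_def)
    show "fls_nth (c (d - u)) 0 \<noteq> 0"
      unfolding c_def fls_X_powi_mult_nth frob_pow_nth using io_u u(1) by (simp add: Z_def)
  qed
  then obtain T where T: "fls_nth T 0 \<noteq> 0" "T = (\<Sum>j=1..d. c j * (F.frob ^^ j) T)" by blast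
  \<comment> \<open>The coefficients of an eigenvector \<Sum> x i psi^i v with eigenvalue \<eta>^rr.
    Modulo \<open>span E\<close> they must satisfy \<eta>^rr x i = \<sigma>(x (i - 1)) + a i
    \<sigma>(x (d - 1)); with \<open>T\<close> in place of x (d - 1) this is a recursion, and the
    fixed point equation for \<open>T\<close> closes it.\<close>
  define x where "x = rec_nat (fls_X powi (- rr) * (io (a 0) * F.frob T))
     (\<lambda>i xi. fls_X powi (- rr) * (F.frob xi + io (a (Suc i)) * F.frob T))"
  have x0: "x 0 = fls_X powi (- rr) * (io (a 0) * F.frob T)"
    and xS: "x (Suc i) = fls_X powi (- rr) * (F.frob (x i) + io (a (Suc i)) * F.frob T)" for i
    by (simp_all add: x_def)
  have frob_pow_mult: "(F.frob ^^ j) (p * p') = (F.frob ^^ j) p * (F.frob ^^ j) p'" for j p p'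
    by (induction j) (auto simp: F.frob_mult)
  have x_closed: "x i = (\<Sum>l\<le>i. fls_X powi (- rr * int (i - l + 1)) * (F.frob ^^ (i - l)) (io (a l) * F.frob T))" for i
  proof (induction i)
    case 0
    then show ?case by (simp add: x0)
  next
    case (Suc i)
    have "(\<Sum>l\<le>Suc i. fls_X powi (- rr * int (Suc i - l + 1)) * (F.frob ^^ (Suc i - l)) (io (a l) * F.frob T))
      = (\<Sum>l\<le>i. fls_X powi (- rr) * F.frob (fls_X powi (- rr * int (i - l + 1)) * (F.frob ^^ (i - l)) (io (a l) * F.frob T)))
        + fls_X powi (- rr) * (io (a (Suc i)) * F.frob T)"
    proof -
      have "fls_X powi (- rr * int (Suc i - l + 1)) * (F.frob ^^ (Suc i - l)) (io (a l) * F.frob T)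
        = fls_X powi (- rr) * F.frob (fls_X powi (- rr * int (i - l + 1)) * (F.frob ^^ (i - l)) (io (a l) * F.frob T))"
        if "l \<le> i" for l
      proof -
        have "- rr * int (Suc i - l + 1) = - rr + - rr * int (i - l + 1)"
          using that by (simp add: of_nat_diff algebra_simps)
        then have "(fls_X :: 'k fls) powi (- rr * int (Suc i - l + 1)) = fls_X powi (- rr) * fls_X powi (- rr * int (i - l + 1))"
          by (simp only: power_int_add fls_X_nonzero simp_thms)
        moreover have "Suc i - l = Suc (i - l)" using that by simp
        ultimately show ?thesis by (simp add: F.frob_mult mult.assoc)
      qed
      then show ?thesis by simp
    qed
    then show ?case by (simp add: xS Suc F.frob_sum distrib_left sum_distrib_left)
  qed
  have xT: "x (d - 1) = T"
  proof -
    have "x (d - 1) = (\<Sum>l\<in>{..d - 1}. fls_X powi (- rr * int (d - l)) * (F.frob ^^ (d - 1 - l)) (io (a l) * F.frob T))"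
      unfolding x_closed using d by (intro sum.cong refl) (auto simp: Suc_diff_le)
    also have "\<dots> = (\<Sum>j\<in>{1..d}. c j * (F.frob ^^ j) T)"
    proof (rule sum.reindex_bij_witness[of _ "\<lambda>j. d - j" "\<lambda>l. d - l"])
      fix l assume l: "l \<in> {..d - 1}"
      then have "d - l = Suc (d - 1 - l)" using d by auto
      then have "(F.frob ^^ (d - l)) T = (F.frob ^^ (d - 1 - l)) (F.frob T)"
        by (simp only: funpow_Suc_right o_apply)
      moreover have "d - (d - l) = l" using l d by auto
      ultimately show "c (d - l) * (F.frob ^^ (d - l)) T =
        fls_X powi (- rr * int (d - l)) * (F.frob ^^ (d - 1 - l)) (io (a l) * F.frob T)"
        by (simp add: c_def frob_pow_mult mult.assoc)
    qed (use d in auto)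
    finally show ?thesis using T(2) by simp
  qed
  have x_rel: "fls_X powi rr * x i = (if i = 0 then 0 else F.frob (x (i - 1))) + io (a i) * F.frob T" for i
    by (cases i) (simp_all add: x0 xS power_int_minus)
  \<comment> \<open>The eigenvector lives over the ramified extension, its sections lie in V.
    Multiplication by \<eta>^rr becomes the shift from rho to rho - rr, and \<open>s\<close> such
    shifts amount to multiplication by \<epsilon>^rr.\<close>
  define w where "w = (\<lambda>rho. \<Sum>i<d. scale (sec s rho (x i)) ((psi ^^ i) v))"
  have step: "psi (w rho) - w (rho - rr) \<in> span E" for rho
  proof -
    define T' where "T' = F.frob (sec s rho T)"
    obtain d' where d': "d = Suc d'" using d by (cases d) auto
    have "psi (w rho) = (\<Sum>i<d. scale (F.frob (sec s rho (x i))) ((psi ^^ Suc i) v))"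
      by (simp add: w_def psi_sum sc)
    also have "\<dots> = (\<Sum>i<d'. scale (F.frob (sec s rho (x i))) ((psi ^^ Suc i) v)) + scale T' ((psi ^^ d) v)"
      using xT by (simp add: d' T'_def)
    also have "(\<Sum>i<d'. scale (F.frob (sec s rho (x i))) ((psi ^^ Suc i) v))
      = (\<Sum>i<d. scale (if i = 0 then 0 else F.frob (sec s rho (x (i - 1)))) ((psi ^^ i) v))"
      unfolding d' by (subst sum.lessThan_Suc_shift) simp
    also have "scale T' ((psi ^^ d) v) = scale T' y + (\<Sum>i<d. scale (T' * a i) ((psi ^^ i) v))"
      unfolding rel by (simp add: scale_right_distrib scale_sum_right)
    finally have "psi (w rho) = scale T' y +
       (\<Sum>i<d. scale ((if i = 0 then 0 else F.frob (sec s rho (x (i - 1)))) + T' * a i) ((psi ^^ i) v))"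
      by (simp add: scale_left_distrib sum.distrib)
    also have "(\<Sum>i<d. scale ((if i = 0 then 0 else F.frob (sec s rho (x (i - 1)))) + T' * a i) ((psi ^^ i) v)) = w (rho - rr)"
      unfolding w_def
    proof (intro sum.cong refl arg_cong2[where f = scale])
      fix i
      have "sec s (rho - rr) (x i) = sec s rho (fls_X powi rr * x i)" by (simp add: sec_X_powi[OF s])
      also have "\<dots> = sec s rho (if i = 0 then 0 else F.frob (x (i - 1))) + sec s rho (io (a i) * F.frob T)"
        unfolding x_rel by (rule sec_add[OF s])
      also have "sec s rho (io (a i) * F.frob T) = T' * a i"
        unfolding io_def sec_compose_power[OF s] F.sec_frob[OF s] T'_def by (rule mult.commute)
      also have "sec s rho (if i = 0 then 0 else F.frob (x (i - 1))) = (if i = 0 then 0 else F.frob (sec s rho (x (i - 1))))"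
        using fls_eqI[of "sec s rho (0 :: 'k fls)" 0] by (simp add: F.sec_frob[OF s] sec_nth[OF s])
      finally show "(if i = 0 then 0 else F.frob (sec s rho (x (i - 1)))) + T' * a i = sec s (rho - rr) (x i)"
        by simp
    qed
    finally have "psi (w rho) - w (rho - rr) = scale T' y" by simp
    then show ?thesis using y span_scale by metis
  qed
  have psi_diff: "psi (p - p') = psi p - psi p'" for p p' using add[of "p - p'" p'] by simp
  have steps: "(psi ^^ m) (w rho) - w (rho - int m * rr) \<in> span E" for m rho
  proof (induction m)
    case 0
    then show ?case by (simp add: span_zero)
  next
    case (Suc m)
    have "(psi ^^ Suc m) (w rho) - w (rho - int (Suc m) * rr) =
       psi ((psi ^^ m) (w rho) - w (rho - int m * rr)) +
       (psi (w (rho - int m * rr)) - w (rho - int m * rr - rr))"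
      by (simp add: psi_diff algebra_simps)
    moreover have "psi ((psi ^^ m) (w rho) - w (rho - int m * rr)) \<in> span E" using Suc E(2) by simp
    ultimately show ?case using step span_add by metis
  qed
  have "w (0 - int s * rr) = scale (fls_X powi rr) (w 0)"
    unfolding w_def by (simp add: sec_shift[OF s] scale_sum_right del: diff_0)
  then have "(psi ^^ s) (w 0) - scale (fls_X powi rr) (w 0) \<in> span E"
    using steps[of s 0] by simp
  moreover have "w 0 \<notin> span E"
  proof
    assume w0: "w 0 \<in> span E"
    obtain d' where d': "d = Suc d'" using d by (cases d) auto
    let ?U = "E \<union> (\<lambda>i. (psi ^^ i) v) ` {..<d'}"
    define T0 where "T0 = sec s 0 T"
    \<comment> \<open>The normalisation of \<open>T\<close> at index 0 is what keeps the section
      with rho = 0 from vanishing.\<close>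
    have T0: "T0 \<noteq> 0" using T(1) by (auto simp: T0_def fls_nonzero_nth sec_nth[OF s] intro!: exI[of _ 0])
    have "w 0 = (\<Sum>i<d'. scale (sec s 0 (x i)) ((psi ^^ i) v)) + scale T0 ((psi ^^ d') v)"
      using xT by (simp add: w_def d' T0_def)
    then have "scale T0 ((psi ^^ d') v) = w 0 - (\<Sum>i<d'. scale (sec s 0 (x i)) ((psi ^^ i) v))" by simp
    also have "\<dots> \<in> span ?U"
    proof (rule span_diff)
      show "w 0 \<in> span ?U" using w0 span_mono[of E ?U] by blast
      show "(\<Sum>i<d'. scale (sec s 0 (x i)) ((psi ^^ i) v)) \<in> span ?U"
        by (intro span_sum span_scale span_base) auto
    qed
    finally have "scale (inverse T0) (scale T0 ((psi ^^ d') v)) \<in> span ?U" by (rule span_scale)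
    then have "(psi ^^ d') v \<in> span ?U" using T0 by simp
    then show False using free[of d'] d' by simp
  qed
  ultimately show ?thesis using s by blast
qed

text \<open>An eigenvector of a further power modulo the span is corrected by a combination of the
  old vectors. Passing from \<open>t\<close> to \<open>t * s\<close> multiplies the old exponents by
  \<open>s\<close>.\<close>

lemma eigen_family_extend:
  assumes ef: "eigen_family t n e r" and sp: "span (e ` {..<n}) \<noteq> UNIV"
  shows "\<exists>t' e' r'. eigen_family t' (Suc n) e' r'"
proof -
  let ?E = "e ` {..<n}"
  have t: "t > 0" and inj: "inj_on e {..<n}" and ind: "independent ?E"
    and eig: "\<And>i. i < n \<Longrightarrow> (\<phi> ^^ t) (e i) = scale (fls_X powi r i) (e i)"
    using ef by (auto simp: eigen_family_def)
  obtain v where v: "v \<notin> span ?E" using sp by blast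
  obtain w s rr where w: "s > 0" "w \<notin> span ?E" "((\<phi> ^^ t) ^^ s) w - scale (fls_X powi rr) w \<in> span ?E"
    using eigenvector_modulo[OF frobenius_field_power[OF t] \<phi>_funpow_add \<phi>_funpow_scale ind
        eigen_family_span[OF ef] v] by blast
  define t' where "t' = t * s"
  have t': "t' > 0" using t w by (simp add: t'_def)
  have pow: "(\<phi> ^^ t) ^^ m = \<phi> ^^ (t * m)" for m by (simp add: funpow_mult mult.commute)
  interpret F: frobenius_field "q ^ t'" "TYPE('k)" by (rule frobenius_field_power[OF t'])
  have eig': "(\<phi> ^^ t') (e i) = scale (fls_X powi (r i * int s)) (e i)" if i: "i < n" for i
  proof -
    have "(\<phi> ^^ (t * m)) (e i) = scale (fls_X powi (r i * int m)) (e i)" for m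
    proof (induction m)
      case (Suc m)
      interpret F1: frobenius_field "q ^ t" "TYPE('k)" by (rule frobenius_field_power[OF t])
      have "(\<phi> ^^ (t * Suc m)) (e i) = (\<phi> ^^ t) (scale (fls_X powi (r i * int m)) (e i))"
        by (simp add: funpow_add Suc)
      also have "\<dots> = scale (fls_X powi (r i * int m) * fls_X powi r i) (e i)"
        by (simp add: \<phi>_funpow_scale eig[OF i])
      also have "fls_X powi (r i * int m) * fls_X powi r i = (fls_X :: 'k fls) powi (r i * int (Suc m))"
        by (subst power_int_add[symmetric]) (auto simp: algebra_simps)
      finally show ?case .
    qed simp
    then show ?thesis by (simp add: t'_def)
  qed
  obtain c where c: "(\<phi> ^^ t') w - scale (fls_X powi rr) w = (\<Sum>i<n. scale (c i) (e i))"
    using span_image_lessThan[OF w(3)] by (auto simp: pow t'_def)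
  \<comment> \<open>The vector w + \<Sum> x i e i is an exact eigenvector if \<epsilon>^(r i s)
    \<sigma>(x i) - \<epsilon>^rr x i = - c i; dividing by \<epsilon>^rr gives the Artin-Schreier
    form.\<close>
  have "\<exists>x. fls_X powi (r i * int s - rr) * F.frob x - x = - (fls_X powi (- rr) * c i)" for i
  proof -
    obtain m where "ordge m (- (fls_X powi (- rr) * c i))" using ordge_ex by blast
    then show ?thesis using F.artin_schreier_fls by blast
  qed
  then obtain x where x: "\<And>i. fls_X powi (r i * int s - rr) * F.frob (x i) - x i = - (fls_X powi (- rr) * c i)"
    by metis
  have x': "c i + F.frob (x i) * fls_X powi (r i * int s) = fls_X powi rr * x i" for i
  proof -
    have "fls_X powi (r i * int s) * F.frob (x i) = fls_X powi rr * (fls_X powi (r i * int s - rr) * F.frob (x i))"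
      by (subst mult.assoc[symmetric], subst power_int_add[symmetric]) auto
    moreover have "fls_X powi rr * (fls_X powi (- rr) * c i) = c i" by (simp add: power_int_minus)
    moreover have "fls_X powi rr * (fls_X powi (r i * int s - rr) * F.frob (x i)) - fls_X powi rr * x i =
        - (fls_X powi rr * (fls_X powi (- rr) * c i))"
      by (simp only: right_diff_distrib[symmetric] x mult_minus_right)
    ultimately have "fls_X powi (r i * int s) * F.frob (x i) - fls_X powi rr * x i = - c i" by (simp only:)
    then show ?thesis by (simp add: diff_eq_eq add.commute mult.commute)
  qed
  define e1 where "e1 = w + (\<Sum>i<n. scale (x i) (e i))"
  note sumE = sum_scale_in_span[where e = e and n = n]
  have e1: "e1 \<notin> span ?E"
    using w(2) sumE[where g = x] span_diff[of e1 ?E "\<Sum>i<n. scale (x i) (e i)"] by (auto simp: e1_def)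
  have "(\<phi> ^^ t') e1 = (\<phi> ^^ t') w + (\<Sum>i<n. scale (F.frob (x i) * fls_X powi (r i * int s)) (e i))"
    by (simp add: e1_def \<phi>_funpow_add \<phi>_funpow_sum \<phi>_funpow_scale eig')
  also have "(\<phi> ^^ t') w = scale (fls_X powi rr) w + (\<Sum>i<n. scale (c i) (e i))" using c by (simp add: algebra_simps)
  also have "scale (fls_X powi rr) w + (\<Sum>i<n. scale (c i) (e i)) + (\<Sum>i<n. scale (F.frob (x i) * fls_X powi (r i * int s)) (e i))
     = scale (fls_X powi rr) w + (\<Sum>i<n. scale (c i + F.frob (x i) * fls_X powi (r i * int s)) (e i))"
    by (simp add: scale_left_distrib sum.distrib)
  also have "\<dots> = scale (fls_X powi rr) e1"
    unfolding x' by (simp add: e1_def scale_right_distrib scale_sum_right)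
  finally have e1_eig: "(\<phi> ^^ t') e1 = scale (fls_X powi rr) e1" .
  define e' where "e' = e(n := e1)"
  have im: "e' ` {..<Suc n} = insert e1 ?E" by (auto simp: e'_def lessThan_Suc)
  have "e1 \<notin> ?E" using e1 span_base[of e1 ?E] by metis
  then have "inj_on e' {..<Suc n}"
    using inj by (auto simp: e'_def inj_on_def lessThan_Suc)
  moreover have "independent (e' ` {..<Suc n})" unfolding im using independent_insertI[OF e1 ind] .
  ultimately have "eigen_family t' (Suc n) e' ((\<lambda>i. r i * int s)(n := rr))"
    using t' eig' e1_eig by (auto simp: eigen_family_def e'_def less_Suc_eq)
  then show ?thesis by blast
qed

text \<open>An eigenfamily of maximal size must span, since it could be extended otherwise; sizes
  are bounded by the dimension. This is the classification in the form of an eigenbasis for a single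
  power of \<phi>.\<close>

theorem dieudonne_manin: "\<exists>t n e r. eigen_family t n e r \<and> span (e ` {..<n}) = UNIV"
proof -
  obtain m where m: "\<And>S. independent S \<Longrightarrow> finite S \<and> card S \<le> m" using independent_card_bound by blast
  define P where "P = (\<lambda>n. \<exists>t e r. eigen_family t n e r)"
  have "n \<le> m" if "P n" for n
    using that m by (fastforce simp: P_def eigen_family_def card_image)
  moreover have "P 0" unfolding P_def eigen_family_def by (intro exI[of _ 1]) (auto simp: independent_empty)
  ultimately obtain n where n: "P n" "\<And>n'. P n' \<Longrightarrow> n' \<le> n"
    using Greatest_le_nat[of P _ m] GreatestI_nat[of P 0 m] by metis
  then obtain t e r where ef: "eigen_family t n e r" by (auto simp: P_def)
  have "\<not> P (Suc n)" using n(2) by fastforce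
  then have "span (e ` {..<n}) = UNIV" using eigen_family_extend[OF ef] by (auto simp: P_def)
  then show ?thesis using ef by blast
qed

end

section \<open>Conjugation on the endomorphism ring\<close>

lemma nth_mult_lead:
  fixes x y :: "'k::field fls"
  assumes "ordge a x" "ordge b y"
  shows "fls_nth (x * y) (a + b) = fls_nth x a * fls_nth y b"
  by (simp add: fls_mult_nth_ordge[OF assms])

lemma ordge_Suc: "ordge (c + 1) x \<longleftrightarrow> ordge c x \<and> fls_nth x c = 0"
  unfolding ordge_def by (metis less_add_one order_less_trans zless_add1_eq)

locale crystal_basis = f_crystal scale q M \<phi> + B: fin_basis scale N b
  for scale :: "'k::alg_closed_field fls \<Rightarrow> 'v::ab_group_add \<Rightarrow> 'v" and q M \<phi> N b +
  assumes M_span: "Modules.module.span (int_scale scale) (b ` {..<N}) = M"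
begin

text \<open>This is \<epsilon>^c M for an arbitrary integer c, written as an order bound on the
  coordinates in the lattice basis.\<close>

definition Mc :: "int \<Rightarrow> 'v set" where
  "Mc c = {v. \<forall>i<N. ordge c (B.coord v i)}"

lemma module_int_scale: "Modules.module (int_scale scale)"
  by unfold_locales
    (simp_all add: int_scale_def scale_right_distrib scale_left_distrib fls_times_fps_to_fls)

lemma M_eq: "M = Mc 0"
proof -
  interpret m: Modules.module "int_scale scale" by (rule module_int_scale)
  have sub: "m.subspace (Mc 0)"
    unfolding m.subspace_def
  proof (intro conjI ballI allI)
    show "0 \<in> Mc 0" by (simp add: Mc_def)
    show "x + y \<in> Mc 0" if "x \<in> Mc 0" "y \<in> Mc 0" for x y
      using that by (auto simp: Mc_def B.coord_add intro: ordge_add)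
    show "int_scale scale c x \<in> Mc 0" if "x \<in> Mc 0" for c x
      using that ordge_mult[of 0 "fps_to_fls c" 0] by (auto simp: Mc_def int_scale_def B.coord_scale)
  qed
  have "b ` {..<N} \<subseteq> Mc 0" by (auto simp: Mc_def B.coord_basis)
  then have "M \<subseteq> Mc 0" using m.span_minimal[OF _ sub] M_span by blast
  moreover have "v \<in> M" if "v \<in> Mc 0" for v
  proof -
    have "\<forall>i. \<exists>f. i < N \<longrightarrow> B.coord v i = fps_to_fls f"
      using that ordge_0_fps by (auto simp: Mc_def)
    then obtain f where f: "\<And>i. i < N \<Longrightarrow> B.coord v i = fps_to_fls (f i)" by metis
    have "v = (\<Sum>i<N. int_scale scale (f i) (b i))"
      by (subst B.coord_expand) (simp add: int_scale_def f)
    also have "\<dots> \<in> m.span (b ` {..<N})"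
      by (intro m.span_sum m.span_scale m.span_base) auto
    finally show ?thesis using M_span by simp
  qed
  ultimately show ?thesis by blast
qed

lemma Mc_mono: "v \<in> Mc c \<Longrightarrow> d \<le> c \<Longrightarrow> v \<in> Mc d"
  by (auto simp: Mc_def intro: ordge_mono)

lemma Mc_0 [simp]: "0 \<in> Mc c"
  by (simp add: Mc_def)

lemma Mc_add: "v \<in> Mc c \<Longrightarrow> w \<in> Mc c \<Longrightarrow> v + w \<in> Mc c"
  by (auto simp: Mc_def B.coord_add intro: ordge_add)

lemma Mc_diff: "v \<in> Mc c \<Longrightarrow> w \<in> Mc c \<Longrightarrow> v - w \<in> Mc c"
  by (auto simp: Mc_def B.coord_diff intro: ordge_diff)

lemma Mc_sum: "(\<And>i. i \<in> A \<Longrightarrow> f i \<in> Mc c) \<Longrightarrow> sum f A \<in> Mc c"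
  by (induction A rule: infinite_finite_induct) (auto intro: Mc_add)

lemma Mc_scale: "ordge a x \<Longrightarrow> v \<in> Mc c \<Longrightarrow> scale x v \<in> Mc (a + c)"
  by (auto simp: Mc_def B.coord_scale intro: ordge_mult)

lemma finite_lower_bound: "finite S \<Longrightarrow> \<exists>c::int. \<forall>x\<in>S. c \<le> f x"
proof (induction S rule: finite_induct)
  case (insert x S)
  then obtain c where "\<forall>x\<in>S. c \<le> f x" by blast
  then show ?case by (intro exI[of _ "min c (f x)"]) auto
qed simp

lemma Mc_ex: "\<exists>c. v \<in> Mc c"
proof -
  have "\<forall>i. \<exists>c. ordge c (B.coord v i)" using ordge_ex by blast
  then obtain g where g: "\<And>i. ordge (g i) (B.coord v i)" by metis
  obtain c where "\<forall>i\<in>{..<N}. c \<le> g i" using finite_lower_bound[of "{..<N}" g] by blast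
  then have "v \<in> Mc c" unfolding Mc_def using ordge_mono[OF g] by auto
  then show ?thesis ..
qed

lemma Mc_Inter: "(\<And>k::nat. v \<in> Mc (c + int k)) \<Longrightarrow> v = 0"
proof (rule B.coord_eqI)
  fix i assume v: "\<And>k::nat. v \<in> Mc (c + int k)" and i: "i < N"
  have "ordge d (B.coord v i)" for d
  proof (rule ordge_mono)
    show "ordge (c + int (nat (d - c))) (B.coord v i)" using v[of "nat (d - c)"] i unfolding Mc_def by blast
  qed simp
  then have "B.coord v i = 0" by (rule ordge_all_imp_0)
  then show "B.coord v i = B.coord 0 i" by simp
qed

lemma EndV_iff: "f \<in> EndV \<longleftrightarrow> Vector_Spaces.linear scale scale f"
  by (simp add: EndV_def)

lemma EndV_iff2: "f \<in> EndV \<longleftrightarrow> (\<forall>v w. f (v + w) = f v + f w) \<and> (\<forall>c v. f (scale c v) = scale c (f v))"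
  unfolding EndV_iff Vector_Spaces.linear_iff using vector_space_axioms by blast

lemma EndV_id [simp]: "id \<in> EndV" and EndV_0 [simp]: "0 \<in> EndV"
  by (auto simp: EndV_iff2)

lemma EndV_add: "f \<in> EndV \<Longrightarrow> g \<in> EndV \<Longrightarrow> f + g \<in> EndV"
  and EndV_diff: "f \<in> EndV \<Longrightarrow> g \<in> EndV \<Longrightarrow> f - g \<in> EndV"
  by (auto simp: EndV_iff2 scale_right_distrib scale_right_diff_distrib algebra_simps)

lemma EndV_comp: "f \<in> EndV \<Longrightarrow> g \<in> EndV \<Longrightarrow> f \<circ> g \<in> EndV"
  by (auto simp: EndV_iff2)

lemma EndV_scale: "f \<in> EndV \<Longrightarrow> end_scale c f \<in> EndV"
  by (auto simp: EndV_iff2 end_scale_def scale_right_distrib mult.commute)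

lemma EndV_matmap: "B.matmap A \<in> EndV"
  using B.linear_matmap by (simp add: EndV_iff)

lemma EndV_app: "f \<in> EndV \<Longrightarrow> f (v + w) = f v + f w" "f \<in> EndV \<Longrightarrow> f (v - w) = f v - f w"
  "f \<in> EndV \<Longrightarrow> f (scale c v) = scale c (f v)" "f \<in> EndV \<Longrightarrow> f 0 = 0"
proof -
  assume f: "f \<in> EndV"
  interpret f: Vector_Spaces.linear scale scale f using f by (simp add: EndV_iff)
  show "f (v + w) = f v + f w" "f (v - w) = f v - f w" "f (scale c v) = scale c (f v)" "f 0 = 0"
    by (auto simp: f.add f.diff f.scale f.zero)
qed

lemma ent_add: "B.ent (f + g) i j = B.ent f i j + B.ent g i j"
  and ent_diff: "B.ent (f - g) i j = B.ent f i j - B.ent g i j"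
  and ent_0 [simp]: "B.ent 0 i j = 0"
  and ent_scale: "B.ent (end_scale c f) i j = c * B.ent f i j"
  by (simp_all add: B.ent_def B.coord_add B.coord_diff B.coord_scale end_scale_def)

lemma ent_comp: "f \<in> EndV \<Longrightarrow> B.ent (f \<circ> g) i j = (\<Sum>l<N. B.ent f i l * B.ent g l j)"
  by (rule B.ent_comp) (simp add: EndV_iff)

lemma EndV_eqI: "f \<in> EndV \<Longrightarrow> g \<in> EndV \<Longrightarrow> (\<And>i j. i < N \<Longrightarrow> j < N \<Longrightarrow> B.ent f i j = B.ent g i j) \<Longrightarrow> f = g"
  using B.linear_eqI by (simp add: EndV_iff)

text \<open>This is \<epsilon>^c End(M) for an arbitrary integer c, written as an order bound on
  matrix entries.\<close>

definition Hc :: "int \<Rightarrow> ('v \<Rightarrow> 'v) set" where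
  "Hc c = {f\<in>EndV. \<forall>i<N. \<forall>j<N. ordge c (B.ent f i j)}"

lemma HcD: "f \<in> Hc c \<Longrightarrow> f \<in> EndV" "f \<in> Hc c \<Longrightarrow> i < N \<Longrightarrow> j < N \<Longrightarrow> ordge c (B.ent f i j)"
  by (auto simp: Hc_def)

lemma Hc_mono: "f \<in> Hc c \<Longrightarrow> d \<le> c \<Longrightarrow> f \<in> Hc d"
  by (auto simp: Hc_def intro: ordge_mono)

lemma Hc_0 [simp]: "0 \<in> Hc c"
  by (simp add: Hc_def)

lemma Hc_id [simp]: "id \<in> Hc 0"
  by (simp add: Hc_def B.ent_id)

lemma Hc_add: "f \<in> Hc c \<Longrightarrow> g \<in> Hc c \<Longrightarrow> f + g \<in> Hc c"
  by (auto simp: Hc_def ent_add EndV_add intro: ordge_add)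

lemma Hc_diff: "f \<in> Hc c \<Longrightarrow> g \<in> Hc c \<Longrightarrow> f - g \<in> Hc c"
  by (auto simp: Hc_def ent_diff EndV_diff intro: ordge_diff)

lemma Hc_sum: "(\<And>i. i \<in> A \<Longrightarrow> f i \<in> Hc c) \<Longrightarrow> sum f A \<in> Hc c"
  by (induction A rule: infinite_finite_induct) (auto intro: Hc_add)

lemma Hc_scale: "ordge a x \<Longrightarrow> f \<in> Hc c \<Longrightarrow> end_scale x f \<in> Hc (a + c)"
  by (auto simp: Hc_def ent_scale EndV_scale intro: ordge_mult)

lemma Hc_comp: "f \<in> Hc a \<Longrightarrow> g \<in> Hc c \<Longrightarrow> f \<circ> g \<in> Hc (a + c)"
  by (auto simp: Hc_def ent_comp EndV_comp intro!: ordge_sum ordge_mult)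

lemma Hc_app: "f \<in> Hc a \<Longrightarrow> v \<in> Mc c \<Longrightarrow> f v \<in> Mc (a + c)"
  by (auto simp: Hc_def Mc_def EndV_iff B.linear_coord intro!: ordge_sum ordge_mult)

lemma EndM_eq: "EndM = Hc 0"
proof -
  have "f \<in> Hc 0" if "f \<in> EndV" "f ` M \<subseteq> M" for f
  proof -
    have "b j \<in> M" if "j < N" for j using that by (auto simp: M_eq Mc_def B.coord_basis)
    then have "f (b j) \<in> Mc 0" if "j < N" for j using that \<open>f ` M \<subseteq> M\<close> M_eq by blast
    then show ?thesis using that(1) by (auto simp: Hc_def Mc_def B.ent_def)
  qed
  moreover have "f ` M \<subseteq> M" if "f \<in> Hc 0" for f
  proof
    fix w assume "w \<in> f ` M"
    then obtain v where "v \<in> Mc 0" "w = f v" unfolding M_eq by blast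
    then show "w \<in> M" using Hc_app[OF that, of v 0] unfolding M_eq by simp
  qed
  ultimately show ?thesis unfolding EndM_def using HcD(1) by blast
qed

lemma scaled_EndM: "end_scale (fls_X ^ n) ` EndM = Hc (int n)"
proof
  show "end_scale (fls_X ^ n) ` EndM \<subseteq> Hc (int n)"
    using Hc_scale[of "int n" "fls_X ^ n" _ 0] by (auto simp: EndM_eq ordge_def)
  show "Hc (int n) \<subseteq> end_scale (fls_X ^ n) ` EndM"
  proof
    fix f assume f: "f \<in> Hc (int n)"
    have "end_scale (fls_X powi (- int n)) f \<in> Hc 0"
      using f by (simp add: Hc_def ent_scale EndV_scale ordge_X_powi_mult)
    moreover have "f = end_scale (fls_X ^ n) (end_scale (fls_X powi (- int n)) f)"
      by (rule ext) (simp add: end_scale_def power_int_minus)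
    ultimately show "f \<in> end_scale (fls_X ^ n) ` EndM" unfolding EndM_eq by blast
  qed
qed

section \<open>The inverse of \<phi> and conjugation by \<phi>\<close>

definition ips :: "'v \<Rightarrow> 'v" where "ips = inv_into UNIV \<phi>"

lemma ips [simp]: "\<phi> (ips v) = v" "ips (\<phi> v) = v"
  using \<phi>_bij by (simp_all add: ips_def bij_is_surj surj_f_inv_f bij_is_inj)

lemma ips_add: "ips (v + w) = ips v + ips w"
  by (metis ips \<phi>_add)

lemma ips_frob_scale: "ips (scale (frob c) v) = scale c (ips v)"
  by (metis ips \<phi>_scale)

lemma \<phi>_0: "\<phi> 0 = 0" using \<phi>_funpow_0[of 1] by simp

lemma \<phi>_sum: "\<phi> (sum f A) = (\<Sum>a\<in>A. \<phi> (f a))"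
  using \<phi>_funpow_sum[of 1] by simp

lemma ips_0: "ips 0 = 0" by (metis ips(2) \<phi>_0)

lemma ips_sum: "ips (sum f A) = (\<Sum>a\<in>A. ips (f a))"
  by (induction A rule: infinite_finite_induct) (auto simp: ips_add ips_0)

lemma phi_end_def': "phi_end f = \<phi> \<circ> f \<circ> ips"
  by (simp add: phi_end_def ips_def)

text \<open>Conjugation is bijective on all functions, not only on the linear ones, so the inverse
  occurring in \<open>O_neg\<close> is a genuine inverse.\<close>

lemma phi_end_bij: "bij phi_end"
proof (rule bij_betw_byWitness[where f' = "\<lambda>f. ips \<circ> f \<circ> \<phi>"])
qed (auto simp: phi_end_def' fun_eq_iff)

definition ipe :: "('v \<Rightarrow> 'v) \<Rightarrow> 'v \<Rightarrow> 'v" where "ipe = inv_into UNIV phi_end"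

lemma ipe [simp]: "phi_end (ipe f) = f" "ipe (phi_end f) = f"
  using phi_end_bij by (simp_all add: ipe_def bij_is_surj surj_f_inv_f bij_is_inj)

lemma ipe_eq: "ipe f = ips \<circ> f \<circ> \<phi>"
proof -
  have "phi_end (ips \<circ> f \<circ> \<phi>) = f" by (auto simp: phi_end_def' fun_eq_iff)
  then show ?thesis by (metis ipe(2))
qed

lemma phi_end_add: "phi_end (f + g) = phi_end f + phi_end g"
  by (auto simp: phi_end_def' fun_eq_iff \<phi>_add)

lemma phi_end_diff: "phi_end (f - g) = phi_end f - phi_end g"
  using phi_end_add[of "f - g" g] by simp

lemma phi_end_0: "phi_end 0 = 0"
  by (auto simp: phi_end_def' fun_eq_iff \<phi>_0)

lemma phi_end_sum: "phi_end (sum f A) = (\<Sum>a\<in>A. phi_end (f a))"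
proof (induction A rule: infinite_finite_induct)
  case (insert x F)
  then show ?case by (simp only: sum.insert phi_end_add simp_thms)
qed (simp_all only: sum.infinite sum.empty phi_end_0 simp_thms)

lemma phi_end_scale: "phi_end (end_scale c f) = end_scale (frob c) (phi_end f)"
  by (auto simp: phi_end_def' fun_eq_iff \<phi>_scale end_scale_def)

lemma phi_end_comp: "phi_end (f \<circ> g) = phi_end f \<circ> phi_end g"
  by (auto simp: phi_end_def' fun_eq_iff)

lemma phi_end_id: "phi_end id = id"
  by (auto simp: phi_end_def' fun_eq_iff)

text \<open>The Frobenius twist of \<phi> cancels the inverse twist of its inverse, so conjugates of
  linear maps are linear.\<close>

lemma EndV_phi_end: "f \<in> EndV \<Longrightarrow> phi_end f \<in> EndV"
proof -
  assume f: "f \<in> EndV"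
  have "phi_end f (scale c v) = scale c (phi_end f v)" for c v
  proof -
    obtain c' where "c = frob c'" using frob_surj by metis
    then show ?thesis using f by (simp add: phi_end_def' ips_frob_scale EndV_app \<phi>_scale)
  qed
  then show "phi_end f \<in> EndV" using f by (auto simp: EndV_iff2 phi_end_def' ips_add \<phi>_add)
qed

lemma EndV_ipe: "f \<in> EndV \<Longrightarrow> ipe f \<in> EndV"
  unfolding ipe_eq EndV_iff2 by (auto simp: \<phi>_add \<phi>_scale ips_add ips_frob_scale)

definition phm :: "nat \<Rightarrow> nat \<Rightarrow> 'k fls" where "phm i a = B.coord (\<phi> (b a)) i"
definition ipm :: "nat \<Rightarrow> nat \<Rightarrow> 'k fls" where "ipm l j = B.coord (ips (b j)) l"

lemma coord_\<phi>: "B.coord (\<phi> v) i = (\<Sum>a<N. frob (B.coord v a) * phm i a)"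
proof -
  have "\<phi> v = (\<Sum>a<N. scale (frob (B.coord v a)) (\<phi> (b a)))"
    by (subst B.coord_expand[of v]) (simp add: \<phi>_sum \<phi>_scale)
  then show ?thesis by (simp add: B.coord_sum B.coord_scale phm_def)
qed

text \<open>Being linear in the Frobenius twists of the entries of \<open>f\<close>, these entries
  are the source of the additive polynomial equations for \<open>g\<close>.\<close>

lemma ent_phi_end:
  assumes "f \<in> EndV"
  shows "B.ent (phi_end f) i j = (\<Sum>a<N. \<Sum>l<N. (phm i a * frob (ipm l j)) * frob (B.ent f a l))"
proof -
  have "B.ent (phi_end f) i j = (\<Sum>a<N. frob (B.coord (f (ips (b j))) a) * phm i a)"
    by (simp add: B.ent_def phi_end_def' coord_\<phi>)
  also have "\<dots> = (\<Sum>a<N. \<Sum>l<N. (phm i a * frob (ipm l j)) * frob (B.ent f a l))"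
    using assms by (simp add: EndV_iff B.linear_coord frob_sum frob_mult ipm_def sum_distrib_left sum_distrib_right mult_ac)
  finally show ?thesis .
qed

text \<open>\<phi> maps each \<epsilon>^d M into itself, so only its inverse, which occurs once in
  either conjugation, costs a power of \<epsilon>; finitely many basis vectors bound that
  cost.\<close>

lemma phi_end_bounded: "\<exists>c\<ge>0. \<forall>d f. f \<in> Hc d \<longrightarrow> phi_end f \<in> Hc (d - c) \<and> ipe f \<in> Hc (d - c)"
proof -
  have phm0: "ordge 0 (phm i a)" if "i < N" "a < N" for i a
  proof -
    have "b a \<in> M" using that by (auto simp: M_eq Mc_def B.coord_basis)
    then have "\<phi> (b a) \<in> Mc 0" using \<phi>_M M_eq by blast
    then show ?thesis using that by (auto simp: Mc_def phm_def)
  qed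
  have "\<forall>j. \<exists>c. ips (b j) \<in> Mc c" using Mc_ex by blast
  then obtain g where g: "\<And>j. ips (b j) \<in> Mc (g j)" by metis
  obtain c0 where c0: "\<forall>j\<in>{..<N}. c0 \<le> g j" using finite_lower_bound[of "{..<N}" g] by blast
  define c where "c = \<bar>c0\<bar>"
  have ipsb: "ips (b j) \<in> Mc (- c)" if "j < N" for j
  proof (rule Mc_mono[OF g])
    have "c0 \<le> g j" using c0 that by blast
    then show "- c \<le> g j" by (simp add: c_def)
  qed
  have \<phi>_Mc: "\<phi> v \<in> Mc d" if "v \<in> Mc d" for v d
    unfolding Mc_def mem_Collect_eq coord_\<phi>
  proof (intro allI impI ordge_sum)
    fix i a assume "i < N" "a \<in> {..<N}"
    then have "ordge d (frob (B.coord v a))" "ordge 0 (phm i a)" using that phm0 by (auto simp: Mc_def)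
    from ordge_mult[OF this] show "ordge d (frob (B.coord v a) * phm i a)" by simp
  qed
  have ips_Mc: "ips v \<in> Mc (d - c)" if v: "v \<in> Mc d" for v d
  proof -
    have "\<forall>i. \<exists>x. frob x = B.coord v i" using frob_surj by blast
    then obtain x where x: "\<And>i. frob (x i) = B.coord v i" by metis
    have "ips v = (\<Sum>i<N. scale (x i) (ips (b i)))"
      by (subst B.coord_expand[of v]) (simp add: ips_sum ips_frob_scale flip: x)
    also have "\<dots> \<in> Mc (d - c)"
    proof (rule Mc_sum)
      fix i assume i: "i \<in> {..<N}"
      have "ordge d (frob (x i))" using v i by (simp add: Mc_def x)
      then show "scale (x i) (ips (b i)) \<in> Mc (d - c)"
        using Mc_scale[of d "x i" "ips (b i)" "- c"] ipsb i by simp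
    qed
    finally show ?thesis .
  qed
  have ent: "f \<in> Hc e" if "f \<in> EndV" "\<And>j. j < N \<Longrightarrow> f (b j) \<in> Mc e" for f e
    using that by (auto simp: Hc_def Mc_def B.ent_def)
  have b0: "b j \<in> Mc 0" if "j < N" for j using that by (auto simp: Mc_def B.coord_basis)
  show ?thesis
  proof (intro exI[of _ c] conjI allI impI)
    show "c \<ge> 0" by (simp add: c_def)
    fix d f assume f: "f \<in> Hc d"
    show "phi_end f \<in> Hc (d - c)"
    proof (rule ent)
      show "phi_end f \<in> EndV" using f HcD EndV_phi_end by blast
      fix j assume "j < N"
      then show "phi_end f (b j) \<in> Mc (d - c)"
        using \<phi>_Mc[OF Hc_app[OF f ipsb]] by (simp add: phi_end_def')
    qed
    show "ipe f \<in> Hc (d - c)"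
    proof (rule ent)
      show "ipe f \<in> EndV" using f HcD EndV_ipe by blast
      fix j assume "j < N"
      then show "ipe f (b j) \<in> Mc (d - c)"
        using ips_Mc[OF Hc_app[OF f \<phi>_Mc[OF b0]]] by (simp add: ipe_eq)
    qed
  qed
qed

text \<open>\<open>u\<close> moves up the filtration by the \<epsilon>^c M. A kernel vector v = - u
  v thus lies in all of them, and in x = v - u x repeated substitution shows that x is integral if v
  is. Surjectivity on V follows from injectivity by dimension.\<close>

lemma one_plus_GLM:
  assumes u: "u \<in> Hc (int m)" "m \<ge> 1"
  shows "id + u \<in> GLM"
proof -
  let ?h = "id + u"
  have h: "?h \<in> EndV" using u HcD(1) by (intro EndV_add) auto
  have app: "?h v = v + u v" for v by simp
  interpret fd: finite_dimensional_vector_space scale "b ` {..<N}"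
    by unfold_locales (auto simp: B.b_indep B.b_span)
  have gain: "u v \<in> Mc (c + 1)" if "v \<in> Mc c" for v c
    by (rule Mc_mono[OF Hc_app[OF u(1) that]]) (use u(2) in simp)
  have "inj ?h"
  proof (rule injI)
    fix x y assume "?h x = ?h y"
    define v where "v = x - y"
    have "u v = u x - u y" unfolding v_def using u(1) HcD(1) by (intro EndV_app(2)) blast
    moreover have "u x = (y + u y) - x" using \<open>?h x = ?h y\<close> by (simp add: eq_diff_eq add.commute)
    ultimately have uv: "u v = - v" by (simp add: v_def)
    obtain c where c: "v \<in> Mc c" using Mc_ex by blast
    have "v \<in> Mc (c + int k)" for k
    proof (induction k)
      case (Suc k)
      then have "0 - u v \<in> Mc (c + int k + 1)" by (intro Mc_diff gain) auto
      then show ?case using uv by (simp add: algebra_simps)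
    qed (use c in simp)
    then have "v = 0" by (rule Mc_Inter)
    then show "x = y" by (simp add: v_def)
  qed
  moreover then have "surj ?h"
    using fd.linear_inj_imp_surj[of ?h] h by (simp add: EndV_iff)
  moreover have "?h ` M = M"
  proof
    show "?h ` M \<subseteq> M"
      using Mc_add gain[of _ 0] Mc_mono[of _ 1 0] by (auto simp: M_eq)
    show "M \<subseteq> ?h ` M"
    proof
      fix v assume v: "v \<in> M"
      obtain x where x: "v = x + u x" using \<open>surj ?h\<close> app by (metis surjD)
      obtain c where c: "x \<in> Mc c" using Mc_ex by blast
      have "x \<in> Mc (min 0 (c + int k))" for k
      proof (induction k)
        case 0
        then show ?case using c Mc_mono by fastforce
      next
        case (Suc k)
        have "u x \<in> Mc (min 0 (c + int (Suc k)))" using gain[OF Suc] by (rule Mc_mono) auto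
        moreover have "v \<in> Mc (min 0 (c + int (Suc k)))" using v Mc_mono[of v 0] by (simp add: M_eq)
        ultimately have "v - u x \<in> Mc (min 0 (c + int (Suc k)))" by (intro Mc_diff)
        then show ?case using x by simp
      qed
      from this[of "nat (- c)"] have "x \<in> Mc 0" by (rule Mc_mono) simp
      then show "v \<in> ?h ` M" using x by (auto simp: M_eq image_iff intro!: bexI[of _ x])
    qed
  qed
  ultimately show ?thesis using h by (simp add: GLM_def bij_def)
qed

section \<open>From isomorphisms to solving \<Phi> g - g = f\<close>

definition surj_at :: "int \<Rightarrow> bool" where
  "surj_at m \<longleftrightarrow> (\<forall>f\<in>Hc m. \<exists>g\<in>Hc 0. phi_end g - g = f)"

definition iso_at :: "nat \<Rightarrow> bool" where
  "iso_at n \<longleftrightarrow> (\<forall>h\<in>GLM. cong_one n h \<longrightarrow> (\<exists>g\<in>GLM. h \<circ> \<phi> = inv_into UNIV g \<circ> \<phi> \<circ> g))"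

lemma GLM_Hc: "g \<in> GLM \<Longrightarrow> g \<in> Hc 0"
  by (auto simp: GLM_def EndM_def simp flip: EndM_eq)

lemma GLM_inv: "g \<in> GLM \<Longrightarrow> inv_into UNIV g \<in> Hc 0"
proof -
  assume g: "g \<in> GLM"
  then have bij: "bij g" "g \<in> EndV" "g ` M = M" by (auto simp: GLM_def)
  have gi: "g ((inv_into UNIV g) v) = v" "inv_into UNIV g (g v) = v" for v
    using bij by (simp_all add: bij_is_surj surj_f_inv_f bij_is_inj)
  have "inv_into UNIV g \<in> EndV"
    unfolding EndV_iff2 by (metis EndV_app(1,3) bij(2) gi)
  moreover have "inv_into UNIV g ` M \<subseteq> M" using bij(3) gi by (metis image_inv_f_f bij(1) bij_is_inj subset_refl)
  ultimately show ?thesis by (auto simp: EndM_def simp flip: EndM_eq)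
qed

text \<open>Composing h \<phi> = \<open>g\<^sup>-\<^sup>1\<close> \<phi> g with g on the left and
  the inverse of \<phi> on the right gives \<Phi> g = g h, where h = 1 + u.\<close>

lemma iso_at_phi_end:
  assumes "iso_at n" "n \<le> m" "m \<ge> 1" "u \<in> Hc (int m)"
  shows "\<exists>g\<in>GLM. phi_end g - g = g \<circ> u"
proof -
  have "cong_one n (id + u)"
    unfolding cong_one_def scaled_EndM using Hc_mono[OF assms(4)] assms(2) by simp
  then obtain g where g: "g \<in> GLM" "(id + u) \<circ> \<phi> = inv_into UNIV g \<circ> \<phi> \<circ> g"
    using assms(1) one_plus_GLM[OF assms(4,3)] unfolding iso_at_def by blast
  have bij: "bij g" using g by (simp add: GLM_def)
  have gE: "g \<in> EndV" using g by (simp add: GLM_def)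
  have "phi_end g v = g v + g (u v)" for v
  proof -
    have "inv_into UNIV g (\<phi> (g (ips v))) = \<phi> (ips v) + u (\<phi> (ips v))"
      using fun_cong[OF g(2), of "ips v"] by simp
    then have "g (inv_into UNIV g (\<phi> (g (ips v)))) = g (v + u v)" by simp
    then show ?thesis using bij gE
      by (simp add: bij_is_surj surj_f_inv_f phi_end_def' EndV_app)
  qed
  then show ?thesis using g(1) by (intro bexI[of _ g]) (auto simp: fun_eq_iff)
qed

text \<open>The pairs \<open>(g mod \<epsilon>, (phi_end g - g) / \<epsilon>\<^sup>m mod \<epsilon>)\<close> are cut out by additive equations: the
  coordinate \<open>(Suc t, i, j)\<close> stands for the coefficient of \<open>\<epsilon>\<^sup>t\<close> in the matrix entry \<open>(i, j)\<close> of \<open>g\<close>,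
  the coordinate \<open>(0, i, j)\<close> for an entry of the second component, and all coordinates with \<open>t > 0\<close>
  are eliminated.\<close>

lemma phi_end_correspondence_qzeros:
  fixes m :: nat
  defines "A \<equiv> {1::nat} \<times> {..<N} \<times> {..<N}" and "B \<equiv> {0::nat} \<times> {..<N} \<times> {..<N}"
  shows "\<exists>es. (\<forall>c\<in>set es. \<forall>i. i \<notin> A \<union> B \<longrightarrow> c i = 0) \<and>
     (\<forall>z. z \<in> qzeros (A \<union> B) es \<longleftrightarrow> (\<exists>g\<in>Hc 0. phi_end g - g \<in> Hc (int m) \<and>
        (\<forall>i<N. \<forall>j<N. z (1, i, j) = fls_nth (B.ent g i j) 0 \<and>
                       z (0, i, j) = fls_nth (B.ent (phi_end g - g) i j) (int m))))"
proof -
  define K where "K = (\<lambda>i j a l. phm i a * frob (ipm l j))"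
  have "\<exists>R0::nat. \<forall>i<N. \<forall>j<N. \<forall>a<N. \<forall>l<N. ordge (- int R0) (K i j a l)"
  proof -
    have "\<forall>x. \<exists>c. ordge c (case x of (i, j, a, l) \<Rightarrow> K i j a l)" using ordge_ex by blast
    then obtain g where g: "\<And>x. ordge (g x) (case x of (i, j, a, l) \<Rightarrow> K i j a l)" by metis
    obtain c where c: "\<forall>x\<in>{..<N} \<times> {..<N} \<times> {..<N} \<times> {..<N}. c \<le> g x"
      using finite_lower_bound[of "{..<N} \<times> {..<N} \<times> {..<N} \<times> {..<N}" g] by blast
    have "ordge (- int (nat (- c))) (K i j a l)" if "i < N" "j < N" "a < N" "l < N" for i j a l
    proof -
      have "- int (nat (- c)) \<le> g (i, j, a, l)" using c that by fastforce
      then show ?thesis using g[of "(i, j, a, l)"] ordge_mono by auto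
    qed
    then show ?thesis by blast
  qed
  then obtain R0 where R0: "\<And>i j a l. i < N \<Longrightarrow> j < N \<Longrightarrow> a < N \<Longrightarrow> l < N \<Longrightarrow> ordge (- int R0) (K i j a l)"
    by blast
  \<comment> \<open>\<open>R0\<close> bounds the poles of the coefficients \<open>K\<close>, so
    coefficients of \<open>g\<close> of index \<open>R\<close> or more cannot influence those of
    \<open>phi_end g - g\<close> up to index \<open>m\<close>: finitely many unknowns
    suffice.\<close>
  define R where "R = m + 1 + R0"
  define If where "If = {..R} \<times> {..<N} \<times> {..<N}"
  have finIf: "finite If" by (simp add: If_def)
  \<comment> \<open>For n \<le> m, equation (i, j, n) says that the coefficient of \<epsilon>^n in
    entry (i, j) of \<open>phi_end g - g\<close> is 0 if n < m and \<open>z (0, i, j)\<close> if n =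
    m.\<close>
  define ceq :: "nat \<times> nat \<times> int \<Rightarrow> nat \<times> nat \<times> nat \<Rightarrow> 'k poly" where
    "ceq = (\<lambda>(i, j, n) (t, a, l).
       if (t, a, l) \<notin> If then 0
       else if t = 0 then (if a = i \<and> l = j \<and> n = int m then monom (- 1) 0 else 0)
       else monom (fls_nth (K i j a l) (n - int (t - 1))) 1 -
            (if a = i \<and> l = j \<and> n = int (t - 1) then monom 1 0 else 0))"
  have qev_m0: "qev q (monom x 0) y = x * y" and qev_m1: "qev q (monom x 1) y = x * y ^ q" for x y :: 'k
  proof -
    show "qev q (monom x 0) y = x * y" by (simp add: qev_def monom_0)
    show "qev q (monom x 1) y = x * y ^ q"
      by (subst qev_sum_upto[of _ 1]) (auto simp: degree_monom_le[of x 1, simplified])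
  qed
  have qev_1: "qev q 1 y = y" for y :: 'k by (simp add: qev_def)
  have If_split: "If = B \<union> (\<lambda>(t, a, l). (Suc t, a, l)) ` ({..<R} \<times> {..<N} \<times> {..<N})"
    unfolding If_def B_def
  proof (intro Set.equalityI subsetI)
    fix x assume "x \<in> {..R} \<times> {..<N} \<times> {..<N}"
    then obtain t a l where x: "x = (t, a, l)" "t \<le> R" "a < N" "l < N" by auto
    show "x \<in> {0} \<times> {..<N} \<times> {..<N} \<union> (\<lambda>(t, a, l). (Suc t, a, l)) ` ({..<R} \<times> {..<N} \<times> {..<N})"
      using x by (cases t) (auto intro!: image_eqI[of _ _ "(t - 1, a, l)"])
  qed auto
  define gz :: "(nat \<times> nat \<times> nat \<Rightarrow> 'k) \<Rightarrow> nat \<Rightarrow> nat \<Rightarrow> 'k fls" where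
    "gz = (\<lambda>z i j. \<Sum>t<R. fls_const (z (Suc t, i, j)) * fls_X ^ t)"
  have gz_nth: "fls_nth (gz z i j) n = (if 0 \<le> n \<and> n < int R then z (Suc (nat n), i, j) else 0)" for z i j n
  proof -
    have "fls_nth (gz z i j) n = (\<Sum>t<R. if n = int t then z (Suc t, i, j) else 0)"
      by (auto simp: gz_def fls_nth_sum intro!: sum.cong)
    also have "\<dots> = (if 0 \<le> n \<and> n < int R then z (Suc (nat n), i, j) else 0)"
    proof (cases "0 \<le> n \<and> n < int R")
      case True
      then have "n = int (nat n)" "nat n < R" by auto
      then have "(\<Sum>t<R. if n = int t then z (Suc t, i, j) else 0) = (\<Sum>t<R. if t = nat n then z (Suc t, i, j) else 0)"
        by (intro sum.cong refl) auto
      also have "\<dots> = z (Suc (nat n), i, j)" using \<open>nat n < R\<close> by simp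
      finally show ?thesis using True by simp
    qed (auto intro!: sum.neutral)
    finally show ?thesis .
  qed
  have key: "qmap If (ceq (i, j, n)) z =
      fls_nth (B.ent (phi_end g - g) i j) n - (if n = int m then z (0, i, j) else 0)"
    if ij: "i < N" "j < N" and n: "n \<le> int m" and g: "g \<in> Hc 0"
      and z: "\<And>t a l. t < R \<Longrightarrow> a < N \<Longrightarrow> l < N \<Longrightarrow> z (Suc t, a, l) = fls_nth (B.ent g a l) (int t)"
    for i j n z g
  proof -
    have gE: "g \<in> EndV" using g HcD(1) by blast
    have "qmap If (ceq (i, j, n)) z = (\<Sum>x\<in>B. qev q (ceq (i, j, n) x) (z x)) +
        (\<Sum>(t, a, l)\<in>{..<R} \<times> {..<N} \<times> {..<N}. qev q (ceq (i, j, n) (Suc t, a, l)) (z (Suc t, a, l)))"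
    proof -
      have inj: "inj_on (\<lambda>(t::nat, a::nat, l::nat). (Suc t, a, l)) ({..<R} \<times> {..<N} \<times> {..<N})"
        by (auto simp: inj_on_def)
      define h where "h = (\<lambda>x. qev q (ceq (i, j, n) x) (z x))"
      define S where "S = (\<lambda>(t::nat, a::nat, l::nat). (Suc t, a, l)) ` ({..<R} \<times> {..<N} \<times> {..<N})"
      have "B \<inter> S = {}" "finite B" "finite S" by (auto simp: B_def S_def)
      then have "sum h (B \<union> S) = sum h B + sum h S" by (intro sum.union_disjoint)
      moreover have "sum h S = (\<Sum>(t, a, l)\<in>{..<R} \<times> {..<N} \<times> {..<N}. h (Suc t, a, l))"
        unfolding S_def sum.reindex[OF inj] by (rule sum.cong) auto
      ultimately show ?thesis
        unfolding qmap_def If_split S_def[symmetric] h_def[symmetric] by (simp only: h_def)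
    qed
    also have "(\<Sum>x\<in>B. qev q (ceq (i, j, n) x) (z x)) = - (if n = int m then z (0, i, j) else 0)"
    proof -
      have "(\<Sum>x\<in>B. qev q (ceq (i, j, n) x) (z x)) = (\<Sum>x\<in>{(0, i, j)}. qev q (ceq (i, j, n) x) (z x))"
        by (rule sum.mono_neutral_right) (use ij in \<open>auto simp: B_def ceq_def If_def split: if_splits\<close>)
      also have "\<dots> = - (if n = int m then z (0, i, j) else 0)"
        using ij by (simp add: ceq_def If_def qev_m0)
      finally show ?thesis .
    qed
    also have "(\<Sum>(t, a, l)\<in>{..<R} \<times> {..<N} \<times> {..<N}. qev q (ceq (i, j, n) (Suc t, a, l)) (z (Suc t, a, l)))
      = (\<Sum>(t, a, l)\<in>{..<R} \<times> {..<N} \<times> {..<N}. fls_nth (K i j a l) (n - int t) * fls_nth (B.ent g a l) (int t) ^ q)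
       - (\<Sum>(t, a, l)\<in>{..<R} \<times> {..<N} \<times> {..<N}. if a = i \<and> l = j \<and> n = int t then fls_nth (B.ent g a l) (int t) else 0)"
      unfolding sum_subtractf[symmetric]
      by (rule sum.cong) (auto simp: ceq_def If_def qev_diff qev_1 qev_m1[unfolded One_nat_def] z)
    also have "(\<Sum>(t, a, l)\<in>{..<R} \<times> {..<N} \<times> {..<N}. if a = i \<and> l = j \<and> n = int t then fls_nth (B.ent g a l) (int t) else 0)
      = fls_nth (B.ent g i j) n"
    proof (cases "0 \<le> n")
      case True
      then have nn: "n = int (nat n)" "nat n < R" using n by (auto simp: R_def)
      have "(\<Sum>(t, a, l)\<in>{..<R} \<times> {..<N} \<times> {..<N}. if a = i \<and> l = j \<and> n = int t then fls_nth (B.ent g a l) (int t) else 0)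
        = (\<Sum>(t, a, l)\<in>{(nat n, i, j)}. if a = i \<and> l = j \<and> n = int t then fls_nth (B.ent g a l) (int t) else 0)"
        by (rule sum.mono_neutral_right) (use ij nn in \<open>auto split: if_splits\<close>)
      then show ?thesis using True by simp
    next
      case False
      have "ordge 0 (B.ent g i j)" using g ij HcD(2) by blast
      then have "fls_nth (B.ent g i j) n = 0" using False by (simp add: ordgeD)
      moreover have "(\<Sum>(t, a, l)\<in>{..<R} \<times> {..<N} \<times> {..<N}. if a = i \<and> l = j \<and> n = int t then fls_nth (B.ent g a l) (int t) else 0) = 0"
        by (rule sum.neutral) (use False in auto)
      ultimately show ?thesis by simp
    qed
    also have "(\<Sum>(t, a, l)\<in>{..<R} \<times> {..<N} \<times> {..<N}. fls_nth (K i j a l) (n - int t) * fls_nth (B.ent g a l) (int t) ^ q)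
      = fls_nth (B.ent (phi_end g) i j) n"
    proof -
      have one: "fls_nth (K i j a l * frob (B.ent g a l)) n =
          (\<Sum>t<R. fls_nth (K i j a l) (n - int t) * fls_nth (B.ent g a l) (int t) ^ q)"
        if al: "a < N" "l < N" for a l
      proof -
        have o: "ordge 0 (frob (B.ent g a l))" using g al HcD(2) by simp
        have "fls_nth (K i j a l * frob (B.ent g a l)) n = fls_nth (frob (B.ent g a l) * K i j a l) n"
          by (simp add: mult.commute)
        also have "\<dots> = (\<Sum>t\<in>{0..n - (- int R0)}. fls_nth (frob (B.ent g a l)) t * fls_nth (K i j a l) (n - t))"
          by (rule fls_mult_nth_ordge[OF o R0[OF ij al]])
        also have "\<dots> = (\<Sum>t\<in>int ` {..<R}. fls_nth (frob (B.ent g a l)) t * fls_nth (K i j a l) (n - t))"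
        proof (rule sum.mono_neutral_left)
          show "{0..n - (- int R0)} \<subseteq> int ` {..<R}"
          proof
            fix t assume "t \<in> {0..n - (- int R0)}"
            then have "t = int (nat t)" "nat t < R" using n by (auto simp: R_def)
            then show "t \<in> int ` {..<R}" by blast
          qed
          show "\<forall>t\<in>int ` {..<R} - {0..n - (- int R0)}. fls_nth (frob (B.ent g a l)) t * fls_nth (K i j a l) (n - t) = 0"
          proof
            fix t assume "t \<in> int ` {..<R} - {0..n - (- int R0)}"
            then have "n - t < - int R0" by auto
            then show "fls_nth (frob (B.ent g a l)) t * fls_nth (K i j a l) (n - t) = 0"
              using ordgeD[OF R0[OF ij al]] by simp
          qed
        qed simp
        also have "\<dots> = (\<Sum>t<R. fls_nth (K i j a l) (n - int t) * fls_nth (B.ent g a l) (int t) ^ q)"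
          by (simp add: sum.reindex mult.commute)
        finally show ?thesis .
      qed
      have "fls_nth (B.ent (phi_end g) i j) n = (\<Sum>a<N. \<Sum>l<N. fls_nth (K i j a l * frob (B.ent g a l)) n)"
        by (simp add: ent_phi_end[OF gE] K_def fls_nth_sum)
      also have "\<dots> = (\<Sum>a<N. \<Sum>l<N. \<Sum>t<R. fls_nth (K i j a l) (n - int t) * fls_nth (B.ent g a l) (int t) ^ q)"
        by (intro sum.cong refl one) auto
      also have "\<dots> = (\<Sum>a<N. \<Sum>t<R. \<Sum>l<N. fls_nth (K i j a l) (n - int t) * fls_nth (B.ent g a l) (int t) ^ q)"
        by (intro sum.cong refl sum.swap)
      also have "\<dots> = (\<Sum>t<R. \<Sum>a<N. \<Sum>l<N. fls_nth (K i j a l) (n - int t) * fls_nth (B.ent g a l) (int t) ^ q)"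
        by (rule sum.swap)
      finally show ?thesis by (simp add: sum.cartesian_product)
    qed
    finally show ?thesis by (simp add: ent_diff)
  qed
  \<comment> \<open>Below index -R0 all coefficients vanish by themselves, so finitely many
    equations suffice too.\<close>
  have "finite ({..<N} \<times> {..<N} \<times> {- int R0..int m})" by simp
  then obtain ixs where ixs: "set ixs = {..<N} \<times> {..<N} \<times> {- int R0..int m}" using finite_list by blast
  define esf where "esf = map ceq ixs"
  have full: "z \<in> qzeros If esf \<longleftrightarrow> phi_end g - g \<in> Hc (int m) \<and>
      (\<forall>i<N. \<forall>j<N. z (0, i, j) = fls_nth (B.ent (phi_end g - g) i j) (int m))"
    if g: "g \<in> Hc 0"
      and z: "\<And>t a l. t < R \<Longrightarrow> a < N \<Longrightarrow> l < N \<Longrightarrow> z (Suc t, a, l) = fls_nth (B.ent g a l) (int t)"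
    for z g
  proof -
    have gE: "phi_end g - g \<in> EndV" using g HcD(1) by (intro EndV_diff EndV_phi_end) auto
    have low: "fls_nth (B.ent (phi_end g - g) i j) n = 0" if "i < N" "j < N" "n < - int R0" for i j n
    proof -
      have "ordge (- int R0 + 0) (B.ent (phi_end g) i j)"
        using that HcD[OF g] R0 unfolding ent_phi_end[OF HcD(1)[OF g]] K_def[symmetric]
        by (intro ordge_sum ordge_mult) (auto simp: K_def)
      moreover have "ordge (- int R0) (B.ent g i j)" using HcD(2)[OF g, of i j] that by (auto intro: ordge_mono)
      ultimately show ?thesis using that(3) by (simp add: ent_diff ordgeD)
    qed
    have "z \<in> qzeros If esf \<longleftrightarrow> (\<forall>i<N. \<forall>j<N. \<forall>n\<in>{- int R0..int m}.
        fls_nth (B.ent (phi_end g - g) i j) n - (if n = int m then z (0, i, j) else 0) = 0)"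
    proof -
      have "z \<in> qzeros If esf \<longleftrightarrow> (\<forall>x\<in>{..<N} \<times> {..<N} \<times> {- int R0..int m}. qmap If (ceq x) z = 0)"
        by (simp add: qzeros_def esf_def ixs)
      also have "\<dots> \<longleftrightarrow> (\<forall>i<N. \<forall>j<N. \<forall>n\<in>{- int R0..int m}. qmap If (ceq (i, j, n)) z = 0)" by auto
      also have "\<dots> \<longleftrightarrow> (\<forall>i<N. \<forall>j<N. \<forall>n\<in>{- int R0..int m}.
        fls_nth (B.ent (phi_end g - g) i j) n - (if n = int m then z (0, i, j) else 0) = 0)"
        using key[OF _ _ _ g z] by simp
      finally show ?thesis .
    qed
    also have "\<dots> \<longleftrightarrow> phi_end g - g \<in> Hc (int m) \<and>
      (\<forall>i<N. \<forall>j<N. z (0, i, j) = fls_nth (B.ent (phi_end g - g) i j) (int m))"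
    proof
      assume h: "\<forall>i<N. \<forall>j<N. \<forall>n\<in>{- int R0..int m}.
        fls_nth (B.ent (phi_end g - g) i j) n - (if n = int m then z (0, i, j) else 0) = 0"
      have "fls_nth (B.ent (phi_end g - g) i j) n = 0" if "i < N" "j < N" "n < int m" for i j n
      proof (cases "n < - int R0")
        case False
        then have "n \<in> {- int R0..int m}" using that by simp
        then have "fls_nth (B.ent (phi_end g - g) i j) n - (if n = int m then z (0, i, j) else 0) = 0"
          using h that(1,2) by blast
        then show ?thesis using that by simp
      qed (use low that in auto)
      moreover have "z (0, i, j) = fls_nth (B.ent (phi_end g - g) i j) (int m)" if "i < N" "j < N" for i j
      proof -
        have "int m \<in> {- int R0..int m}" by simp
        then have "fls_nth (B.ent (phi_end g - g) i j) (int m) - (if int m = int m then z (0, i, j) else 0) = 0"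
          using h that by blast
        then show ?thesis by simp
      qed
      ultimately show "phi_end g - g \<in> Hc (int m) \<and>
        (\<forall>i<N. \<forall>j<N. z (0, i, j) = fls_nth (B.ent (phi_end g - g) i j) (int m))"
        using gE by (simp add: Hc_def ordge_def)
    qed (auto simp: Hc_def ordge_def)
    finally show ?thesis .
  qed
  \<comment> \<open>The coefficients of \<epsilon>^1 up to \<epsilon>^(R - 1); index 1, the
    reduction of \<open>g\<close>, is kept.\<close>
  define J where "J = {2..R} \<times> {..<N} \<times> {..<N}"
  have IfJ: "If - J = A \<union> B" "J \<subseteq> If" "A \<union> B \<subseteq> If" by (auto simp: If_def J_def A_def B_def R_def)
  obtain es where es: "\<forall>c\<in>set es. \<forall>j\<in>J. c j = 0"
    "\<And>i. (\<forall>c\<in>set esf. c i = 0) \<longrightarrow> (\<forall>c\<in>set es. c i = 0)"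
    "\<And>z. (\<exists>z'. (\<forall>i. i \<notin> J \<longrightarrow> z' i = z i) \<and> z' \<in> qzeros If esf) \<longleftrightarrow> z \<in> qzeros If es"
    using eliminate_coordinates[OF finIf IfJ(2), of esf] by blast
  have outside: "c i = 0" if "c \<in> set es" "i \<notin> A \<union> B" for c i
  proof (cases "i \<in> J")
    case True
    then show ?thesis using es(1) that by blast
  next
    case False
    then have "i \<notin> If" using that IfJ(1) by blast
    then have "\<forall>c\<in>set esf. c i = 0" by (cases i) (auto simp: esf_def ceq_def)
    then show ?thesis using es(2) that(1) by blast
  qed
  have "qmap If c z = qmap (A \<union> B) c z" if "c \<in> set es" for c z
    using outside[OF that] by (intro qmap_mono_neutral[OF finIf IfJ(3)]) auto
  then have same: "qzeros (A \<union> B) es = qzeros If es" by (simp add: qzeros_def)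
  have main: "z \<in> qzeros If es \<longleftrightarrow> (\<exists>g\<in>Hc 0. phi_end g - g \<in> Hc (int m) \<and>
        (\<forall>i<N. \<forall>j<N. z (1, i, j) = fls_nth (B.ent g i j) 0 \<and>
                       z (0, i, j) = fls_nth (B.ent (phi_end g - g) i j) (int m)))" for z
  proof
    assume "z \<in> qzeros If es"
    then obtain z' where z': "\<forall>i. i \<notin> J \<longrightarrow> z' i = z i" "z' \<in> qzeros If esf" using es(3) by blast
    define g where "g = B.matmap (gz z')"
    have ent_g: "B.ent g i j = gz z' i j" if "i < N" "j < N" for i j
      using that by (simp add: g_def B.ent_matmap)
    have g: "g \<in> Hc 0" using ent_g EndV_matmap by (auto simp: Hc_def ordge_def gz_nth g_def)
    have z'g: "z' (Suc t, a, l) = fls_nth (B.ent g a l) (int t)" if "t < R" "a < N" "l < N" for t a l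
      using that by (simp add: ent_g gz_nth)
    from full[OF g z'g] z'(2) have f: "phi_end g - g \<in> Hc (int m)"
      "\<forall>i<N. \<forall>j<N. z' (0, i, j) = fls_nth (B.ent (phi_end g - g) i j) (int m)" by auto
    have "z (0, i, j) = z' (0, i, j)" "z (1, i, j) = fls_nth (B.ent g i j) 0" if "i < N" "j < N" for i j
    proof -
      show "z (0, i, j) = z' (0, i, j)" using z'(1) by (simp add: J_def)
      have "z (1, i, j) = z' (Suc 0, i, j)" using z'(1) by (simp add: J_def)
      then show "z (1, i, j) = fls_nth (B.ent g i j) 0" using z'g[of 0 i j] that by (simp add: R_def)
    qed
    then show "\<exists>g\<in>Hc 0. phi_end g - g \<in> Hc (int m) \<and>
        (\<forall>i<N. \<forall>j<N. z (1, i, j) = fls_nth (B.ent g i j) 0 \<and>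
                       z (0, i, j) = fls_nth (B.ent (phi_end g - g) i j) (int m))"
      using f g by auto
  next
    assume "\<exists>g\<in>Hc 0. phi_end g - g \<in> Hc (int m) \<and>
        (\<forall>i<N. \<forall>j<N. z (1, i, j) = fls_nth (B.ent g i j) 0 \<and>
                       z (0, i, j) = fls_nth (B.ent (phi_end g - g) i j) (int m))"
    then obtain g where g: "g \<in> Hc 0" "phi_end g - g \<in> Hc (int m)"
      "\<And>i j. i < N \<Longrightarrow> j < N \<Longrightarrow> z (1, i, j) = fls_nth (B.ent g i j) 0"
      "\<And>i j. i < N \<Longrightarrow> j < N \<Longrightarrow> z (0, i, j) = fls_nth (B.ent (phi_end g - g) i j) (int m)" by blast
    define z' where "z' = (\<lambda>(t, a, l). if (t, a, l) \<in> J then fls_nth (B.ent g a l) (int (t - 1)) else z (t, a, l))"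
    have "z' (Suc t, a, l) = fls_nth (B.ent g a l) (int t)" if "t < R" "a < N" "l < N" for t a l
      using that g(3)[of a l] by (cases t) (auto simp: z'_def J_def)
    moreover have "z' (0, i, j) = z (0, i, j)" for i j by (simp add: z'_def J_def)
    ultimately have "z' \<in> qzeros If esf" using full[OF g(1), of z'] g(2,4) by simp
    moreover have "\<forall>i. i \<notin> J \<longrightarrow> z' i = z i" by (auto simp: z'_def)
    ultimately show "z \<in> qzeros If es" using es(3) by blast
  qed
  show ?thesis using outside main same by (intro exI[of _ es]) auto
qed

text \<open>\<open>twisted_surj_imp_surj\<close> allows any leading matrix to be attained; the error
  then lies in \<epsilon>^(m + 1) H and is removed by \<open>next_surj\<close>. The isomorphism
  condition supplies the twisted solutions, for h = 1 + \<epsilon>^m f with constant f.\<close>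

lemma surj_at_step:
  assumes iso: "iso_at n" "n \<le> m" "m \<ge> 1" and next_surj: "surj_at (int m + 1)"
  shows "surj_at (int m)"
proof -
  let ?A = "{1::nat} \<times> {..<N} \<times> {..<N}" and ?B = "{0::nat} \<times> {..<N} \<times> {..<N}"
  obtain es where es0: "\<forall>c\<in>set es. \<forall>i. i \<notin> ?A \<union> ?B \<longrightarrow> c i = 0"
    and G0: "\<forall>z. z \<in> qzeros (?A \<union> ?B) es \<longleftrightarrow> (\<exists>g\<in>Hc 0. phi_end g - g \<in> Hc (int m) \<and>
        (\<forall>i<N. \<forall>j<N. z (1, i, j) = fls_nth (B.ent g i j) 0 \<and>
                       z (0, i, j) = fls_nth (B.ent (phi_end g - g) i j) (int m)))"
    by (rule exE[OF phi_end_correspondence_qzeros[of m]]) (elim conjE, rule that)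
  note G = spec[OF G0]
  have es: "c i = 0" if "c \<in> set es" "i \<notin> ?A \<union> ?B" for c i using es0 that by blast
  define pt where "pt = (\<lambda>g. (\<lambda>(t::nat, i, j). if t = 1 then fls_nth (B.ent g i j) 0
      else fls_nth (B.ent (phi_end g - g) i j) (int m)))"
  have pt: "pt g \<in> qzeros (?A \<union> ?B) es" if "g \<in> Hc 0" "phi_end g - g \<in> Hc (int m)" for g
    unfolding G using that by (intro bexI[of _ g]) (auto simp: pt_def)
  have pt_g: "gmat N (pt g) = mat N N (\<lambda>(i, j). fls_nth (B.ent g i j) 0)"
    and pt_w: "wmat N (pt g) = mat N N (\<lambda>(i, j). fls_nth (B.ent (phi_end g - g) i j) (int m))" for g
    by (simp_all add: gmat_def wmat_def pt_def)
  have G': "\<exists>g\<in>Hc 0. phi_end g - g \<in> Hc (int m) \<and> gmat N z = gmat N (pt g) \<and> wmat N z = wmat N (pt g)"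
    if zz: "z \<in> qzeros (?A \<union> ?B) es" for z
  proof -
    obtain g where g: "g \<in> Hc 0" "phi_end g - g \<in> Hc (int m)"
      "\<forall>i<N. \<forall>j<N. z (1, i, j) = fls_nth (B.ent g i j) 0 \<and> z (0, i, j) = fls_nth (B.ent (phi_end g - g) i j) (int m)"
      using zz unfolding G by blast
    then show ?thesis unfolding pt_g pt_w by (intro bexI[of _ g]) (auto intro!: eq_matI)
  qed
  have lead: "fls_nth (B.ent (f \<circ> g) i j) (a + c) = (\<Sum>l<N. fls_nth (B.ent f i l) a * fls_nth (B.ent g l j) c)"
    if "f \<in> Hc a" "g \<in> Hc c" "i < N" "j < N" for f g a c i j
    unfolding ent_comp[OF HcD(1)[OF that(1)]] fls_nth_sum
    by (intro sum.cong refl nth_mult_lead HcD(2)[OF that(1)] HcD(2)[OF that(2)] that(3,4)) auto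
  have mat_prod: "mat N N (\<lambda>(i, j). x i j) * mat N N (\<lambda>(i, j). y i j) = mat N N (\<lambda>(i, j). \<Sum>l<N. x i l * y l j)"
    for x y :: "nat \<Rightarrow> nat \<Rightarrow> 'k"
    by (rule eq_matI) (auto simp: scalar_prod_def atLeast0LessThan)
  have surj_mat: "\<exists>z\<in>qzeros (?A \<union> ?B) es. wmat N z = v" if "v \<in> carrier_mat N N" for v
  proof (rule twisted_surj_imp_surj[where es = es and n = N])
    show "c i = 0" if "c \<in> set es" "i \<notin> ?A \<union> ?B" for c i using es[OF that] .
    show "\<exists>z\<in>qzeros (?A \<union> ?B) es. gmat N z = 1\<^sub>m N \<and> wmat N z = 0\<^sub>m N N"
    proof (intro bexI[of _ "pt id"] conjI)
      show "gmat N (pt id) = 1\<^sub>m N" unfolding pt_g by (rule eq_matI) (auto simp: B.ent_id)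
      show "wmat N (pt id) = 0\<^sub>m N N" unfolding pt_w phi_end_id by (rule eq_matI) auto
      show "pt id \<in> qzeros (?A \<union> ?B) es" by (rule pt) (simp_all only: phi_end_id diff_self Hc_id Hc_0)
    qed
    show "\<exists>z''\<in>qzeros (?A \<union> ?B) es. gmat N z'' = gmat N z * gmat N z' \<and> wmat N z'' = gmat N z * wmat N z'"
      if z: "z \<in> qzeros (?A \<union> ?B) es" "z' \<in> qzeros (?A \<union> ?B) es" "wmat N z = 0\<^sub>m N N" for z z'
    proof -
      obtain g where g: "g \<in> Hc 0" "phi_end g - g \<in> Hc (int m)" "gmat N z = gmat N (pt g)" "wmat N z = wmat N (pt g)"
        using G'[OF z(1)] by blast
      obtain g' where g': "g' \<in> Hc 0" "phi_end g' - g' \<in> Hc (int m)" "gmat N z' = gmat N (pt g')" "wmat N z' = wmat N (pt g')"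
        using G'[OF z(2)] by blast
      have "fls_nth (B.ent (phi_end g - g) i j) (int m) = 0" if "i < N" "j < N" for i j
        using arg_cong[OF z(3)[unfolded g(4) pt_w], of "\<lambda>m. m $$ (i, j)"] that by simp
      then have g1: "phi_end g - g \<in> Hc (int m + 1)"
        using g(2) by (simp add: Hc_def ordge_Suc)
      have pg': "phi_end g' \<in> Hc 0"
        using Hc_add[OF g'(1), of "phi_end g' - g'"] Hc_mono[OF g'(2), of 0] by simp
      \<comment> \<open>A twisted Leibniz rule. When the first pair has w = 0, the first summand is
        divisible by \<epsilon>^(m + 1), so only the second one contributes to the leading
        coefficients.\<close>
      have e: "phi_end (g \<circ> g') - (g \<circ> g') = ((phi_end g - g) \<circ> phi_end g') + (g \<circ> (phi_end g' - g'))"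
        unfolding phi_end_comp using EndV_app(2)[OF HcD(1)[OF g(1)]] by (auto simp: fun_eq_iff)
      have u1: "(phi_end g - g) \<circ> phi_end g' \<in> Hc (int m + 1)" using Hc_comp[OF g1 pg'] by simp
      have u2: "g \<circ> (phi_end g' - g') \<in> Hc (int m)" using Hc_comp[OF g(1) g'(2)] by simp
      have d: "phi_end (g \<circ> g') - (g \<circ> g') \<in> Hc (int m)"
        unfolding e using Hc_mono[OF u1, of "int m"] u2 by (intro Hc_add) auto
      have gg': "g \<circ> g' \<in> Hc 0" using Hc_comp[OF g(1) g'(1)] by simp
      show ?thesis
      proof (intro bexI[of _ "pt (g \<circ> g')"] conjI)
        show "pt (g \<circ> g') \<in> qzeros (?A \<union> ?B) es" by (rule pt[OF gg' d])
        show "gmat N (pt (g \<circ> g')) = gmat N z * gmat N z'"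
          unfolding g(3) g'(3) pt_g mat_prod using lead[OF g(1) g'(1)] by (intro eq_matI) auto
        have "fls_nth (B.ent (phi_end (g \<circ> g') - (g \<circ> g')) i j) (int m) =
            (\<Sum>l<N. fls_nth (B.ent g i l) 0 * fls_nth (B.ent (phi_end g' - g') l j) (int m))" if "i < N" "j < N" for i j
        proof -
          have "fls_nth (B.ent ((phi_end g - g) \<circ> phi_end g') i j) (int m) = 0"
            using HcD(2)[OF u1 that] by (simp add: ordgeD)
          then show ?thesis
            unfolding e ent_add using lead[OF g(1) g'(2) that] by simp
        qed
        then show "wmat N (pt (g \<circ> g')) = gmat N z * wmat N z'"
          unfolding g(3) g'(4) pt_w pt_g mat_prod by (intro eq_matI) auto
      qed
    qed
    show "\<exists>z\<in>qzeros (?A \<union> ?B) es. det (gmat N z) \<noteq> 0 \<and> wmat N z = gmat N z * f"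
      if f: "f \<in> carrier_mat N N" for f
    proof -
      define fh where "fh = B.matmap (\<lambda>i j. fls_const (f $$ (i, j)))"
      have ent_fh: "B.ent fh i j = fls_const (f $$ (i, j))" if "i < N" "j < N" for i j
        using that by (simp add: fh_def B.ent_matmap)
      have fh: "fh \<in> Hc 0" using EndV_matmap ent_fh by (auto simp: Hc_def fh_def)
      define u where "u = end_scale (fls_X ^ m) fh"
      have ent_u: "B.ent u i j = fls_X ^ m * fls_const (f $$ (i, j))" if "i < N" "j < N" for i j
        using that by (simp add: u_def ent_scale ent_fh)
      have u: "u \<in> Hc (int m)"
        using Hc_scale[of "int m" "fls_X ^ m" fh 0] fh by (simp add: u_def ordge_def)
      obtain g where g: "g \<in> GLM" "phi_end g - g = g \<circ> u" using iso_at_phi_end[OF iso u] by blast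
      have g0: "g \<in> Hc 0" and gi: "inv_into UNIV g \<in> Hc 0" using g(1) GLM_Hc GLM_inv by auto
      have d: "phi_end g - g \<in> Hc (int m)" unfolding g(2) using Hc_comp[OF g0 u] by simp
      \<comment> \<open>The inverse of \<open>g\<close> is integral as well, so its reduction
        inverts that of \<open>g\<close>.\<close>
      have "g \<circ> inv_into UNIV g = id"
        using g(1) by (auto simp: GLM_def fun_eq_iff bij_is_surj surj_f_inv_f)
      then have "(\<Sum>l<N. fls_nth (B.ent g i l) 0 * fls_nth (B.ent (inv_into UNIV g) l j) 0) = (if i = j then 1 else 0)"
        if "i < N" "j < N" for i j
        using lead[OF g0 gi that] that by (auto simp: B.ent_id)
      then have "gmat N (pt g) * gmat N (pt (inv_into UNIV g)) = 1\<^sub>m N"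
        unfolding pt_g mat_prod by (intro eq_matI) auto
      then have "det (gmat N (pt g)) * det (gmat N (pt (inv_into UNIV g))) = 1"
        by (metis det_mult det_one gmat_carrier)
      then have "det (gmat N (pt g)) \<noteq> 0" by auto
      moreover have "wmat N (pt g) = gmat N (pt g) * f"
      proof -
        have "f = mat N N (\<lambda>(i, j). fls_nth (B.ent u i j) (int m))"
          using f by (intro eq_matI) (auto simp: ent_u fls_X_power_mult_nth)
        then have "gmat N (pt g) * f = gmat N (pt g) * mat N N (\<lambda>(i, j). fls_nth (B.ent u i j) (int m))"
          by (rule arg_cong)
        also have "\<dots> = mat N N (\<lambda>(i, j). \<Sum>l<N. fls_nth (B.ent g i l) 0 * fls_nth (B.ent u l j) (int m))"
          unfolding pt_g by (rule mat_prod)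
        also have "\<dots> = wmat N (pt g)"
          unfolding pt_w g(2) using lead[OF g0 u] by (intro eq_matI) auto
        finally show ?thesis by simp
      qed
      ultimately show ?thesis using pt[OF g0 d] by blast
    qed
    show "v \<in> carrier_mat N N" by (rule that)
  qed
  show ?thesis
    unfolding surj_at_def
  proof
    fix f assume f: "f \<in> Hc (int m)"
    obtain z where z: "z \<in> qzeros (?A \<union> ?B) es" "wmat N z = mat N N (\<lambda>(i, j). fls_nth (B.ent f i j) (int m))"
      using surj_mat[of "mat N N (\<lambda>(i, j). fls_nth (B.ent f i j) (int m))"] by auto
    obtain g where g: "g \<in> Hc 0" "phi_end g - g \<in> Hc (int m)" "wmat N z = wmat N (pt g)"
      using G'[OF z(1)] by blast
    have "fls_nth (B.ent (phi_end g - g) i j) (int m) = fls_nth (B.ent f i j) (int m)" if "i < N" "j < N" for i j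
      using arg_cong[OF z(2)[unfolded g(3) pt_w], of "\<lambda>m. m $$ (i, j)"] that by simp
    then have "f - (phi_end g - g) \<in> Hc (int m + 1)"
      using Hc_diff[OF f g(2)] by (simp add: Hc_def ordge_Suc ent_diff)
    then obtain g2 where g2: "g2 \<in> Hc 0" "phi_end g2 - g2 = f - (phi_end g - g)"
      using next_surj unfolding surj_at_def by blast
    have "phi_end (g + g2) - (g + g2) = (phi_end g - g) + (phi_end g2 - g2)"
      unfolding phi_end_add by (simp add: algebra_simps)
    also have "\<dots> = f" unfolding g2(2) by (simp add: algebra_simps)
    finally show "\<exists>g\<in>Hc 0. phi_end g - g = f" using Hc_add[OF g(1) g2(1)] by blast
  qed
qed

end

section \<open>The slope decomposition of endomorphisms\<close>

context frobenius_field
begin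

lemma of_nat_q_pow: "R > 0 \<Longrightarrow> (of_nat (q ^ R) :: 'k) = 0"
  using q_power' by (metis dvd_power dvd_trans of_nat_eq_0_iff_char_dvd power_mult bot_nat_0.not_eq_extremum nat_0_less_mult_iff)

text \<open>The polynomial X^Q - X has derivative -1, hence only simple roots, and it splits over
  k.\<close>

lemma card_frobenius_fixed:
  assumes "R > 0"
  shows "card {x::'k. x ^ (q ^ R) = x} = q ^ R"
proof -
  define Q where "Q = q ^ R"
  have Q1: "Q > 1" unfolding Q_def using assms by (intro one_less_power q_gt1)
  define P :: "'k poly" where "P = monom 1 Q - monom 1 1"
  have cP: "coeff P n = (if n = Q then 1 else 0) - (if n = 1 then 1 else 0)" for n by (simp add: P_def)
  have degP: "degree P = Q"
  proof (rule antisym)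
    show "degree P \<le> Q" by (rule degree_le) (use Q1 in \<open>auto simp: cP\<close>)
    show "Q \<le> degree P" by (rule le_degree) (use Q1 in \<open>auto simp: cP\<close>)
  qed
  have P0: "P \<noteq> 0" using degP Q1 by auto
  have ev: "poly P x = x ^ Q - x" for x by (simp add: P_def poly_monom)
  have dP: "pderiv P = - 1"
    using of_nat_q_pow[OF assms] by (simp add: P_def pderiv_diff pderiv_monom Q_def)
  obtain A where A: "size A = degree P" "P = Polynomial.smult (lead_coeff P) (\<Prod>x\<in>#A. [:-x, 1:])"
    using alg_closed_imp_factorization[OF P0] by blast
  have lc: "lead_coeff P = 1" using Q1 by (simp add: degP cP)
  have count: "count A x \<le> 1" for x
  proof (rule ccontr)
    assume "\<not> count A x \<le> 1"
    then have "{#x, x#} \<subseteq># A" by (simp add: subseteq_mset_def)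
    then obtain A' where "A = {#x, x#} + A'" by (metis subset_mset.add_diff_inverse)
    define S where "S = (\<Prod>x\<in>#A'. [:-x, 1:])"
    define L where "L = [:-x, 1:]"
    have "P = L * (L * S)" using A(2) lc \<open>A = {#x, x#} + A'\<close> by (simp add: S_def L_def del: mult_pCons_left mult_pCons_right)
    moreover have "poly L x = 0" by (simp add: L_def)
    ultimately have "poly (pderiv P) x = 0" by (simp only: pderiv_mult poly_add poly_mult mult_zero_left mult_zero_right add_0)
    then show False by (simp add: dP)
  qed
  have "size A = (\<Sum>x\<in>set_mset A. count A x)" by (simp add: size_multiset_overloaded_eq)
  also have "\<dots> = (\<Sum>x\<in>set_mset A. 1)"
    by (intro sum.cong refl) (use count in \<open>metis count_greater_zero_iff le_neq_implies_less less_one not_gr_zero order_antisym_conv\<close>)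
  finally have "card (set_mset A) = Q" using A(1) degP by simp
  moreover have "set_mset A = {x. x ^ Q = x}"
  proof -
    have "poly P x = 0 \<longleftrightarrow> x \<in># A" for x
    proof -
      have "poly P x = (\<Prod>y\<in>#A. x - y)" by (subst A(2)) (simp add: lc poly_prod_mset)
      then show ?thesis by auto
    qed
    then show ?thesis using ev by auto
  qed
  ultimately show ?thesis by (simp add: Q_def)
qed

text \<open>This sums the multiplicative character x \<mapsto> x^(1 - q^j). For j < R it is
  nontrivial, since only q^j elements satisfy x^(q^j) = x, so the sum vanishes; for j = R it is
  trivial and the sum is q^R - 1 = -1 in k.\<close>

lemma unit_roots_sum:
  assumes R: "R > 0" and j: "1 \<le> j" "j \<le> R"
  defines "mu \<equiv> {x::'k. x ^ (q ^ R) = x \<and> x \<noteq> 0}"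
  shows "(\<Sum>x\<in>mu. x * inverse x ^ (q ^ j)) = (if j = R then - 1 else 0)"
proof -
  let ?F = "{x::'k. x ^ (q ^ R) = x}"
  have qR: "q ^ R > 1" using R by (intro one_less_power q_gt1)
  have finF: "finite ?F" using card_frobenius_fixed[OF R] qR by (metis card.infinite not_one_less_zero)
  have mu: "mu = ?F - {0}" by (auto simp: mu_def)
  have finmu: "finite mu" using finF by (simp add: mu)
  have "0 \<in> ?F" using qR by simp
  then have cmu: "card mu = q ^ R - 1" unfolding mu using finF card_frobenius_fixed[OF R] by simp
  show ?thesis
  proof (cases "j = R")
    case True
    have "(\<Sum>x\<in>mu. x * inverse x ^ (q ^ j)) = (\<Sum>x\<in>mu. 1)"
      by (rule sum.cong) (auto simp: True mu_def power_inverse)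
    also have "\<dots> = of_nat (q ^ R - 1)" by (simp add: cmu)
    also have "\<dots> = of_nat (q ^ R) - 1" using qR by (simp add: of_nat_diff)
    also have "\<dots> = - 1" using of_nat_q_pow[OF R] by simp
    finally show ?thesis using True by simp
  next
    case False
    then have jR: "q ^ j < q ^ R" using j q_gt1 by simp
    have qj: "q ^ j > 1" using j by (intro one_less_power q_gt1) simp
    have "\<exists>x0\<in>mu. x0 ^ (q ^ j) \<noteq> x0"
    proof (rule ccontr)
      assume "\<not> ?thesis"
      then have "?F \<subseteq> {x. x ^ (q ^ j) = x}" using qj by (auto simp: mu_def)
      moreover have "finite {x::'k. x ^ (q ^ j) = x}"
        using card_frobenius_fixed[of j] j qj by (intro card_ge_0_finite) simp
      ultimately have "card ?F \<le> card {x::'k. x ^ (q ^ j) = x}" by (rule card_mono[rotated])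
      then show False using card_frobenius_fixed[of j] card_frobenius_fixed[OF R] j jR by simp
    qed
    then obtain x0 where x0: "x0 \<in> mu" "x0 ^ (q ^ j) \<noteq> x0" by blast
    have nz: "x0 \<noteq> 0" using x0 by (simp add: mu_def)
    define S where "S = (\<Sum>x\<in>mu. x * inverse x ^ (q ^ j))"
    have bij: "bij_betw (\<lambda>x. x0 * x) mu mu"
    proof (rule bij_betw_byWitness[where f' = "\<lambda>x. inverse x0 * x"])
      show "(\<lambda>x. x0 * x) ` mu \<subseteq> mu" "(\<lambda>x. inverse x0 * x) ` mu \<subseteq> mu"
        using x0(1) by (auto simp: mu_def power_mult_distrib power_inverse)
    qed (use nz in \<open>auto simp: mult.assoc[symmetric]\<close>)
    have "S = (\<Sum>x\<in>mu. (x0 * x) * inverse (x0 * x) ^ (q ^ j))"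
      unfolding S_def by (rule sum.reindex_bij_betw[OF bij, symmetric])
    also have "\<dots> = x0 * inverse x0 ^ (q ^ j) * S"
      unfolding S_def sum_distrib_left by (simp add: power_mult_distrib mult_ac)
    finally have "(x0 * inverse x0 ^ (q ^ j) - 1) * S = 0" by (simp add: algebra_simps)
    moreover have "x0 * inverse x0 ^ (q ^ j) \<noteq> 1" using x0(2) nz by (simp add: field_simps power_inverse)
    ultimately show ?thesis using False by (simp add: S_def)
  qed
qed

end

text \<open>Vectors witnessing \<open>card S + 1\<close> strict inclusions would be linearly
  independent: the later ones span a subspace of \<open>T (Suc j)\<close>, which misses the one
  chosen from \<open>T j\<close>.\<close>

lemma chain_stabilizes:
  fixes T :: "nat \<Rightarrow> ('p \<Rightarrow> 'k::field) set"
  assumes sub: "\<And>j. fs.subspace (T j)" and dec: "\<And>j. T (Suc j) \<subseteq> T j"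
    and fin: "finite S" "T 0 \<subseteq> fs.span S"
  shows "\<exists>j\<le>card S. T (Suc j) = T j"
proof (rule ccontr)
  assume "\<not> ?thesis"
  then have "\<forall>j. \<exists>x. j \<le> card S \<longrightarrow> x \<in> T j \<and> x \<notin> T (Suc j)" using dec by blast
  then obtain x where x: "\<And>j. j \<le> card S \<Longrightarrow> x j \<in> T j \<and> x j \<notin> T (Suc j)" by metis
  have dec': "T j \<subseteq> T i" if "i \<le> j" for i j
    using that by (induction rule: dec_induct) (use dec in blast)+
  have "fs.independent (x ` {j..<Suc (card S)}) \<and> card (x ` {j..<Suc (card S)}) = Suc (card S) - j"
    if "j \<le> Suc (card S)" for j
    using that
  proof (induction j rule: inc_induct)
    case base
    then show ?case by (simp add: fs.independent_empty)
  next
    case (step j)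
    have ins: "x ` {j..<Suc (card S)} = insert (x j) (x ` {Suc j..<Suc (card S)})"
      using step.hyps by (auto simp: atLeastLessThan_def atLeast_Suc_greaterThan le_less)
    have "x ` {Suc j..<Suc (card S)} \<subseteq> T (Suc j)"
    proof
      fix y assume "y \<in> x ` {Suc j..<Suc (card S)}"
      then obtain i where "y = x i" "i \<le> card S" "Suc j \<le> i" by auto
      then show "y \<in> T (Suc j)" using x[of i] dec'[of "Suc j" i] by blast
    qed
    then have "fs.span (x ` {Suc j..<Suc (card S)}) \<subseteq> T (Suc j)" by (rule fs.span_minimal[OF _ sub])
    then have nin: "x j \<notin> fs.span (x ` {Suc j..<Suc (card S)})" using x[of j] step.hyps by auto
    then have "x j \<notin> x ` {Suc j..<Suc (card S)}" using fs.span_base[of "x j" "x ` {Suc j..<Suc (card S)}"] by metis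
    then show ?case
      unfolding ins using fs.independent_insertI[OF nin] step by (simp add: Suc_diff_le)
  qed
  from this[of 0] have "fs.independent (x ` {0..<Suc (card S)})" "card (x ` {0..<Suc (card S)}) = Suc (card S)" by auto
  moreover have "x ` {0..<Suc (card S)} \<subseteq> fs.span S"   proof
    fix y assume "y \<in> x ` {0..<Suc (card S)}"
    then obtain j where "y = x j" "j \<le> card S" by auto
    then show "y \<in> fs.span S" using x[of j] dec'[of 0 j] fin(2) by blast
  qed
  ultimately have "Suc (card S) \<le> card S" using fs.independent_span_bound[OF fin(1)] by metis
  then show False by simp
qed

text \<open>Integrality is read off in the lattice basis \<open>b\<close>, slopes in the eigenbasis
  \<open>e\<close>.\<close>

locale crystal_eigen = crystal_basis scale q M \<phi> N b + E: fin_basis scale n e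
  for scale :: "'k::alg_closed_field fls \<Rightarrow> 'v::ab_group_add \<Rightarrow> 'v" and q M \<phi> N b n e +
  fixes t :: nat and r :: "nat \<Rightarrow> int"
  assumes eigen: "eigen_family t n e r"
begin

section \<open>Conjugation in the eigenbasis\<close>

lemma t_pos [simp]: "t > 0"
  and eig: "i < n \<Longrightarrow> (\<phi> ^^ t) (e i) = scale (fls_X powi r i) (e i)"
  using eigen by (auto simp: eigen_family_def)

lemma E_eqI: "f \<in> EndV \<Longrightarrow> g \<in> EndV \<Longrightarrow> (\<And>i j. i < n \<Longrightarrow> j < n \<Longrightarrow> E.ent f i j = E.ent g i j) \<Longrightarrow> f = g"
  using E.linear_eqI by (simp add: EndV_iff)

lemma E_matmap: "E.matmap A \<in> EndV"
  using E.linear_matmap by (simp add: EndV_iff)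

lemma E_ent_add: "E.ent (f + g) i j = E.ent f i j + E.ent g i j"
  and E_ent_diff: "E.ent (f - g) i j = E.ent f i j - E.ent g i j"
  and E_ent_scale: "E.ent (end_scale c f) i j = c * E.ent f i j"
  by (simp_all add: E.ent_def E.coord_add E.coord_diff E.coord_scale end_scale_def)

text \<open>Changing between the two bases has bounded denominators in both directions; the factor 2
  in the constant arises because an endomorphism is transformed on both sides.\<close>

lemma ent_bound:
  "\<exists>c1\<ge>0. \<forall>f\<in>EndV. \<forall>c. (f \<in> Hc c \<longrightarrow> (\<forall>i<n. \<forall>j<n. ordge (c - c1) (E.ent f i j))) \<and>
      ((\<forall>i<n. \<forall>j<n. ordge c (E.ent f i j)) \<longrightarrow> f \<in> Hc (c - c1))"
proof -
  have "\<forall>i. \<exists>c. e i \<in> Mc c" using Mc_ex by blast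
  then obtain g where g: "\<And>i. e i \<in> Mc (g i)" by metis
  obtain a1 where a1: "\<forall>i\<in>{..<n}. a1 \<le> g i" using finite_lower_bound[of "{..<n}" g] by blast
  have "\<forall>x. \<exists>c. ordge c (case x of (l, i) \<Rightarrow> E.coord (b l) i)" using ordge_ex by blast
  then obtain h where h: "\<And>x. ordge (h x) (case x of (l, i) \<Rightarrow> E.coord (b l) i)" by metis
  obtain a2 where a2: "\<forall>x\<in>{..<N} \<times> {..<n}. a2 \<le> h x" using finite_lower_bound[of "{..<N} \<times> {..<n}" h] by blast
  define a where "a = \<bar>a1\<bar> + \<bar>a2\<bar>"
  have eM: "e i \<in> Mc (- a)" if "i < n" for i
  proof (rule Mc_mono[OF g])
    have "a1 \<le> g i" using a1 that by blast
    then show "- a \<le> g i" by (simp add: a_def)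
  qed
  have bE: "ordge (- a) (E.coord (b l) i)" if "l < N" "i < n" for l i
  proof -
    have "a2 \<le> h (l, i)" using a2 that by blast
    then show ?thesis using ordge_mono[OF h[of "(l, i)"], of "- a"] by (simp add: a_def)
  qed
  have coordE: "ordge (d - a) (E.coord v i)" if "v \<in> Mc d" "i < n" for v d i
  proof -
    have "E.coord v i = (\<Sum>l<N. B.coord v l * E.coord (b l) i)"
      by (subst B.coord_expand[of v]) (simp add: E.coord_sum E.coord_scale)
    moreover have "ordge (d + - a) (\<Sum>l<N. B.coord v l * E.coord (b l) i)"
      using that bE by (intro ordge_sum ordge_mult) (auto simp: Mc_def)
    ultimately show ?thesis by simp
  qed
  show ?thesis
  proof (intro exI[of _ "2 * a"] conjI ballI allI impI)
    show "0 \<le> 2 * a" by (simp add: a_def)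
    fix f c i j assume f: "f \<in> EndV" "f \<in> Hc c" and ij: "i < n" "j < n"
    show "ordge (c - 2 * a) (E.ent f i j)"
      unfolding E.ent_def using coordE[OF Hc_app[OF f(2) eM[OF ij(2)]] ij(1)] by (simp add: algebra_simps)
  next
    fix f c assume f: "f \<in> EndV" "\<forall>i<n. \<forall>j<n. ordge c (E.ent f i j)"
    have "f (b j) \<in> Mc (c - 2 * a)" if j: "j < N" for j
    proof -
      have "f (b j) = (\<Sum>k<n. scale (E.coord (f (b j)) k) (e k))" by (rule E.coord_expand)
      also have "\<dots> \<in> Mc (c - 2 * a)"
      proof (rule Mc_sum)
        fix k assume k: "k \<in> {..<n}"
        have "ordge (c + - a) (E.coord (f (b j)) k)"
          using f k bE[OF j] by (simp only: EndV_iff E.linear_coord) (intro ordge_sum ordge_mult, auto)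
        from Mc_scale[OF this eM[of k]] show "scale (E.coord (f (b j)) k) (e k) \<in> Mc (c - 2 * a)"
          using k by (simp add: algebra_simps)
      qed
      finally show ?thesis .
    qed
    then show "f \<in> Hc (c - 2 * a)" using f by (auto simp: Hc_def Mc_def B.ent_def)
  qed
qed

lemma ent_boundE:
  obtains c1 where "c1 \<ge> 0" "\<And>f c i j. f \<in> Hc c \<Longrightarrow> i < n \<Longrightarrow> j < n \<Longrightarrow> ordge (c - c1) (E.ent f i j)"
    "\<And>f c. f \<in> EndV \<Longrightarrow> (\<And>i j. i < n \<Longrightarrow> j < n \<Longrightarrow> ordge c (E.ent f i j)) \<Longrightarrow> f \<in> Hc (c - c1)"
proof -
  from ent_bound obtain c1 where c1: "c1 \<ge> 0" and
    c: "\<forall>f\<in>EndV. \<forall>c. (f \<in> Hc c \<longrightarrow> (\<forall>i<n. \<forall>j<n. ordge (c - c1) (E.ent f i j))) \<and>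
      ((\<forall>i<n. \<forall>j<n. ordge c (E.ent f i j)) \<longrightarrow> f \<in> Hc (c - c1))" by (elim exE conjE)
  show thesis
  proof (rule that[OF c1])
    fix f c i j assume "f \<in> Hc c" "i < n" "j < n"
    then show "ordge (c - c1) (E.ent f i j)" using c[rule_format, of f c] HcD(1)[of f c] by simp
  next
    fix f c assume "f \<in> EndV" "\<And>i j. i < n \<Longrightarrow> j < n \<Longrightarrow> ordge c (E.ent f i j)"
    then show "f \<in> Hc (c - c1)" using c[rule_format, of f c] by simp
  qed
qed

lemma phi_end_funpow: "(phi_end ^^ l) f = (\<phi> ^^ l) \<circ> f \<circ> (ips ^^ l)"
proof (induction l)
  case (Suc l)
  have "(phi_end ^^ Suc l) f v = \<phi> ((\<phi> ^^ l) (f ((ips ^^ l) (ips v))))" for v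
    by (simp add: phi_end_def' Suc)
  moreover have "(ips ^^ l) (ips v) = (ips ^^ Suc l) v" for v by (simp only: funpow_Suc_right o_apply)
  ultimately show ?case by (auto simp: fun_eq_iff)
qed simp

lemma EndV_phi_pow: "f \<in> EndV \<Longrightarrow> (phi_end ^^ l) f \<in> EndV"
  by (induction l) (auto simp: EndV_phi_end)

lemma EndV_ipe_pow: "f \<in> EndV \<Longrightarrow> (ipe ^^ l) f \<in> EndV"
  by (induction l) (auto simp: EndV_ipe)

lemma phi_ipe_pow [simp]: "(phi_end ^^ l) ((ipe ^^ l) f) = f" "(ipe ^^ l) ((phi_end ^^ l) f) = f"
proof -
  show "(phi_end ^^ l) ((ipe ^^ l) f) = f"
  proof (induction l arbitrary: f)
    case (Suc l)
    have "(phi_end ^^ Suc l) ((ipe ^^ Suc l) f) = phi_end ((phi_end ^^ l) ((ipe ^^ l) (ipe f)))"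
      by (simp only: funpow.simps(2) o_apply funpow_swap1)
    then show ?case by (simp add: Suc)
  qed simp
  show "(ipe ^^ l) ((phi_end ^^ l) f) = f"
  proof (induction l arbitrary: f)
    case (Suc l)
    have "(ipe ^^ Suc l) ((phi_end ^^ Suc l) f) = ipe ((ipe ^^ l) ((phi_end ^^ l) (phi_end f)))"
      by (simp only: funpow.simps(2) o_apply funpow_swap1)
    then show ?case by (simp add: Suc)
  qed simp
qed

lemma ips_funpow: "(\<phi> ^^ l) ((ips ^^ l) v) = v"
proof (induction l arbitrary: v)
  case (Suc l)
  have "(\<phi> ^^ Suc l) ((ips ^^ Suc l) v) = (\<phi> ^^ l) (\<phi> (ips ((ips ^^ l) v)))"
    by (simp only: funpow.simps(2)[of l ips] funpow_Suc_right[of l \<phi>] o_apply)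
  then show ?case using Suc by simp
qed simp

text \<open>The inverse of \<open>\<phi> ^^ t\<close> scales \<open>e j\<close> by \<epsilon>^(- r
  j), so the power acts on each matrix entry separately. The sign of r i - r j decides whether an
  entry contracts or expands under iteration.\<close>

lemma ent_phi_pow_t:
  assumes f: "f \<in> EndV" and ij: "i < n" "j < n"
  shows "E.ent ((phi_end ^^ t) f) i j = fls_X powi (r i - r j) * fls_frob (q ^ t) (E.ent f i j)"
proof -
  interpret F: frobenius_field "q ^ t" "TYPE('k)" by (rule frobenius_field_power[OF t_pos])
  have "(\<phi> ^^ t) ((ips ^^ t) (e j)) = (\<phi> ^^ t) (scale (fls_X powi (- r j)) (e j))"
    using ij by (simp only: ips_funpow \<phi>_funpow_scale F.frob_X_powi eig scale_scale power_int_add[symmetric])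
      (simp add: power_int_minus)
  then have ipse: "(ips ^^ t) (e j) = scale (fls_X powi (- r j)) (e j)" using \<phi>_funpow_inj by blast
  have "(phi_end ^^ t) f (e j) = (\<phi> ^^ t) (scale (fls_X powi (- r j)) (\<Sum>k<n. scale (E.ent f k j) (e k)))"
    unfolding phi_end_funpow using E.coord_expand[of "f (e j)"] f
    by (simp add: ipse EndV_app E.ent_def)
  also have "\<dots> = scale (fls_X powi (- r j)) (\<Sum>k<n. scale (F.frob (E.ent f k j) * fls_X powi r k) (e k))"
    by (simp only: \<phi>_funpow_scale \<phi>_funpow_sum F.frob_X_powi) (simp add: eig)
  finally have "E.ent ((phi_end ^^ t) f) i j = fls_X powi (- r j) * (F.frob (E.ent f i j) * fls_X powi r i)"
    using ij by (simp add: E.ent_def[of "(phi_end ^^ t) f"] E.coord_scale E.coord_comb)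
  also have "\<dots> = (fls_X powi (r i) * fls_X powi (- r j)) * F.frob (E.ent f i j)" by (simp add: mult_ac)
  also have "fls_X powi (r i) * fls_X powi (- r j) = (fls_X :: 'k fls) powi (r i - r j)"
    by (subst power_int_add[symmetric]) auto
  finally show ?thesis .
qed

lemma ent_phi_pow_ta:
  assumes "f \<in> EndV" and ij: "i < n" "j < n"
  shows "E.ent ((phi_end ^^ (t * a)) f) i j = 0 \<longleftrightarrow> E.ent f i j = 0"
    and "ordge (c + int a * (r i - r j)) (E.ent ((phi_end ^^ (t * a)) f) i j) \<longleftrightarrow> ordge c (E.ent f i j)"
proof -
  interpret F: frobenius_field "q ^ t" "TYPE('k)" by (rule frobenius_field_power[OF t_pos])
  have "(E.ent ((phi_end ^^ (t * a)) f) i j = 0 \<longleftrightarrow> E.ent f i j = 0) \<and>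
    (ordge (c + int a * (r i - r j)) (E.ent ((phi_end ^^ (t * a)) f) i j) \<longleftrightarrow> ordge c (E.ent f i j))"
  proof (induction a)
    case (Suc a)
    have step: "(phi_end ^^ (t * Suc a)) f = (phi_end ^^ t) ((phi_end ^^ (t * a)) f)"
      by (simp add: funpow_add)
    have "E.ent ((phi_end ^^ (t * Suc a)) f) i j =
        fls_X powi (r i - r j) * F.frob (E.ent ((phi_end ^^ (t * a)) f) i j)"
      unfolding step by (rule ent_phi_pow_t[OF EndV_phi_pow[OF assms(1)] ij])
    then show ?case using Suc by (simp add: ordge_X_powi_mult algebra_simps)
  qed simp
  then show "E.ent ((phi_end ^^ (t * a)) f) i j = 0 \<longleftrightarrow> E.ent f i j = 0"
    "ordge (c + int a * (r i - r j)) (E.ent ((phi_end ^^ (t * a)) f) i j) \<longleftrightarrow> ordge c (E.ent f i j)" by auto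
qed

lemma ent_ipe_pow_ta:
  assumes "f \<in> EndV" and ij: "i < n" "j < n"
  shows "E.ent ((ipe ^^ (t * a)) f) i j = 0 \<longleftrightarrow> E.ent f i j = 0"
    and "ordge (c - int a * (r i - r j)) (E.ent ((ipe ^^ (t * a)) f) i j) \<longleftrightarrow> ordge c (E.ent f i j)"
  using ent_phi_pow_ta(1)[OF EndV_ipe_pow[OF assms(1)] ij, of a "t * a"]
    ent_phi_pow_ta(2)[OF EndV_ipe_pow[OF assms(1)] ij, of "c - int a * (r i - r j)" a "t * a"] by auto

text \<open>\<open>P\<close> compares the exponent of the target \<open>e i\<close> with that of the
  source \<open>e j\<close>: the relations (>), (=), (<) give the projections to the positive, zero
  and negative parts.\<close>

definition part :: "(int \<Rightarrow> int \<Rightarrow> bool) \<Rightarrow> ('v \<Rightarrow> 'v) \<Rightarrow> 'v \<Rightarrow> 'v" where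
  "part P f = E.matmap (\<lambda>i j. if P (r i) (r j) then E.ent f i j else 0)"

lemma part_EndV [simp]: "part P f \<in> EndV"
  unfolding part_def by (rule E_matmap)

lemma ent_part: "i < n \<Longrightarrow> j < n \<Longrightarrow> E.ent (part P f) i j = (if P (r i) (r j) then E.ent f i j else 0)"
  unfolding part_def by (rule E.ent_matmap)

lemma part_sum: "f \<in> EndV \<Longrightarrow> f = part (>) f + part (=) f + part (<) f"
  by (rule E_eqI) (auto simp: EndV_add E_ent_add ent_part)

lemma part_add: "part P (f + g) = part P f + part P g"
  by (rule E_eqI) (auto simp: EndV_add E_ent_add ent_part)

lemma part_0: "part P 0 = 0"
proof (rule E_eqI)
  fix i j assume "i < n" "j < n"
  then show "E.ent (part P 0) i j = E.ent 0 i j" by (simp add: ent_part) (simp add: E.ent_def)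
qed auto

text \<open>Comparing coordinate \<open>i\<close> on both sides gives equal subdegrees up to r i and
  r j, because the Frobenius preserves the subdegree.\<close>

lemma coord_same_slope:
  assumes ij: "i < n" "j < n" and v: "(\<phi> ^^ t) v = scale (fls_X powi r j) v" and nz: "E.coord v i \<noteq> 0"
  shows "r i = r j"
proof -
  interpret F: frobenius_field "q ^ t" "TYPE('k)" by (rule frobenius_field_power[OF t_pos])
  have "(\<phi> ^^ t) v = (\<Sum>k<n. scale (F.frob (E.coord v k) * fls_X powi r k) (e k))"
    by (subst E.coord_expand[of v]) (simp add: \<phi>_funpow_sum \<phi>_funpow_scale eig)
  then have "E.coord ((\<phi> ^^ t) v) i = F.frob (E.coord v i) * fls_X powi r i"
    using E.coord_comb[OF ij(1), of "\<lambda>k. F.frob (E.coord v k) * fls_X powi r k"] by (simp only:)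
  then have eq: "F.frob (E.coord v i) * fls_X powi r i = fls_X powi r j * E.coord v i"
    unfolding v E.coord_scale by (rule sym)
  let ?x = "E.coord v i"
  have sd: "fls_subdegree (F.frob ?x) = fls_subdegree ?x"
    by (rule fls_subdegree_eqI) (use nz in auto)
  have "fls_subdegree (F.frob ?x * fls_X powi r i) = fls_subdegree ?x + r i"
    using nz by (simp add: sd)
  moreover have "fls_subdegree (fls_X powi r j * ?x) = r j + fls_subdegree ?x" using nz by simp
  ultimately show ?thesis using eq by simp
qed

lemma \<phi>_eigen: "j < n \<Longrightarrow> (\<phi> ^^ t) (\<phi> (e j)) = scale (fls_X powi r j) (\<phi> (e j))"
  by (simp add: funpow_swap1[symmetric] eig \<phi>_scale)

lemma ips_eigen: "j < n \<Longrightarrow> (\<phi> ^^ t) (ips (e j)) = scale (fls_X powi r j) (ips (e j))"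
proof -
  assume j: "j < n"
  have "\<phi> ((\<phi> ^^ t) (ips (e j))) = (\<phi> ^^ t) (e j)" by (simp add: funpow_swap1)
  also have "\<dots> = \<phi> (scale (fls_X powi r j) (ips (e j)))" using j by (simp add: eig \<phi>_scale)
  finally show ?thesis using \<phi>_funpow_inj[of 1] by simp
qed

lemma ent_phi_end_eigen:
  assumes "f \<in> EndV"
  shows "E.ent (phi_end f) i j =
    (\<Sum>a<n. \<Sum>l<n. (E.coord (\<phi> (e a)) i * frob (E.coord (ips (e j)) l)) * frob (E.ent f a l))"
proof -
  have c: "E.coord (\<phi> v) i = (\<Sum>a<n. frob (E.coord v a) * E.coord (\<phi> (e a)) i)" for v
    by (subst E.coord_expand[of v]) (simp add: \<phi>_sum \<phi>_scale E.coord_sum E.coord_scale)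
  have "E.ent (phi_end f) i j = (\<Sum>a<n. frob (E.coord (f (ips (e j))) a) * E.coord (\<phi> (e a)) i)"
    unfolding E.ent_def phi_end_def' o_apply by (rule c)
  also have "\<dots> = (\<Sum>a<n. \<Sum>l<n. (E.coord (\<phi> (e a)) i * frob (E.coord (ips (e j)) l)) * frob (E.ent f a l))"
    using assms by (simp add: EndV_iff E.linear_coord frob_sum frob_mult sum_distrib_left sum_distrib_right mult_ac)
  finally show ?thesis .
qed

text \<open>\<phi> need not be diagonal in the eigenbasis, but it commutes with
  \<open>\<phi> ^^ t\<close> and so, like its inverse, mixes only vectors with the same
  exponent.\<close>

lemma phi_end_part:
  assumes f: "f \<in> EndV"
  shows "phi_end (part P f) = part P (phi_end f)"
proof (rule E_eqI)
  fix i j assume ij: "i < n" "j < n"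
  have z1: "E.coord (\<phi> (e a)) i = 0 \<or> r a = r i" if "a < n" for a
    using coord_same_slope[OF ij(1) that \<phi>_eigen[OF that]] by metis
  have z2: "E.coord (ips (e j)) l = 0 \<or> r l = r j" if "l < n" for l
    using coord_same_slope[OF that ij(2) ips_eigen[OF ij(2)]] by metis
  have "E.ent (phi_end (part P f)) i j = (\<Sum>a<n. \<Sum>l<n. (E.coord (\<phi> (e a)) i * frob (E.coord (ips (e j)) l)) *
      (if P (r i) (r j) then frob (E.ent f a l) else 0))"
    unfolding ent_phi_end_eigen[OF part_EndV]
  proof (intro sum.cong refl)
    fix a l assume al: "a \<in> {..<n}" "l \<in> {..<n}"
    show "E.coord (\<phi> (e a)) i * frob (E.coord (ips (e j)) l) * frob (E.ent (part P f) a l) =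
      E.coord (\<phi> (e a)) i * frob (E.coord (ips (e j)) l) * (if P (r i) (r j) then frob (E.ent f a l) else 0)"
      using z1[of a] z2[of l] al by (auto simp: ent_part)
  qed
  also have "\<dots> = (if P (r i) (r j) then E.ent (phi_end f) i j else 0)"
    by (simp add: ent_phi_end_eigen[OF f])
  finally show "E.ent (phi_end (part P f)) i j = E.ent (part P (phi_end f)) i j"
    using ij by (simp add: ent_part)
qed (use f in \<open>auto intro: EndV_phi_end\<close>)

lemma phi_pow_part: "f \<in> EndV \<Longrightarrow> (phi_end ^^ l) (part P f) = part P ((phi_end ^^ l) f)"
  by (induction l) (auto simp: phi_end_part EndV_phi_pow)

lemma ipe_pow_part: "f \<in> EndV \<Longrightarrow> (ipe ^^ l) (part P f) = part P ((ipe ^^ l) f)"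
proof -
  assume f: "f \<in> EndV"
  have "(phi_end ^^ l) (part P ((ipe ^^ l) f)) = part P f"
    using phi_pow_part[OF EndV_ipe_pow[OF f], of l P l] by simp
  then show ?thesis by (metis phi_ipe_pow(2))
qed

lemma pow_bounded: "\<exists>c2\<ge>0. \<forall>f d. \<forall>l\<le>t. f \<in> Hc d \<longrightarrow> (phi_end ^^ l) f \<in> Hc (d - c2) \<and> (ipe ^^ l) f \<in> Hc (d - c2)"
proof -
  obtain c where c: "c \<ge> 0" "\<And>d f. f \<in> Hc d \<Longrightarrow> phi_end f \<in> Hc (d - c) \<and> ipe f \<in> Hc (d - c)"
    using phi_end_bounded by blast
  have "f \<in> Hc d \<Longrightarrow> (phi_end ^^ l) f \<in> Hc (d - int l * c) \<and> (ipe ^^ l) f \<in> Hc (d - int l * c)" for f d l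
  proof (induction l)
    case (Suc l)
    then have "phi_end ((phi_end ^^ l) f) \<in> Hc (d - int l * c - c)" "ipe ((ipe ^^ l) f) \<in> Hc (d - int l * c - c)"
      using c(2) by blast+
    then show ?case by (simp add: algebra_simps)
  qed simp
  moreover have "int l * c \<le> int t * c" if "l \<le> t" for l using that c(1) by (intro mult_right_mono) auto
  ultimately have "f \<in> Hc d \<Longrightarrow> l \<le> t \<Longrightarrow> (phi_end ^^ l) f \<in> Hc (d - int t * c) \<and> (ipe ^^ l) f \<in> Hc (d - int t * c)" for f d l
    by (meson Hc_mono diff_left_mono)
  then show ?thesis using c(1) by (intro exI[of _ "int t * c"]) auto
qed

text \<open>Split \<open>l\<close> into full periods of length \<open>t\<close> and a remainder.
  Each period gains a factor \<epsilon> on the positive part (backwards: on the negative part),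
  since nonzero exponent differences are at least 1, and loses nothing on the zero part; remainder
  and base change cost a constant.\<close>

lemma part_bounds:
  "\<exists>c0. \<forall>f\<in>Hc 0. \<forall>l. (phi_end ^^ l) (part (>) f) \<in> Hc (int (l div t) - c0) \<and>
      (ipe ^^ l) (part (<) f) \<in> Hc (int (l div t) - c0) \<and>
      (phi_end ^^ l) (part (=) f) \<in> Hc (- c0) \<and> (ipe ^^ l) (part (=) f) \<in> Hc (- c0)"
proof -
  obtain c1 where c1: "c1 \<ge> 0" "\<And>f c i j. f \<in> Hc c \<Longrightarrow> i < n \<Longrightarrow> j < n \<Longrightarrow> ordge (c - c1) (E.ent f i j)"
    "\<And>f c. f \<in> EndV \<Longrightarrow> (\<And>i j. i < n \<Longrightarrow> j < n \<Longrightarrow> ordge c (E.ent f i j)) \<Longrightarrow> f \<in> Hc (c - c1)"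
    by (fact ent_boundE)
  obtain c2 where c2: "c2 \<ge> 0" "\<And>f d l. l \<le> t \<Longrightarrow> f \<in> Hc d \<Longrightarrow> (phi_end ^^ l) f \<in> Hc (d - c2) \<and> (ipe ^^ l) f \<in> Hc (d - c2)"
    using pow_bounded by blast
  have split: "l = l mod t + t * (l div t)" for l by simp
  show ?thesis
  proof (intro exI[of _ "2 * c1 + c2"] ballI allI)
    fix f l assume f: "f \<in> Hc 0"
    define a where "a = l div t"
    have fE: "f \<in> EndV" using f HcD(1) by blast
    have lt: "l mod t \<le> t" using t_pos by (simp add: less_imp_le)
    have entf: "ordge (- c1) (E.ent f i j)" if "i < n" "j < n" for i j using c1(2)[OF f that] by simp
    have P: "(phi_end ^^ (t * a)) (part P f) \<in> Hc (d - 2 * c1)"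
      if "\<And>x y. P x y \<Longrightarrow> d \<le> int a * (x - y)" for P d
    proof -
      have "ordge (d - c1) (E.ent ((phi_end ^^ (t * a)) (part P f)) i j)" if ij: "i < n" "j < n" for i j
      proof (cases "P (r i) (r j)")
        case True
        have "ordge (- c1 + int a * (r i - r j)) (E.ent ((phi_end ^^ (t * a)) (part P f)) i j)"
          unfolding ent_phi_pow_ta(2)[OF part_EndV ij] using entf[OF ij] True ij by (simp add: ent_part)
        then show ?thesis by (rule ordge_mono) (use \<open>\<And>x y. P x y \<Longrightarrow> d \<le> int a * (x - y)\<close>[OF True] in simp)
      next
        case False
        then have "E.ent ((phi_end ^^ (t * a)) (part P f)) i j = 0"
          unfolding ent_phi_pow_ta(1)[OF part_EndV ij] using ij by (simp add: ent_part)
        then show ?thesis by simp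
      qed
      from c1(3)[OF EndV_phi_pow[OF part_EndV] this] show ?thesis by simp
    qed
    have I: "(ipe ^^ (t * a)) (part P f) \<in> Hc (d - 2 * c1)"
      if "\<And>x y. P x y \<Longrightarrow> d \<le> int a * (y - x)" for P d
    proof -
      have "ordge (d - c1) (E.ent ((ipe ^^ (t * a)) (part P f)) i j)" if ij: "i < n" "j < n" for i j
      proof (cases "P (r i) (r j)")
        case True
        have "ordge (- c1 - int a * (r i - r j)) (E.ent ((ipe ^^ (t * a)) (part P f)) i j)"
          unfolding ent_ipe_pow_ta(2)[OF part_EndV ij] using entf[OF ij] True ij by (simp add: ent_part)
        then show ?thesis
          by (rule ordge_mono) (use \<open>\<And>x y. P x y \<Longrightarrow> d \<le> int a * (y - x)\<close>[OF True] in \<open>simp add: algebra_simps\<close>)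
      next
        case False
        then have "E.ent ((ipe ^^ (t * a)) (part P f)) i j = 0"
          unfolding ent_ipe_pow_ta(1)[OF part_EndV ij] using ij by (simp add: ent_part)
        then show ?thesis by simp
      qed
      from c1(3)[OF EndV_ipe_pow[OF part_EndV] this] show ?thesis by simp
    qed
    have powP: "(phi_end ^^ l) g = (phi_end ^^ (l mod t)) ((phi_end ^^ (t * a)) g)"
      and powI: "(ipe ^^ l) g = (ipe ^^ (l mod t)) ((ipe ^^ (t * a)) g)" for g
      unfolding a_def by (subst split[of l], simp only: funpow_add o_apply)+
    have mul: "int a \<le> int a * z" if "z > 0" for z
      using mult_left_mono[of 1 z "int a"] that by simp
    have "(phi_end ^^ l) (part (>) f) \<in> Hc (int a - 2 * c1 - c2)"
      unfolding powP using c2(2)[OF lt P[of "(>)" "int a"]] mul by auto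
    moreover have "(ipe ^^ l) (part (<) f) \<in> Hc (int a - 2 * c1 - c2)"
      unfolding powI using c2(2)[OF lt I[of "(<)" "int a"]] mul by auto
    moreover have "(phi_end ^^ l) (part (=) f) \<in> Hc (0 - 2 * c1 - c2)"
      unfolding powP using c2(2)[OF lt P[of "(=)" 0]] by auto
    moreover have "(ipe ^^ l) (part (=) f) \<in> Hc (0 - 2 * c1 - c2)"
      unfolding powI using c2(2)[OF lt I[of "(=)" 0]] by auto
    ultimately show "(phi_end ^^ l) (part (>) f) \<in> Hc (int (l div t) - (2 * c1 + c2)) \<and>
      (ipe ^^ l) (part (<) f) \<in> Hc (int (l div t) - (2 * c1 + c2)) \<and>
      (phi_end ^^ l) (part (=) f) \<in> Hc (- (2 * c1 + c2)) \<and> (ipe ^^ l) (part (=) f) \<in> Hc (- (2 * c1 + c2))"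
      unfolding a_def diff_diff_eq by simp
  qed
qed

text \<open>The equation for the t-th power of \<open>phi_end\<close> decouples into one
  Artin-Schreier equation per matrix entry in the eigenbasis. Summing t iterates of its solution h
  gives g by telescoping.\<close>

lemma surj_at_large: "\<exists>m::nat. surj_at (int m)"
proof -
  interpret F: frobenius_field "q ^ t" "TYPE('k)" by (rule frobenius_field_power[OF t_pos])
  obtain c1 where c1: "c1 \<ge> 0" "\<And>f c i j. f \<in> Hc c \<Longrightarrow> i < n \<Longrightarrow> j < n \<Longrightarrow> ordge (c - c1) (E.ent f i j)"
    "\<And>f c. f \<in> EndV \<Longrightarrow> (\<And>i j. i < n \<Longrightarrow> j < n \<Longrightarrow> ordge c (E.ent f i j)) \<Longrightarrow> f \<in> Hc (c - c1)"
    by (fact ent_boundE)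
  obtain c2 where c2: "c2 \<ge> 0" "\<And>f d l. l \<le> t \<Longrightarrow> f \<in> Hc d \<Longrightarrow> (phi_end ^^ l) f \<in> Hc (d - c2) \<and> (ipe ^^ l) f \<in> Hc (d - c2)"
    using pow_bounded by blast
  \<comment> \<open>Pays for the base change to the eigenbasis and back, and for the iterates summed
    in \<open>g\<close>.\<close>
  define C where "C = 2 * c1 + c2"
  have "surj_at C"
    unfolding surj_at_def
  proof
    fix f assume f: "f \<in> Hc C"
    have fE: "f \<in> EndV" using f HcD(1) by blast
    have "\<exists>a. i < n \<longrightarrow> j < n \<longrightarrow> ordge (C - c1) a \<and> fls_X powi (r i - r j) * F.frob a - a = E.ent f i j" for i j
      using F.artin_schreier_fls[OF c1(2)[OF f]] by blast
    then obtain a where a: "\<And>i j. i < n \<Longrightarrow> j < n \<Longrightarrow>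
        ordge (C - c1) (a i j) \<and> fls_X powi (r i - r j) * F.frob (a i j) - a i j = E.ent f i j" by metis
    define h where "h = E.matmap a"
    have hE: "h \<in> EndV" unfolding h_def by (rule E_matmap)
    have ent_h: "E.ent h i j = a i j" if "i < n" "j < n" for i j using that by (simp add: h_def E.ent_matmap)
    have "h \<in> Hc (C - c1 - c1)" using a ent_h by (intro c1(3)[OF hE]) auto
    then have hH: "(phi_end ^^ l) h \<in> Hc 0" if "l < t" for l
      using c2(2)[of l h "C - c1 - c1"] that by (simp add: C_def)
    have hf: "(phi_end ^^ t) h - h = f"
      by (rule E_eqI) (use hE fE a in \<open>auto simp: EndV_diff EndV_phi_pow E_ent_diff ent_phi_pow_t ent_h\<close>)
    define g where "g = (\<Sum>l<t. (phi_end ^^ l) h)"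
    have "phi_end g - g = (\<Sum>l<t. (phi_end ^^ Suc l) h - (phi_end ^^ l) h)"
      unfolding g_def phi_end_sum sum_subtractf by simp
    also have "\<dots> = (phi_end ^^ t) h - (phi_end ^^ 0) h" by (rule sum_lessThan_telescope)
    also have "\<dots> = f" using hf by simp
    finally show "\<exists>g\<in>Hc 0. phi_end g - g = f" using Hc_sum[of "{..<t}" "\<lambda>l. (phi_end ^^ l) h" 0] hH by (auto simp: g_def)
  qed
  moreover have "C = int (nat C)" using c1(1) c2(1) by (simp add: C_def)
  ultimately show ?thesis by metis
qed

lemma phi_pow_add: "(phi_end ^^ l) (f + g) = (phi_end ^^ l) f + (phi_end ^^ l) g"
  by (induction l) (simp_all only: funpow.simps id_apply o_apply phi_end_add)

lemma phi_pow_diff: "(phi_end ^^ l) (f - g) = (phi_end ^^ l) f - (phi_end ^^ l) g"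
  by (induction l) (simp_all only: funpow.simps id_apply o_apply phi_end_diff)

lemma ipe_add: "ipe (f + g) = ipe f + ipe g"
  by (auto simp: ipe_eq fun_eq_iff ips_add)

lemma ipe_diff: "ipe (f - g) = ipe f - ipe g"
  using ipe_add[of "f - g" g] by simp

lemma ipe_pow_diff: "(ipe ^^ l) (f - g) = (ipe ^^ l) f - (ipe ^^ l) g"
  by (induction l) (simp_all only: funpow.simps id_apply o_apply ipe_diff)

text \<open>The solutions of \<open>phi_end g - g = x f\<close>, for \<open>x\<close> in the multiplicative group of the field with
  \<open>q\<^sup>R\<close> elements, are averaged with weights \<open>- x\<^sup>-\<^sup>1\<close>.\<close>

lemma surj_at_window:
  assumes s: "surj_at m" and f: "f \<in> Hc m" and R: "R > 0"
  shows "\<exists>a. (\<forall>i<R. (phi_end ^^ i) a \<in> Hc 0) \<and> (phi_end ^^ R) a = a + f"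
proof -
  define mu where "mu = {x::'k. x ^ (q ^ R) = x \<and> x \<noteq> 0}"
  have "\<exists>g. g \<in> Hc 0 \<and> phi_end g - g = end_scale (fls_const x) f" for x
    using s Hc_scale[of 0 "fls_const x" f m] f unfolding surj_at_def by auto
  then obtain g where g: "\<And>x. g x \<in> Hc 0" "\<And>x. phi_end (g x) - g x = end_scale (fls_const x) f" by metis
  have g': "phi_end (g x) = g x + end_scale (fls_const x) f" for x
    using g(2)[of x] by (simp only: diff_eq_eq add.commute)
  \<comment> \<open>\<open>G i\<close> is the i-th iterate of \<open>G 0\<close> as long as the
    contributions of \<open>f\<close> cancel. By \<open>unit_roots_sum\<close> they do until step
    \<open>R\<close>, where exactly one copy of \<open>f\<close> appears; and
    \<open>G R = G 0\<close> because x^(q^R) = x.\<close>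
  define G where "G = (\<lambda>i. \<Sum>x\<in>mu. end_scale (fls_const (- (inverse x ^ (q ^ i)))) (g x))"
  have GH: "G i \<in> Hc 0" for i
    unfolding G_def using Hc_scale[OF ordge_const g(1)] by (intro Hc_sum) (simp only: add_0)
  have es_add: "end_scale c (u + v) = end_scale c u + end_scale c v"
    and es_es: "end_scale c (end_scale d u) = end_scale (c * d) u" for c d u v
    by (simp_all add: end_scale_def fun_eq_iff scale_right_distrib)
  have es_sum: "(\<Sum>x\<in>A. end_scale (c x) u) = end_scale (sum c A) u" for c u and A :: "'k set"
    by (induction A rule: infinite_finite_induct) (simp_all add: end_scale_def fun_eq_iff scale_left_distrib)
  have const_sum: "(\<Sum>x\<in>A. fls_const (c x)) = fls_const (sum c A)" for c :: "'k \<Rightarrow> 'k" and A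
    by (induction A rule: infinite_finite_induct) (simp_all add: fls_plus_const)
  have step: "phi_end (G i) = G (Suc i) + end_scale (fls_const (- (\<Sum>x\<in>mu. x * inverse x ^ (q ^ Suc i)))) f" for i
  proof -
    have pw: "(- (inverse x ^ (q ^ i))) ^ q = - (inverse x ^ (q ^ Suc i))" for x :: 'k
      using pow_uminus[of "inverse x ^ (q ^ i)" 1] by (simp add: power_mult[symmetric] mult.commute)
    have "phi_end (G i) = (\<Sum>x\<in>mu. end_scale (fls_const (- (inverse x ^ (q ^ Suc i)))) (g x + end_scale (fls_const x) f))"
      unfolding G_def phi_end_sum by (simp only: phi_end_scale frob_const pw g')
    also have "\<dots> = (\<Sum>x\<in>mu. end_scale (fls_const (- (inverse x ^ (q ^ Suc i)))) (g x) +
        end_scale (fls_const (- (inverse x ^ (q ^ Suc i)) * x)) f)"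
      by (simp only: es_add es_es fls_const_mult_const)
    also have "\<dots> = G (Suc i) + (\<Sum>x\<in>mu. end_scale (fls_const (- (inverse x ^ (q ^ Suc i)) * x)) f)"
      unfolding G_def by (rule sum.distrib)
    also have "(\<Sum>x\<in>mu. end_scale (fls_const (- (inverse x ^ (q ^ Suc i)) * x)) f) =
        end_scale (fls_const (- (\<Sum>x\<in>mu. x * inverse x ^ (q ^ Suc i)))) f"
      unfolding es_sum const_sum by (simp add: sum_negf mult.commute)
    finally show ?thesis .
  qed
  have step0: "phi_end (G i) = G (Suc i)" if "Suc i < R" for i
  proof -
    have "(\<Sum>x\<in>mu. x * inverse x ^ (q ^ Suc i)) = 0"
      using unit_roots_sum[OF R, of "Suc i"] that by (simp add: mu_def)
    then show ?thesis unfolding step by (simp only: minus_zero fls_const_0) (simp add: end_scale_def fun_eq_iff)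
  qed
  have pow: "(phi_end ^^ i) (G 0) = G i" if "i < R" for i
    using that by (induction i) (simp_all add: step0)
  obtain R' where R': "R = Suc R'" using R by (cases R) auto
  have "(\<Sum>x\<in>mu. x * inverse x ^ (q ^ R)) = - 1"
    using unit_roots_sum[OF R, of R] R by (simp add: mu_def)
  then have "phi_end (G R') = G R + end_scale (fls_const (- (- 1))) f" using step[of R'] R' by simp
  moreover have "end_scale (fls_const (- (- 1))) f = f" by (simp add: end_scale_def fun_eq_iff)
  moreover have "G R = G 0"
    unfolding G_def by (rule sum.cong) (auto simp: mu_def power_inverse)
  moreover have "(phi_end ^^ R) (G 0) = phi_end (G R')" using pow[of R'] R' by simp
  ultimately have "(phi_end ^^ R) (G 0) = G 0 + f" by (simp only:)
  then show ?thesis using pow GH by (intro exI[of _ "G 0"]) auto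
qed

definition VP :: "(int \<Rightarrow> int \<Rightarrow> bool) \<Rightarrow> ('v \<Rightarrow> 'v) set" where
  "VP P = {f\<in>EndV. part P f = f}"

text \<open>Slope zero elements with integral iterates up to j, reduced modulo \<epsilon>^c0, form a
  descending chain of subspaces of a finite-dimensional space over k. Where it stabilises, two
  elements with equal reduction differ by an element of \<epsilon>^c0 H, whose iterates are all
  integral by \<open>bd\<close>; so the next iterate is integral as well. \<open>\<Phi>\<close> is
  kept abstract to cover both directions.\<close>

lemma window_stabilizes:
  assumes add: "\<And>f g. \<Phi> (f - g) = \<Phi> f - \<Phi> g"
    and sc: "\<And>c f. \<exists>d. \<Phi> (end_scale (fls_const c) f) = end_scale (fls_const d) (\<Phi> f)"
    and stable_VP: "\<And>v. v \<in> VP (=) \<Longrightarrow> \<Phi> v \<in> VP (=)"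
    and bd: "\<And>v l. v \<in> VP (=) \<Longrightarrow> v \<in> Hc (int c0) \<Longrightarrow> (\<Phi> ^^ l) v \<in> Hc 0"
  shows "\<exists>J. \<forall>v\<in>VP (=). (\<forall>i\<le>J. (\<Phi> ^^ i) v \<in> Hc 0) \<longrightarrow> (\<forall>i. (\<Phi> ^^ i) v \<in> Hc 0)"
proof -
  define W where "W = (\<lambda>j. {v\<in>VP (=). \<forall>i\<le>j. (\<Phi> ^^ i) v \<in> Hc 0})"
  define X where "X = {..<c0} \<times> {..<N} \<times> {..<N}"
  \<comment> \<open>Reduction modulo \<epsilon>^c0, as a function on the finite set of coefficient
    positions.\<close>
  define th where "th = (\<lambda>v (s, i, j). if (s, i, j) \<in> X then fls_nth (B.ent v i j) (int s) else 0)"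
  define T where "T = (\<lambda>j. th ` W j)"
  have pow_diff: "(\<Phi> ^^ l) (f - g) = (\<Phi> ^^ l) f - (\<Phi> ^^ l) g" for l f g
    by (induction l) (simp_all only: funpow.simps id_apply o_apply add)
  have pow_sc: "\<exists>d. (\<Phi> ^^ l) (end_scale (fls_const c) f) = end_scale (fls_const d) ((\<Phi> ^^ l) f)" for l c f
  proof (induction l)
    case 0
    then show ?case by (intro exI[of _ c]) simp
  next
    case (Suc l)
    then obtain d where "(\<Phi> ^^ l) (end_scale (fls_const c) f) = end_scale (fls_const d) ((\<Phi> ^^ l) f)" by blast
    then show ?case using sc[of d "(\<Phi> ^^ l) f"] by simp
  qed
  have VP_diff: "f - g \<in> VP (=)" if "f \<in> VP (=)" "g \<in> VP (=)" for f g
  proof -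
    have "part (=) (f - g) + part (=) g = part (=) f" unfolding part_add[symmetric] by simp
    then have "part (=) (f - g) = part (=) f - part (=) g" by (simp only: eq_diff_eq)
    then show ?thesis using that by (auto simp: VP_def EndV_diff)
  qed
  have VP_sc: "end_scale c f \<in> VP (=)" if "f \<in> VP (=)" for c f
  proof -
    have f: "f \<in> EndV" "part (=) f = f" using that by (auto simp: VP_def)
    have "part (=) (end_scale c f) = end_scale c (part (=) f)"
      by (rule E_eqI) (use f(1) in \<open>auto simp: EndV_scale E_ent_scale ent_part\<close>)
    then show ?thesis using f by (simp add: VP_def EndV_scale)
  qed
  have W_diff: "f - g \<in> W j" if "f \<in> W j" "g \<in> W j" for f g j
    using that by (auto simp: W_def VP_diff pow_diff Hc_diff)
  have W_sc: "end_scale (fls_const c) f \<in> W j" if "f \<in> W j" for f c j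
  proof -
    have "(\<Phi> ^^ i) (end_scale (fls_const c) f) \<in> Hc 0" if "i \<le> j" for i
    proof -
      obtain d where "(\<Phi> ^^ i) (end_scale (fls_const c) f) = end_scale (fls_const d) ((\<Phi> ^^ i) f)" using pow_sc by blast
      then show ?thesis using Hc_scale[OF ordge_const, of "(\<Phi> ^^ i) f" 0 d] \<open>f \<in> W j\<close> that by (simp add: W_def)
    qed
    then show ?thesis using that VP_sc by (auto simp: W_def)
  qed
  have th_diff: "th (f - g) = th f - th g" for f g by (auto simp: th_def fun_eq_iff ent_diff)
  have th_sc: "th (end_scale (fls_const c) f) = fun_scale c (th f)" for c f
    by (auto simp: th_def fun_eq_iff ent_scale fun_scale_def)
  have W0: "0 \<in> W j" for j
  proof -
    have "(0 :: 'v \<Rightarrow> 'v) \<in> VP (=)" by (simp add: VP_def part_0)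
    moreover have "(\<Phi> ^^ i) 0 = 0" for i using pow_diff[of i 0 0] by simp
    ultimately show ?thesis by (simp add: W_def)
  qed
  have sub: "fs.subspace (T j)" for j
    unfolding fs.subspace_def
  proof (intro conjI ballI allI)
    have "th 0 = 0" using th_diff[of 0 0] by simp
    then show "0 \<in> T j" using W0[of j] by (metis T_def image_eqI)
    fix x assume x: "x \<in> T j"
    then obtain f where f: "f \<in> W j" "x = th f" by (auto simp: T_def)
    show "fun_scale c x \<in> T j" for c
      unfolding T_def f(2) th_sc[symmetric] by (rule imageI[OF W_sc[OF f(1)]])
    fix y assume "y \<in> T j"
    then obtain g where g: "g \<in> W j" "y = th g" by (auto simp: T_def)
    have "x + y = th (f - (0 - g))" unfolding th_diff f(2) g(2) \<open>th 0 = 0\<close> by simp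
    then show "x + y \<in> T j" unfolding T_def using imageI[OF W_diff[OF f(1) W_diff[OF W0 g(1)]], of th] by (simp only:)
  qed
  have dec: "T (Suc j) \<subseteq> T j" for j by (auto simp: T_def W_def)
  define S where "S = (\<lambda>x. (\<lambda>y. if y = x then (1::'k) else 0)) ` X"
  have finX: "finite X" by (simp add: X_def)
  have finS: "finite S" by (simp add: S_def finX)
  have "T 0 \<subseteq> fs.span S"
  proof
    fix y assume "y \<in> T 0"
    then obtain v where v: "y = th v" by (auto simp: T_def)
    have "y = (\<Sum>x\<in>X. fun_scale (y x) (\<lambda>z. if z = x then 1 else 0))"
    proof
      fix z
      have "(\<Sum>x\<in>X. fun_scale (y x) (\<lambda>z. if z = x then 1 else 0)) z = (\<Sum>x\<in>X. if x = z then y x else 0)"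
        unfolding fun_sum_apply fun_scale_def by (intro sum.cong refl) auto
      also have "\<dots> = (if z \<in> X then y z else 0)" using finX by simp
      also have "\<dots> = y z" by (cases z) (auto simp: v th_def)
      finally show "y z = (\<Sum>x\<in>X. fun_scale (y x) (\<lambda>z. if z = x then 1 else 0)) z" by simp
    qed
    moreover have "(\<Sum>x\<in>X. fun_scale (y x) (\<lambda>z. if z = x then 1 else 0)) \<in> fs.span S"
      by (intro fs.span_sum fs.span_scale fs.span_base) (auto simp: S_def)
    ultimately show "y \<in> fs.span S" by (simp only:)
  qed
  then obtain j where j: "T (Suc j) = T j" using chain_stabilizes[of T S, OF sub dec finS] by blast
  have Weq: "v \<in> W (Suc j)" if v: "v \<in> W j" for v
  proof -
    have "th v \<in> T (Suc j)" using v j by (auto simp: T_def)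
    then obtain v' where v': "v' \<in> W (Suc j)" "th v = th v'" by (auto simp: T_def)
    define d where "d = v - v'"
    have "v' \<in> W j" using v'(1) by (auto simp: W_def)
    then have d: "d \<in> W j" using W_diff[OF v] by (simp add: d_def)
    then have dH: "d \<in> Hc 0" by (auto simp: W_def)
    have "th d = 0" using th_diff[of v v'] v'(2) by (simp add: d_def)
    then have thd: "th d x = 0" for x by simp
    have "fls_nth (B.ent d i l) (int s) = 0" if "s < c0" "i < N" "l < N" for s i l
      using thd[of "(s, i, l)"] that by (simp add: th_def X_def)
    have "fls_nth (B.ent d i l) m = 0" if "i < N" "l < N" "m < int c0" for i l m
    proof (cases "m < 0")
      case True
      then show ?thesis using HcD(2)[OF dH that(1,2)] by (simp add: ordgeD)
    next
      case False
      then show ?thesis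
        using \<open>\<And>s i l. s < c0 \<Longrightarrow> i < N \<Longrightarrow> l < N \<Longrightarrow> fls_nth (B.ent d i l) (int s) = 0\<close>[of "nat m" i l] that by simp
    qed
    then have "d \<in> Hc (int c0)" using HcD(1)[OF dH] by (auto simp: Hc_def ordge_def)
    moreover have "d \<in> VP (=)" using d by (simp add: W_def)
    ultimately have "d \<in> W (Suc j)" using bd by (simp add: W_def)
    from W_diff[OF this W_diff[OF W0 v'(1)]] show ?thesis by (simp add: d_def)
  qed
  have stable: "\<Phi> v \<in> W j" if "v \<in> W j" for v
  proof -
    have "(\<Phi> ^^ i) (\<Phi> v) \<in> Hc 0" if "i \<le> j" for i
      using Weq[OF \<open>v \<in> W j\<close>] that unfolding W_def by (auto simp: funpow_swap1 dest!: spec[of _ "Suc i"])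
    then show ?thesis using that stable_VP by (auto simp: W_def)
  qed
  have "(\<Phi> ^^ i) v \<in> W j" if "v \<in> W j" for i v using that by (induction i) (auto simp: stable)
  then have "(\<Phi> ^^ i) v \<in> Hc 0" if "v \<in> W j" for i v
    using that by (metis (mono_tags, lifting) W_def funpow_0 le0 mem_Collect_eq)
  then show ?thesis by (intro exI[of _ j] ballI impI allI) (simp add: W_def)
qed

end

section \<open>The lattice \<open>O\<^sub>H\<close>\<close>

context crystal_eigen
begin

lemma part_diff: "part P (f - g) = part P f - part P g"
  by (rule E_eqI) (auto simp: EndV_diff E_ent_diff ent_part)

lemma part_scale: "f \<in> EndV \<Longrightarrow> part P (end_scale c f) = end_scale c (part P f)"
  by (rule E_eqI) (auto simp: EndV_scale E_ent_scale ent_part)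

lemma part_part: "part P (part P f) = part P f"
  by (rule E_eqI) (auto simp: ent_part)

lemma ipe_scale: "ipe (end_scale (frob c) f) = end_scale c (ipe f)"
  by (metis ipe phi_end_scale)

lemma phi_pow_scale_X: "(phi_end ^^ l) (end_scale (fls_X powi c) f) = end_scale (fls_X powi c) ((phi_end ^^ l) f)"
  by (induction l) (simp_all add: phi_end_scale)

lemma ipe_pow_scale_X: "(ipe ^^ l) (end_scale (fls_X powi c) f) = end_scale (fls_X powi c) ((ipe ^^ l) f)"
proof (induction l)
  case (Suc l)
  then show ?case using ipe_scale[of "fls_X powi c" "(ipe ^^ l) f"] by simp
qed simp

text \<open>On slope zero the loss under iteration is bounded independently of the number of steps,
  so elements of \<epsilon>^c H with c large stay integral for ever in both directions, which
  \<open>window_stabilizes\<close> requires.\<close>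

lemma slope_zero_window:
  "\<exists>J. \<forall>v\<in>VP (=). ((\<forall>i\<le>J. (phi_end ^^ i) v \<in> Hc 0) \<longrightarrow> (\<forall>i. (phi_end ^^ i) v \<in> Hc 0)) \<and>
     ((\<forall>i\<le>J. (ipe ^^ i) v \<in> Hc 0) \<longrightarrow> (\<forall>i. (ipe ^^ i) v \<in> Hc 0))"
proof -
  obtain c0 where c0: "\<forall>f\<in>Hc 0. \<forall>l. (phi_end ^^ l) (part (>) f) \<in> Hc (int (l div t) - c0) \<and>
      (ipe ^^ l) (part (<) f) \<in> Hc (int (l div t) - c0) \<and>
      (phi_end ^^ l) (part (=) f) \<in> Hc (- c0) \<and> (ipe ^^ l) (part (=) f) \<in> Hc (- c0)"
    using part_bounds by (elim exE)
  define c where "c = nat c0"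
  have bd: "(phi_end ^^ l) v \<in> Hc 0 \<and> (ipe ^^ l) v \<in> Hc 0" if v: "v \<in> VP (=)" "v \<in> Hc (int c)" for v l
  proof -
    define w where "w = end_scale (fls_X powi (- int c)) v"
    have vE: "v \<in> EndV" "part (=) v = v" using v(1) by (auto simp: VP_def)
    have "ordge (- int c) (fls_X powi (- int c) :: 'k fls)"
      using ordge_X_powi_mult[of "- int c" "- int c" 1] by simp
    from Hc_scale[OF this v(2)] have w: "w \<in> Hc 0" by (simp add: w_def)
    have pw: "part (=) w = w" unfolding w_def part_scale[OF vE(1)] vE(2) ..
    have v_w: "v = end_scale (fls_X powi (int c)) w"
      unfolding w_def by (simp add: end_scale_def power_int_minus)
    have X: "ordge (int c) (fls_X powi int c :: 'k fls)"
      using ordge_X_powi_mult[of "int c" "int c" 1] by simp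
    have "(phi_end ^^ l) w \<in> Hc (- c0)" "(ipe ^^ l) w \<in> Hc (- c0)"
      using c0[rule_format, OF w, of l] unfolding pw by blast+
    from this[THEN Hc_scale[OF X]] have "(phi_end ^^ l) v \<in> Hc (int c + - c0)" "(ipe ^^ l) v \<in> Hc (int c + - c0)"
      unfolding v_w phi_pow_scale_X ipe_pow_scale_X .
    then show ?thesis by (auto intro: Hc_mono simp: c_def)
  qed
  have 1: "\<exists>J. \<forall>v\<in>VP (=). (\<forall>i\<le>J. (phi_end ^^ i) v \<in> Hc 0) \<longrightarrow> (\<forall>i. (phi_end ^^ i) v \<in> Hc 0)"
  proof (rule window_stabilizes)
    show "\<exists>d. phi_end (end_scale (fls_const c) f) = end_scale (fls_const d) (phi_end f)" for c f
      using phi_end_scale[of "fls_const c" f] frob_const by metis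
    show "phi_end v \<in> VP (=)" if "v \<in> VP (=)" for v
      using that phi_end_part[of v "(=)"] by (auto simp: VP_def EndV_phi_end)
    show "(phi_end ^^ l) v \<in> Hc 0" if "v \<in> VP (=)" "v \<in> Hc (int c)" for v l using bd that by blast
  qed (rule phi_end_diff)
  have 2: "\<exists>J. \<forall>v\<in>VP (=). (\<forall>i\<le>J. (ipe ^^ i) v \<in> Hc 0) \<longrightarrow> (\<forall>i. (ipe ^^ i) v \<in> Hc 0)"
  proof (rule window_stabilizes)
    show "\<exists>d. ipe (end_scale (fls_const x) f) = end_scale (fls_const d) (ipe f)" for x f
    proof -
      obtain y where "y ^ q = x" using nth_root_exists[of q x] q_gt1 by auto
      then have "frob (fls_const y) = fls_const x" by (simp add: frob_const)
      then show ?thesis using ipe_scale[of "fls_const y" f] by metis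
    qed
    show "ipe v \<in> VP (=)" if "v \<in> VP (=)" for v
      using that ipe_pow_part[of v 1 "(=)"] by (auto simp: VP_def EndV_ipe)
    show "(ipe ^^ l) v \<in> Hc 0" if "v \<in> VP (=)" "v \<in> Hc (int c)" for v l using bd that by blast
  qed (rule ipe_diff)
  obtain J1 where J1: "\<forall>v\<in>VP (=). (\<forall>i\<le>J1. (phi_end ^^ i) v \<in> Hc 0) \<longrightarrow> (\<forall>i. (phi_end ^^ i) v \<in> Hc 0)"
    using 1 by (elim exE)
  obtain J2 where J2: "\<forall>v\<in>VP (=). (\<forall>i\<le>J2. (ipe ^^ i) v \<in> Hc 0) \<longrightarrow> (\<forall>i. (ipe ^^ i) v \<in> Hc 0)"
    using 2 by (elim exE)
  show ?thesis
  proof (intro exI[of _ "J1 + J2"] ballI conjI impI)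
    fix v assume v: "v \<in> VP (=)"
    show "\<forall>i. (phi_end ^^ i) v \<in> Hc 0" if "\<forall>i\<le>J1 + J2. (phi_end ^^ i) v \<in> Hc 0"
      using J1[rule_format, OF v] that by simp
    show "\<forall>i. (ipe ^^ i) v \<in> Hc 0" if "\<forall>i\<le>J1 + J2. (ipe ^^ i) v \<in> Hc 0"
      using J2[rule_format, OF v] that by simp
  qed
qed

text \<open>A solution \<open>a\<close> of \<open>phi_end\<^sup>R a = a + f\<close> whose first \<open>R\<close> iterates are integral: the positive
  (negative) parts of the iterates are small towards the end (the beginning) of the window, so in the
  middle of the window the slope zero part is integral, hence integral throughout.\<close>

lemma surj_at_parts:
  assumes s: "surj_at (int m)" and f: "f \<in> Hc (int m)"
  shows "(phi_end ^^ i) (part (>) f) \<in> Hc 0" "(phi_end ^^ i) (part (=) f) \<in> Hc 0"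
    "(ipe ^^ i) (part (=) f) \<in> Hc 0" "(ipe ^^ i) (part (<) f) \<in> Hc 0"
proof -
  obtain c0 where c0: "\<forall>f\<in>Hc 0. \<forall>l. (phi_end ^^ l) (part (>) f) \<in> Hc (int (l div t) - c0) \<and>
      (ipe ^^ l) (part (<) f) \<in> Hc (int (l div t) - c0) \<and>
      (phi_end ^^ l) (part (=) f) \<in> Hc (- c0) \<and> (ipe ^^ l) (part (=) f) \<in> Hc (- c0)"
    using part_bounds by (elim exE)
  obtain J where J: "\<forall>v\<in>VP (=). ((\<forall>i\<le>J. (phi_end ^^ i) v \<in> Hc 0) \<longrightarrow> (\<forall>i. (phi_end ^^ i) v \<in> Hc 0)) \<and>
     ((\<forall>i\<le>J. (ipe ^^ i) v \<in> Hc 0) \<longrightarrow> (\<forall>i. (ipe ^^ i) v \<in> Hc 0))"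
    using slope_zero_window by (elim exE)
  \<comment> \<open>After \<open>T\<close> steps the gain on the positive part has made up for the
    constant \<open>c0\<close>.\<close>
  define T where "T = Suc (t * nat c0)"
  have T: "c0 \<le> int (l div t)" if "T \<le> l" for l
  proof -
    have "nat c0 \<le> l div t" using div_le_mono[of "t * nat c0" l t] that by (simp add: T_def)
    then show ?thesis by simp
  qed
  \<comment> \<open>Between \<open>T\<close> and \<open>R - T\<close> both contracting parts are
    integral. This range reaches \<open>J\<close> steps to either side of its centre
    \<open>T + J\<close>, as \<open>slope_zero_window\<close> needs.\<close>
  define R where "R = 2 * T + 2 * J"
  have R: "R > 0" by (simp add: R_def T_def)
  obtain a where a: "\<forall>i<R. (phi_end ^^ i) a \<in> Hc 0" "(phi_end ^^ R) a = a + f"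
    using surj_at_window[OF s f R] by (elim exE conjE)
  define G where "G = (\<lambda>i. (phi_end ^^ i) a)"
  have f0: "f \<in> Hc 0" by (rule Hc_mono[OF f]) simp
  have G0: "G 0 = a" by (simp add: G_def)
  have aH: "a \<in> Hc 0" using a(1) R by auto
  have aE: "a \<in> EndV" using HcD(1)[OF aH] .
  have GE: "G i \<in> EndV" for i unfolding G_def using EndV_phi_pow[OF aE] .
  have GH: "G i \<in> Hc 0" if "i \<le> R" for i
    using that a Hc_add[OF aH f0] by (cases "i = R") (auto simp: G_def)
  have pw: "(phi_end ^^ i) (part P (G j)) = part P (G (i + j))" for i j P
    unfolding phi_pow_part[OF GE] by (simp add: G_def funpow_add)
  have ipw: "(ipe ^^ i) (part P (G (i + j))) = part P (G j)" for i j P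
    unfolding pw[symmetric] by simp
  have f_eq: "part P f = part P (G R) - part P (G 0)" for P
    unfolding part_diff[symmetric] using a(2) by (simp add: G_def)
  have plus: "part (>) (G i) \<in> Hc 0" if "T \<le> i" for i
  proof -
    have "(phi_end ^^ i) (part (>) (G 0)) \<in> Hc (int (i div t) - c0)" using c0[rule_format, OF GH[of 0], of i] by blast
    then show ?thesis unfolding pw using Hc_mono T[OF that] by simp
  qed
  have minus: "(ipe ^^ i) (part (<) (G R)) \<in> Hc 0" if "T \<le> i" for i
  proof -
    have "(ipe ^^ i) (part (<) (G R)) \<in> Hc (int (i div t) - c0)" using c0[rule_format, OF GH[of R], of i] by blast
    then show ?thesis using Hc_mono T[OF that] by simp
  qed
  have minus': "part (<) (G i) \<in> Hc 0" if "i + T \<le> R" for i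
    using minus[of "R - i"] ipw[of "R - i" "(<)" i] that by simp
  have split: "G i = part (>) (G i) + part (=) (G i) + part (<) (G i)" for i by (rule part_sum[OF GE])
  have zero: "part (=) (G i) \<in> Hc 0" if "T \<le> i" "i + T \<le> R" for i
  proof -
    have "part (=) (G i) = G i - part (>) (G i) - part (<) (G i)"
      by (subst (2) split) simp
    then show ?thesis using Hc_diff[OF Hc_diff[OF GH plus] minus'] that by simp
  qed
  define v where "v = part (=) (G (T + J))"
  have vV: "v \<in> VP (=)" by (simp add: VP_def v_def part_part)
  have "(phi_end ^^ i) v \<in> Hc 0" if "i \<le> J" for i
    unfolding v_def pw using zero[of "i + (T + J)"] that by (simp add: R_def)
  then have vp: "(phi_end ^^ i) v \<in> Hc 0" for i using J[rule_format, OF vV] by blast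
  have "(ipe ^^ i) v \<in> Hc 0" if "i \<le> J" for i
    unfolding v_def using zero[of "T + J - i"] ipw[of i "(=)" "T + J - i"] that by (simp add: R_def)
  then have vi: "(ipe ^^ i) v \<in> Hc 0" for i using J[rule_format, OF vV] by blast
  have zero': "part (=) (G i) \<in> Hc 0" for i
  proof (cases "T + J \<le> i")
    case True
    then show ?thesis using vp[of "i - (T + J)"] pw[of "i - (T + J)" "(=)" "T + J"] by (simp add: v_def)
  next
    case False
    then show ?thesis using vi[of "T + J - i"] ipw[of "T + J - i" "(=)" i] by (simp add: v_def)
  qed
  have zeroi: "(ipe ^^ l) (part (=) (G i)) \<in> Hc 0" for l i
  proof (cases "l \<le> i")
    case True
    then show ?thesis using ipw[of l "(=)" "i - l"] zero'[of "i - l"] by simp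
  next
    case False
    have "(ipe ^^ l) (part (=) (G i)) = (ipe ^^ (l - i)) ((ipe ^^ i) (part (=) (G (i + 0))))"
      using False by (simp add: funpow_add[symmetric, THEN fun_cong, unfolded o_apply])
    also have "\<dots> = (ipe ^^ (l - i)) ((ipe ^^ (T + J)) (part (=) (G (T + J + 0))))" by (simp only: ipw)
    also have "\<dots> = (ipe ^^ (l - i + (T + J))) v" by (simp add: v_def funpow_add)
    finally show ?thesis using vi by simp
  qed
  \<comment> \<open>The first \<open>T\<close> iterates, too early for contraction, are handled by
    subtraction: there the zero and negative parts are known to be integral.\<close>
  have plus': "part (>) (G i) \<in> Hc 0" for i
  proof (cases "T \<le> i")
    case False
    have "part (>) (G i) = G i - part (=) (G i) - part (<) (G i)"
      by (subst (2) split) simp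
    then show ?thesis using Hc_diff[OF Hc_diff[OF GH zero'] minus', of i i] False by (simp add: R_def)
  qed (rule plus)
  have minusi: "(ipe ^^ i) (part (<) (G R)) \<in> Hc 0" for i
  proof (cases "T \<le> i")
    case False
    then have iR: "i \<le> R" by (simp add: R_def)
    have "part (<) (G (R - i)) = G (R - i) - part (=) (G (R - i)) - part (>) (G (R - i))"
      by (subst (2) split) simp
    then have "part (<) (G (R - i)) \<in> Hc 0" using Hc_diff[OF Hc_diff[OF GH zero'] plus', of "R - i" "R - i"] by simp
    then show ?thesis using ipw[of i "(<)" "R - i"] iR by simp
  qed (rule minus)
  have minusi0: "(ipe ^^ i) (part (<) (G 0)) \<in> Hc 0" for i
  proof -
    have "(ipe ^^ i) (part (<) (G 0)) = (ipe ^^ i) ((ipe ^^ R) (part (<) (G (R + 0))))" by (simp only: ipw)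
    also have "\<dots> = (ipe ^^ (i + R)) (part (<) (G R))" by (simp add: funpow_add)
    finally show ?thesis using minusi by simp
  qed
  show "(phi_end ^^ i) (part (>) f) \<in> Hc 0" "(phi_end ^^ i) (part (=) f) \<in> Hc 0"
    unfolding f_eq phi_pow_diff pw by (rule Hc_diff[OF plus' plus'], rule Hc_diff[OF zero' zero'])
  show "(ipe ^^ i) (part (=) f) \<in> Hc 0" "(ipe ^^ i) (part (<) f) \<in> Hc 0"
    unfolding f_eq ipe_pow_diff by (rule Hc_diff[OF zeroi zeroi], rule Hc_diff[OF minusi minusi0])
qed

section \<open>Comparison of the eigenbasis with the slope decomposition\<close>

lemma coord_\<phi>_pow_t: "i < n \<Longrightarrow> E.coord ((\<phi> ^^ t) v) i = fls_X powi r i * fls_frob (q ^ t) (E.coord v i)"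
proof -
  assume i: "i < n"
  have "(\<phi> ^^ t) v = (\<Sum>k<n. scale (fls_X powi r k * fls_frob (q ^ t) (E.coord v k)) (e k))"
    by (subst E.coord_expand[of v]) (simp add: \<phi>_funpow_sum \<phi>_funpow_scale eig mult.commute)
  then show ?thesis using E.coord_comb[OF i, of "\<lambda>k. fls_X powi r k * fls_frob (q ^ t) (E.coord v k)"] by (simp only:)
qed

lemma coord_\<phi>_pow_ta:
  assumes "i < n"
  shows "ordge (d + int a * r i) (E.coord ((\<phi> ^^ (t * a)) v) i) \<longleftrightarrow> ordge d (E.coord v i)"
proof (induction a)
  case (Suc a)
  interpret F: frobenius_field "q ^ t" "TYPE('k)" by (rule frobenius_field_power[OF t_pos])
  have "(\<phi> ^^ (t * Suc a)) v = (\<phi> ^^ t) ((\<phi> ^^ (t * a)) v)" by (simp add: funpow_add)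
  then have "E.coord ((\<phi> ^^ (t * Suc a)) v) i = fls_X powi r i * F.frob (E.coord ((\<phi> ^^ (t * a)) v) i)"
    using coord_\<phi>_pow_t[OF assms] by simp
  then show ?case using Suc by (simp add: ordge_X_powi_mult algebra_simps)
qed simp

lemma coord_\<phi>_pow_t_eq_0: "i < n \<Longrightarrow> E.coord ((\<phi> ^^ t) v) i = 0 \<longleftrightarrow> E.coord v i = 0"
proof -
  assume i: "i < n"
  interpret F: frobenius_field "q ^ t" "TYPE('k)" by (rule frobenius_field_power[OF t_pos])
  show ?thesis unfolding coord_\<phi>_pow_t[OF i] by simp
qed

text \<open>The span of the eigenvectors with \<open>r i / t = \<alpha>\<close>, which is zero if
  there are none.\<close>

definition slope_space :: "rat \<Rightarrow> 'v set" where
  "slope_space \<alpha> = {v. \<forall>i<n. E.coord v i \<noteq> 0 \<longrightarrow> of_int (r i) = \<alpha> * of_nat t}"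

lemma subspace_slope_space: "subspace (slope_space \<alpha>)"
  unfolding subspace_def slope_space_def by (auto simp: E.coord_add E.coord_scale)

text \<open>Applying \<open>\<phi> ^^ (t * (s * l))\<close> to the invariant lattice scales it by
  \<epsilon>^(r' t l) but scales coordinate i by \<epsilon>^(r i s l). Coordinates of the lattice
  are bounded below, so used in both directions a mismatch \<rho> would give coordinate i
  arbitrarily high order, forcing it to vanish.\<close>

lemma isoclinic_subset:
  assumes "isoclinic \<alpha> W"
  shows "W \<subseteq> slope_space \<alpha>"
proof -
  interpret m: Modules.module "int_scale scale" by (rule module_int_scale)
  obtain r' :: int and s L B where s: "s > 0" "\<alpha> = of_int r' / of_nat s"
    and L: "(\<phi> ^^ s) ` L = scale (fls_X powi r') ` L"
    and B: "finite B" "span B = W" "m.span B = L"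
    using assms unfolding isoclinic_def lattice_of_def by blast
  have "\<forall>x. \<exists>c. ordge c (case x of (v, i) \<Rightarrow> E.coord v i)" using ordge_ex by blast
  then obtain g where g: "\<And>x. ordge (g x) (case x of (v, i) \<Rightarrow> E.coord v i)" by metis
  obtain c where c: "\<forall>x\<in>B \<times> {..<n}. c \<le> g x" using finite_lower_bound[of "B \<times> {..<n}" g] B(1) by blast
  define D where "D = {v. \<forall>i<n. ordge c (E.coord v i)}"
  have "m.subspace D"
    unfolding m.subspace_def
  proof (intro conjI ballI allI)
    show "0 \<in> D" by (simp add: D_def)
    show "x + y \<in> D" if "x \<in> D" "y \<in> D" for x y
      using that by (auto simp: D_def E.coord_add intro: ordge_add)
    show "int_scale scale a x \<in> D" if "x \<in> D" for a x
      using that ordge_mult[of 0 "fps_to_fls a" c] by (auto simp: D_def int_scale_def E.coord_scale)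
  qed
  moreover have "B \<subseteq> D"
  proof
    fix v assume v: "v \<in> B"
    have "ordge c (E.coord v i)" if "i < n" for i
    proof -
      have "c \<le> g (v, i)" using c v that by blast
      then show ?thesis using ordge_mono[OF g[of "(v, i)"], of c] by simp
    qed
    then show "v \<in> D" by (simp add: D_def)
  qed
  ultimately have LD: "L \<subseteq> D" using m.span_minimal B(3) by blast
  have frobX: "(\<phi> ^^ l) (scale (fls_X powi c) v) = scale (fls_X powi c) ((\<phi> ^^ l) v)" for l c v
    by (induction l) (simp_all add: \<phi>_scale)
  have pow: "(\<phi> ^^ (s * l)) ` L = scale (fls_X powi (r' * int l)) ` L" for l
  proof (induction l)
    case (Suc l)
    have "(\<phi> ^^ (s * Suc l)) ` L = (\<phi> ^^ s) ` ((\<phi> ^^ (s * l)) ` L)" by (simp add: funpow_add image_comp)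
    also have "\<dots> = scale (fls_X powi (r' * int l)) ` ((\<phi> ^^ s) ` L)" unfolding Suc by (simp add: image_image frobX)
    also have "\<dots> = scale (fls_X powi (r' * int l) * fls_X powi r') ` L" unfolding L by (simp add: image_image)
    also have "fls_X powi (r' * int l) * fls_X powi r' = (fls_X powi (r' * int (Suc l)) :: 'k fls)"
      by (subst power_int_add[symmetric]) (auto simp: algebra_simps)
    finally show ?case .
  qed simp
  have "v \<in> slope_space \<alpha>" if v: "v \<in> L" for v
    unfolding slope_space_def
  proof (intro CollectI allI impI)
    fix i assume i: "i < n" "E.coord v i \<noteq> 0"
    define \<rho> where "\<rho> = int s * r i - r' * int t"
    have "ordge (c + int l * \<rho>) (E.coord v i)" "ordge (c - int l * \<rho>) (E.coord v i)" for l
    proof -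
      have pow': "(\<phi> ^^ (t * (s * l))) ` L = scale (fls_X powi (r' * int (t * l))) ` L"
        using pow[of "t * l"] by (simp add: mult_ac)
      have "(\<phi> ^^ (t * (s * l))) v \<in> scale (fls_X powi (r' * int (t * l))) ` L" using v pow' by blast
      then obtain w where w: "w \<in> L" "(\<phi> ^^ (t * (s * l))) v = scale (fls_X powi (r' * int (t * l))) w" by blast
      have "ordge (c + r' * int (t * l)) (E.coord ((\<phi> ^^ (t * (s * l))) v) i)"
        unfolding w(2) E.coord_scale ordge_X_powi_mult using LD w(1) i(1) by (auto simp: D_def)
      moreover have "c + r' * int (t * l) = (c - int l * \<rho>) + int (s * l) * r i" by (simp add: \<rho>_def algebra_simps)
      ultimately show "ordge (c - int l * \<rho>) (E.coord v i)" using coord_\<phi>_pow_ta[OF i(1)] by metis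
      have "scale (fls_X powi (r' * int (t * l))) v \<in> (\<phi> ^^ (t * (s * l))) ` L" using v pow' by blast
      then obtain w where w: "w \<in> L" "scale (fls_X powi (r' * int (t * l))) v = (\<phi> ^^ (t * (s * l))) w" by blast
      have "ordge (c + int (s * l) * r i) (E.coord (scale (fls_X powi (r' * int (t * l))) v) i)"
        unfolding w(2) coord_\<phi>_pow_ta[OF i(1)] using LD w(1) i(1) by (auto simp: D_def)
      then show "ordge (c + int l * \<rho>) (E.coord v i)"
        unfolding E.coord_scale ordge_X_powi_mult by (simp add: \<rho>_def algebra_simps)
    qed
    then have bd: "ordge (c + int l * \<bar>\<rho>\<bar>) (E.coord v i)" for l by (cases "\<rho> \<ge> 0") (simp_all add: abs_if)
    have "\<rho> = 0"
    proof (rule ccontr)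
      assume "\<rho> \<noteq> 0"
      have "ordge d (E.coord v i)" for d
      proof (rule ordge_mono[OF bd[of "nat (d - c)"]])
        have "int (nat (d - c)) * 1 \<le> int (nat (d - c)) * \<bar>\<rho>\<bar>" using \<open>\<rho> \<noteq> 0\<close> by (intro mult_left_mono) auto
        moreover have "d - c \<le> int (nat (d - c))" by simp
        ultimately show "d \<le> c + int (nat (d - c)) * \<bar>\<rho>\<bar>" by linarith
      qed
      then show False using ordge_all_imp_0 i(2) by blast
    qed
    then have "of_int (r i) * of_nat s = (of_int r' * of_nat t :: rat)"
      by (simp add: \<rho>_def mult.commute) (metis of_int_mult of_int_of_nat_eq)
    then show "of_int (r i) = \<alpha> * of_nat t" unfolding s(2) using s(1) by (simp add: field_simps)
  qed
  then have "B \<subseteq> slope_space \<alpha>" using B(3) m.span_superset by blast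
  then show ?thesis using span_minimal[OF _ subspace_slope_space] B(2) by blast
qed

text \<open>Eigenvectors of different exponents do not mix. A preimage of v is the (t - 1)-st
  iterate of the preimage under \<open>\<phi> ^^ t\<close>, which is diagonal.\<close>

lemma slope_space_\<phi>: "\<phi> ` slope_space \<alpha> = slope_space \<alpha>"
proof -
  have sub: "\<phi> v \<in> slope_space \<alpha>" if v: "v \<in> slope_space \<alpha>" for v
    unfolding slope_space_def
  proof (intro CollectI allI impI, rule ccontr)
    fix i assume i: "i < n" "E.coord (\<phi> v) i \<noteq> 0" "of_int (r i) \<noteq> \<alpha> * of_nat t"
    have "E.coord (\<phi> v) i = (\<Sum>a<n. frob (E.coord v a) * E.coord (\<phi> (e a)) i)"
      by (subst E.coord_expand[of v]) (simp add: \<phi>_sum \<phi>_scale E.coord_sum E.coord_scale)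
    also have "\<dots> = 0"
    proof (intro sum.neutral ballI)
      fix a assume a: "a \<in> {..<n}"
      show "frob (E.coord v a) * E.coord (\<phi> (e a)) i = 0"
      proof (cases "E.coord v a = 0")
        case False
        then have "r i \<noteq> r a" using v a i(3) by (auto simp: slope_space_def)
        then have "E.coord (\<phi> (e a)) i = 0" using coord_same_slope[OF i(1) _ \<phi>_eigen, of a] a by auto
        then show ?thesis by simp
      qed simp
    qed
    finally show False using i(2) by simp
  qed
  have pow: "(\<phi> ^^ l) v \<in> slope_space \<alpha>" if "v \<in> slope_space \<alpha>" for v l
    using that by (induction l) (auto intro: sub)
  have "v \<in> \<phi> ` slope_space \<alpha>" if v: "v \<in> slope_space \<alpha>" for v
  proof -
    define w where "w = (ips ^^ t) v"
    have w: "(\<phi> ^^ t) w = v" by (simp add: w_def ips_funpow)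
    have "w \<in> slope_space \<alpha>"
      using v unfolding slope_space_def w[symmetric] by (auto simp: coord_\<phi>_pow_t_eq_0)
    moreover have "v = \<phi> ((\<phi> ^^ (t - 1)) w)" unfolding w[symmetric] using t_pos
      by (metis Suc_diff_1 funpow.simps(2) o_apply)
    ultimately show ?thesis using pow by blast
  qed
  then show ?thesis using sub by blast
qed

text \<open>The eigenvectors of this slope generate a lattice on which \<open>\<phi> ^^ t\<close>
  acts as \<epsilon>^(r k) up to an automorphism of the lattice.\<close>

lemma isoclinic_slope_space:
  assumes k: "k < n" "of_int (r k) = \<alpha> * of_nat t"
  shows "isoclinic \<alpha> (slope_space \<alpha>)"
proof -
  interpret m: Modules.module "int_scale scale" by (rule module_int_scale)
  define I where "I = {i. i < n \<and> r i = r k}"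
  define L where "L = {v. \<forall>i<n. ordge 0 (E.coord v i) \<and> (E.coord v i \<noteq> 0 \<longrightarrow> r i = r k)}"
  have W: "slope_space \<alpha> = {v. \<forall>i<n. E.coord v i \<noteq> 0 \<longrightarrow> r i = r k}"
    unfolding slope_space_def k(2)[symmetric] by simp
  have fI: "finite I" by (simp add: I_def)
  have comb: "v = (\<Sum>i\<in>I. scale (E.coord v i) (e i))" if "\<forall>i<n. E.coord v i \<noteq> 0 \<longrightarrow> r i = r k" for v
  proof -
    have "v = (\<Sum>i<n. scale (E.coord v i) (e i))" by (rule E.coord_expand)
    also have "\<dots> = (\<Sum>i\<in>I. scale (E.coord v i) (e i))"
      by (rule sum.mono_neutral_right) (use that in \<open>auto simp: I_def\<close>)
    finally show ?thesis .
  qed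
  have eW: "e ` I \<subseteq> slope_space \<alpha>" unfolding W by (auto simp: I_def E.coord_basis split: if_splits)
  have span: "span (e ` I) = slope_space \<alpha>"
  proof
    show "span (e ` I) \<subseteq> slope_space \<alpha>" by (rule span_minimal[OF eW subspace_slope_space])
    show "slope_space \<alpha> \<subseteq> span (e ` I)"
    proof
      fix v assume "v \<in> slope_space \<alpha>"
      then have "v = (\<Sum>i\<in>I. scale (E.coord v i) (e i))" using comb unfolding W by blast
      also have "\<dots> \<in> span (e ` I)" by (intro span_sum span_scale span_base) auto
      finally show "v \<in> span (e ` I)" .
    qed
  qed
  have sub: "m.subspace L"
    unfolding m.subspace_def
  proof (intro conjI ballI allI)
    show "0 \<in> L" by (simp add: L_def)
    show "x + y \<in> L" if "x \<in> L" "y \<in> L" for x y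
      using that by (auto simp: L_def E.coord_add intro: ordge_add)
    show "int_scale scale a x \<in> L" if "x \<in> L" for a x
      using that ordge_mult[of 0 "fps_to_fls a" 0] by (auto simp: L_def int_scale_def E.coord_scale)
  qed
  have mspan: "m.span (e ` I) = L"
  proof
    show "m.span (e ` I) \<subseteq> L"
      by (rule m.span_minimal[OF _ sub]) (auto simp: L_def I_def E.coord_basis split: if_splits)
    show "L \<subseteq> m.span (e ` I)"
    proof
      fix v assume v: "v \<in> L"
      have "\<forall>i. \<exists>f. i < n \<longrightarrow> E.coord v i = fps_to_fls f" using v ordge_0_fps by (auto simp: L_def)
      then obtain f where f: "\<And>i. i < n \<Longrightarrow> E.coord v i = fps_to_fls (f i)" by metis
      have "v = (\<Sum>i\<in>I. scale (E.coord v i) (e i))" using v by (intro comb) (auto simp: L_def)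
      also have "\<dots> = (\<Sum>i\<in>I. int_scale scale (f i) (e i))" by (rule sum.cong) (auto simp: int_scale_def f I_def)
      also have "\<dots> \<in> m.span (e ` I)" by (intro m.span_sum m.span_scale m.span_base) auto
      finally show "v \<in> m.span (e ` I)" .
    qed
  qed
  have key: "scale (fls_X powi (- r k)) ((\<phi> ^^ t) v) \<in> L \<longleftrightarrow> v \<in> L" for v
  proof -
    have "E.coord (scale (fls_X powi (- r k)) ((\<phi> ^^ t) v)) i = 0 \<longleftrightarrow> E.coord v i = 0" if "i < n" for i
      using coord_\<phi>_pow_t_eq_0[OF that] by (simp add: E.coord_scale)
    moreover have "ordge 0 (E.coord (scale (fls_X powi (- r k)) ((\<phi> ^^ t) v)) i) \<longleftrightarrow> ordge 0 (E.coord v i)"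
      if "i < n" "r i = r k" for i
      using coord_\<phi>_pow_ta[OF that(1), of 0 1 v] that(2) unfolding E.coord_scale ordge_X_powi_mult by simp
    ultimately show ?thesis by (auto simp: L_def) (metis ordge_0)+
  qed
  have "(\<phi> ^^ t) ` L = scale (fls_X powi r k) ` L"
  proof
    show "(\<phi> ^^ t) ` L \<subseteq> scale (fls_X powi r k) ` L"
    proof
      fix w assume "w \<in> (\<phi> ^^ t) ` L"
      then obtain v where v: "v \<in> L" "w = (\<phi> ^^ t) v" by blast
      have "w = scale (fls_X powi r k) (scale (fls_X powi (- r k)) ((\<phi> ^^ t) v))" by (simp add: v power_int_minus)
      then show "w \<in> scale (fls_X powi r k) ` L" using key v(1) by blast
    qed
    show "scale (fls_X powi r k) ` L \<subseteq> (\<phi> ^^ t) ` L"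
    proof
      fix w assume "w \<in> scale (fls_X powi r k) ` L"
      then obtain u where u: "u \<in> L" "w = scale (fls_X powi r k) u" by blast
      define v where "v = (ips ^^ t) w"
      have v: "(\<phi> ^^ t) v = w" by (simp add: v_def ips_funpow)
      have "u = scale (fls_X powi (- r k)) ((\<phi> ^^ t) v)" unfolding v u(2) by (simp add: power_int_minus)
      then have "v \<in> L" using key[of v] u(1) by simp
      then show "w \<in> (\<phi> ^^ t) ` L" using v by blast
    qed
  qed
  moreover have "independent (e ` I)"
    using E.b_indep by (rule independent_mono) (auto simp: I_def)
  ultimately show ?thesis
    unfolding isoclinic_def lattice_of_def
    using k fI span mspan t_pos
    by (intro exI[of _ "r k"] exI[of _ t] exI[of _ L] conjI exI[of _ "e ` I"]) (auto simp: field_simps)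
qed

text \<open>One inclusion is \<open>isoclinic_subset\<close>. For the other, a nonzero vector has a
  nonzero coordinate, whose index makes the whole slope space isoclinic; the zero vector provides no
  such index and lies in any span.\<close>

lemma slope_part_eq: "slope_part \<alpha> = slope_space \<alpha>"
proof
  show "slope_part \<alpha> \<subseteq> slope_space \<alpha>"
    unfolding slope_part_def by (rule span_minimal[OF _ subspace_slope_space]) (use isoclinic_subset in blast)
  show "slope_space \<alpha> \<subseteq> slope_part \<alpha>"
  proof
    fix v assume v: "v \<in> slope_space \<alpha>"
    show "v \<in> slope_part \<alpha>"
    proof (cases "v = 0")
      case True
      then show ?thesis by (simp add: slope_part_def span_zero)
    next
      case False
      then obtain k where k: "k < n" "E.coord v k \<noteq> 0" using E.coord_eqI[of v 0] by auto
      then have "isoclinic \<alpha> (slope_space \<alpha>)" using v by (intro isoclinic_slope_space[of k]) (auto simp: slope_space_def)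
      then have "v \<in> \<Union>{W. subspace W \<and> \<phi> ` W = W \<and> isoclinic \<alpha> W}"
        using v subspace_slope_space slope_space_\<phi> by blast
      then show ?thesis unfolding slope_part_def by (rule span_base)
    qed
  qed
qed

lemma VP_iff: "f \<in> VP P \<longleftrightarrow> f \<in> EndV \<and> (\<forall>i<n. \<forall>j<n. E.ent f i j \<noteq> 0 \<longrightarrow> P (r i) (r j))"
proof
  assume "f \<in> VP P"
  then have f: "f \<in> EndV" "part P f = f" by (auto simp: VP_def)
  have "P (r i) (r j)" if "i < n" "j < n" "E.ent f i j \<noteq> 0" for i j
    using ent_part[OF that(1,2), of P f] that(3) unfolding f(2) by (auto split: if_splits)
  then show "f \<in> EndV \<and> (\<forall>i<n. \<forall>j<n. E.ent f i j \<noteq> 0 \<longrightarrow> P (r i) (r j))" using f by blast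
next
  assume f: "f \<in> EndV \<and> (\<forall>i<n. \<forall>j<n. E.ent f i j \<noteq> 0 \<longrightarrow> P (r i) (r j))"
  then have "part P f = f" by (intro E_eqI) (auto simp: ent_part)
  then show "f \<in> VP P" using f by (simp add: VP_def)
qed

lemma module_end_scale: "Modules.module end_scale"
  by unfold_locales (simp_all add: end_scale_def fun_eq_iff scale_right_distrib scale_left_distrib)

lemma module_int_end_scale: "Modules.module (int_scale end_scale)"
  by unfold_locales
    (simp_all add: int_scale_def end_scale_def fun_eq_iff scale_right_distrib scale_left_distrib fls_times_fps_to_fls)

text \<open>\<open>P\<close> compares target with source exponents, \<open>Q\<close> source with
  target slopes. The larger inclusion writes an endomorphism as a sum of multiples of matrix units
  in the eigenbasis, each of which lies in one \<open>slope_hom\<close>.\<close>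

lemma span_slope_hom:
  assumes PQ: "\<And>i j. i < n \<Longrightarrow> j < n \<Longrightarrow> P (r i) (r j) \<longleftrightarrow> Q (of_int (r j) / of_nat t) (of_int (r i) / of_nat t)"
  shows "Modules.module.span end_scale (\<Union>{slope_hom \<alpha> \<beta> | \<alpha> \<beta>. Q \<alpha> \<beta>}) = VP P"
proof
  interpret m: Modules.module end_scale by (rule module_end_scale)
  let ?U = "\<Union>{slope_hom \<alpha> \<beta> | \<alpha> \<beta>. Q \<alpha> \<beta>}"
  have sub: "m.subspace (VP P)"
    unfolding m.subspace_def
  proof (intro conjI ballI allI)
    show "0 \<in> VP P" by (simp add: VP_def part_0)
    show "x + y \<in> VP P" if "x \<in> VP P" "y \<in> VP P" for x y
      using that by (simp add: VP_def part_add EndV_add)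
    show "end_scale a x \<in> VP P" if "x \<in> VP P" for a x
      using that by (simp add: VP_def part_scale EndV_scale)
  qed
  have eS: "e j \<in> slope_part (of_int (r j) / of_nat t)" if "j < n" for j
    unfolding slope_part_eq slope_space_def using that t_pos by (auto simp: E.coord_basis)
  show "m.span ?U \<subseteq> VP P"
  proof (rule m.span_minimal[OF _ sub], rule subsetI)
    fix f assume "f \<in> ?U"
    then obtain \<alpha> \<beta> where f: "Q \<alpha> \<beta>" "f \<in> slope_hom \<alpha> \<beta>" by blast
    have fE: "f \<in> EndV" and f1: "f ` slope_part \<alpha> \<subseteq> slope_part \<beta>"
      and f2: "\<And>\<gamma> v. \<gamma> \<noteq> \<alpha> \<Longrightarrow> v \<in> slope_part \<gamma> \<Longrightarrow> f v = 0"
      using f(2) by (auto simp: slope_hom_def)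
    have "P (r i) (r j)" if ij: "i < n" "j < n" and nz: "E.ent f i j \<noteq> 0" for i j
    proof -
      have a: "of_int (r j) / of_nat t = \<alpha>" using f2[OF _ eS[OF ij(2)]] nz E.coord_0 unfolding E.ent_def by metis
      then have "f (e j) \<in> slope_part \<beta>" using f1 eS[OF ij(2)] by blast
      then have "of_int (r i) = \<beta> * of_nat t" using nz ij by (auto simp: slope_part_eq slope_space_def E.ent_def)
      then have "of_int (r i) / of_nat t = \<beta>" using t_pos by simp
      then show ?thesis using PQ[OF ij] a f(1) by simp
    qed
    then show "f \<in> VP P" unfolding VP_iff using fE by blast
  qed
  show "VP P \<subseteq> m.span ?U"
  proof
    fix f assume f: "f \<in> VP P"
    have fE: "f \<in> EndV" using f by (simp add: VP_iff)
    define u where "u = (\<lambda>(i, j) v. scale (E.ent f i j * E.coord v j) (e i))"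
    have "f = (\<Sum>x\<in>{..<n} \<times> {..<n}. u x)"
    proof
      fix v
      have "f v = (\<Sum>i<n. scale (\<Sum>j<n. E.ent f i j * E.coord v j) (e i))"
        using E.coord_expand[of "f v"] E.linear_coord[of f v] fE by (simp add: EndV_iff)
      also have "\<dots> = (\<Sum>i<n. \<Sum>j<n. u (i, j) v)" by (simp add: u_def scale_sum_left)
      also have "\<dots> = (\<Sum>x\<in>{..<n} \<times> {..<n}. u x v)" by (simp add: sum.cartesian_product)
      finally show "f v = (\<Sum>x\<in>{..<n} \<times> {..<n}. u x) v" by (simp only: fun_sum_apply)
    qed
    also have "\<dots> \<in> m.span ?U"
    proof (rule m.span_sum)
      fix x assume "x \<in> {..<n} \<times> {..<n}"
      then obtain i j where x: "x = (i, j)" and ij: "i < n" "j < n" by blast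
      show "u x \<in> m.span ?U"
      proof (cases "E.ent f i j = 0")
        case True
        then have "u x = 0" by (simp add: x u_def fun_eq_iff)
        then show ?thesis by (simp add: m.span_zero)
      next
        case False
        let ?a = "of_int (r j) / of_nat t" and ?b = "of_int (r i) / of_nat t"
        have "Q ?a ?b" using f False ij PQ[OF ij] by (auto simp: VP_iff)
        moreover have "u x \<in> slope_hom ?a ?b"
          unfolding slope_hom_def
        proof (intro CollectI conjI allI impI ballI)
          show "u x \<in> EndV" unfolding EndV_iff2
            by (simp add: x u_def E.coord_add E.coord_scale scale_left_distrib distrib_left mult_ac)
          show "u x ` slope_part ?a \<subseteq> slope_part ?b"
            using eS[OF ij(1)] by (auto simp: x u_def slope_part_eq intro!: subspace_scale[OF subspace_slope_space])
          fix \<gamma> v assume "\<gamma> \<noteq> ?a" "v \<in> slope_part \<gamma>"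
          then have "E.coord v j = 0" using ij t_pos by (auto simp: slope_part_eq slope_space_def)
          then show "u x v = 0" by (simp add: x u_def)
        qed
        ultimately show ?thesis by (intro m.span_base) blast
      qed
    qed
    finally show "f \<in> m.span ?U" .
  qed
qed

lemma V_pos_eq: "V_pos = VP (>)"
  unfolding V_pos_def using t_pos by (intro span_slope_hom) (simp add: divide_less_cancel)

lemma V_neg_eq: "V_neg = VP (<)"
proof -
  have "\<Union>{slope_hom \<beta> \<alpha> | \<alpha> \<beta>. \<alpha> < \<beta>} = \<Union>{slope_hom \<alpha> \<beta> | \<alpha> \<beta>. \<beta> < \<alpha>}" by blast
  then show ?thesis
    unfolding V_neg_def using t_pos by (simp only:) (intro span_slope_hom, simp add: divide_less_cancel)
qed

lemma V_zero_eq: "V_zero = VP (=)"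
proof -
  have "\<Union>{slope_hom \<alpha> \<alpha> | \<alpha>. True} = \<Union>{slope_hom \<alpha> \<beta> | \<alpha> \<beta>. \<alpha> = \<beta>}" by blast
  then show ?thesis
    unfolding V_zero_def by (simp only:) (intro span_slope_hom, auto simp: gr_implies_not0[OF t_pos])
qed

section \<open>The maximal stable submodules\<close>

lemma VP_add: "v \<in> VP P \<Longrightarrow> w \<in> VP P \<Longrightarrow> v + w \<in> VP P"
  by (simp add: VP_def part_add EndV_add)

lemma VP_scale: "v \<in> VP P \<Longrightarrow> end_scale a v \<in> VP P"
  by (simp add: VP_def part_scale EndV_scale)

lemma VP_phi_end: "v \<in> VP P \<Longrightarrow> phi_end v \<in> VP P"
  using phi_end_part[of v P] by (simp add: VP_def EndV_phi_end)

lemma VP_ipe: "v \<in> VP P \<Longrightarrow> ipe v \<in> VP P"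
  using ipe_pow_part[of v 1 P] by (simp add: VP_def EndV_ipe)

lemma ipe_pow_add: "(ipe ^^ l) (f + g) = (ipe ^^ l) f + (ipe ^^ l) g"
  by (induction l) (simp_all only: funpow.simps id_apply o_apply ipe_add)

lemma phi_pow_scale: "ordge 0 c \<Longrightarrow> \<exists>d. ordge 0 d \<and> (\<forall>f. (phi_end ^^ l) (end_scale c f) = end_scale d ((phi_end ^^ l) f))"
proof (induction l)
  case (Suc l)
  then obtain d where "ordge 0 d" "\<forall>f. (phi_end ^^ l) (end_scale c f) = end_scale d ((phi_end ^^ l) f)" by blast
  then show ?case by (intro exI[of _ "frob d"]) (simp add: phi_end_scale)
qed auto

lemma ipe_pow_scale: "ordge 0 c \<Longrightarrow> \<exists>d. ordge 0 d \<and> (\<forall>f. (ipe ^^ l) (end_scale c f) = end_scale d ((ipe ^^ l) f))"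
proof (induction l)
  case (Suc l)
  then obtain d where d: "ordge 0 d" "\<forall>f. (ipe ^^ l) (end_scale c f) = end_scale d ((ipe ^^ l) f)" by blast
  obtain d' where d': "frob d' = d" using frob_surj by blast
  then have "ordge 0 d'" using d(1) by (metis ordge_frob)
  then show ?case using d(2) ipe_scale[of d'] d' by (intro exI[of _ d']) simp
qed auto

lemma submodule_phi_pow: "end_submodule {v\<in>VP P. \<forall>i. (phi_end ^^ i) v \<in> Hc 0}"
proof -
  interpret m: Modules.module "int_scale end_scale" by (rule module_int_end_scale)
  show ?thesis
    unfolding end_submodule_def m.subspace_def
  proof (intro conjI ballI allI)
    have "(phi_end ^^ i) 0 = 0" for i by (induction i) (simp_all only: funpow.simps id_apply o_apply phi_end_0)
    then show "0 \<in> {v\<in>VP P. \<forall>i. (phi_end ^^ i) v \<in> Hc 0}" by (simp add: VP_def part_0)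
    show "x + y \<in> {v\<in>VP P. \<forall>i. (phi_end ^^ i) v \<in> Hc 0}"
      if "x \<in> {v\<in>VP P. \<forall>i. (phi_end ^^ i) v \<in> Hc 0}" "y \<in> {v\<in>VP P. \<forall>i. (phi_end ^^ i) v \<in> Hc 0}" for x y
      using that by (simp add: phi_pow_add Hc_add VP_add)
    show "int_scale end_scale c x \<in> {v\<in>VP P. \<forall>i. (phi_end ^^ i) v \<in> Hc 0}"
      if x: "x \<in> {v\<in>VP P. \<forall>i. (phi_end ^^ i) v \<in> Hc 0}" for c x
    proof -
      have "(phi_end ^^ i) (end_scale (fps_to_fls c) x) \<in> Hc 0" for i
      proof -
        obtain d where d: "ordge 0 d" "\<forall>f. (phi_end ^^ i) (end_scale (fps_to_fls c) f) = end_scale d ((phi_end ^^ i) f)"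
          using phi_pow_scale[OF ordge_fps[of c], of i] by (elim exE conjE)
        show ?thesis unfolding d(2)[rule_format] using Hc_scale[OF d(1), of "(phi_end ^^ i) x" 0] x by simp
      qed
      then show ?thesis using x by (simp add: int_scale_def VP_scale)
    qed
  qed
qed

lemma submodule_ipe_pow: "end_submodule {v\<in>VP P. \<forall>i. (ipe ^^ i) v \<in> Hc 0}"
proof -
  interpret m: Modules.module "int_scale end_scale" by (rule module_int_end_scale)
  show ?thesis
    unfolding end_submodule_def m.subspace_def
  proof (intro conjI ballI allI)
    have "ipe 0 = 0" by (metis ipe(2) phi_end_0)
    then have "(ipe ^^ i) 0 = 0" for i by (induction i) (simp_all only: funpow.simps id_apply o_apply)
    then show "0 \<in> {v\<in>VP P. \<forall>i. (ipe ^^ i) v \<in> Hc 0}" by (simp add: VP_def part_0)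
    show "x + y \<in> {v\<in>VP P. \<forall>i. (ipe ^^ i) v \<in> Hc 0}"
      if "x \<in> {v\<in>VP P. \<forall>i. (ipe ^^ i) v \<in> Hc 0}" "y \<in> {v\<in>VP P. \<forall>i. (ipe ^^ i) v \<in> Hc 0}" for x y
      using that by (simp add: ipe_pow_add Hc_add VP_add)
    show "int_scale end_scale c x \<in> {v\<in>VP P. \<forall>i. (ipe ^^ i) v \<in> Hc 0}"
      if x: "x \<in> {v\<in>VP P. \<forall>i. (ipe ^^ i) v \<in> Hc 0}" for c x
    proof -
      have "(ipe ^^ i) (end_scale (fps_to_fls c) x) \<in> Hc 0" for i
      proof -
        obtain d where d: "ordge 0 d" "\<forall>f. (ipe ^^ i) (end_scale (fps_to_fls c) f) = end_scale d ((ipe ^^ i) f)"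
          using ipe_pow_scale[OF ordge_fps[of c], of i] by (elim exE conjE)
        show ?thesis unfolding d(2)[rule_format] using Hc_scale[OF d(1), of "(ipe ^^ i) x" 0] x by simp
      qed
      then show ?thesis using x by (simp add: int_scale_def VP_scale)
    qed
  qed
qed

text \<open>A stable submodule of H contains all iterates of its elements; conversely, the elements
  whose iterates all stay in H form a stable submodule.\<close>

lemma O_pos_eq: "O_pos EndM = {v\<in>VP (>). \<forall>i. (phi_end ^^ i) v \<in> Hc 0}" (is "_ = ?A")
  unfolding O_pos_def
proof (rule Greatest_equality)
  have "phi_end v \<in> ?A" if v: "v \<in> ?A" for v
  proof -
    have "(phi_end ^^ i) (phi_end v) \<in> Hc 0" for i
      using v funpow_swap1[of phi_end i v] by (metis (mono_tags, lifting) funpow.simps(2) mem_Collect_eq o_apply)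
    then show ?thesis using v VP_phi_end by simp
  qed
  moreover have "v \<in> Hc 0" if "v \<in> ?A" for v using that by (auto dest!: spec[of _ 0])
  ultimately show "end_submodule ?A \<and> ?A \<subseteq> V_pos \<inter> EndM \<and> phi_end ` ?A \<subseteq> ?A"
    unfolding V_pos_eq EndM_eq using submodule_phi_pow by blast
  fix A assume A: "end_submodule A \<and> A \<subseteq> V_pos \<inter> EndM \<and> phi_end ` A \<subseteq> A"
  show "A \<le> ?A"
  proof
    fix v assume v: "v \<in> A"
    have "(phi_end ^^ i) v \<in> A" for i using v A by (induction i) auto
    then show "v \<in> ?A" using v A unfolding V_pos_eq EndM_eq by blast
  qed
qed

lemma O_neg_eq: "O_neg EndM = {v\<in>VP (<). \<forall>i. (ipe ^^ i) v \<in> Hc 0}" (is "_ = ?A")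
  unfolding O_neg_def ipe_def[symmetric]
proof (rule Greatest_equality)
  have "ipe v \<in> ?A" if v: "v \<in> ?A" for v
  proof -
    have "(ipe ^^ i) (ipe v) \<in> Hc 0" for i
      using v funpow_swap1[of ipe i v] by (metis (mono_tags, lifting) funpow.simps(2) mem_Collect_eq o_apply)
    then show ?thesis using v VP_ipe by simp
  qed
  moreover have "v \<in> Hc 0" if "v \<in> ?A" for v using that by (auto dest!: spec[of _ 0])
  ultimately show "end_submodule ?A \<and> ?A \<subseteq> V_neg \<inter> EndM \<and> ipe ` ?A \<subseteq> ?A"
    unfolding V_neg_eq EndM_eq using submodule_ipe_pow by blast
  fix A assume A: "end_submodule A \<and> A \<subseteq> V_neg \<inter> EndM \<and> ipe ` A \<subseteq> A"
  show "A \<le> ?A"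
  proof
    fix v assume v: "v \<in> A"
    have "(ipe ^^ i) v \<in> A" for i using v A by (induction i) auto
    then show "v \<in> ?A" using v A unfolding V_neg_eq EndM_eq by blast
  qed
qed

text \<open>The condition \<Phi> A = A means stability under \<Phi> and its inverse, hence the
  iterates in both directions.\<close>

lemma O_zero_eq: "O_zero EndM = {v\<in>VP (=). (\<forall>i. (phi_end ^^ i) v \<in> Hc 0) \<and> (\<forall>i. (ipe ^^ i) v \<in> Hc 0)}" (is "_ = ?A")
  unfolding O_zero_def
proof (rule Greatest_equality)
  interpret m: Modules.module "int_scale end_scale" by (rule module_int_end_scale)
  have H: "v \<in> Hc 0" if "v \<in> ?A" for v using that by (auto dest!: spec[of _ 0])
  have 1: "phi_end v \<in> ?A" if v: "v \<in> ?A" for v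
  proof -
    have "(phi_end ^^ i) (phi_end v) \<in> Hc 0" for i
      using v funpow_swap1[of phi_end i v] by (metis (mono_tags, lifting) funpow.simps(2) mem_Collect_eq o_apply)
    moreover have "(ipe ^^ i) (phi_end v) \<in> Hc 0" for i
    proof (cases i)
      case 0
      then show ?thesis using calculation[of 0] by simp
    next
      case (Suc l)
      then have "(ipe ^^ i) (phi_end v) = (ipe ^^ l) v" by (simp only: funpow_Suc_right o_apply ipe)
      then show ?thesis using v by simp
    qed
    ultimately show ?thesis using v VP_phi_end by simp
  qed
  have 2: "ipe v \<in> ?A" if v: "v \<in> ?A" for v
  proof -
    have "(ipe ^^ i) (ipe v) \<in> Hc 0" for i
      using v funpow_swap1[of ipe i v] by (metis (mono_tags, lifting) funpow.simps(2) mem_Collect_eq o_apply)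
    moreover have "(phi_end ^^ i) (ipe v) \<in> Hc 0" for i
    proof (cases i)
      case 0
      then show ?thesis using calculation[of 0] by simp
    next
      case (Suc l)
      then have "(phi_end ^^ i) (ipe v) = (phi_end ^^ l) v" by (simp only: funpow_Suc_right o_apply ipe)
      then show ?thesis using v by simp
    qed
    ultimately show ?thesis using v VP_ipe by simp
  qed
  have A_eq: "?A = {v\<in>VP (=). \<forall>i. (phi_end ^^ i) v \<in> Hc 0} \<inter> {v\<in>VP (=). \<forall>i. (ipe ^^ i) v \<in> Hc 0}" by blast
  have "end_submodule ?A"
    unfolding A_eq end_submodule_def
    by (rule m.subspace_inter) (rule submodule_phi_pow[unfolded end_submodule_def], rule submodule_ipe_pow[unfolded end_submodule_def])
  moreover have "phi_end ` ?A = ?A"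
  proof
    show "?A \<subseteq> phi_end ` ?A"
    proof
      fix v assume "v \<in> ?A"
      then have "ipe v \<in> ?A" by (rule 2)
      then have "phi_end (ipe v) \<in> phi_end ` ?A" by (rule imageI)
      then show "v \<in> phi_end ` ?A" by simp
    qed
  qed (use 1 in blast)
  ultimately show "end_submodule ?A \<and> ?A \<subseteq> V_zero \<inter> EndM \<and> phi_end ` ?A = ?A"
    unfolding V_zero_eq EndM_eq using H by blast
  fix A assume A: "end_submodule A \<and> A \<subseteq> V_zero \<inter> EndM \<and> phi_end ` A = A"
  show "A \<le> ?A"
  proof
    fix v assume v: "v \<in> A"
    have ip: "ipe w \<in> A" if w: "w \<in> A" for w
    proof -
      have "w \<in> phi_end ` A" using w A by simp
      then show ?thesis by auto
    qed
    have "(phi_end ^^ i) v \<in> A" for i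
    proof (induction i)
      case (Suc i)
      then show ?case using A by (simp) blast
    qed (use v in simp)
    moreover have "(ipe ^^ i) v \<in> A" for i using v by (induction i) (auto intro: ip)
    ultimately show "v \<in> ?A" using v A unfolding V_zero_eq EndM_eq by blast
  qed
qed

lemma surj_at_O_all:
  assumes "surj_at (int m)"
  shows "end_scale (fls_X ^ m) ` EndM \<subseteq> O_all EndM"
  unfolding scaled_EndM
proof
  fix f assume f: "f \<in> Hc (int m)"
  have fE: "f \<in> EndV" using HcD(1)[OF f] .
  have VPp: "part P f \<in> VP P" for P by (simp add: VP_def part_part)
  have "part (>) f \<in> O_pos EndM" unfolding O_pos_eq using VPp surj_at_parts(1)[OF assms f] by simp
  moreover have "part (=) f \<in> O_zero EndM"
    unfolding O_zero_eq using VPp surj_at_parts(2,3)[OF assms f] by simp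
  moreover have "part (<) f \<in> O_neg EndM" unfolding O_neg_eq using VPp surj_at_parts(4)[OF assms f] by simp
  ultimately show "f \<in> O_all EndM" unfolding O_all_def using part_sum[OF fE] by blast
qed

lemma iso_at_O_all:
  assumes iso: "iso_at m" and "m \<ge> 1"
  shows "end_scale (fls_X ^ m) ` EndM \<subseteq> O_all EndM"
proof (rule surj_at_O_all)
  obtain k :: nat where "surj_at (int k)" using surj_at_large by (elim exE)
  \<comment> \<open>Larger exponents are easier, so the descending induction can start at or above
    \<open>m\<close>.\<close>
  moreover have "surj_at (int (max k m))" if "surj_at (int k)" for k :: nat
    using that Hc_mono unfolding surj_at_def by (metis max.cobounded1 of_nat_le_iff)
  ultimately have big: "surj_at (int (max k m))" by blast
  show "surj_at (int m)"
  proof (rule inc_induct[of m "max k m" "\<lambda>l. surj_at (int l)"])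
    fix l assume "m \<le> l" "surj_at (int (Suc l))"
    then show "surj_at (int l)" using surj_at_step[OF iso, of l] assms(2) by (simp add: add.commute)
  qed (use big in simp_all)
qed

text \<open>\<open>m \<ge> 1\<close> absorbs case (a) of the definition, where the value is 1; case
  (b) is the containment of \<epsilon>^m H.\<close>

lemma level_torsion_le:
  assumes "iso_at m" "m \<ge> 1"
  shows "level_torsion \<le> enat m"
proof (cases "EndM = O_all EndM \<and> \<not> top_nilpotent {a + c | a c. a \<in> O_pos EndM \<and> c \<in> O_neg EndM}")
  case True
  then have "level_torsion = 1" by (simp add: level_torsion_def)
  then show ?thesis using assms(2) by (simp add: one_enat_def)
next
  case False
  then have "level_torsion = (INF n \<in> {n. end_scale (fls_X ^ n) ` EndM \<subseteq> O_all EndM}. enat n)"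
    unfolding level_torsion_def by (simp only: if_False)
  also have "\<dots> \<le> enat m" using iso_at_O_all[OF assms] by (intro INF_lower) simp
  finally show ?thesis .
qed

end

section \<open>Isomorphism number zero\<close>

text \<open>A model of \<open>k\<^sup>N\<close>, into which M / \<epsilon> M is mapped, inside the
  function space already used for counting.\<close>

definition kvec :: "nat \<Rightarrow> (nat \<Rightarrow> 'k::field) set" where
  "kvec N = {x. \<forall>i\<ge>N. x i = 0}"

definition unit_fun :: "nat \<Rightarrow> nat \<Rightarrow> 'k::field" where
  "unit_fun j = (\<lambda>i. if i = j then 1 else 0)"

lemma subspace_kvec: "fs.subspace (kvec N)"
  by (auto simp: fs.subspace_def kvec_def fun_scale_def)

lemma unit_fun_kvec: "j < N \<Longrightarrow> unit_fun j \<in> kvec N"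
  by (auto simp: unit_fun_def kvec_def)

lemma kvec_expand:
  assumes "x \<in> kvec N"
  shows "x = (\<Sum>j<N. fun_scale (x j) (unit_fun j))"
proof
  fix i
  have "(\<Sum>j<N. fun_scale (x j) (unit_fun j)) i = (\<Sum>j<N. if j = i then x j else 0)"
    unfolding fun_sum_apply fun_scale_def unit_fun_def by (intro sum.cong refl) auto
  also have "\<dots> = x i" using assms by (auto simp: kvec_def)
  finally show "x i = (\<Sum>j<N. fun_scale (x j) (unit_fun j)) i" by simp
qed

lemma kvec_span: "kvec N \<subseteq> fs.span (unit_fun ` {..<N})"
proof
  fix x :: "nat \<Rightarrow> 'a" assume "x \<in> kvec N"
  then have "x = (\<Sum>j<N. fun_scale (x j) (unit_fun j))" by (rule kvec_expand)
  also have "\<dots> \<in> fs.span (unit_fun ` {..<N})" by (intro fs.span_sum fs.span_scale fs.span_base) auto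
  finally show "x \<in> fs.span (unit_fun ` {..<N})" .
qed

locale kvec_hom =
  fixes N :: nat and h :: "(nat \<Rightarrow> 'k::field) \<Rightarrow> nat \<Rightarrow> 'k"
  assumes h_add: "h (x + y) = h x + h y" and h_scale: "h (fun_scale c x) = fun_scale c (h x)"
    and h_kvec: "x \<in> kvec N \<Longrightarrow> h x \<in> kvec N"
begin

lemma h_0: "h 0 = 0"
  using h_add[of 0 0] by simp

lemma h_expand: "x \<in> kvec N \<Longrightarrow> h x i = (\<Sum>j<N. x j * h (unit_fun j) i)"
proof -
  assume x: "x \<in> kvec N"
  have "h (\<Sum>j\<in>A. fun_scale (x j) (unit_fun j)) = (\<Sum>j\<in>A. fun_scale (x j) (h (unit_fun j)))" for A
    by (induction A rule: infinite_finite_induct) (simp_all only: sum.infinite sum.empty sum.insert h_0 h_add h_scale simp_thms)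
  then have "h x = (\<Sum>j<N. fun_scale (x j) (h (unit_fun j)))" using kvec_expand[OF x] by metis
  then show ?thesis by (simp only: fun_sum_apply fun_scale_def)
qed

end

text \<open>The maps are total functions, so they are only required to be inverse to each other on
  \<open>kvec N\<close>.\<close>

definition kvec_aut :: "nat \<Rightarrow> ((nat \<Rightarrow> 'k::field) \<Rightarrow> nat \<Rightarrow> 'k) \<Rightarrow> ((nat \<Rightarrow> 'k) \<Rightarrow> nat \<Rightarrow> 'k) \<Rightarrow> bool" where
  "kvec_aut N h h' \<longleftrightarrow> kvec_hom N h \<and> kvec_hom N h' \<and> (\<forall>x\<in>kvec N. h' (h x) = x \<and> h (h' x) = x)"

lemma linear_fun_scale_iff:
  "Vector_Spaces.linear fun_scale fun_scale h \<longleftrightarrow>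
    (\<forall>x y. h (x + y) = h x + h y) \<and> (\<forall>c x. h (fun_scale c x) = fun_scale c (h x))"
  by (simp add: Vector_Spaces.linear_iff fs.vector_space_axioms)

text \<open>Both independent sets are completed to bases of \<open>kvec N\<close>; the complements
  have equal size and are matched arbitrarily.\<close>

lemma kvec_extend:
  fixes B1 B2 :: "(nat \<Rightarrow> 'k::field) set"
  assumes B1: "B1 \<subseteq> kvec N" "fs.independent B1" and B2: "B2 \<subseteq> kvec N" "fs.independent B2"
    and f0: "bij_betw f0 B1 B2"
  shows "\<exists>h h'. kvec_aut N h h' \<and> (\<forall>x\<in>B1. h x = f0 x)"
proof -
  interpret fp: vector_space_pair "fun_scale :: 'k \<Rightarrow> (nat \<Rightarrow> 'k) \<Rightarrow> _" "fun_scale :: 'k \<Rightarrow> (nat \<Rightarrow> 'k) \<Rightarrow> _" ..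
  obtain C1 where C1: "B1 \<subseteq> C1" "C1 \<subseteq> kvec N" "fs.independent C1" "kvec N \<subseteq> fs.span C1"
    by (rule fs.maximal_independent_subset_extend[OF B1])
  obtain C2 where C2: "B2 \<subseteq> C2" "C2 \<subseteq> kvec N" "fs.independent C2" "kvec N \<subseteq> fs.span C2"
    by (rule fs.maximal_independent_subset_extend[OF B2])
  have fU: "finite (unit_fun ` {..<N} :: (nat \<Rightarrow> 'k) set)" by simp
  have fin: "finite C1" "finite C2"
    using fs.independent_span_bound[OF fU C1(3)] fs.independent_span_bound[OF fU C2(3)] C1(2) C2(2) kvec_span[of N]
    by (meson subset_trans)+
  have "card C1 \<le> card C2" "card C2 \<le> card C1"
    using fs.independent_span_bound[OF fin(2) C1(3)] fs.independent_span_bound[OF fin(1) C2(3)] C1(2,4) C2(2,4)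
    by (meson subset_trans)+
  then have card: "card C1 = card C2" by simp
  have finB: "finite B1" "finite B2" using fin C1(1) C2(1) finite_subset by blast+
  have "card (C1 - B1) = card (C2 - B2)"
    using card_Diff_subset[OF finB(1) C1(1)] card_Diff_subset[OF finB(2) C2(1)] card bij_betw_same_card[OF f0] by simp
  then obtain f1 where f1: "bij_betw f1 (C1 - B1) (C2 - B2)"
    using finite_same_card_bij[of "C1 - B1" "C2 - B2"] fin by auto
  define f where "f = (\<lambda>x. if x \<in> B1 then f0 x else f1 x)"
  have "bij_betw f B1 B2" using f0 by (simp add: f_def cong: bij_betw_cong)
  moreover have "bij_betw f (C1 - B1) (C2 - B2)" using f1 by (rule bij_betw_cong[THEN iffD1, rotated]) (simp add: f_def)
  ultimately have "bij_betw f (B1 \<union> (C1 - B1)) (B2 \<union> (C2 - B2))" by (rule bij_betw_combine) auto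
  moreover have "B1 \<union> (C1 - B1) = C1" "B2 \<union> (C2 - B2) = C2" using C1(1) C2(1) by auto
  ultimately have f: "bij_betw f C1 C2" by simp
  obtain h where h: "Vector_Spaces.linear fun_scale fun_scale h" "\<forall>x\<in>C1. h x = f x"
    using fp.linear_independent_extend[OF C1(3), of f] by (elim exE conjE)
  obtain h' where h': "Vector_Spaces.linear fun_scale fun_scale h'" "\<forall>x\<in>C2. h' x = inv_into C1 f x"
    using fp.linear_independent_extend[OF C2(3), of "inv_into C1 f"] by (elim exE conjE)
  have ha: "h (x + y) = h x + h y" "h (fun_scale c x) = fun_scale c (h x)"
    and ha': "h' (x + y) = h' x + h' y" "h' (fun_scale c x) = fun_scale c (h' x)" for x y c
    using h(1) h'(1) unfolding linear_fun_scale_iff by simp_all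
  have h0: "h 0 = 0" "h' 0 = 0" using ha(1)[of 0 0] ha'(1)[of 0 0] by simp_all
  have hC: "h x \<in> C2" "h' (h x) = x" if "x \<in> C1" for x
    using h(2) h'(2) f that bij_betwE[OF f] by (auto simp: bij_betw_inv_into_left[OF f that])
  have hC': "h' x \<in> C1" "h (h' x) = x" if "x \<in> C2" for x
    using h(2) h'(2) that bij_betwE[OF bij_betw_inv_into[OF f]] by (auto simp: bij_betw_inv_into_right[OF f that])
  have "fs.span C1 \<subseteq> {x. h x \<in> kvec N}"
    by (rule fs.span_minimal)
      (use hC(1) C2(2) subspace_kvec[of N] in \<open>auto simp: fs.subspace_def ha h0\<close>)
  moreover have "fs.span C2 \<subseteq> {x. h' x \<in> kvec N}"
    by (rule fs.span_minimal)
      (use hC'(1) C1(2) subspace_kvec[of N] in \<open>auto simp: fs.subspace_def ha' h0\<close>)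
  moreover have "fs.span C1 \<subseteq> {x. h' (h x) = x}"
    by (rule fs.span_minimal) (use hC(2) in \<open>auto simp: fs.subspace_def ha ha' h0\<close>)
  moreover have "fs.span C2 \<subseteq> {x. h (h' x) = x}"
    by (rule fs.span_minimal) (use hC'(2) in \<open>auto simp: fs.subspace_def ha ha' h0\<close>)
  ultimately have "kvec_aut N h h'"
    unfolding kvec_aut_def kvec_hom_def using C1(4) C2(4) ha ha' by blast
  moreover have "\<forall>x\<in>B1. h x = f0 x" using h(2) C1(1) by (auto simp: f_def)
  ultimately show ?thesis by blast
qed

text \<open>A basis of the smaller subspace is matched with part of a basis of the larger one,
  whichever of the two that is.\<close>

lemma kvec_aut_comparable:
  fixes S1 S2 :: "(nat \<Rightarrow> 'k::field) set"
  assumes S: "fs.subspace S1" "fs.subspace S2" "S1 \<subseteq> kvec N" "S2 \<subseteq> kvec N"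
  shows "\<exists>h h'. kvec_aut N h h' \<and> (h ` S1 \<subseteq> S2 \<or> S2 \<subseteq> h ` S1)"
proof -
  obtain B1 where B1: "B1 \<subseteq> S1" "fs.independent B1" "S1 \<subseteq> fs.span B1"
    by (rule fs.maximal_independent_subset)
  obtain B2 where B2: "B2 \<subseteq> S2" "fs.independent B2" "S2 \<subseteq> fs.span B2"
    by (rule fs.maximal_independent_subset)
  have fU: "finite (unit_fun ` {..<N} :: (nat \<Rightarrow> 'k) set)" by simp
  have fin: "finite B1" "finite B2"
    using fs.independent_span_bound[OF fU B1(2)] fs.independent_span_bound[OF fU B2(2)] B1(1) B2(1) S(3,4) kvec_span[of N]
    by (meson subset_trans)+
  have img: "fs.subspace (h ` S1)" if "kvec_hom N h" for h
  proof -
    interpret kvec_hom N h by (rule that)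
    show ?thesis
      unfolding fs.subspace_def
    proof (intro conjI ballI allI)
      show "0 \<in> h ` S1" using h_0 fs.subspace_0[OF S(1)] by (metis imageI)
      show "x + y \<in> h ` S1" if xy: "x \<in> h ` S1" "y \<in> h ` S1" for x y
      proof -
        obtain x' y' where "x = h x'" "y = h y'" "x' \<in> S1" "y' \<in> S1" using xy by blast
        then have "x + y = h (x' + y')" "x' + y' \<in> S1" using h_add fs.subspace_add[OF S(1)] by simp_all
        then show ?thesis by blast
      qed
      show "fun_scale c x \<in> h ` S1" if x: "x \<in> h ` S1" for c x
      proof -
        obtain x' where "x = h x'" "x' \<in> S1" using x by blast
        then have "fun_scale c x = h (fun_scale c x')" "fun_scale c x' \<in> S1" using h_scale fs.subspace_scale[OF S(1)] by simp_all
        then show ?thesis by blast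
      qed
    qed
  qed
  show ?thesis
  proof (cases "card B1 \<le> card B2")
    case True
    then obtain D where D: "D \<subseteq> B2" "card D = card B1" by (meson obtain_subset_with_card_n)
    obtain f0 where f0: "bij_betw f0 B1 D" using finite_same_card_bij[OF fin(1), of D] D fin(2) finite_subset by metis
    have "D \<subseteq> kvec N" "fs.independent D" "B1 \<subseteq> kvec N" using D(1) B1(1) B2(1,2) S(3,4) fs.independent_mono by blast+
    then obtain h h' where h: "kvec_aut N h h'" "\<forall>x\<in>B1. h x = f0 x"
      using kvec_extend[OF _ B1(2) _ _ f0, of N] by (metis (no_types))
    interpret kvec_hom N h using h(1) by (simp add: kvec_aut_def)
    have sub: "fs.subspace {x. h x \<in> S2}" using S(2) by (simp add: fs.subspace_def h_0 h_add h_scale)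
    have "h x \<in> S2" if "x \<in> B1" for x using h(2) that bij_betwE[OF f0] D(1) B2(1) by (metis subsetD)
    then have "B1 \<subseteq> {x. h x \<in> S2}" by blast
    then have "fs.span B1 \<subseteq> {x. h x \<in> S2}" by (rule fs.span_minimal[OF _ sub])
    then have "h ` S1 \<subseteq> S2" using B1(3) by blast
    then show ?thesis using h(1) by blast
  next
    case False
    then have "card B2 \<le> card B1" by simp
    then obtain D where D: "D \<subseteq> B1" "card D = card B2" by (meson obtain_subset_with_card_n)
    obtain f0 where f0: "bij_betw f0 D B2" using finite_same_card_bij[OF _ fin(2), of D] D fin(1) finite_subset by metis
    have "D \<subseteq> kvec N" "fs.independent D" "B2 \<subseteq> kvec N" using D(1) B2(1) B1(1,2) S(3,4) fs.independent_mono by blast+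
    then obtain h h' where h: "kvec_aut N h h'" "\<forall>x\<in>D. h x = f0 x"
      using kvec_extend[OF _ _ _ B2(2) f0, of N] by (metis (no_types))
    have sub: "fs.subspace (h ` S1)" using img h(1) by (simp add: kvec_aut_def)
    have "B2 \<subseteq> h ` S1"
    proof
      fix y assume "y \<in> B2"
      then obtain x where "x \<in> D" "y = f0 x" using f0 by (auto simp: bij_betw_def)
      then show "y \<in> h ` S1" using h(2) D(1) B1(1) by force
    qed
    then have "S2 \<subseteq> h ` S1" using fs.span_minimal[OF _ sub] B2(3) by blast
    then show ?thesis using h(1) by blast
  qed
qed

text \<open>Take u outside S1 and w outside S2, and let h send u to z and y to w. Then w = h y lies
  in h S1 but not in S2, and z = h u lies in S2 but, by injectivity, not in h S1.\<close>

lemma kvec_aut_incomparable: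
  fixes S1 S2 :: "(nat \<Rightarrow> 'k::field) set"
  assumes S: "fs.subspace S1" "fs.subspace S2" "S1 \<subseteq> kvec N" "S2 \<subseteq> kvec N" "S1 \<noteq> kvec N" "S2 \<noteq> kvec N"
    and nz: "y \<in> S1" "y \<noteq> 0" "z \<in> S2" "z \<noteq> 0"
  shows "\<exists>h h'. kvec_aut N h h' \<and> \<not> h ` S1 \<subseteq> S2 \<and> \<not> S2 \<subseteq> h ` S1"
proof -
  obtain u where u: "u \<in> kvec N" "u \<notin> S1" using S by blast
  obtain w where w: "w \<in> kvec N" "w \<notin> S2" using S by blast
  have ind: "fs.independent {u, y}" if "u \<notin> S1" "y \<in> S1" "y \<noteq> 0" "fs.subspace S1" for u y :: "nat \<Rightarrow> 'k" and S1
  proof -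
    have "fs.span {y} \<subseteq> S1" using that by (intro fs.span_minimal) auto
    then have "u \<notin> fs.span {y}" using that by blast
    then show ?thesis using that by (intro fs.independent_insertI) (simp_all add: fs.independent_empty)
  qed
  have uy: "u \<noteq> y" and wz: "w \<noteq> z" using u w nz by auto
  have bij: "bij_betw (\<lambda>x. if x = u then z else w) {u, y} {w, z}"
    using uy wz by (auto simp: bij_betw_def inj_on_def)
  have sub: "{u, y} \<subseteq> kvec N" "{w, z} \<subseteq> kvec N" using u w nz S(3,4) by blast+
  obtain h h' where h: "kvec_aut N h h'" "\<forall>x\<in>{u, y}. h x = (if x = u then z else w)"
    using kvec_extend[OF sub(1) ind[OF u(2) nz(1,2) S(1)] sub(2) ind[OF w(2) nz(3,4) S(2)] bij] by (elim exE conjE)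
  have "h y = w" "h u = z" using h(2) uy by auto
  then have "\<not> h ` S1 \<subseteq> S2" using nz(1) w(2) by blast
  moreover have "z \<notin> h ` S1"
  proof
    assume "z \<in> h ` S1"
    then obtain x where x: "x \<in> S1" "h x = h u" using \<open>h u = z\<close> by force
    then have "h' (h x) = h' (h u)" by simp
    then have "x = u" using h(1) x(1) u(1) S(3) unfolding kvec_aut_def by (metis subsetD)
    then show False using x u by simp
  qed
  ultimately show ?thesis using h(1) nz(3) by blast
qed

section \<open>Reduction of lattices modulo \<epsilon>\<close>

context crystal_basis
begin

text \<open>Defined on all of V, but it is the reduction modulo \<epsilon> only on M.\<close>

definition red :: "'v \<Rightarrow> nat \<Rightarrow> 'k" where
  "red v = (\<lambda>i. if i < N then fls_nth (B.coord v i) 0 else 0)"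

lemma red_kvec: "red v \<in> kvec N"
  by (simp add: red_def kvec_def)

lemma red_add: "red (u + v) = red u + red v"
  by (auto simp: red_def fun_eq_iff B.coord_add)

lemma red_0: "red 0 = 0"
  by (auto simp: red_def fun_eq_iff)

lemma red_scale: "v \<in> Mc 0 \<Longrightarrow> ordge 0 c \<Longrightarrow> red (scale c v) = fun_scale (fls_nth c 0) (red v)"
  using nth_mult_lead[of 0 c 0] by (auto simp: red_def fun_eq_iff B.coord_scale fun_scale_def Mc_def)

lemma red_eq_iff: "u \<in> Mc 0 \<Longrightarrow> v \<in> Mc 0 \<Longrightarrow> red u = red v \<longleftrightarrow> u - v \<in> Mc 1"
proof -
  assume uv: "u \<in> Mc 0" "v \<in> Mc 0"
  have "red u = red v \<longleftrightarrow> (\<forall>i<N. fls_nth (B.coord (u - v) i) 0 = 0)"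
    by (auto simp: red_def fun_eq_iff B.coord_diff)
  also have "\<dots> \<longleftrightarrow> (\<forall>i<N. ordge 0 (B.coord (u - v) i) \<and> fls_nth (B.coord (u - v) i) 0 = 0)"
    using Mc_diff[OF uv] by (auto simp: Mc_def)
  also have "\<dots> \<longleftrightarrow> u - v \<in> Mc 1" unfolding ordge_Suc[symmetric] by (simp add: Mc_def)
  finally show ?thesis .
qed

text \<open>The endomorphism of V with the same matrix, its entries taken as constant
  series.\<close>

definition lift :: "((nat \<Rightarrow> 'k) \<Rightarrow> nat \<Rightarrow> 'k) \<Rightarrow> 'v \<Rightarrow> 'v" where
  "lift h = B.matmap (\<lambda>i j. fls_const (h (unit_fun j) i))"

lemma red_lift:
  assumes "kvec_hom N h"
  shows "red (lift h v) = h (red v)"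
proof
  interpret kvec_hom N h by (rule assms)
  fix i
  show "red (lift h v) i = h (red v) i"
  proof (cases "i < N")
    case True
    have "fls_nth (B.coord (lift h v) i) 0 = (\<Sum>j<N. fls_nth (fls_const (h (unit_fun j) i) * B.coord v j) 0)"
      unfolding lift_def B.coord_matmap[OF True] by (simp add: fls_nth_sum)
    also have "\<dots> = (\<Sum>j<N. red v j * h (unit_fun j) i)"
      by (intro sum.cong) (auto simp: red_def)
    finally show ?thesis using True h_expand[OF red_kvec] by (simp add: red_def[of "lift h v"])
  next
    case False
    then show ?thesis using h_kvec[OF red_kvec, of v] by (simp add: red_def[of "lift h v"] kvec_def)
  qed
qed

lemma lift_lift:
  assumes h: "kvec_hom N h" "kvec_hom N h'" and id: "\<And>x. x \<in> kvec N \<Longrightarrow> h (h' x) = x"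
  shows "lift h \<circ> lift h' = id"
proof (rule EndV_eqI)
  show "lift h \<circ> lift h' \<in> EndV" unfolding lift_def by (intro EndV_comp EndV_matmap)
  fix i j assume ij: "i < N" "j < N"
  have const_sum: "(\<Sum>x\<in>A. fls_const (c x)) = fls_const (sum c A)" for c :: "nat \<Rightarrow> 'k" and A
    by (induction A rule: infinite_finite_induct) (simp_all add: fls_plus_const)
  have "B.ent (lift h \<circ> lift h') i j = (\<Sum>l<N. B.ent (lift h) i l * B.ent (lift h') l j)"
    unfolding lift_def by (rule ent_comp[OF EndV_matmap])
  also have "\<dots> = (\<Sum>l<N. fls_const (h' (unit_fun j) l * h (unit_fun l) i))"
    using ij by (intro sum.cong) (auto simp: lift_def B.ent_matmap fls_const_mult_const mult.commute)
  also have "\<dots> = fls_const (h (h' (unit_fun j)) i)"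
    unfolding const_sum using kvec_hom.h_expand[OF h(1) kvec_hom.h_kvec[OF h(2) unit_fun_kvec[OF ij(2)]]] by simp
  also have "\<dots> = B.ent id i j" using ij by (simp add: id unit_fun_kvec B.ent_id) (simp add: unit_fun_def)
  finally show "B.ent (lift h \<circ> lift h') i j = B.ent id i j" .
qed simp

lemma lift_GLM:
  assumes "kvec_aut N h h'"
  shows "lift h \<in> GLM"
proof -
  have h: "kvec_hom N h" "kvec_hom N h'" "\<forall>x\<in>kvec N. h' (h x) = x \<and> h (h' x) = x"
    using assms by (auto simp: kvec_aut_def)
  have 1: "lift h \<circ> lift h' = id" by (rule lift_lift[OF h(1,2)]) (use h(3) in blast)
  have 2: "lift h' \<circ> lift h = id" by (rule lift_lift[OF h(2,1)]) (use h(3) in blast)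
  have M: "lift f v \<in> M" if "v \<in> M" for f v
  proof -
    have "lift f \<in> Hc 0" by (auto simp: Hc_def lift_def EndV_matmap B.ent_matmap)
    then show ?thesis using Hc_app[of "lift f" 0 v 0] that by (simp add: M_eq)
  qed
  have "bij (lift h)" using o_bij[OF 2 1] .
  moreover have "M \<subseteq> lift h ` M"
  proof
    fix v assume v: "v \<in> M"
    have "v = lift h (lift h' v)" using fun_cong[OF 1, of v] by simp
    then show "v \<in> lift h ` M" using M[OF v] by blast
  qed
  ultimately show ?thesis using M by (auto simp: GLM_def lift_def EndV_matmap)
qed

text \<open>\<open>g\<close> and its inverse preserve \<epsilon> M, so \<open>g\<close> induces an
  injective map on M / \<epsilon> M, which preserves and reflects inclusions.\<close>

lemma red_GLM_subset:
  assumes g: "g \<in> GLM" and A: "A \<subseteq> M" and A': "A' \<subseteq> M"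
  shows "red ` g ` A \<subseteq> red ` g ` A' \<longleftrightarrow> red ` A \<subseteq> red ` A'"
proof -
  have gH: "g \<in> Hc 0" "inv_into UNIV g \<in> Hc 0" using GLM_Hc[OF g] GLM_inv[OF g] by blast+
  have gE: "g \<in> EndV" using HcD(1)[OF gH(1)] .
  have inj: "inv_into UNIV g (g v) = v" for v using g by (simp add: GLM_def bij_is_inj)
  have gM: "g v \<in> Mc c" if "v \<in> Mc c" for v c using Hc_app[OF gH(1) that] by simp
  have iff: "red (g u) = red (g v) \<longleftrightarrow> red u = red v" if "u \<in> M" "v \<in> M" for u v
  proof -
    have "g u - g v = g (u - v)" using gE by (simp add: EndV_app)
    moreover have "g (u - v) \<in> Mc 1 \<longleftrightarrow> u - v \<in> Mc 1"
      using gM Hc_app[OF gH(2), of "g (u - v)" 1] by (auto simp: inj)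
    ultimately show ?thesis using that gM by (simp add: M_eq red_eq_iff)
  qed
  show ?thesis
  proof
    assume l: "red ` g ` A \<subseteq> red ` g ` A'"
    show "red ` A \<subseteq> red ` A'"
    proof
      fix y assume "y \<in> red ` A"
      then obtain u where u: "u \<in> A" "y = red u" by blast
      then obtain v where v: "v \<in> A'" "red (g u) = red (g v)" using l by blast
      then have "red u = red v" using iff u(1) A A' by blast
      then show "y \<in> red ` A'" using u v by blast
    qed
  next
    assume l: "red ` A \<subseteq> red ` A'"
    show "red ` g ` A \<subseteq> red ` g ` A'"
    proof
      fix y assume "y \<in> red ` g ` A"
      then obtain u where u: "u \<in> A" "y = red (g u)" by blast
      then obtain v where v: "v \<in> A'" "red u = red v" using l by blast
      then have "red (g u) = red (g v)" using iff u(1) A A' by blast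
      then show "y \<in> red ` g ` A'" using u v by blast
    qed
  qed
qed

text \<open>The last clause replaces a finiteness condition: it lets approximation modulo powers of
  \<epsilon> stop after finitely many steps.\<close>

definition sublattice :: "'v set \<Rightarrow> bool" where
  "sublattice L \<longleftrightarrow> 0 \<in> L \<and> (\<forall>u\<in>L. \<forall>v\<in>L. u + v \<in> L) \<and> (\<forall>c. \<forall>v\<in>L. ordge 0 c \<longrightarrow> scale c v \<in> L) \<and>
     (\<exists>c. Mc c \<subseteq> L)"

lemma ordge_X_powi [simp]: "ordge c (fls_X powi c :: 'k fls)"
  using ordge_X_powi_mult[of c c "1 :: 'k fls"] by simp

lemma sublattice_scale: "sublattice L \<Longrightarrow> sublattice (scale (fls_X powi d) ` L)"
  unfolding sublattice_def
proof (elim conjE exE, intro conjI ballI allI impI)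
  let ?s = "scale (fls_X powi d)"
  assume L: "0 \<in> L" "\<forall>u\<in>L. \<forall>v\<in>L. u + v \<in> L" "\<forall>c. \<forall>v\<in>L. ordge 0 c \<longrightarrow> scale c v \<in> L"
  show "0 \<in> ?s ` L" using imageI[OF L(1), of ?s] by simp
  show "u + v \<in> ?s ` L" if uv: "u \<in> ?s ` L" "v \<in> ?s ` L" for u v
  proof -
    obtain u' v' where "u = ?s u'" "v = ?s v'" "u' \<in> L" "v' \<in> L" using uv by blast
    then have "u + v = ?s (u' + v')" "u' + v' \<in> L" using L(2) by (simp_all add: scale_right_distrib)
    then show ?thesis by blast
  qed
  show "scale c v \<in> ?s ` L" if "v \<in> ?s ` L" "ordge 0 c" for c v
  proof -
    from that(1) obtain v' where "v = ?s v'" "v' \<in> L" by blast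
    then have "scale c v = ?s (scale c v')" "scale c v' \<in> L" using L(3) that by (simp_all add: mult.commute)
    then show ?thesis by blast
  qed
  fix c assume c: "Mc c \<subseteq> L"
  show "\<exists>c. Mc c \<subseteq> ?s ` L"
  proof (intro exI[of _ "d + c"] subsetI)
    fix v assume v: "v \<in> Mc (d + c)"
    have "scale (fls_X powi (- d)) v \<in> Mc (- d + (d + c))" by (rule Mc_scale[OF ordge_X_powi v])
    then have "scale (fls_X powi (- d)) v \<in> L" using c by auto
    moreover have "v = ?s (scale (fls_X powi (- d)) v)" by (simp add: power_int_minus)
    ultimately show "v \<in> ?s ` L" by blast
  qed
qed

lemma sublattice_red:
  assumes "sublattice L" "L \<subseteq> Mc 0"
  shows "fs.subspace (red ` L)"
  unfolding fs.subspace_def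
proof (intro conjI ballI allI)
  have L: "0 \<in> L" "\<And>u v. u \<in> L \<Longrightarrow> v \<in> L \<Longrightarrow> u + v \<in> L" "\<And>c v. v \<in> L \<Longrightarrow> ordge 0 c \<Longrightarrow> scale c v \<in> L"
    using assms(1) by (auto simp: sublattice_def)
  show "0 \<in> red ` L" using imageI[OF L(1), of red] by (simp only: red_0)
  show "x + y \<in> red ` L" if xy: "x \<in> red ` L" "y \<in> red ` L" for x y
  proof -
    obtain u v where "x = red u" "y = red v" "u \<in> L" "v \<in> L" using xy by blast
    then have "x + y = red (u + v)" "u + v \<in> L" using L(2) by (simp_all add: red_add)
    then show ?thesis by blast
  qed
  show "fun_scale c x \<in> red ` L" if x: "x \<in> red ` L" for c x
  proof -
    obtain u where u: "x = red u" "u \<in> L" using x by blast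
    have "fun_scale c x = red (scale (fls_const c) u)"
      unfolding u(1) using u(2) assms(2) by (subst red_scale) auto
    then show ?thesis using L(3)[OF u(2), of "fls_const c"] by simp
  qed
qed

text \<open>Nakayama's lemma by successive approximation. The error is pushed into \<epsilon>^l M
  until it falls into the \<epsilon>^c M contained in \<open>L\<close>, so no limit is
  taken.\<close>

lemma sublattice_red_full:
  assumes L: "sublattice L" "L \<subseteq> Mc 0" and full: "red ` L = kvec N"
  shows "L = Mc 0"
proof
  have add: "u + v \<in> L" if "u \<in> L" "v \<in> L" for u v using L(1) that by (simp add: sublattice_def)
  have sc: "scale c v \<in> L" if "v \<in> L" "ordge 0 c" for c v using L(1) that by (simp add: sublattice_def)
  obtain c where c: "Mc c \<subseteq> L" using L(1) by (auto simp: sublattice_def)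
  show "Mc 0 \<subseteq> L"
  proof
    fix v assume v: "v \<in> Mc 0"
    have "\<exists>y\<in>L. v - y \<in> Mc (int l)" for l
    proof (induction l)
      case 0
      have "0 \<in> L" using L(1) by (simp add: sublattice_def)
      then show ?case using v by (intro bexI[of _ 0]) auto
    next
      case (Suc l)
      then obtain y where y: "y \<in> L" "v - y \<in> Mc (int l)" by blast
      define w where "w = scale (fls_X powi (- int l)) (v - y)"
      have "w \<in> Mc (- int l + int l)" unfolding w_def by (rule Mc_scale[OF ordge_X_powi y(2)])
      then have w: "w \<in> Mc 0" by simp
      have "red w \<in> red ` L" unfolding full by (rule red_kvec)
      then obtain y' where y': "y' \<in> L" "red w = red y'" by blast
      then have "w - y' \<in> Mc 1" using red_eq_iff[OF w, of y'] L(2) by blast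
      from Mc_scale[OF ordge_X_powi this, of "int l"]
      have "scale (fls_X powi int l) (w - y') \<in> Mc (int (Suc l))" by (simp add: add.commute)
      moreover have "scale (fls_X powi int l) (w - y') = v - (y + scale (fls_X powi int l) y')"
        by (simp add: w_def scale_right_diff_distrib power_int_minus)
      moreover have "ordge 0 (fls_X powi int l :: 'k fls)" by (rule ordge_mono[OF ordge_X_powi]) simp
      ultimately show ?case using add[OF y(1) sc[OF y'(1)]] by metis
    qed
    then obtain y where y: "y \<in> L" "v - y \<in> Mc (int (nat c))" by blast
    then have "v - y \<in> L" using c Mc_mono[of "v - y" "int (nat c)" c] by auto
    from add[OF y(1) this] show "v \<in> L" by simp
  qed
qed (rule L(2))

lemma \<phi>_Mc: "v \<in> Mc d \<Longrightarrow> \<phi> ` M \<subseteq> Mc a \<Longrightarrow> \<phi> v \<in> Mc (a + d)"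
proof -
  assume v: "v \<in> Mc d" and a: "\<phi> ` M \<subseteq> Mc a"
  have "scale (fls_X powi (- d)) v \<in> Mc (- d + d)" by (rule Mc_scale[OF ordge_X_powi v])
  then have "\<phi> (scale (fls_X powi (- d)) v) \<in> Mc a" using a by (auto simp: M_eq)
  from Mc_scale[OF ordge_X_powi this, of d] have "scale (fls_X powi d) (\<phi> (scale (fls_X powi (- d)) v)) \<in> Mc (d + a)" .
  moreover have "scale (fls_X powi d) (\<phi> (scale (fls_X powi (- d)) v)) = \<phi> v"
    unfolding \<phi>_scale frob_X_powi by (simp add: power_int_minus)
  ultimately show ?thesis by (simp add: add.commute)
qed

lemma ips_Mc: "v \<in> Mc d \<Longrightarrow> ips ` M \<subseteq> Mc a \<Longrightarrow> ips v \<in> Mc (a + d)"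
proof -
  assume v: "v \<in> Mc d" and a: "ips ` M \<subseteq> Mc a"
  have "scale (fls_X powi (- d)) v \<in> Mc (- d + d)" by (rule Mc_scale[OF ordge_X_powi v])
  then have "ips (scale (fls_X powi (- d)) v) \<in> Mc a" using a by (auto simp: M_eq)
  from Mc_scale[OF ordge_X_powi this, of d] have "scale (fls_X powi d) (ips (scale (fls_X powi (- d)) v)) \<in> Mc (d + a)" .
  moreover have "ips (scale (fls_X powi (- d)) v) = scale (fls_X powi (- d)) (ips v)"
    using ips_frob_scale[of "fls_X powi (- d)" v] by (simp only: frob_X_powi)
  ultimately show ?thesis by (simp add: power_int_minus add.commute)
qed

lemma ips_M_bounded: "\<exists>c. ips ` M \<subseteq> Mc c"
proof -
  have "\<forall>j. \<exists>c. ips (b j) \<in> Mc c" using Mc_ex by blast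
  then obtain g where g: "\<And>j. ips (b j) \<in> Mc (g j)" by metis
  obtain c0 where c0: "\<forall>j\<in>{..<N}. c0 \<le> g j" using finite_lower_bound[of "{..<N}" g] by blast
  have "ips v \<in> Mc c0" if v: "v \<in> Mc 0" for v
  proof -
    have "\<forall>i. \<exists>x. frob x = B.coord v i" using frob_surj by blast
    then obtain x where x: "\<And>i. frob (x i) = B.coord v i" by metis
    have "ips v = (\<Sum>i<N. scale (x i) (ips (b i)))"
      by (subst B.coord_expand[of v]) (simp add: ips_sum ips_frob_scale flip: x)
    also have "\<dots> \<in> Mc c0"
    proof (rule Mc_sum)
      fix i assume i: "i \<in> {..<N}"
      have "ordge 0 (frob (x i))" using v i by (simp add: Mc_def x)
      then show "scale (x i) (ips (b i)) \<in> Mc c0"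
        using Mc_scale[of 0 "x i" "ips (b i)" c0] Mc_mono[OF g[of i], of c0] c0 i by simp
    qed
    finally show ?thesis .
  qed
  then show ?thesis by (auto simp: M_eq)
qed

text \<open>Otherwise \<open>L\<close> could be pushed into ever smaller \<epsilon>^d M, and the
  nonzero vector \<open>v\<close> would lie in their intersection.\<close>

lemma exact_level:
  assumes L: "L \<subseteq> Mc c" and v: "v \<in> L" "v \<noteq> 0"
  shows "\<exists>d. L \<subseteq> Mc d \<and> \<not> L \<subseteq> Mc (d + 1)"
proof (rule ccontr)
  assume n: "\<not> ?thesis"
  have "L \<subseteq> Mc (c + int k)" for k
  proof (induction k)
    case (Suc k)
    then have "L \<subseteq> Mc (c + int k + 1)" using n by blast
    then show ?case by (simp add: add.commute add.left_commute)
  qed (use L in simp)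
  then show False using Mc_Inter[of v c] v by blast
qed

lemma sublattice_\<phi>_M: "sublattice (\<phi> ` M)"
  unfolding sublattice_def
proof (intro conjI ballI allI impI)
  show "0 \<in> \<phi> ` M" using imageI[of 0 M \<phi>] by (simp add: \<phi>_0 M_eq)
  show "u + v \<in> \<phi> ` M" if uv: "u \<in> \<phi> ` M" "v \<in> \<phi> ` M" for u v
  proof -
    obtain u' v' where "u = \<phi> u'" "v = \<phi> v'" "u' \<in> M" "v' \<in> M" using uv by blast
    then have "u + v = \<phi> (u' + v')" "u' + v' \<in> M" by (simp_all add: \<phi>_add M_eq Mc_add)
    then show ?thesis by blast
  qed
  show "scale c v \<in> \<phi> ` M" if "v \<in> \<phi> ` M" "ordge 0 c" for c v
  proof -
    from that(1) obtain v' where v': "v = \<phi> v'" "v' \<in> M" by blast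
    obtain c' where c': "frob c' = c" using frob_surj by blast
    have "scale c v = \<phi> (scale c' v')" by (simp add: v' \<phi>_scale c')
    moreover have "ordge 0 c'" using that(2) c' by (metis ordge_frob)
    ultimately show ?thesis using Mc_scale[of 0 c' v' 0] v'(2) by (simp add: M_eq)
  qed
  obtain a where a: "ips ` M \<subseteq> Mc a" using ips_M_bounded by blast
  show "\<exists>c. Mc c \<subseteq> \<phi> ` M"
  proof (intro exI[of _ "- a"] subsetI)
    fix v assume "v \<in> Mc (- a)"
    then have "ips v \<in> Mc (a + - a)" using ips_Mc a by blast
    then show "v \<in> \<phi> ` M" using imageI[of "ips v" M \<phi>] by (simp add: M_eq)
  qed
qed

lemma sublattice_ips_M: "sublattice (ips ` M)"
  unfolding sublattice_def
proof (intro conjI ballI allI impI)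
  show "0 \<in> ips ` M" using imageI[of 0 M ips] by (simp add: ips_0 M_eq)
  show "u + v \<in> ips ` M" if uv: "u \<in> ips ` M" "v \<in> ips ` M" for u v
  proof -
    obtain u' v' where "u = ips u'" "v = ips v'" "u' \<in> M" "v' \<in> M" using uv by blast
    then have "u + v = ips (u' + v')" "u' + v' \<in> M" by (simp_all add: ips_add M_eq Mc_add)
    then show ?thesis by blast
  qed
  show "scale c v \<in> ips ` M" if "v \<in> ips ` M" "ordge 0 c" for c v
  proof -
    from that(1) obtain v' where v': "v = ips v'" "v' \<in> M" by blast
    have "scale c v = ips (scale (frob c) v')" by (simp add: v' ips_frob_scale)
    then show ?thesis using Mc_scale[of 0 "frob c" v' 0] v'(2) that(2) by (simp add: M_eq)
  qed
  show "\<exists>c. Mc c \<subseteq> ips ` M"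
  proof (intro exI[of _ 0] subsetI)
    fix v assume "v \<in> Mc 0"
    then have "\<phi> v \<in> M" using \<phi>_M M_eq by blast
    then show "v \<in> ips ` M" using imageI[of "\<phi> v" M ips] by simp
  qed
qed

text \<open>If \<open>\<phi> M\<close> is not of the form \<open>\<epsilon>\<^sup>a M\<close>, then the reductions modulo \<open>\<epsilon>\<close> of the primitive
  multiples of \<open>\<phi> M\<close> and \<open>\<phi>\<^sup>-\<^sup>1 M\<close> are proper nonzero subspaces, and twisting \<open>\<phi>\<close> by an element of
  \<open>GL(M)\<close> moves one of them arbitrarily while conjugation preserves their relative position.\<close>

lemma iso_at_0_scalar:
  assumes iso: "iso_at 0"
  shows "\<exists>a. \<phi> ` M = Mc a"
proof (cases "N = 0")
  case True
  then have "Mc 0 = UNIV" unfolding Mc_def by blast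
  then have "M = UNIV" "Mc 0 = UNIV" by (simp_all add: M_eq)
  then show ?thesis using \<phi>_bij by (intro exI[of _ 0]) (simp add: bij_is_surj)
next
  case False
  have b0: "b 0 \<in> M" "b 0 \<noteq> 0"
  proof -
    show "b 0 \<in> M" using False by (auto simp: M_eq Mc_def B.coord_basis)
    show "b 0 \<noteq> 0" using False B.coord_basis[of 0 0] by auto
  qed
  have \<phi>1: "\<phi> ` M \<subseteq> Mc 0" using \<phi>_M M_eq by simp
  have \<phi>2: "\<phi> (b 0) \<noteq> 0" using b0(2) ips(2)[of "b 0"] ips_0 by metis
  obtain a where a: "\<phi> ` M \<subseteq> Mc a" "\<not> \<phi> ` M \<subseteq> Mc (a + 1)"
    using exact_level[OF \<phi>1 imageI[OF b0(1)] \<phi>2] by (elim exE conjE)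
  obtain c where c: "ips ` M \<subseteq> Mc c" using ips_M_bounded by (elim exE)
  have ips2: "ips (b 0) \<noteq> 0" using b0(2) ips(1)[of "b 0"] \<phi>_0 by metis
  obtain d where d: "ips ` M \<subseteq> Mc d" "\<not> ips ` M \<subseteq> Mc (d + 1)"
    using exact_level[OF c imageI[OF b0(1)] ips2] by (elim exE conjE)
  \<comment> \<open>Primitive multiples: contained in M but not in \<epsilon> M, so that their
    reductions are nonzero.\<close>
  define Y where "Y = scale (fls_X powi (- a)) ` \<phi> ` M"
  define Z where "Z = scale (fls_X powi (- d)) ` ips ` M"
  have norm: "scale (fls_X powi (- a)) ` L \<subseteq> Mc 0 \<and> \<not> scale (fls_X powi (- a)) ` L \<subseteq> Mc 1"
    if L: "L \<subseteq> Mc a" "\<not> L \<subseteq> Mc (a + 1)" for L a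
  proof
    show "scale (fls_X powi (- a)) ` L \<subseteq> Mc 0"
    proof
      fix v assume "v \<in> scale (fls_X powi (- a)) ` L"
      then obtain u where u: "u \<in> Mc a" "v = scale (fls_X powi (- a)) u" using L by blast
      show "v \<in> Mc 0" using Mc_scale[OF ordge_X_powi u(1), of "- a"] u(2) by simp
    qed
    obtain u where u: "u \<in> L" "u \<notin> Mc (a + 1)" using L by blast
    have "scale (fls_X powi (- a)) u \<notin> Mc 1"
    proof
      assume "scale (fls_X powi (- a)) u \<in> Mc 1"
      from Mc_scale[OF ordge_X_powi this, of a] show False using u(2) by (simp add: power_int_minus)
    qed
    then show "\<not> scale (fls_X powi (- a)) ` L \<subseteq> Mc 1" using u(1) by blast
  qed
  have Y: "sublattice Y" "Y \<subseteq> Mc 0" "\<not> Y \<subseteq> Mc 1"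
    unfolding Y_def using sublattice_scale[OF sublattice_\<phi>_M] norm[OF a] by blast+
  have Z: "sublattice Z" "Z \<subseteq> Mc 0" "\<not> Z \<subseteq> Mc 1"
    unfolding Z_def using sublattice_scale[OF sublattice_ips_M] norm[OF d] by blast+
  \<comment> \<open>For h \<phi> = \<open>g\<^sup>-\<^sup>1\<close> \<phi> g one has h Y =
    \<open>g\<^sup>-\<^sup>1\<close> Y and \<open>g\<^sup>-\<^sup>1\<close> Z = Z. Moving Y by h
    therefore amounts to applying \<open>g\<^sup>-\<^sup>1\<close> to both lattices, which preserves
    inclusions modulo \<epsilon>.\<close>
  have inv: "(red ` lift h ` Y \<subseteq> red ` Z \<longleftrightarrow> red ` Y \<subseteq> red ` Z) \<and> (red ` Z \<subseteq> red ` lift h ` Y \<longleftrightarrow> red ` Z \<subseteq> red ` Y)"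
    if h: "kvec_aut N h h'" for h h'
  proof -
    let ?h = "lift h"
    have hG: "?h \<in> GLM" by (rule lift_GLM[OF h])
    have "?h - id \<in> Hc 0" using Hc_diff[OF GLM_Hc[OF hG] Hc_id] .
    then have "cong_one 0 ?h" using scaled_EndM[of 0] by (simp add: cong_one_def)
    then obtain g where g: "g \<in> GLM" "?h \<circ> \<phi> = inv_into UNIV g \<circ> \<phi> \<circ> g" using iso hG unfolding iso_at_def by blast
    define G where "G = inv_into UNIV g"
    have bij: "bij g" "g ` M = M" using g(1) by (auto simp: GLM_def)
    have Gg: "G (g v) = v" "g (G v) = v" for v using bij(1) by (simp_all add: G_def bij_is_inj bij_is_surj surj_f_inv_f)
    have GE: "G \<in> EndV" using HcD(1)[OF GLM_inv[OF g(1)]] by (simp add: G_def)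
    have GM: "G ` M = M" using bij by (metis G_def bij_is_inj image_inv_f_f)
    have GG: "G \<in> GLM" using GE GM bij(1) by (auto simp: GLM_def G_def bij_imp_bij_inv)
    have h\<phi>: "?h (\<phi> v) = G (\<phi> (g v))" for v using fun_cong[OF g(2), of v] by (simp add: G_def)
    have hE: "?h \<in> EndV" using hG by (simp add: GLM_def)
    have "?h ` \<phi> ` M = G ` \<phi> ` g ` M" by (simp add: image_image h\<phi>)
    then have "?h ` \<phi> ` M = G ` \<phi> ` M" by (simp only: bij(2))
    moreover have "?h ` Y = scale (fls_X powi (- a)) ` ?h ` \<phi> ` M" "G ` Y = scale (fls_X powi (- a)) ` G ` \<phi> ` M"
      unfolding Y_def image_image using EndV_app(3)[OF hE] EndV_app(3)[OF GE] by simp_all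
    ultimately have hY: "?h ` Y = G ` Y" by simp
    have "g (ips v) = ips (g (?h v))" for v
    proof -
      have "\<phi> (g (ips v)) = g (?h v)" using h\<phi>[of "ips v"] by (simp add: Gg)
      then show ?thesis by (metis ips(2))
    qed
    then have "g ` ips ` M = ips ` g ` ?h ` M" by (simp add: image_image)
    also have "\<dots> = ips ` M" using hG bij(2) by (simp add: GLM_def)
    finally have "G ` ips ` M = ips ` M" using Gg(1) by (metis (no_types, lifting) image_cong image_ident image_image)
    then have GZ: "G ` Z = Z" unfolding Z_def image_image by (simp add: EndV_app(3)[OF GE]) (metis image_image)
    have "Y \<subseteq> M" "Z \<subseteq> M" using Y(2) Z(2) by (simp_all add: M_eq)
    then show ?thesis using red_GLM_subset[OF GG, of Y Z] red_GLM_subset[OF GG, of Z Y] unfolding hY GZ by simp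
  qed
  have redh: "red ` lift h ` Y = h ` red ` Y" if "kvec_aut N h h'" for h h'
    using that red_lift[of h] by (auto simp: kvec_aut_def image_image)
  have sub: "red ` Y \<subseteq> kvec N" "red ` Z \<subseteq> kvec N" using red_kvec by blast+
  have full: "red ` Y = kvec N \<or> red ` Z = kvec N"
  proof (rule ccontr)
    assume n: "\<not> ?thesis"
    have nz: "\<exists>y\<in>L. red y \<noteq> 0" if L: "L \<subseteq> Mc 0" "\<not> L \<subseteq> Mc 1" for L
    proof -
      obtain y where y: "y \<in> L" "y \<notin> Mc 1" using L by blast
      then show ?thesis using red_eq_iff[of y 0] L(1) red_0 by auto
    qed
    obtain y where y: "y \<in> Y" "red y \<noteq> 0" using nz[OF Y(2,3)] by blast
    obtain z where z: "z \<in> Z" "red z \<noteq> 0" using nz[OF Z(2,3)] by blast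
    note sb = sublattice_red[OF Y(1,2)] sublattice_red[OF Z(1,2)] sub
    obtain h1 h1' where h1: "kvec_aut N h1 h1'" "h1 ` red ` Y \<subseteq> red ` Z \<or> red ` Z \<subseteq> h1 ` red ` Y"
      using kvec_aut_comparable[OF sb] by (elim exE conjE)
    obtain h2 h2' where h2: "kvec_aut N h2 h2'" "\<not> h2 ` red ` Y \<subseteq> red ` Z" "\<not> red ` Z \<subseteq> h2 ` red ` Y"
      using kvec_aut_incomparable[OF sb, of "red y" "red z"] n y z by blast
    show False
      using inv[OF h1(1)] inv[OF h2(1)] h1(2) h2(2,3) unfolding redh[OF h1(1)] redh[OF h2(1)] by simp
  qed
  then show ?thesis
  proof
    assume "red ` Y = kvec N"
    then have YM: "Y = Mc 0" by (rule sublattice_red_full[OF Y(1,2)])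
    have "Mc a \<subseteq> \<phi> ` M"
    proof
      fix v assume v: "v \<in> Mc a"
      have "scale (fls_X powi (- a)) v \<in> Mc (- a + a)" by (rule Mc_scale[OF ordge_X_powi v])
      then have "scale (fls_X powi (- a)) v \<in> Y" using YM by simp
      then obtain u where "u \<in> \<phi> ` M" "scale (fls_X powi (- a)) v = scale (fls_X powi (- a)) u" unfolding Y_def by blast
      then show "v \<in> \<phi> ` M" by simp
    qed
    then show ?thesis using a(1) by blast
  next
    assume "red ` Z = kvec N"
    then have ZM: "Z = Mc 0" by (rule sublattice_red_full[OF Z(1,2)])
    have "\<phi> ` M \<subseteq> Mc (- d)"
    proof
      fix v assume "v \<in> \<phi> ` M"
      then obtain m where m: "m \<in> Mc 0" "v = \<phi> m" by (auto simp: M_eq)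
      then obtain u where u: "u \<in> M" "m = scale (fls_X powi (- d)) (ips u)" using ZM by (auto simp: Z_def)
      have "v = scale (fls_X powi (- d)) u" unfolding m(2) u(2) \<phi>_scale frob_X_powi by simp
      then show "v \<in> Mc (- d)" using Mc_scale[OF ordge_X_powi, of u 0 "- d"] u(1) by (simp add: M_eq)
    qed
    moreover have "Mc (- d) \<subseteq> \<phi> ` M"
    proof
      fix v assume "v \<in> Mc (- d)"
      then have "ips v \<in> Mc (d + - d)" using ips_Mc d(1) by blast
      then show "v \<in> \<phi> ` M" using imageI[of "ips v" M \<phi>] by (simp add: M_eq)
    qed
    ultimately show ?thesis by blast
  qed
qed

end

section \<open>Crystals with \<phi> M = \<epsilon>^a M\<close>

context crystal_eigen
begin

text \<open>All slopes equal a, so the positive and negative parts vanish, and conjugation preserves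
  H in both directions. Hence H = \<open>O\<^sub>H\<close>, while the zero module is topologically
  nilpotent: case (a) is excluded and case (b) holds with exponent 0.\<close>

lemma scalar_level_torsion:
  assumes a: "\<phi> ` M = Mc a"
  shows "level_torsion = 0"
proof -
  have ipsM: "ips ` M \<subseteq> Mc (- a)"
  proof
    fix v assume "v \<in> ips ` M"
    then obtain m where m: "m \<in> Mc 0" "v = ips m" by (auto simp: M_eq)
    have "scale (fls_X powi a) m \<in> \<phi> ` M" unfolding a using Mc_scale[OF ordge_X_powi m(1), of a] by simp
    then obtain u where u: "u \<in> M" "scale (fls_X powi a) m = \<phi> u" by blast
    have "m = scale (frob (fls_X powi (- a))) (\<phi> u)" unfolding u(2)[symmetric] frob_X_powi by (simp add: power_int_minus)
    then have "v = scale (fls_X powi (- a)) u" by (simp only: m(2) ips_frob_scale ips)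
    then show "v \<in> Mc (- a)" using Mc_scale[OF ordge_X_powi, of u 0 "- a"] u(1) by (simp add: M_eq)
  qed
  have \<phi>M: "\<phi> v \<in> Mc (a + c) \<longleftrightarrow> v \<in> Mc c" for v c
  proof
    assume "\<phi> v \<in> Mc (a + c)"
    from ips_Mc[OF this ipsM] show "v \<in> Mc c" by simp
  qed (use \<phi>_Mc a in blast)
  have powM: "(\<phi> ^^ l) v \<in> Mc (int l * a + c) \<longleftrightarrow> v \<in> Mc c" for l v c
  proof (induction l)
    case (Suc l)
    have eq: "int (Suc l) * a + c = a + (int l * a + c)" by (simp add: algebra_simps)
    show ?case unfolding eq funpow.simps o_apply \<phi>M by (rule Suc)
  qed simp
  have r: "r i = int t * a" if i: "i < n" for i
  proof (rule ccontr)
    assume "r i \<noteq> int t * a"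
    \<comment> \<open>\<open>\<phi> ^^ t\<close> shifts the lattice filtration by t a but scales
      \<open>e i\<close> by \<epsilon>^(r i). A discrepancy would move \<open>e i\<close> up the
      filtration without end.\<close>
    define \<delta> where "\<delta> = int t * a - r i"
    have sh: "e i \<in> Mc (c + \<delta>) \<longleftrightarrow> e i \<in> Mc c" for c
    proof -
      have "e i \<in> Mc c \<longleftrightarrow> scale (fls_X powi r i) (e i) \<in> Mc (int t * a + c)"
        using powM[of t "e i" c] unfolding eig[OF i] by simp
      also have "\<dots> \<longleftrightarrow> e i \<in> Mc (c + \<delta>)"
        unfolding Mc_def mem_Collect_eq B.coord_scale ordge_X_powi_mult by (simp add: \<delta>_def algebra_simps)
      finally show ?thesis by simp
    qed
    obtain c where c: "e i \<in> Mc c" using Mc_ex by blast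
    have "e i \<in> Mc (c + int l * \<delta>) \<and> e i \<in> Mc (c - int l * \<delta>)" for l
    proof (induction l)
      case (Suc l)
      then show ?case using sh[of "c + int l * \<delta>"] sh[of "c - int l * \<delta> - \<delta>"] by (simp add: algebra_simps)
    qed (use c in simp)
    then have abs: "e i \<in> Mc (c + int l * \<bar>\<delta>\<bar>)" for l by (cases "\<delta> \<ge> 0") (simp_all add: abs_if)
    have "e i \<in> Mc (c + int l)" for l
    proof (rule Mc_mono[OF abs[of l]])
      have "int l * 1 \<le> int l * \<bar>\<delta>\<bar>" using \<open>r i \<noteq> int t * a\<close> by (intro mult_left_mono) (auto simp: \<delta>_def)
      then show "c + int l \<le> c + int l * \<bar>\<delta>\<bar>" by simp
    qed
    then have "e i = 0" by (rule Mc_Inter)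
    then show False using E.coord_basis[OF i i] by simp
  qed
  have VP0: "VP P = {0}" if "\<not> P (int t * a) (int t * a)" for P
  proof -
    have "f = 0" if "f \<in> VP P" for f
    proof (rule E_eqI)
      show "f \<in> EndV" using that by (simp add: VP_iff)
      fix i j assume "i < n" "j < n"
      then have "E.ent f i j = 0" using that \<open>\<not> P (int t * a) (int t * a)\<close> r by (auto simp: VP_iff)
      then show "E.ent f i j = E.ent 0 i j" by (simp add: E.ent_def)
    qed simp
    moreover have "0 \<in> VP P" by (simp add: VP_def part_0)
    ultimately show ?thesis by blast
  qed
  have phi0: "(phi_end ^^ i) 0 = 0" for i by (induction i) (simp_all only: funpow.simps id_apply o_apply phi_end_0)
  have ipe0: "(ipe ^^ i) 0 = 0" for i using phi_ipe_pow(2)[of i 0] by (simp only: phi0)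
  have Op: "O_pos EndM = {0}" unfolding O_pos_eq using VP0[of "(>)"] phi0 by auto
  have On: "O_neg EndM = {0}" unfolding O_neg_eq using VP0[of "(<)"] ipe0 by auto
  have H1: "phi_end f \<in> Hc 0" "ipe f \<in> Hc 0" if f: "f \<in> Hc 0" for f
  proof -
    have fE: "f \<in> EndV" using HcD(1)[OF f] .
    have "phi_end f ` M \<subseteq> M"
    proof
      fix w assume "w \<in> phi_end f ` M"
      then obtain v where v: "v \<in> M" "w = \<phi> (f (ips v))" by (auto simp: phi_end_def')
      have "f (ips v) \<in> Mc (0 + - a)" using Hc_app[OF f] ipsM v(1) by blast
      then show "w \<in> M" using \<phi>M[of "f (ips v)" "- a"] v(2) by (simp add: M_eq)
    qed
    then show "phi_end f \<in> Hc 0" using EndV_phi_end[OF fE] EndM_eq by (auto simp: EndM_def)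
    have "ipe f ` M \<subseteq> M"
    proof
      fix w assume "w \<in> ipe f ` M"
      then obtain v where v: "v \<in> M" "w = ips (f (\<phi> v))" by (auto simp: ipe_eq)
      have "f (\<phi> v) \<in> Mc (0 + a)" using Hc_app[OF f] a v(1) by blast
      then show "w \<in> M" using \<phi>M[of w 0] v(2) by (simp add: M_eq)
    qed
    then show "ipe f \<in> Hc 0" using EndV_ipe[OF fE] EndM_eq by (auto simp: EndM_def)
  qed
  have "f \<in> O_zero EndM" if f: "f \<in> Hc 0" for f
  proof -
    have "f \<in> VP (=)" unfolding VP_iff using HcD(1)[OF f] r by auto
    moreover have "(phi_end ^^ i) f \<in> Hc 0" "(ipe ^^ i) f \<in> Hc 0" for i
      using f by (induction i) (auto intro: H1)
    ultimately show ?thesis unfolding O_zero_eq by simp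
  qed
  then have "f \<in> O_all EndM" if "f \<in> EndM" for f
    unfolding O_all_def Op On using that EndM_eq by (intro CollectI exI[of _ 0] exI[of _ f]) simp
  then have sub: "EndM \<subseteq> O_all EndM" by blast
  have "top_nilpotent {x + y | x y. x \<in> O_pos EndM \<and> y \<in> O_neg EndM}"
    unfolding top_nilpotent_def scaled_EndM Op On
  \<comment> \<open>The length bound 1 only excludes the empty product, which is the
    identity.\<close>
  proof (intro allI exI[of _ 1] impI)
    fix m :: nat and fs :: "('v \<Rightarrow> 'v) list"
    assume fs: "set fs \<subseteq> {x + y | x y. x \<in> {0} \<and> y \<in> {0}} \<and> 1 \<le> length fs"
    then obtain f fs' where f: "fs = f # fs'" "f = 0" by (cases fs) auto
    then have "foldr (\<circ>) fs id = 0" by (simp add: fun_eq_iff)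
    then show "foldr (\<circ>) fs id \<in> Hc (int m)" by (simp only: Hc_0)
  qed
  then have "level_torsion = (INF n \<in> {n. end_scale (fls_X ^ n) ` EndM \<subseteq> O_all EndM}. enat n)"
    unfolding level_torsion_def by (simp only: if_False not_True_eq_False simp_thms)
  also have "\<dots> \<le> enat 0"
  proof (rule INF_lower)
    show "0 \<in> {n. end_scale (fls_X ^ n) ` EndM \<subseteq> O_all EndM}" using sub scaled_EndM[of 0] EndM_eq by simp
  qed
  finally show ?thesis by (simp flip: zero_enat_def)
qed

lemma level_torsion_le_isomorphism_number: "level_torsion \<le> isomorphism_number"
  unfolding isomorphism_number_def
proof (rule INF_greatest)
  fix m assume "m \<in> {n. \<forall>h\<in>GLM. cong_one n h \<longrightarrow> (\<exists>g\<in>GLM. h \<circ> \<phi> = inv_into UNIV g \<circ> \<phi> \<circ> g)}"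
  then have m: "iso_at m" by (simp add: iso_at_def)
  show "level_torsion \<le> enat m"
  proof (cases "m = 0")
    case True
    then show ?thesis using m iso_at_0_scalar scalar_level_torsion by fastforce
  next
    case False
    then show ?thesis using m level_torsion_le by simp
  qed
qed

end

theorem theorem1p1:
  fixes scale :: "'k::alg_closed_field fls \<Rightarrow> 'v::ab_group_add \<Rightarrow> 'v"
    and q :: nat and M :: "'v set" and \<phi> :: "'v \<Rightarrow> 'v"
  assumes "f_crystal scale q M \<phi>"
  shows "f_crystal.isomorphism_number scale M \<phi> \<ge> f_crystal.level_torsion scale M \<phi>"
proof -
  interpret f_crystal scale q M \<phi> by (rule assms)
  obtain B where B: "finite B" "independent B" "span B = UNIV" "Modules.module.span (int_scale scale) B = M"
    using lattice_M unfolding lattice_of_def by blast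
  obtain b where b: "bij_betw b {0..<card B} B" using ex_bij_betw_nat_finite[OF B(1)] by blast
  have im: "b ` {..<card B} = B" and inj: "inj_on b {..<card B}"
    using b by (simp_all add: bij_betw_def atLeast0LessThan)
  obtain t n e r where e: "eigen_family t n e r" "span (e ` {..<n}) = UNIV"
    using dieudonne_manin by (elim exE conjE)
  interpret crystal_eigen scale q M \<phi> "card B" b n e t r
    by unfold_locales (use inj im B e in \<open>simp_all add: eigen_family_def\<close>)
  show ?thesis by (rule level_torsion_le_isomorphism_number)
qed

end
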